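(* Let $f(X)=X^{p^2}+f_1X^{p^2-1}+\dots+f_{p^2-1}X+f_{p^2}\in\mathcal{O}_K[X]$ be an Eisenstein polynomial such that (1) $v_p(f_p)\ge 1$, and $v_p(f_{pi})\ge 2$ for $i\in I(2,p-1)$; (2) $v_p(f_1)=1$, and $v_p(f_i)\ge 2$ for $i\in I(2,p^2-1)$; and, putting $F_i=\overline{f_i/p}$ for $i=1,p,p^2$, (3) the polynomial $F_{p^2}Y^{p^2}+F_pY^p+F_1Y$ has a root in $\kappa_K^\times$, and $F_1/F_{p^2}\in(\kappa_K^\times)^{p-1}$. Let $L$ be the extension of $K$ determined by $f(X)$, $\tilde L$ its normal closure over $K$, $F$ a subextension of degree $p$ over $K$ contained in $L$, and $M=\mathrm{Gal}(\tilde L/F)$. Then: - if $F_{p^2}Y^{p^2}+F_pY^p+F_1Y$ does not split in $\kappa_K$, then $F$ is the unique such subextension, $M$ has length $2$ (as an $\mathbb{F}_p[\mathrm{Gal}(F/K)]$-module), $\tilde L/F$ is formed by an unramified extension followed by a totally ramified extension with upper ramification break $1$, and $\mathrm{Gal}(\tilde L/K)$ is a split extension of $\mathrm{Gal}(F/K)$ by $\mathrm{Gal}(\tilde L/F)$; - if $F_{p^2}Y^{p^2}+F_pY^p+F_1Y$ has all its roots in $\kappa_K$, then $M$ has length $1$ and $L/K$ is an abelian elementary $p$-extension.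
   Context: Throughout, $p$ is an odd prime and $K$ is a finite unramified extension of $\mathbb{Q}_p$, with ring of integers $\mathcal{O}_K$ and residue field $\kappa_K=\mathcal{O}_K/p\mathcal{O}_K$. For $x\in\mathcal{O}_K$, $\overline{x}$ is its image in $\kappa_K$; $v_p$ is the valuation on $K$ with $v_p(p)=1$. For integers $a,b$, $I(a,b)$ is the set of integers $i$ with $a\le i\le b$ and $\gcd(i,p)=1$. "The extension determined by $f$" is $L=K(\pi)$ with $\pi$ a root of $f$. The group $\mathrm{Gal}(F/K)$ acts on the elementary abelian $p$-group $\mathrm{Gal}(\tilde L/F)$ by conjugation; the length of this module is its composition length, i.e. its dimension over $\mathbb{F}_p$. *)

theory Defs
  imports
    "HOL-Algebra.Algebra"
    "HOL-Analysis.Analysis"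
begin

text \<open>All fields are subfields of one ambient field \<open>R\<close>, which in the application is an algebraic
  closure of the field of \<open>p\<close>-adic numbers; the valuation lives on all of \<open>R\<close>, being there the unique extension
  of the \<open>p\<close>-adic one.  As in \<^theory>\<open>HOL-Algebra.Polynomials\<close>, a polynomial
  is the list of its coefficients, leading coefficient first, so that the coefficient \<open>f\<^sub>i\<close> of
  \<open>X\<^sup>n + f\<^sub>1 X\<^sup>n\<^sup>-\<^sup>1 + \<dots> + f\<^sub>n\<close> is \<open>f ! i\<close>.\<close>


section \<open>Valuations and the \<open>p\<close>-adic numbers\<close>

definition (in ring) valuation :: "('a \<Rightarrow> ereal) \<Rightarrow> bool"
  where "valuation v \<longleftrightarrow>
    (\<forall>x \<in> carrier R. v x \<noteq> -\<infinity> \<and> (v x = \<infinity> \<longleftrightarrow> x = \<zero>)) \<and>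
    (\<forall>x \<in> carrier R. \<forall>y \<in> carrier R.
       v (x \<otimes> y) = v x + v y \<and> min (v x) (v y) \<le> v (x \<oplus> y))"

text \<open>The field of \<open>p\<close>-adic numbers is the completion of the field of rational numbers for the
  \<open>p\<close>-adic valuation: \<open>v\<close> restricts to the \<open>p\<close>-adic valuation on the prime field, the prime field
  is dense in \<open>Q\<close>, and \<open>Q\<close> is complete.\<close>

definition (in ring) padic_numbers :: "('a \<Rightarrow> ereal) \<Rightarrow> nat \<Rightarrow> 'a set \<Rightarrow> bool"
  where "padic_numbers v p Q \<longleftrightarrow>
    subfield Q R \<and>
    (\<forall>n::int. n \<noteq> 0 \<longrightarrow> v ([n] \<cdot> \<one>) = ereal (real (multiplicity (int p) n))) \<and>
    (\<forall>x \<in> Q. \<forall>C::real. \<exists>(m::int) (n::int). n \<noteq> 0 \<and>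
       ereal C \<le> v (x \<ominus> ([m] \<cdot> \<one>) \<otimes> inv ([n] \<cdot> \<one>))) \<and>
    (\<forall>s::nat \<Rightarrow> 'a. range s \<subseteq> Q \<longrightarrow>
       (\<forall>C::real. \<exists>N. \<forall>i\<ge>N. \<forall>j\<ge>N. ereal C \<le> v (s i \<ominus> s j)) \<longrightarrow>
       (\<exists>x \<in> Q. \<forall>C::real. \<exists>N. \<forall>i\<ge>N. ereal C \<le> v (s i \<ominus> x)))"

definition val_ring :: "('a \<Rightarrow> ereal) \<Rightarrow> 'a set \<Rightarrow> 'a set"
  where "val_ring v E = {x \<in> E. 0 \<le> v x}"

text \<open>The index of the value group of \<open>K\<close> in the value group of \<open>E\<close>.\<close>

definition (in ring) ram_index :: "('a \<Rightarrow> ereal) \<Rightarrow> 'a set \<Rightarrow> 'a set \<Rightarrow> nat"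
  where "ram_index v K E =
    card ((\<lambda>x. {v x + v y | y. y \<in> K - {\<zero>}}) ` (E - {\<zero>}))"

text \<open>Residue fields of finite extensions of the \<open>p\<close>-adic numbers are finite, so the residue field
  extension is automatically separable and being unramified amounts to \<open>e = 1\<close>.\<close>

definition (in ring) unramified :: "('a \<Rightarrow> ereal) \<Rightarrow> 'a set \<Rightarrow> 'a set \<Rightarrow> bool"
  where "unramified v K E \<longleftrightarrow>
    subfield K R \<and> subfield E R \<and> K \<subseteq> E \<and> finite_dimension K E \<and> ram_index v K E = 1"

definition (in ring) totally_ramified :: "('a \<Rightarrow> ereal) \<Rightarrow> 'a set \<Rightarrow> 'a set \<Rightarrow> bool"
  where "totally_ramified v K E \<longleftrightarrow>
    subfield K R \<and> subfield E R \<and> K \<subseteq> E \<and> dimension (ram_index v K E) K E"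


section \<open>The polynomial data over the residue field\<close>

text \<open>Here \<open>K\<close> is unramified over the \<open>p\<close>-adic numbers, so its residue field is \<open>O\<^sub>K / p O\<^sub>K\<close>.\<close>

definition (in ring) residue_field :: "('a \<Rightarrow> ereal) \<Rightarrow> nat \<Rightarrow> 'a set \<Rightarrow> 'a set ring"
  where "residue_field v p K =
    (let S = R\<lparr>carrier := val_ring v K\<rparr> in S Quot (PIdl\<^bsub>S\<^esub> ([p] \<cdot> \<one>)))"

definition (in ring) residue_class :: "('a \<Rightarrow> ereal) \<Rightarrow> nat \<Rightarrow> 'a set \<Rightarrow> 'a \<Rightarrow> 'a set"
  where "residue_class v p K x =
    (let S = R\<lparr>carrier := val_ring v K\<rparr> in (PIdl\<^bsub>S\<^esub> ([p] \<cdot> \<one>)) +>\<^bsub>S\<^esub> x)"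

text \<open>Relative to a valuation normalised so that its value group on the base field is the
  group of integers.\<close>

definition (in ring) eisenstein :: "('a \<Rightarrow> ereal) \<Rightarrow> 'a list \<Rightarrow> bool"
  where "eisenstein v f \<longleftrightarrow>
    1 < length f \<and> hd f = \<one> \<and> (\<forall>i \<in> {1..<length f}. 1 \<le> v (f ! i)) \<and> v (last f) = 1"

definition coprime_range :: "nat \<Rightarrow> nat \<Rightarrow> nat \<Rightarrow> nat set"
  where "coprime_range p a b = {i. a \<le> i \<and> i \<le> b \<and> gcd i p = 1}"

definition (in ring) red_coeff :: "('a \<Rightarrow> ereal) \<Rightarrow> nat \<Rightarrow> 'a set \<Rightarrow> 'a list \<Rightarrow> nat \<Rightarrow> 'a set"
  where "red_coeff v p K f i = residue_class v p K ((f ! i) \<otimes> inv ([p] \<cdot> \<one>))"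

text \<open>The polynomial \<open>F\<^sub>p\<^sub>2 Y\<^sup>p\<^sup>2 + F\<^sub>p Y\<^sup>p + F\<^sub>1 Y\<close>, with \<open>p2\<close> standing for the square of \<open>p\<close>;
  polynomial addition normalises, so \<open>F\<^sub>p = 0\<close> is harmless.\<close>

definition (in ring) red_poly :: "('a \<Rightarrow> ereal) \<Rightarrow> nat \<Rightarrow> 'a set \<Rightarrow> 'a list \<Rightarrow> 'a set list"
  where "red_poly v p K f =
    (let k = residue_field v p K; F = red_coeff v p K f in
      ring.monom k (F (p^2)) (p^2)
        \<oplus>\<^bsub>poly_ring k\<^esub> ring.monom k (F p) p
        \<oplus>\<^bsub>poly_ring k\<^esub> ring.monom k (F 1) 1)"


section \<open>Normal extensions and Galois groups\<close>

definition (in ring) subextension :: "nat \<Rightarrow> 'a set \<Rightarrow> 'a set \<Rightarrow> 'a set \<Rightarrow> bool"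
  where "subextension n K L F \<longleftrightarrow> subfield F R \<and> K \<subseteq> F \<and> F \<subseteq> L \<and> dimension n K F"

definition (in ring) normal_extension :: "'a set \<Rightarrow> 'a set \<Rightarrow> bool"
  where "normal_extension K E \<longleftrightarrow>
    subfield K R \<and> subfield E R \<and> K \<subseteq> E \<and> (\<forall>x \<in> E. (algebraic over K) x) \<and>
    (\<forall>P \<in> carrier (K[X]). pirreducible K P \<longrightarrow> (\<exists>x \<in> E. eval P x = \<zero>) \<longrightarrow>
       ring.splitted (R\<lparr>carrier := E\<rparr>) P)"

text \<open>Only sensible when \<open>R\<close> itself is normal over \<open>K\<close>, for instance an algebraic closure.\<close>

definition (in ring) normal_closure :: "'a set \<Rightarrow> 'a set \<Rightarrow> 'a set"
  where "normal_closure K L = \<Inter>{N. normal_extension K N \<and> L \<subseteq> N}"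

definition (in ring) Gal :: "'a set \<Rightarrow> 'a set \<Rightarrow> ('a \<Rightarrow> 'a) monoid"
  where "Gal K E = (BijGroup E)\<lparr>carrier :=
    {\<sigma> \<in> Bij E. \<sigma> \<in> ring_hom (R\<lparr>carrier := E\<rparr>) (R\<lparr>carrier := E\<rparr>) \<and> (\<forall>x \<in> K. \<sigma> x = x)}\<rparr>"

definition elementary_abelian :: "nat \<Rightarrow> ('g, 'h) monoid_scheme \<Rightarrow> bool"
  where "elementary_abelian p G \<longleftrightarrow>
    comm_group G \<and> finite (carrier G) \<and> (\<forall>x \<in> carrier G. x [^]\<^bsub>G\<^esub> p = \<one>\<^bsub>G\<^esub>)"

text \<open>Separability is not mentioned, since all fields considered have characteristic zero.\<close>

definition (in ring) elementary_abelian_extension :: "nat \<Rightarrow> 'a set \<Rightarrow> 'a set \<Rightarrow> bool"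
  where "elementary_abelian_extension p K E \<longleftrightarrow>
    normal_extension K E \<and> finite_dimension K E \<and> elementary_abelian p (Gal K E)"

text \<open>\<open>G\<close> is a split extension of \<open>Q\<close> by its subgroup \<open>N\<close>, the projection being \<open>r\<close>.\<close>

definition split_extension ::
    "('g, 'm) monoid_scheme \<Rightarrow> 'g set \<Rightarrow> ('q, 'n) monoid_scheme \<Rightarrow> ('g \<Rightarrow> 'q) \<Rightarrow> bool"
  where "split_extension G N Q r \<longleftrightarrow>
    group G \<and> group Q \<and> r \<in> epi G Q \<and> kernel G Q r = N \<and>
    (\<exists>s \<in> hom Q G. \<forall>q \<in> carrier Q. r (s q) = q)"


section \<open>The Galois module \<open>Gal(E/F)\<close>\<close>

text \<open>For \<open>K \<subseteq> F \<subseteq> E\<close> with \<open>E\<close> and \<open>F\<close> normal over \<open>K\<close> and \<open>Gal(E/F)\<close> elementary abelian, an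
  element of \<open>Gal(F/K)\<close> acts on \<open>Gal(E/F)\<close> as conjugation by any of its lifts to \<open>Gal(E/K)\<close>.
  The scalars of the prime field act as powers, so that the submodules over the group algebra
  of \<open>Gal(F/K)\<close> are the subgroups stable under conjugation by \<open>Gal(E/K)\<close>.\<close>

definition (in ring) gal_module :: "nat \<Rightarrow> 'a set \<Rightarrow> 'a set \<Rightarrow> 'a set \<Rightarrow> bool"
  where "gal_module p K F E \<longleftrightarrow>
    normal_extension K E \<and> normal_extension K F \<and> F \<subseteq> E \<and> elementary_abelian p (Gal F E)"

definition (in ring) gal_submodule :: "'a set \<Rightarrow> 'a set \<Rightarrow> 'a set \<Rightarrow> ('a \<Rightarrow> 'a) set \<Rightarrow> bool"
  where "gal_submodule K F E N \<longleftrightarrow>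
    subgroup N (Gal F E) \<and>
    (\<forall>\<sigma> \<in> carrier (Gal K E). \<forall>\<tau> \<in> N.
       \<sigma> \<otimes>\<^bsub>Gal K E\<^esub> \<tau> \<otimes>\<^bsub>Gal K E\<^esub> inv\<^bsub>Gal K E\<^esub> \<sigma> \<in> N)"

text \<open>Composition length, as the length of a composition series (well defined by
  the Jordan-Hoelder theorem).\<close>

definition (in ring) gal_module_has_length ::
    "nat \<Rightarrow> 'a set \<Rightarrow> 'a set \<Rightarrow> 'a set \<Rightarrow> nat \<Rightarrow> bool"
  where "gal_module_has_length p K F E n \<longleftrightarrow>
    gal_module p K F E \<and>
    (\<exists>N :: nat \<Rightarrow> ('a \<Rightarrow> 'a) set.
       N 0 = {\<one>\<^bsub>Gal F E\<^esub>} \<and> N n = carrier (Gal F E) \<and>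
       (\<forall>i\<le>n. gal_submodule K F E (N i)) \<and>
       (\<forall>i<n. N i \<subset> N (Suc i) \<and>
          \<not> (\<exists>H. gal_submodule K F E H \<and> N i \<subset> H \<and> H \<subset> N (Suc i))))"


section \<open>Ramification groups\<close>

definition (in ring) uniformizer :: "('a \<Rightarrow> ereal) \<Rightarrow> 'a set \<Rightarrow> 'a \<Rightarrow> bool"
  where "uniformizer v E t \<longleftrightarrow>
    t \<in> E - {\<zero>} \<and> 0 < v t \<and> (\<forall>y \<in> E. 0 < v y \<longrightarrow> v t \<le> v y)"

text \<open>Serre's numbering: \<open>\<sigma>\<close> is in \<open>G\<^sub>u\<close> iff \<open>\<sigma> x - x\<close> has normalised valuation at least \<open>u + 1\<close>
  for every integer \<open>x\<close> of \<open>E\<close>; here \<open>v\<close> is not normalised for \<open>E\<close>, hence the factor \<open>v t\<close>.\<close>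

definition (in ring) lower_ram_group ::
    "('a \<Rightarrow> ereal) \<Rightarrow> 'a set \<Rightarrow> 'a set \<Rightarrow> real \<Rightarrow> ('a \<Rightarrow> 'a) set"
  where "lower_ram_group v K E u =
    {\<sigma> \<in> carrier (Gal K E). \<forall>x \<in> val_ring v E. \<forall>t.
       uniformizer v E t \<longrightarrow> ereal (u + 1) * v t \<le> v (\<sigma> x \<ominus> x)}"

definition (in ring) herbrand :: "('a \<Rightarrow> ereal) \<Rightarrow> 'a set \<Rightarrow> 'a set \<Rightarrow> real \<Rightarrow> real"
  where "herbrand v K E u =
    (if u < 0 then u
     else integral {0..u}
       (\<lambda>t. real (card (lower_ram_group v K E t)) / real (card (lower_ram_group v K E 0))))"

definition (in ring) upper_ram_group ::
    "('a \<Rightarrow> ereal) \<Rightarrow> 'a set \<Rightarrow> 'a set \<Rightarrow> real \<Rightarrow> ('a \<Rightarrow> 'a) set"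
  where "upper_ram_group v K E w =
    lower_ram_group v K E (inv_into {-1..} (herbrand v K E) w)"

definition (in ring) upper_breaks :: "('a \<Rightarrow> ereal) \<Rightarrow> 'a set \<Rightarrow> 'a set \<Rightarrow> real set"
  where "upper_breaks v K E =
    {w. -1 \<le> w \<and> (\<forall>e>0. upper_ram_group v K E (w + e) \<noteq> upper_ram_group v K E w)}"

end

theory Submission
  imports Defs
begin

text \<open>
  Put \<open>N = p\<^sup>2\<close> and \<open>T y = f\<^sub>N y\<^sup>N + f\<^sub>p y\<^sup>p + f\<^sub>1 y\<close>, and let \<open>E\<close> be generated over \<open>K\<close> by the roots of \<open>f\<close>.
  Conditions (1) and (2) give \<open>f(\<pi> + \<pi>\<^sup>2 y) = - \<pi>\<^sup>N T y\<close> up to \<open>y\<close> times an error of valuation at least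
  \<open>2 + 1 / N\<close>; hence the roots of \<open>f\<close> are the elements \<open>\<pi> + \<pi>\<^sup>2 y\<close> where the residues of the \<open>y\<close> are the \<open>N\<close> distinct
  roots of the reduced additive polynomial.  For \<open>\<rho> \<in> Gal(E/K)\<close> let \<open>Y \<rho>\<close> be the residue of \<open>(\<rho> \<pi> - \<pi>) / \<pi>\<^sup>2\<close>;
  then \<open>Y (\<rho> \<tau>) = Y \<rho> + \<rho> (Y \<tau>)\<close>.

  By condition (3) the reduced polynomial is, up to a factor, \<open>S\<^sup>p - d\<^sup>p\<^sup>-\<^sup>1 S\<close> with \<open>S = y\<^sup>p - w\<^sup>p\<^sup>-\<^sup>1 y\<close> and \<open>w\<close>, \<open>d\<close> in the
  residue field \<open>\<kappa>\<close> of \<open>K\<close>.  If it splits over \<open>\<kappa>\<close>, then \<open>Y\<close> is an injective homomorphism into an additive group.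
  Otherwise choose \<open>\<eta>\<close> with \<open>S \<eta> = d\<close>.  Writing \<open>Y \<rho> = \<alpha> \<eta> + \<beta> w\<close> and \<open>\<rho> \<eta> = \<eta> + \<gamma> w\<close> with coordinates in the prime
  field identifies \<open>Gal(E/K)\<close> with the Heisenberg group of order \<open>p\<^sup>3\<close>, in which \<open>Gal(E/F)\<close> is \<open>\<alpha> = 0\<close>,
  \<open>Gal(E/L)\<close> is \<open>\<alpha> = \<beta> = 0\<close>, and the inertia group of \<open>E/F\<close> is \<open>\<alpha> = \<gamma> = 0\<close>.
\<close>

text \<open>The substitution \<open>\<pi> + \<pi>\<^sup>2 y\<close> is dictated by the coefficients:
  at this scale the terms of index 0, p and 1 balance, while the remaining coefficients are too
  divisible to interfere. The error keeps the factor \<open>y\<close> so that one estimate also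
  rules out small nonzero \<open>y\<close>, that is, roots that are too close. Condition (3) enters
  twice: the root \<open>w\<close> factors the additive polynomial, and the power of exponent p - 1
  puts \<open>d\<close> into \<kappa>, so that \<alpha> is a homomorphism into the prime field. That
  automorphisms preserve the valuation is not assumed; it follows from completeness of
  \<open>K\<close>. The map \<open>Y\<close> has only p^2 values, so the third factor p of the group
  order comes from residues: were the stabiliser of \<pi> trivial, E would equal L, which adds
  nothing to \<kappa>, whereas \<eta> lies outside \<kappa>. The integers of E are handled without a
  single generator. Norms supply elements of fixed fields with known value or residue: that of \<pi>
  over the centre is a uniformizer of F, that of a lift of \<eta> over the stabiliser of \<eta> is a
  unit \<omega>, and along the powers of \<omega> the valuation is the minimum over the
  coefficients.\<close>

no_notation ideal_prod (infixl "\<cdot>\<index>" 80)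

hide_const (open) Polynomial.degree Polynomial.coeff Polynomial.monom Polynomial.lead_coeff
  Polynomial.order

section \<open>Polynomials and their roots\<close>

lemma (in ring) eval_in_subring:
  assumes "subring K R" "set q \<subseteq> K" "x \<in> K"
  shows "eval q x \<in> K"
  using ring.eval_in_carrier[OF subring_is_ring[OF assms(1)]] assms(2,3)
  unfolding eval_consistent[OF assms(1)] by simp

lemmas (in cring) ring_ac_distr = l_distr r_distr a_ac m_ac

lemma (in ring) poly_coeffs:
  assumes "q \<in> carrier (K[X])"
  shows "set q \<subseteq> K"
  using assms polynomial_incl univ_poly_carrier by blast

lemma (in field) card_roots_le_degree:
  assumes q: "q \<in> carrier (poly_ring R)" "q \<noteq> []" and S: "\<And>x. x \<in> S \<Longrightarrow> x \<in> carrier R \<and> eval q x = \<zero>"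
  shows "finite S" "card S \<le> degree q"
proof -
  have sub: "S \<subseteq> set_mset (roots q)" using roots_mem_iff_is_root[OF q(1)] q(2) S unfolding is_root_def by auto
  then show "finite S" by (rule finite_subset) simp
  have "card S \<le> card (set_mset (roots q))" using card_mono[OF finite_set_mset sub] .
  also have "\<dots> \<le> (\<Sum>a\<in>set_mset (roots q). count (roots q) a)"
    by (simp only: card_eq_sum) (intro sum_mono, simp add: Suc_leI)
  also have "\<dots> = size (roots q)" by (simp only: size_multiset_overloaded_eq)
  also have "\<dots> \<le> degree q" using size_roots_le_degree[OF q(1)] .
  finally show "card S \<le> degree q" .
qed

lemma (in domain) poly_eq_if_eval_eq:
  assumes "q \<in> carrier (poly_ring R)" "r \<in> carrier (poly_ring R)"
    and "infinite S" "S \<subseteq> carrier R" "\<And>x. x \<in> S \<Longrightarrow> eval q x = eval r x"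
  shows "q = r"
proof (rule ccontr)
  assume ne: "q \<noteq> r"
  interpret UP: domain "poly_ring R" using univ_poly_is_domain[OF carrier_is_subring] .
  let ?d = "q \<ominus>\<^bsub>poly_ring R\<^esub> r"
  have d: "?d \<in> carrier (poly_ring R)" using assms by simp
  have dn: "?d \<noteq> []" using ne assms(1,2) UP.r_right_minus_eq unfolding univ_poly_zero by metis
  have "S \<subseteq> {x. is_root ?d x}"
  proof
    fix x assume x: "x \<in> S"
    then have xR: "x \<in> carrier R" using assms by blast
    interpret h: ring_hom_ring "poly_ring R" R "\<lambda>p. eval p x"
      using eval_ring_hom[OF carrier_is_subring xR] .
    have "eval ?d x = eval q x \<ominus> eval r x"
      using assms(1,2) by (simp add: a_minus_def)
    also have "\<dots> = \<zero>" using assms(5)[OF x] eval_in_carrier[OF poly_coeffs[OF assms(2)] xR]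
      by (simp add: r_neg a_minus_def)
    finally show "x \<in> {x. is_root ?d x}" using dn xR unfolding is_root_def by simp
  qed
  then show False using finite_number_of_roots[OF d] assms(3) finite_subset by blast
qed

text \<open>The formal derivative; in \<open>c # q\<close> the head has exponent
  \<open>length q\<close>. No normalisation is done: over a field of characteristic zero the new
  leading coefficient cannot vanish.\<close>

fun (in ring) deriv_coeffs :: "'a list \<Rightarrow> 'a list" where
  "deriv_coeffs [] = []"
| "deriv_coeffs [c] = []"
| "deriv_coeffs (c # q) = ([length q] \<cdot> c) # deriv_coeffs q"

lemma (in ring) length_deriv_coeffs: "length (deriv_coeffs q) = length q - 1"
  by (induction q rule: deriv_coeffs.induct) auto

lemma (in ring) deriv_coeffs_closed:
  assumes "subring K R" "set q \<subseteq> K"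
  shows "set (deriv_coeffs q) \<subseteq> K"
proof -
  have m: "[(n::nat)] \<cdot> c \<in> K" if "c \<in> K" for n c
    using that subringE(2,7)[OF assms(1)] by (induction n) auto
  show ?thesis using assms(2)
    by (induction q rule: deriv_coeffs.induct) (use m subringE(7)[OF assms(1)] in auto)
qed

text \<open>The remainder is wanted as one polynomial in \<open>x\<close>, with the linear term
  explicit, because the separability argument compares two expansions as polynomials and not only at
  a single point.\<close>

lemma (in cring) power_taylor:
  fixes n :: nat
  assumes a: "a \<in> carrier R"
  shows "\<exists>q \<in> carrier (poly_ring R). \<forall>x \<in> carrier R.
    x [^] n = a [^] n \<oplus> (x \<ominus> a) \<otimes> ([n] \<cdot> (a [^] (n - 1))) \<oplus> (x \<ominus> a) \<otimes> (x \<ominus> a) \<otimes> eval q x"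
proof (induction n)
  case 0
  show ?case by (rule bexI[of _ "[]"]) (use a in \<open>auto simp: univ_poly_def a_minus_def\<close>)
next
  case (Suc n)
  then obtain q where q: "q \<in> carrier (poly_ring R)" and qe: "\<And>x. x \<in> carrier R \<Longrightarrow>
    x [^] n = a [^] n \<oplus> (x \<ominus> a) \<otimes> ([n] \<cdot> (a [^] (n - 1))) \<oplus> (x \<ominus> a) \<otimes> (x \<ominus> a) \<otimes> eval q x"
    by blast
  let ?c = "[n] \<cdot> (a [^] (n - 1))"
  have c: "?c \<in> carrier R" using a by simp
  have qs: "set q \<subseteq> carrier R" using poly_coeffs[OF q] .
  \<comment> \<open>Multiplying the expansion by \<open>x = u \<oplus> a\<close>, the product of the
    linear part with \<open>u\<close> moves into the remainder, which becomes
    \<open>q X + n a^(n-1)\<close>: shift the list and append \<open>?c\<close>.\<close>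
  let ?q = "normalize (q @ [?c])"
  have "set (q @ [?c]) \<subseteq> carrier R" using qs c by simp
  then have "?q \<in> carrier (poly_ring R)" using normalize_gives_polynomial univ_poly_carrier by blast
  moreover have "x [^] Suc n = a [^] Suc n \<oplus> (x \<ominus> a) \<otimes> ([Suc n] \<cdot> (a [^] (Suc n - 1)))
      \<oplus> (x \<ominus> a) \<otimes> (x \<ominus> a) \<otimes> eval ?q x" if x: "x \<in> carrier R" for x
  proof -
    have e: "eval ?q x = eval q x \<otimes> x \<oplus> ?c"
      using eval_normalize[of "q @ [?c]" x] eval_append_aux[OF qs c x] qs c x by simp
    have qx: "eval q x \<in> carrier R" using eval_in_carrier[OF qs x] .
    have an: "a [^] n \<in> carrier R" using a by simp
    have xn: "x [^] n \<in> carrier R" using x by simp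
    have ca: "?c \<otimes> a = [n] \<cdot> (a [^] n)"
    proof (cases n)
      case (Suc m)
      then show ?thesis using a add_pow_ldistr[of "a [^] m" a n] by simp
    qed (use a in simp)
    define N where "N = [n] \<cdot> (a [^] n)"
    define C where "C = ?c"
    define Q where "Q = eval q x"
    define P where "P = a [^] n"
    have in_c: "N \<in> carrier R" "C \<in> carrier R" "Q \<in> carrier R" "P \<in> carrier R"
      using an qx c unfolding N_def C_def Q_def P_def by auto
    have CN: "C \<otimes> a = N" using ca C_def N_def by simp
    define u where "u = x \<ominus> a"
    have u: "u \<in> carrier R" "x = u \<oplus> a" unfolding u_def using a x by (auto simp: a_minus_def a_assoc l_neg)
    have "x [^] Suc n = x [^] n \<otimes> x" by simp
    also have "x [^] n = P \<oplus> u \<otimes> C \<oplus> u \<otimes> u \<otimes> Q"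
      using qe[OF x] unfolding P_def C_def Q_def u_def by simp
    also have "(P \<oplus> u \<otimes> C \<oplus> u \<otimes> u \<otimes> Q) \<otimes> x
       = P \<otimes> a \<oplus> u \<otimes> (P \<oplus> C \<otimes> a) \<oplus> u \<otimes> u \<otimes> (Q \<otimes> x \<oplus> C)"
      unfolding u(2) using a u(1) in_c by (simp add: ring_ac_distr)
    finally have "x [^] Suc n = P \<otimes> a \<oplus> (x \<ominus> a) \<otimes> (P \<oplus> N) \<oplus> (x \<ominus> a) \<otimes> (x \<ominus> a) \<otimes> (Q \<otimes> x \<oplus> C)"
      unfolding CN u_def .
    moreover have "[Suc n] \<cdot> (a [^] (Suc n - 1)) = P \<oplus> N"
      using an a_comm[of "a [^] n" "[n] \<cdot> (a [^] n)"] by (simp add: N_def P_def)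
    moreover have "a [^] Suc n = P \<otimes> a" by (simp add: P_def)
    ultimately show ?thesis unfolding e C_def Q_def by simp
  qed
  ultimately show ?case by blast
qed

lemma (in cring) deriv_coeffs_taylor:
  assumes a: "a \<in> carrier R" and p: "set p \<subseteq> carrier R"
  shows "\<exists>q \<in> carrier (poly_ring R). \<forall>x \<in> carrier R.
    eval p x = eval p a \<oplus> (x \<ominus> a) \<otimes> eval (deriv_coeffs p) a \<oplus> (x \<ominus> a) \<otimes> (x \<ominus> a) \<otimes> eval q x"
  using p
proof (induction p rule: deriv_coeffs.induct)
  case 1
  show ?case by (rule bexI[of _ "[]"]) (use a in \<open>auto simp: univ_poly_def a_minus_def\<close>)
next
  case (2 c)
  then show ?case by (intro bexI[of _ "[]"]) (use a in \<open>auto simp: univ_poly_def a_minus_def\<close>)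
next
  case (3 c d p)
  let ?p = "d # p"
  let ?n = "length ?p"
  obtain q where q: "q \<in> carrier (poly_ring R)" and qe: "\<And>x. x \<in> carrier R \<Longrightarrow>
    eval ?p x = eval ?p a \<oplus> (x \<ominus> a) \<otimes> eval (deriv_coeffs ?p) a \<oplus> (x \<ominus> a) \<otimes> (x \<ominus> a) \<otimes> eval q x"
    using 3 by auto
  obtain r where r: "r \<in> carrier (poly_ring R)" and re: "\<And>x. x \<in> carrier R \<Longrightarrow>
    x [^] ?n = a [^] ?n \<oplus> (x \<ominus> a) \<otimes> ([?n] \<cdot> (a [^] (?n - 1))) \<oplus> (x \<ominus> a) \<otimes> (x \<ominus> a) \<otimes> eval r x"
    using power_taylor[OF a, of ?n] by blast
  have qs: "set q \<subseteq> carrier R" and rs: "set r \<subseteq> carrier R" using poly_coeffs q r by auto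
  have c: "c \<in> carrier R" and ps: "set ?p \<subseteq> carrier R" using 3 by auto
  let ?s = "poly_add (poly_mult [c] r) q"
  have ms: "set (poly_mult [c] r) \<subseteq> carrier R" using poly_mult_in_carrier[of "[c]" r] rs c by (simp del: poly_mult.simps)
  have s: "?s \<in> carrier (poly_ring R)"
    using poly_add_is_polynomial[OF carrier_is_subring ms qs] univ_poly_carrier by blast
  have dl: "length (deriv_coeffs ?p) = ?n - 1" by (simp add: length_deriv_coeffs)
  have ds: "set (deriv_coeffs ?p) \<subseteq> carrier R" using deriv_coeffs_closed[OF carrier_is_subring ps] .
  have "eval (c # ?p) x = eval (c # ?p) a \<oplus> (x \<ominus> a) \<otimes> eval (deriv_coeffs (c # ?p)) a
     \<oplus> (x \<ominus> a) \<otimes> (x \<ominus> a) \<otimes> eval ?s x" if x: "x \<in> carrier R" for x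
  proof -
    define D where "D = eval (deriv_coeffs ?p) a"
    define N where "N = [?n] \<cdot> (a [^] (?n - 1))"
    define An where "An = a [^] ?n"
    define Pa where "Pa = eval ?p a"
    define Q where "Q = eval q x"
    define T where "T = eval r x"
    have cl: "D \<in> carrier R" "N \<in> carrier R" "An \<in> carrier R" "Pa \<in> carrier R" "Q \<in> carrier R" "T \<in> carrier R"
      unfolding D_def N_def An_def Pa_def Q_def T_def
      using eval_in_carrier ds ps a x qs rs by auto
    have ev: "eval ?s x = c \<otimes> T \<oplus> Q" unfolding T_def Q_def
      using eval_poly_add[OF ms qs x] eval_poly_mult[of "[c]" r x] c rs x by simp
    have dd: "eval (deriv_coeffs (c # ?p)) a = c \<otimes> N \<oplus> D"
      using dl c a add_pow_ldistr[of c "a [^] (?n - 1)" ?n] add_pow_rdistr[of c "a [^] (?n - 1)" ?n]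
      unfolding D_def N_def by simp
    define u where "u = x \<ominus> a"
    have u: "u \<in> carrier R" unfolding u_def using a x by simp
    have "eval (c # ?p) x = c \<otimes> (An \<oplus> u \<otimes> N \<oplus> u \<otimes> u \<otimes> T)
        \<oplus> (Pa \<oplus> u \<otimes> D \<oplus> u \<otimes> u \<otimes> Q)"
      using re[OF x] qe[OF x] unfolding An_def N_def T_def Pa_def D_def Q_def u_def by simp
    also have "\<dots> = (c \<otimes> An \<oplus> Pa) \<oplus> u \<otimes> (c \<otimes> N \<oplus> D) \<oplus> u \<otimes> u \<otimes> (c \<otimes> T \<oplus> Q)"
      using u c cl by (simp add: ring_ac_distr)
    also have "c \<otimes> An \<oplus> Pa = eval (c # ?p) a" unfolding An_def Pa_def by simp
    finally show ?thesis unfolding ev dd u_def .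
  qed
  then show ?case using s by blast
qed

lemma (in cring) square_cancel:
  assumes "u \<in> carrier R" "h \<in> carrier R" "D \<in> carrier R" "q \<in> carrier R"
    and e: "u \<otimes> u \<otimes> h = u \<otimes> D \<oplus> u \<otimes> u \<otimes> q"
  shows "u \<otimes> D = u \<otimes> (u \<otimes> (h \<ominus> q))"
proof -
  have "u \<otimes> D = (u \<otimes> D \<oplus> u \<otimes> u \<otimes> q) \<ominus> u \<otimes> u \<otimes> q" using assms(1-4) by algebra
  also have "\<dots> = u \<otimes> (u \<otimes> (h \<ominus> q))" unfolding e[symmetric] using assms(1-4) by algebra
  finally show ?thesis .
qed

section \<open>Separability of minimal polynomials in characteristic zero\<close>

locale char0_closed = algebraically_closed R for R (structure) +
  assumes char0: "n \<noteq> 0 \<Longrightarrow> [(n::nat)] \<cdot> \<one> \<noteq> \<zero>"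
begin

lemma nat_mult_not_zero:
  assumes "n \<noteq> (0::nat)" "c \<in> carrier R" "c \<noteq> \<zero>"
  shows "[n] \<cdot> c \<noteq> \<zero>"
proof -
  have "[n] \<cdot> c = ([n] \<cdot> \<one>) \<otimes> c" using add_pow_ldistr[of \<one> c n] assms by simp
  then show ?thesis using char0[OF assms(1)] assms integral_iff by simp
qed

lemma inj_nat_mult_one: "inj (\<lambda>n::nat. [n] \<cdot> \<one>)"
proof (rule linorder_injI)
  fix m n :: nat assume mn: "m < n"
  show "[m] \<cdot> \<one> \<noteq> [n] \<cdot> \<one>"
  proof
    assume eq: "[m] \<cdot> \<one> = [n] \<cdot> \<one>"
    have "[n] \<cdot> \<one> = [m] \<cdot> \<one> \<oplus> [(n - m)] \<cdot> \<one>"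
      using add.nat_pow_mult[of \<one> m "n - m"] mn by (simp add: add_pow_def)
    then have "[(n - m)] \<cdot> \<one> = \<zero>"
      using eq add.r_cancel_one[of "[m] \<cdot> \<one>" "[(n - m)] \<cdot> \<one>"] by simp
    then show False using char0[of "n - m"] mn by simp
  qed
qed

lemma subring_nat_mult_one:
  assumes "subring K R" shows "[(n::nat)] \<cdot> \<one> \<in> K"
  using subringE(2,3,7)[OF assms] by (induction n) auto

lemma infinite_subfield:
  assumes "subring K R" shows "infinite K"
  using subring_nat_mult_one[OF assms] inj_nat_mult_one
  by (metis finite_subset image_subsetI range_inj_infinite)

lemma Irr_eq_if_root:
  assumes K: "subfield K R" and x: "x \<in> carrier R" "(algebraic over K) x"
    and y: "y \<in> carrier R" "eval (Irr K x) y = \<zero>"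
  shows "(algebraic over K) y" "Irr K y = Irr K x"
proof -
  note I = IrrE[OF K x]
  have "Irr K x \<noteq> []" using pirreducibleE(1)[OF subfieldE(1)[OF K] I(1,2)] .
  then show alg: "(algebraic over K) y" using algebraicI[OF I(1)] y(2) by blast
  show "Irr K y = Irr K x"
    using minimal_polynomial_is_unique[OF K y(1) alg] IrrE[OF K y(1) alg] I y(2) by blast
qed

lemma Irr_not_empty:
  assumes "subfield K R" "x \<in> carrier R" "(algebraic over K) x"
  shows "Irr K x \<noteq> []" "Irr K x \<in> carrier (poly_ring R)" "degree (Irr K x) \<ge> 1"
  using pirreducibleE(1)[OF subfieldE(1)[OF assms(1)] IrrE(1,2)[OF assms]]
    carrier_polynomial_shell[OF subfieldE(1)[OF assms(1)] IrrE(1)[OF assms]]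
    pirreducible_degree[OF assms(1) IrrE(1,2)[OF assms]] by auto

lemma degree_Irr_le:
  assumes "subfield K R" "x \<in> carrier R" "(algebraic over K) x"
    "q \<in> carrier (K[X])" "q \<noteq> []" "eval q x = \<zero>"
  shows "degree (Irr K x) \<le> degree q"
  using pdivides_imp_degree_le[OF subfieldE(1)[OF assms(1)] IrrE(1)[OF assms(1-3)] assms(4,5)
      Irr_minimal[OF assms(1-4,6)]] .

text \<open>A double root \<open>a\<close> would be a root of the derivative, which is nonzero in
  characteristic zero, has coefficients in \<open>K\<close> and smaller degree. This contradicts the
  minimality of \<open>Irr K a\<close>, which equals \<open>Irr K x\<close>.\<close>

lemma Irr_alg_mult_le_1:
  assumes K: "subfield K R" and x: "x \<in> carrier R" "(algebraic over K) x" and a: "a \<in> carrier R"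
  shows "alg_mult (Irr K x) a \<le> 1"
proof (rule ccontr)
  let ?m = "Irr K x"
  assume "\<not> ?thesis"
  then have two: "2 \<le> alg_mult ?m a" by simp
  note I = IrrE[OF K x] and J = Irr_not_empty[OF K x]
  have "is_root ?m a" using two alg_mult_gt_zero_iff_is_root[OF J(2), of a] by linarith
  then have ma: "eval ?m a = \<zero>" unfolding is_root_def by simp
  note A = Irr_eq_if_root[OF K x a ma]
  have lin: "[\<one>, \<ominus> a] \<in> carrier (poly_ring R)"
    using a by (simp add: univ_poly_def polynomial_def)
  interpret UP: domain "poly_ring R" using univ_poly_is_domain[OF carrier_is_subring] .
  obtain h where h: "h \<in> carrier (poly_ring R)"
    "?m = ([\<one>, \<ominus> a] [^]\<^bsub>poly_ring R\<^esub> (2::nat)) \<otimes>\<^bsub>poly_ring R\<^esub> h"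
    using le_alg_mult_imp_pdivides[OF a J(2) two] unfolding pdivides_def factor_def by blast
  obtain q where q: "q \<in> carrier (poly_ring R)" and qe: "\<And>x. x \<in> carrier R \<Longrightarrow>
    eval ?m x = eval ?m a \<oplus> (x \<ominus> a) \<otimes> eval (deriv_coeffs ?m) a \<oplus> (x \<ominus> a) \<otimes> (x \<ominus> a) \<otimes> eval q x"
    using deriv_coeffs_taylor[OF a poly_coeffs[OF J(2)]] by blast
  have ds: "set (deriv_coeffs ?m) \<subseteq> K"
    using deriv_coeffs_closed[OF subfieldE(1)[OF K] poly_coeffs[OF I(1)]] .
  define D where "D = eval (deriv_coeffs ?m) a"
  have D: "D \<in> carrier R" unfolding D_def using eval_in_carrier[of "deriv_coeffs ?m" a] ds a subfieldE(3)[OF K] by auto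
  let ?s = "h \<ominus>\<^bsub>poly_ring R\<^esub> q"
  let ?t = "[\<one>, \<ominus> a] \<otimes>\<^bsub>poly_ring R\<^esub> ?s"
  have sC: "?s \<in> carrier (poly_ring R)" using h q by simp
  have ev: "eval ?t y = (y \<ominus> a) \<otimes> (eval h y \<ominus> eval q y)" "eval h y \<in> carrier R" "eval q y \<in> carrier R"
     "eval ?m y = (y \<ominus> a) \<otimes> (y \<ominus> a) \<otimes> eval h y" if y: "y \<in> carrier R" for y
  proof -
    interpret e: ring_hom_ring "poly_ring R" R "\<lambda>p. eval p y"
      using eval_ring_hom[OF carrier_is_subring y] .
    have l: "eval [\<one>, \<ominus> a] y = y \<ominus> a" using y a by (simp add: a_minus_def)
    show "eval h y \<in> carrier R" "eval q y \<in> carrier R" using h q by auto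
    show "eval ?t y = (y \<ominus> a) \<otimes> (eval h y \<ominus> eval q y)"
      using e.hom_mult[OF lin sC] l h q by (simp add: a_minus_def)
    have "eval ?m y = eval ([\<one>, \<ominus> a] [^]\<^bsub>poly_ring R\<^esub> (2::nat)) y \<otimes> eval h y"
      unfolding h(2) using e.hom_mult[of "[\<one>, \<ominus> a] [^]\<^bsub>poly_ring R\<^esub> (2::nat)" h] lin h by simp
    also have "eval ([\<one>, \<ominus> a] [^]\<^bsub>poly_ring R\<^esub> (2::nat)) y = (y \<ominus> a) \<otimes> (y \<ominus> a)"
      using e.hom_mult[OF lin lin] l lin by (simp add: numeral_2_eq_2)
    finally show "eval ?m y = (y \<ominus> a) \<otimes> (y \<ominus> a) \<otimes> eval h y" .
  qed
  define c where "c = poly_of_const D"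
  have c: "c \<in> carrier (poly_ring R)" "\<And>y. y \<in> carrier R \<Longrightarrow> eval c y = D"
    unfolding c_def poly_of_const_def using D normalize_gives_polynomial[of "[D]" "carrier R"]
    by (auto simp: univ_poly_carrier)
  \<comment> \<open>Off \<open>a\<close>, cancelling one factor \<open>y \<ominus> a\<close> between
    the double-root form and the Taylor form shows that \<open>?t\<close> takes the value
    \<open>D\<close>. Infinitely many points make this an identity of polynomials, and
    \<open>?t\<close> vanishes at \<open>a\<close>.\<close>
  have "?t = c"
  proof (rule poly_eq_if_eval_eq[of _ _ "carrier R - {a}"])
    show "?t \<in> carrier (poly_ring R)" using lin sC by simp
    show "infinite (carrier R - {a})" using infinite_subfield[OF carrier_is_subring] by simp
    fix y assume "y \<in> carrier R - {a}"
    then have y: "y \<in> carrier R" "y \<noteq> a" by auto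
    have d: "y \<ominus> a \<in> carrier R" "y \<ominus> a \<noteq> \<zero>" using y a by auto
    have "(y \<ominus> a) \<otimes> D = (y \<ominus> a) \<otimes> ((y \<ominus> a) \<otimes> (eval h y \<ominus> eval q y))"
      using square_cancel[of "y \<ominus> a" "eval h y" D "eval q y"] qe[OF y(1)] ev(2-4)[OF y(1)] d D
      unfolding D_def ma by simp
    then have "D = (y \<ominus> a) \<otimes> (eval h y \<ominus> eval q y)"
      using d D ev(2,3)[OF y(1)] m_lcancel[of "y \<ominus> a" D] by simp
    then show "eval ?t y = eval c y" using ev(1)[OF y(1)] c(2)[OF y(1)] by simp
  qed (use c in auto)
  then have "D = \<zero>" using ev(1)[OF a] c(2)[OF a] ev(2,3)[OF a] a by (simp add: a_minus_def r_neg)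
  moreover have "deriv_coeffs ?m \<in> carrier (K[X])" "deriv_coeffs ?m \<noteq> []"
  proof -
    obtain l d r where m: "?m = l # d # r"
    proof (cases "?m")
      case (Cons l r)
      then show ?thesis using J(3) that by (cases r) auto
    qed (use J in simp)
    have "l \<noteq> \<zero>" "l \<in> carrier R" using J(2) m by (auto simp: univ_poly_def polynomial_def)
    then have "[length (d # r)] \<cdot> l \<noteq> \<zero>" using nat_mult_not_zero[of "length (d # r)" l] by simp
    then show "deriv_coeffs ?m \<in> carrier (K[X])" "deriv_coeffs ?m \<noteq> []"
      using ds m by (auto simp: univ_poly_def polynomial_def)
  qed
  ultimately have "degree (Irr K a) \<le> degree (deriv_coeffs ?m)"
    using degree_Irr_le[OF K a A(1)] D_def by simp
  then show False using J(3) unfolding A(2) length_deriv_coeffs by simp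
qed

lemma card_roots_Irr:
  assumes K: "subfield K R" and x: "x \<in> carrier R" "(algebraic over K) x"
  shows "card {y \<in> carrier R. eval (Irr K x) y = \<zero>} = degree (Irr K x)"
    "finite {y \<in> carrier R. eval (Irr K x) y = \<zero>}"
proof -
  let ?m = "Irr K x"
  note J = Irr_not_empty[OF K x]
  have s: "set_mset (roots ?m) = {y \<in> carrier R. eval ?m y = \<zero>}"
    using roots_mem_iff_is_root[OF J(2)] J(1) unfolding is_root_def by auto
  have "count (roots ?m) a = 1" if "a \<in># roots ?m" for a
  proof -
    have "a \<in> carrier R" using that s by auto
    then have "count (roots ?m) a \<le> 1"
      using Irr_alg_mult_le_1[OF K x] alg_mult_eq_count_roots[OF J(2)] by metis
    then show ?thesis using that count_greater_zero_iff[of "roots ?m" a] by linarith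
  qed
  then have "sum (count (roots ?m)) (set_mset (roots ?m)) = (\<Sum>a\<in>set_mset (roots ?m). 1)"
    by (intro sum.cong) auto
  then have "size (roots ?m) = card (set_mset (roots ?m))"
    unfolding size_multiset_overloaded_eq by (simp only: card_eq_sum)
  then show "card {y \<in> carrier R. eval ?m y = \<zero>} = degree ?m"
    using roots_over_carrier[OF J(2)] unfolding splitted_def s by simp
  show "finite {y \<in> carrier R. eval ?m y = \<zero>}" unfolding s[symmetric] by simp
qed

end

section \<open>Galois extensions inside an algebraically closed field of characteristic zero\<close>

context char0_closed begin

text \<open>Provides the polynomial \<open>g(t - c X)\<close> of the primitive element argument,
  with coefficients in the field generated by \<open>t\<close>.\<close>

lemma comp_linear_exists:
  assumes F: "subring F R" and "set q \<subseteq> F" "c \<in> F" "d \<in> F"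
  shows "\<exists>r \<in> carrier (F[X]). \<forall>x \<in> carrier R. eval r x = eval q (d \<ominus> c \<otimes> x)"
  using assms(2)
proof (induction q rule: rev_induct)
  case Nil
  show ?case by (rule bexI[of _ "[]"]) auto
next
  case (snoc b q)
  then obtain r where r: "r \<in> carrier (F[X])" "\<And>x. x \<in> carrier R \<Longrightarrow> eval r x = eval q (d \<ominus> c \<otimes> x)"
    by auto
  note FR = subringE(1)[OF F]
  interpret UP: domain "F[X]" using univ_poly_is_domain[OF F] .
  let ?l = "normalize [\<ominus> c, d]" and ?b = "normalize [b]"
  have l: "?l \<in> carrier (F[X])" "?b \<in> carrier (F[X])"
    using normalize_gives_polynomial[of _ F] assms(3,4) snoc.prems subringE(5)[OF F]
    by (auto simp: univ_poly_carrier simp del: normalize.simps)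
  have "eval (r \<otimes>\<^bsub>F[X]\<^esub> ?l \<oplus>\<^bsub>F[X]\<^esub> ?b) x = eval (q @ [b]) (d \<ominus> c \<otimes> x)" if x: "x \<in> carrier R" for x
  proof -
    interpret e: ring_hom_ring "F[X]" R "\<lambda>p. eval p x" using eval_ring_hom[OF F x] .
    have cd: "c \<in> carrier R" "d \<in> carrier R" "b \<in> carrier R" "set q \<subseteq> carrier R"
      using assms(3,4) snoc.prems FR by auto
    have "eval ?l x = eval [\<ominus> c, d] x" "eval ?b x = eval [b] x"
      using eval_normalize[of _ x] x cd by (simp_all del: normalize.simps eval.simps)
    then have "eval ?l x = d \<ominus> c \<otimes> x" "eval ?b x = b" using x cd by (auto simp: a_minus_def l_minus a_comm)
    moreover have "eval (q @ [b]) (d \<ominus> c \<otimes> x) = eval q (d \<ominus> c \<otimes> x) \<otimes> (d \<ominus> c \<otimes> x) \<oplus> b"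
      using eval_append_aux[of q b "d \<ominus> c \<otimes> x"] x cd by simp
    ultimately show ?thesis using r l x by simp
  qed
  then show ?case using r l by (metis UP.a_closed UP.m_closed)
qed

lemma subfield_simple_extension:
  assumes "subfield K R" "x \<in> carrier R" "(algebraic over K) x"
  shows "subfield (simple_extension K x) R" "K \<subseteq> simple_extension K x" "x \<in> simple_extension K x"
  using simple_extension_is_subfield[OF assms(1,2)] assms(3)
    simple_extension_incl[OF subfieldE(3)[OF assms(1)] assms(2)]
    simple_extension_mem[OF subfieldE(1)[OF assms(1)] assms(2)] by auto

lemma roots_Irr_mono:
  assumes K: "subfield K R" and F: "subfield F R" "K \<subseteq> F" and x: "x \<in> carrier R" "(algebraic over K) x"
    and y: "y \<in> carrier R" "eval (Irr F x) y = \<zero>"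
  shows "eval (Irr K x) y = \<zero>"
proof -
  have xF: "(algebraic over F) x" using algebraic_mono[OF F(2) x(2)] .
  have KF: "q \<in> carrier (K[X]) \<Longrightarrow> q \<in> carrier (F[X])" for q
    using F(2) unfolding univ_poly_def polynomial_def by auto
  have "Irr F x pdivides Irr K x"
    using Irr_minimal[OF F(1) x(1) xF KF[OF IrrE(1)[OF K x]] IrrE(4)[OF K x]] .
  then show ?thesis using pdivides_imp_root_sharing[OF Irr_not_empty(2)[OF F(1) x(1) xF] _ y(1)] y(2) by simp
qed

lemma root_of_multiple_Irr:
  assumes F: "subfield F R" and x: "x \<in> carrier R" "(algebraic over F) x"
    and q: "q \<in> carrier (F[X])" "eval q x = \<zero>"
    and y: "y \<in> carrier R" "eval (Irr F x) y = \<zero>"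
  shows "eval q y = \<zero>"
  using pdivides_imp_root_sharing[OF Irr_not_empty(2)[OF F x] Irr_minimal[OF F x q] y] .

text \<open>The classical choice \<open>t = a + c b\<close>, with \<open>c\<close> a multiple of
  \<open>\<one>\<close> avoiding finitely many quotients. Over \<open>K(t)\<close> the element
  \<open>b\<close> is then the only common root of its minimal polynomial and of
  \<open>Irr K a\<close> composed with \<open>t - c X\<close>, so separability leaves degree
  one.\<close>

lemma primitive_element_pair:
  assumes K: "subfield K R" and a: "a \<in> carrier R" "(algebraic over K) a"
    and b: "b \<in> carrier R" "(algebraic over K) b"
  shows "\<exists>t \<in> carrier R. (algebraic over K) t \<and> simple_extension K t = finite_extension K [a, b]"
proof -
  define A where "A = {y \<in> carrier R. eval (Irr K a) y = \<zero>}"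
  define B where "B = {y \<in> carrier R. eval (Irr K b) y = \<zero>}"
  have fin: "finite A" "finite B"
    unfolding A_def B_def using card_roots_Irr(2)[OF K a] card_roots_Irr(2)[OF K b] by auto
  \<comment> \<open>Another conjugate \<open>y\<close> of \<open>b\<close> could only survive if
    \<open>x \<ominus> a = c \<otimes> (b \<ominus> y)\<close> for a conjugate \<open>x\<close> of
    \<open>a\<close>. The pairs with \<open>y = b\<close> add harmless values to this finite
    set.\<close>
  let ?bad = "(\<lambda>(x, y). (x \<ominus> a) \<otimes> inv (b \<ominus> y)) ` (A \<times> B)"
  have "infinite (range (\<lambda>n::nat. [n] \<cdot> \<one>) - ?bad)"
    using fin range_inj_infinite[OF inj_nat_mult_one] by simp
  then obtain n :: nat where n: "[n] \<cdot> \<one> \<notin> ?bad" by (metis (no_types, lifting) Diff_iff infinite_imp_nonempty ex_in_conv imageE)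
  define c where "c = [n] \<cdot> \<one>"
  have cK: "c \<in> K" unfolding c_def using subring_nat_mult_one[OF subfieldE(1)[OF K]] .
  have c: "c \<in> carrier R" using cK subfieldE(3)[OF K] by blast
  define t where "t = a \<oplus> c \<otimes> b"
  have t: "t \<in> carrier R" unfolding t_def using a b c by simp
  let ?E = "finite_extension K [a, b]"
  have E: "subring ?E R" using finite_extension_is_subring[OF subfieldE(1)[OF K], of "[a,b]"] a b by simp
  have abE: "a \<in> ?E" "b \<in> ?E" using finite_extension_mem[OF subfieldE(1)[OF K], of "[a,b]"] a b by auto
  have KE: "K \<subseteq> ?E" using finite_extension_incl[OF subfieldE(3)[OF K], of "[a,b]"] a b by simp
  have tE: "t \<in> ?E" unfolding t_def using abE KE cK subringE(6,7)[OF E] by blast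
  have talg: "(algebraic over K) t"
    using finite_extesion_mem_imp_algebraic[OF K, of "[a,b]" t] a b tE by auto
  let ?F = "simple_extension K t"
  note F = subfield_simple_extension[OF K t talg]
  have balg: "(algebraic over ?F) b" using algebraic_mono[OF F(2) b(2)] .
  obtain r where r: "r \<in> carrier (?F[X])" "\<And>x. x \<in> carrier R \<Longrightarrow> eval r x = eval (Irr K a) (t \<ominus> c \<otimes> x)"
    using comp_linear_exists[OF subfieldE(1)[OF F(1)], of "Irr K a" c t] poly_coeffs[OF IrrE(1)[OF K a]] F(2,3) cK
    by blast
  have tcb: "t \<ominus> c \<otimes> b = a" unfolding t_def using a b c by (simp add: a_minus_def a_assoc r_neg)
  have rb: "eval r b = \<zero>" using r(2)[OF b(1)] tcb IrrE(4)[OF K a] by simp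
  have "{y \<in> carrier R. eval (Irr ?F b) y = \<zero>} = {b}"
  proof (intro equalityI subsetI)
    fix y assume "y \<in> {y \<in> carrier R. eval (Irr ?F b) y = \<zero>}"
    then have y: "y \<in> carrier R" "eval (Irr ?F b) y = \<zero>" by auto
    have yB: "y \<in> B" unfolding B_def using roots_Irr_mono[OF K F(1,2) b y] y(1) by simp
    define x where "x = t \<ominus> c \<otimes> y"
    have x: "x \<in> carrier R" unfolding x_def using t c y by simp
    have "eval r y = \<zero>" using root_of_multiple_Irr[OF F(1) b(1) balg r(1) rb y] .
    then have xA: "x \<in> A" unfolding A_def using r(2)[OF y(1)] x x_def by simp
    show "y \<in> {b}"
    proof (rule ccontr)
      assume "y \<notin> {b}"
      then have yb: "y \<noteq> b" by simp
      define s where "s = b \<ominus> y"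
      have s: "s \<in> carrier R" "s \<noteq> \<zero>" unfolding s_def using yb y b by auto
      have b': "b = s \<oplus> y" unfolding s_def using b y by (simp add: a_minus_def a_assoc l_neg)
      have "x \<ominus> a = c \<otimes> s" unfolding x_def t_def b' using a c s y
        by (simp add: a_minus_def r_distr a_ac r_neg r_neg1 r_neg2)
      then have "(x \<ominus> a) \<otimes> inv s = c"
        using s c field_Units by (simp add: m_assoc)
      then have "c \<in> ?bad" using xA yB s_def by force
      then show False using n c_def by simp
    qed
  qed (use b IrrE(4)[OF F(1) b(1) balg] in auto)
  then have "degree (Irr ?F b) = 1" using card_roots_Irr(1)[OF F(1) b(1) balg] by simp
  then obtain l d where ld: "Irr ?F b = [l, d]" "l \<in> ?F" "d \<in> ?F"
    using degree_oneE[OF IrrE(1)[OF F(1) b(1) balg]] by metis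
  then have "l = \<one>" using IrrE(3)[OF F(1) b(1) balg] by simp
  moreover have dR: "d \<in> carrier R" using ld(3) subfieldE(3)[OF F(1)] by blast
  ultimately have "b \<oplus> d = \<zero>" using IrrE(4)[OF F(1) b(1) balg] ld b by simp
  then have "b = \<ominus> d" using b dR by (simp add: minus_equality)
  then have bF: "b \<in> ?F" using ld(3) subringE(5)[OF subfieldE(1)[OF F(1)]] by simp
  have "c \<otimes> b \<in> ?F" using bF cK F(2) subringE(6)[OF subfieldE(1)[OF F(1)]] by blast
  then have aF: "a \<in> ?F" using tcb F(3) subringE(5,7)[OF subfieldE(1)[OF F(1)]] by (metis a_minus_def)
  have "?F = ?E"
    using simple_extension_subring_incl[OF E KE tE]
      finite_extension_subring_incl[OF subfieldE(1)[OF F(1)] F(2), of "[a,b]"] aF bF by auto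
  then show ?thesis using t talg by blast
qed

lemma primitive_element_list:
  assumes K: "subfield K R" and xs: "set xs \<subseteq> carrier R" "\<And>x. x \<in> set xs \<Longrightarrow> (algebraic over K) x"
  shows "\<exists>t \<in> carrier R. (algebraic over K) t \<and> simple_extension K t = finite_extension K xs"
  using xs
proof (induction xs)
  case Nil
  have "simple_extension K \<zero> \<subseteq> K"
    using simple_extension_subring_incl[OF subfieldE(1)[OF K]] subringE(2)[OF subfieldE(1)[OF K]] by simp
  then show ?case
    using zero_is_algebraic[OF subfieldE(1)[OF K]] simple_extension_incl[OF subfieldE(3)[OF K], of \<zero>]
    by (intro bexI[of _ \<zero>]) auto
next
  case (Cons x xs)
  then obtain t where t: "t \<in> carrier R" "(algebraic over K) t" "simple_extension K t = finite_extension K xs"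
    by auto
  have "finite_extension K (x # xs) = finite_extension K [x, t]" using t(3) by simp
  then show ?case using primitive_element_pair[OF K _ _ t(1,2), of x] Cons.prems by simp
qed

lemma dimension_subset_eq:
  assumes K: "subfield K R" and d: "dimension n K V" "dimension n K W" and s: "V \<subseteq> W"
  shows "V = W"
proof -
  obtain Us where U: "set Us \<subseteq> carrier R" "independent K Us" "length Us = n" "Span K Us = V"
    using exists_base[OF K d(1)] by blast
  have "set Us \<subseteq> W" using Span_base_incl[OF K U(1)] U(4) s by blast
  then show ?thesis using independent_length_eq_dimension[OF K d(2) U(2)] U(3,4) by simp
qed

lemma primitive_element:
  assumes K: "subfield K R" and E: "subfield E R" "K \<subseteq> E" "finite_dimension K E"
  shows "\<exists>t \<in> E. simple_extension K t = E"
proof -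
  obtain n where n: "dimension n K E" using E(3) by auto
  obtain Us where U: "set Us \<subseteq> carrier R" "independent K Us" "length Us = n" "Span K Us = E"
    using exists_base[OF K n] by blast
  have UE: "set Us \<subseteq> E" using Span_base_incl[OF K U(1)] U(4) by blast
  have alg: "(algebraic over K) x" if "x \<in> set Us" for x
    using finite_dimension_imp_algebraic[OF K subfieldE(1)[OF E(1)] E(3)] UE that by blast
  have "finite_extension K Us \<subseteq> E"
    using finite_extension_subring_incl[OF subfieldE(1)[OF E(1)] E(2) UE] .
  moreover have "Span K Us \<subseteq> finite_extension K Us"
    using subalgebra_Span_incl[OF K finite_dimension_imp_subalgebra[OF K finite_extension_finite_dimension(1)[OF K U(1)]]
        finite_extension_mem[OF subfieldE(1)[OF K] U(1)]] alg by blast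
  ultimately have "finite_extension K Us = E" using U(4) by blast
  moreover obtain t where t: "t \<in> carrier R" "(algebraic over K) t" "simple_extension K t = finite_extension K Us"
    using primitive_element_list[OF K U(1) alg] by blast
  ultimately show ?thesis using subfield_simple_extension(3)[OF K t(1,2)] by auto
qed

text \<open>The value \<open>eval q u\<close> does not depend on the polynomial chosen to represent
  an element of \<open>K(t)\<close>: two representatives differ by a polynomial vanishing at
  \<open>t\<close>, hence also at its conjugate \<open>u\<close>.\<close>

lemma simple_extension_hom:
  assumes K: "subfield K R" and t: "t \<in> carrier R" "(algebraic over K) t"
    and u: "u \<in> carrier R" "eval (Irr K t) u = \<zero>"
  shows "\<exists>\<sigma> \<in> ring_hom (R\<lparr>carrier := simple_extension K t\<rparr>) R. \<forall>q \<in> carrier (K[X]). \<sigma> (eval q t) = eval q u"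
proof -
  define \<sigma> where "\<sigma> x = eval (SOME q. q \<in> carrier (K[X]) \<and> eval q t = x) u" for x
  interpret UP: domain "K[X]" using univ_poly_is_domain[OF subfieldE(1)[OF K]] .
  interpret et: ring_hom_ring "K[X]" R "\<lambda>p. eval p t" using eval_ring_hom[OF subfieldE(1)[OF K] t(1)] .
  interpret eu: ring_hom_ring "K[X]" R "\<lambda>p. eval p u" using eval_ring_hom[OF subfieldE(1)[OF K] u(1)] .
  have wd: "eval q u = eval r u" if "q \<in> carrier (K[X])" "r \<in> carrier (K[X])" "eval q t = eval r t" for q r
  proof -
    have "eval (q \<ominus>\<^bsub>K[X]\<^esub> r) t = \<zero>" using that by (simp add: a_minus_def r_neg)
    then have "eval (q \<ominus>\<^bsub>K[X]\<^esub> r) u = \<zero>" using root_of_multiple_Irr[OF K t _ _ u] that by simp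
    then have "eval q u \<ominus> eval r u = \<zero>" using that by (simp add: a_minus_def)
    then show ?thesis using that by simp
  qed
  have ev: "\<sigma> (eval q t) = eval q u" if "q \<in> carrier (K[X])" for q
    unfolding \<sigma>_def by (rule wd, insert someI[of "\<lambda>r. r \<in> carrier (K[X]) \<and> eval r t = eval q t" q] that) auto
  have img: "simple_extension K t = (\<lambda>p. eval p t) ` carrier (K[X])"
    using simple_extension_as_eval_img[OF subfieldE(3)[OF K] t(1)] .
  have "\<sigma> \<in> ring_hom (R\<lparr>carrier := simple_extension K t\<rparr>) R"
  proof (rule ring_hom_memI)
    fix x assume "x \<in> carrier (R\<lparr>carrier := simple_extension K t\<rparr>)"
    then show "\<sigma> x \<in> carrier R" using img ev by auto
  next
    fix x y assume "x \<in> carrier (R\<lparr>carrier := simple_extension K t\<rparr>)" "y \<in> carrier (R\<lparr>carrier := simple_extension K t\<rparr>)"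
    then obtain q r where q: "q \<in> carrier (K[X])" "x = eval q t" and r: "r \<in> carrier (K[X])" "y = eval r t"
      using img by auto
    show "\<sigma> (x \<otimes>\<^bsub>R\<lparr>carrier := simple_extension K t\<rparr>\<^esub> y) = \<sigma> x \<otimes> \<sigma> y"
      using ev[of "q \<otimes>\<^bsub>K[X]\<^esub> r"] ev q r by simp
    show "\<sigma> (x \<oplus>\<^bsub>R\<lparr>carrier := simple_extension K t\<rparr>\<^esub> y) = \<sigma> x \<oplus> \<sigma> y"
      using ev[of "q \<oplus>\<^bsub>K[X]\<^esub> r"] ev q r by simp
  next
    show "\<sigma> \<one>\<^bsub>R\<lparr>carrier := simple_extension K t\<rparr>\<^esub> = \<one>"
      using ev[of "\<one>\<^bsub>K[X]\<^esub>"] et.hom_one eu.hom_one UP.one_closed by simp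
  qed
  then show ?thesis using ev by blast
qed

end

section \<open>Automorphisms of a field over a subfield\<close>

lemma (in ring) Gal_iff:
  "\<rho> \<in> carrier (Gal K E) \<longleftrightarrow> \<rho> \<in> Bij E \<and> \<rho> \<in> ring_hom (R\<lparr>carrier := E\<rparr>) (R\<lparr>carrier := E\<rparr>) \<and> (\<forall>x \<in> K. \<rho> x = x)"
  unfolding Gal_def by auto

lemma (in ring) Gal_memD:
  assumes "\<rho> \<in> carrier (Gal K E)"
  shows "\<And>x. x \<in> E \<Longrightarrow> \<rho> x \<in> E" "\<rho> \<in> extensional E" "inj_on \<rho> E" "\<rho> ` E = E" "\<And>x. x \<in> K \<Longrightarrow> \<rho> x = x"
    "\<And>x y. x \<in> E \<Longrightarrow> y \<in> E \<Longrightarrow> \<rho> (x \<oplus> y) = \<rho> x \<oplus> \<rho> y"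
    "\<And>x y. x \<in> E \<Longrightarrow> y \<in> E \<Longrightarrow> \<rho> (x \<otimes> y) = \<rho> x \<otimes> \<rho> y" "\<rho> \<one> = \<one>"
  using assms unfolding Gal_iff Bij_def bij_betw_def ring_hom_def by auto

lemma (in ring) Gal_ext:
  assumes "\<rho> \<in> carrier (Gal K E)" "\<tau> \<in> carrier (Gal F E)" "\<And>x. x \<in> E \<Longrightarrow> \<rho> x = \<tau> x"
  shows "\<rho> = \<tau>"
  using extensionalityI[OF Gal_memD(2)[OF assms(1)] Gal_memD(2)[OF assms(2)] assms(3)] .

lemma (in ring) Gal_mult:
  assumes "\<rho> \<in> carrier (Gal K E)" "\<tau> \<in> carrier (Gal K E)"
  shows "\<rho> \<otimes>\<^bsub>Gal K E\<^esub> \<tau> = compose E \<rho> \<tau>"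
  using assms unfolding Gal_def BijGroup_def by simp

lemma (in ring) Gal_mult_apply:
  assumes "\<rho> \<in> carrier (Gal K E)" "\<tau> \<in> carrier (Gal K E)" "x \<in> E"
  shows "(\<rho> \<otimes>\<^bsub>Gal K E\<^esub> \<tau>) x = \<rho> (\<tau> x)"
  unfolding Gal_mult[OF assms(1,2)] compose_def using assms(3) by simp

lemma (in ring) Gal_one: "\<one>\<^bsub>Gal K E\<^esub> = (\<lambda>x\<in>E. x)"
  unfolding Gal_def BijGroup_def by simp

lemma (in ring) Gal_carrier_mono:
  assumes "K \<subseteq> F" shows "carrier (Gal F E) \<subseteq> carrier (Gal K E)"
  using assms unfolding Gal_iff subset_iff by blast

lemma (in ring) Gal_group:
  assumes E: "subring E R" and KE: "K \<subseteq> E"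
  shows "group (Gal K E)"
proof -
  note cl = subringE[OF E]
  let ?H = "carrier (Gal K E)"
  have "subgroup ?H (BijGroup E)"
  proof (rule group.subgroupI[OF group_BijGroup])
    show "?H \<subseteq> carrier (BijGroup E)" by (auto simp: Gal_iff BijGroup_def)
    have "(\<lambda>x\<in>E. x) \<in> ?H" unfolding Gal_iff
      using id_Bij[of E] KE cl by (auto intro!: ring_hom_memI)
    then show "?H \<noteq> {}" by blast
  next
    fix \<rho> assume s: "\<rho> \<in> ?H"
    note d = Gal_memD[OF s]
    have B: "\<rho> \<in> Bij E" using s unfolding Gal_iff by simp
    have i: "inv\<^bsub>BijGroup E\<^esub> \<rho> = (\<lambda>x\<in>E. inv_into E \<rho> x)" using inv_BijGroup[OF B] .
    have "(\<lambda>x\<in>E. inv_into E \<rho> x) \<in> ring_hom (R\<lparr>carrier := E\<rparr>) (R\<lparr>carrier := E\<rparr>)"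
      using cl d(6,7,8) Bij_inv_into_mem[OF B] inv_into_f_f[OF d(3)]
        Bij_inv_into_lemma[OF _ B, of "\<lambda>x y. x \<oplus> y"] Bij_inv_into_lemma[OF _ B, of "\<lambda>x y. x \<otimes> y"]
      by (intro ring_hom_memI) (auto, metis)
    moreover have "(\<lambda>x\<in>E. inv_into E \<rho> x) x = x" if "x \<in> K" for x
      using inv_into_f_f[OF d(3), of x] d(5)[OF that] that KE by auto
    ultimately show "inv\<^bsub>BijGroup E\<^esub> \<rho> \<in> ?H" unfolding i Gal_iff using restrict_inv_into_Bij[OF B] by blast
  next
    fix \<rho> \<tau> assume s: "\<rho> \<in> ?H" and t: "\<tau> \<in> ?H"
    note d = Gal_memD[OF s] and e = Gal_memD[OF t]
    have B: "\<rho> \<in> Bij E" "\<tau> \<in> Bij E" using s t unfolding Gal_iff by auto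
    have "compose E \<rho> \<tau> \<in> ?H" unfolding Gal_iff
      using compose_Bij[OF B] d e KE cl by (auto intro!: ring_hom_memI simp: compose_def)
    then show "\<rho> \<otimes>\<^bsub>BijGroup E\<^esub> \<tau> \<in> ?H" using B unfolding BijGroup_def by simp
  qed
  then show ?thesis
    using subgroup.subgroup_is_group[OF _ group_BijGroup] unfolding Gal_def by simp
qed

lemma (in ring) Gal_inv_apply:
  assumes E: "subring E R" "K \<subseteq> E" and s: "\<rho> \<in> carrier (Gal K E)" and x: "x \<in> E"
  shows "(inv\<^bsub>Gal K E\<^esub> \<rho>) (\<rho> x) = x" "\<rho> ((inv\<^bsub>Gal K E\<^esub> \<rho>) x) = x"
proof -
  interpret G: group "Gal K E" using Gal_group[OF E] .
  show "(inv\<^bsub>Gal K E\<^esub> \<rho>) (\<rho> x) = x"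
    using Gal_mult_apply[OF G.inv_closed[OF s] s x] G.l_inv[OF s] Gal_one x by simp
  show "\<rho> ((inv\<^bsub>Gal K E\<^esub> \<rho>) x) = x"
    using Gal_mult_apply[OF s G.inv_closed[OF s] x] G.r_inv[OF s] Gal_one x by simp
qed

lemma (in ring) Gal_subset_mult:
  assumes "K \<subseteq> F" "\<rho> \<in> carrier (Gal F E)" "\<tau> \<in> carrier (Gal F E)"
  shows "\<rho> \<otimes>\<^bsub>Gal F E\<^esub> \<tau> = \<rho> \<otimes>\<^bsub>Gal K E\<^esub> \<tau>"
proof -
  have "\<rho> \<in> carrier (Gal K E)" "\<tau> \<in> carrier (Gal K E)" using Gal_carrier_mono[OF assms(1)] assms(2,3) by auto
  then show ?thesis using Gal_mult[OF assms(2,3)] Gal_mult by simp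
qed

lemma (in ring) ring_hom_eval_fixed:
  assumes E: "subring E R" and s: "\<rho> \<in> ring_hom (R\<lparr>carrier := E\<rparr>) R"
    and fx: "\<And>x. x \<in> K \<Longrightarrow> \<rho> x = x" and q: "set q \<subseteq> K" "K \<subseteq> E" and x: "x \<in> E"
  shows "\<rho> (eval q x) = eval q (\<rho> x)"
proof -
  interpret h: ring_hom_ring "R\<lparr>carrier := E\<rparr>" R \<rho>
    using ring_hom_ringI2[OF subring_is_ring[OF E] ring_axioms s] .
  have "map \<rho> q = q" using q(1) fx by (intro map_idI) auto
  then show ?thesis using h.eval_hom'[of x q] x q eval_consistent[OF E] by auto
qed

lemma (in ring) Gal_hom:
  assumes E: "subring E R" and s: "\<rho> \<in> carrier (Gal K E)"
  shows "\<rho> \<in> ring_hom (R\<lparr>carrier := E\<rparr>) R"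
  using Gal_memD[OF s] subringE(1)[OF E] by (intro ring_hom_memI) auto

lemma (in ring) Gal_ring_hom_ring:
  assumes E: "subring E R" and s: "\<rho> \<in> carrier (Gal K E)"
  shows "ring_hom_ring (R\<lparr>carrier := E\<rparr>) R \<rho>"
  using ring_hom_ringI2[OF subring_is_ring[OF E] ring_axioms Gal_hom[OF E s]] .

lemma (in ring) Gal_eval:
  assumes E: "subring E R" "K \<subseteq> E" and s: "\<rho> \<in> carrier (Gal K E)" and q: "set q \<subseteq> K" and x: "x \<in> E"
  shows "\<rho> (eval q x) = eval q (\<rho> x)"
  using ring_hom_eval_fixed[OF E(1) Gal_hom[OF E(1) s] Gal_memD(5)[OF s] q E(2) x] .

lemma (in ring) Gal_minus:
  assumes E: "subring E R" and s: "\<rho> \<in> carrier (Gal K E)"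
  shows "x \<in> E \<Longrightarrow> y \<in> E \<Longrightarrow> \<rho> (x \<ominus> y) = \<rho> x \<ominus> \<rho> y" "\<rho> \<zero> = \<zero>" "x \<in> E \<Longrightarrow> \<rho> (\<ominus> x) = \<ominus> \<rho> x"
    "x \<in> E \<Longrightarrow> \<rho> (x [^] (n::nat)) = \<rho> x [^] n" "x \<in> E \<Longrightarrow> \<rho> ([n] \<cdot> x) = [n] \<cdot> \<rho> x"
proof -
  interpret h: ring_hom_ring "R\<lparr>carrier := E\<rparr>" R \<rho> using Gal_ring_hom_ring[OF E s] .
  note cl = subringE[OF E]
  show z: "\<rho> \<zero> = \<zero>" using h.hom_zero by simp
  show m: "\<rho> (\<ominus> x) = \<ominus> \<rho> x" if x: "x \<in> E" for x
  proof -
    have "\<rho> (\<ominus> x) \<oplus> \<rho> x = \<zero>"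
      using Gal_memD(6)[OF s cl(5)[OF x] x] x cl(1) z l_neg by auto
    then show ?thesis using minus_equality[of "\<rho> (\<ominus> x)" "\<rho> x"] Gal_memD(1)[OF s] x cl(1,5) by (simp add: subset_iff)
  qed
  show "\<rho> (x \<ominus> y) = \<rho> x \<ominus> \<rho> y" if "x \<in> E" "y \<in> E"
    unfolding a_minus_def using Gal_memD(6)[OF s that(1) cl(5)[OF that(2)]] m that by simp
  show "\<rho> (x [^] n) = \<rho> x [^] n" if x: "x \<in> E"
  proof (induction n)
    case (Suc n)
    have "x [^] n \<in> E" using x cl(3,6) by (induction n) auto
    then show ?case using Suc Gal_memD(7)[OF s _ x] by simp
  qed (use Gal_memD(8)[OF s] in simp)
  show "\<rho> ([n] \<cdot> x) = [n] \<cdot> \<rho> x" if x: "x \<in> E"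
  proof (induction n)
    case (Suc n)
    have "[n] \<cdot> x \<in> E" using x cl(2,7) by (induction n) auto
    then show ?case using Suc Gal_memD(6)[OF s _ x] by simp
  qed (use z in simp)
qed

text \<open>Stated through a primitive element all of whose conjugates lie in \<open>E\<close>, so
  that automorphisms are counted by the roots of one minimal polynomial. Separability is automatic
  in characteristic zero.\<close>

definition (in ring) galois :: "'a set \<Rightarrow> 'a set \<Rightarrow> bool" where
  "galois K E \<longleftrightarrow> subfield K R \<and> subfield E R \<and> K \<subseteq> E \<and>
    (\<exists>t \<in> E. (algebraic over K) t \<and> simple_extension K t = E \<and>
      (\<forall>y \<in> carrier R. eval (Irr K t) y = \<zero> \<longrightarrow> y \<in> E))"

definition (in ring) fixed_field :: "'a set \<Rightarrow> ('a \<Rightarrow> 'a) set \<Rightarrow> 'a set" where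
  "fixed_field E H = {x \<in> E. \<forall>\<rho> \<in> H. \<rho> x = x}"

section \<open>The Galois correspondence\<close>

context char0_closed begin

text \<open>Surjectivity is the point: an injective endomorphism over \<open>K\<close> maps the
  finite set of conjugates of \<open>y\<close> inside \<open>E\<close> to itself, hence onto
  itself.\<close>

lemma restrict_in_Gal:
  assumes K: "subfield K R" and E: "subfield E R" "K \<subseteq> E" "\<And>x. x \<in> E \<Longrightarrow> (algebraic over K) x"
    and s: "\<rho> \<in> ring_hom (R\<lparr>carrier := E\<rparr>) R" "\<rho> ` E \<subseteq> E" "\<And>x. x \<in> K \<Longrightarrow> \<rho> x = x"
  shows "restrict \<rho> E \<in> carrier (Gal K E)"
proof -
  interpret EF: field "R\<lparr>carrier := E\<rparr>" using subfield_iff(2)[OF E(1)] .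
  interpret h: ring_hom_ring "R\<lparr>carrier := E\<rparr>" R \<rho>
    using ring_hom_ringI2[OF subring_is_ring[OF subfieldE(1)[OF E(1)]] is_ring s(1)] .
  have inj: "inj_on \<rho> E" using h.img_is_subfield(1)[OF EF.carrier_is_subfield] by simp
  have surj: "E \<subseteq> \<rho> ` E"
  proof
    fix y assume y: "y \<in> E"
    then have yR: "y \<in> carrier R" using subfieldE(3)[OF E(1)] by blast
    define S where "S = {z \<in> E. eval (Irr K y) z = \<zero>}"
    have "S \<subseteq> {z \<in> carrier R. eval (Irr K y) z = \<zero>}" using subfieldE(3)[OF E(1)] unfolding S_def by blast
    then have fin: "finite S" using card_roots_Irr(2)[OF K yR E(3)[OF y]] finite_subset by blast
    have sub: "\<rho> ` S \<subseteq> S"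
    proof
      fix z assume "z \<in> \<rho> ` S"
      then obtain x where x: "x \<in> E" "eval (Irr K y) x = \<zero>" "z = \<rho> x" unfolding S_def by blast
      have "eval (Irr K y) z = \<rho> (eval (Irr K y) x)"
        using ring_hom_eval_fixed[OF subfieldE(1)[OF E(1)] s(1,3) poly_coeffs[OF IrrE(1)[OF K yR E(3)[OF y]]] E(2) x(1)]
          x(3) by simp
      then show "z \<in> S" unfolding S_def using x s(2) h.hom_zero by auto
    qed
    have "inj_on \<rho> S" using inj_on_subset[OF inj, of S] unfolding S_def by simp
    then have "\<rho> ` S = S" using endo_inj_surj[OF fin sub] by simp
    moreover have "y \<in> S" unfolding S_def using y IrrE(4)[OF K yR E(3)[OF y]] by simp
    ultimately show "y \<in> \<rho> ` E" unfolding S_def by blast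
  qed
  have "bij_betw (restrict \<rho> E) E E" using inj surj s(2) by (auto simp: bij_betw_def)
  moreover have "restrict \<rho> E \<in> ring_hom (R\<lparr>carrier := E\<rparr>) (R\<lparr>carrier := E\<rparr>)"
    using ring_hom_memE[OF s(1)] s(2) subringE[OF subfieldE(1)[OF E(1)]] by (intro ring_hom_memI) auto
  ultimately show ?thesis unfolding Gal_iff Bij_def using s(3) E(2) by auto
qed

lemma galoisD:
  assumes "galois K E"
  shows "subfield K R" "subfield E R" "K \<subseteq> E" "finite_dimension K E" "\<And>x. x \<in> E \<Longrightarrow> (algebraic over K) x"
    "subring K R" "subring E R" "K \<subseteq> carrier R" "E \<subseteq> carrier R"
proof -
  show g: "subfield K R" "subfield E R" "K \<subseteq> E" using assms unfolding galois_def by auto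
  obtain t where t: "t \<in> E" "(algebraic over K) t" "simple_extension K t = E" using assms unfolding galois_def by blast
  have tR: "t \<in> carrier R" using t(1) subfieldE(3)[OF g(2)] by blast
  show fd: "finite_dimension K E" using finite_dimension_simple_extension[OF g(1) tR] t(2,3) by simp
  show "\<And>x. x \<in> E \<Longrightarrow> (algebraic over K) x"
    using finite_dimension_imp_algebraic[OF g(1) subfieldE(1)[OF g(2)] fd] .
  show "subring K R" "subring E R" "K \<subseteq> carrier R" "E \<subseteq> carrier R" using subfieldE(1,3) g by auto
qed

text \<open>Injective because \<open>t\<close> generates \<open>E\<close>; surjective because
  \<open>simple_extension_hom\<close> realises every conjugate \<open>y\<close> of \<open>t\<close>,
  and the image stays in \<open>E\<close> once \<open>y\<close> does.\<close>

lemma Gal_bij_roots: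
  assumes g: "galois K E" and t: "t \<in> E" "simple_extension K t = E"
    and r: "\<And>y. y \<in> carrier R \<Longrightarrow> eval (Irr K t) y = \<zero> \<Longrightarrow> y \<in> E"
  shows "bij_betw (\<lambda>\<rho>. \<rho> t) (carrier (Gal K E)) {y \<in> carrier R. eval (Irr K t) y = \<zero>}"
proof (rule bij_betw_imageI)
  note d = galoisD[OF g]
  have tR: "t \<in> carrier R" and ta: "(algebraic over K) t" using t(1) d(5,9) by auto
  have img: "E = (\<lambda>p. eval p t) ` carrier (K[X])"
    using simple_extension_as_eval_img[OF d(8) tR] t(2) by simp
  show "inj_on (\<lambda>\<rho>. \<rho> t) (carrier (Gal K E))"
  proof (rule inj_onI)
    fix \<rho> \<tau> assume s: "\<rho> \<in> carrier (Gal K E)" and u: "\<tau> \<in> carrier (Gal K E)" and eq: "\<rho> t = \<tau> t"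
    show "\<rho> = \<tau>"
    proof (rule Gal_ext[OF s u])
      fix x assume "x \<in> E"
      then obtain q where q: "q \<in> carrier (K[X])" "x = eval q t" using img by blast
      show "\<rho> x = \<tau> x" using Gal_eval[OF d(7,3) s poly_coeffs[OF q(1)] t(1)]
          Gal_eval[OF d(7,3) u poly_coeffs[OF q(1)] t(1)] q(2) eq by simp
    qed
  qed
  show "(\<lambda>\<rho>. \<rho> t) ` carrier (Gal K E) = {y \<in> carrier R. eval (Irr K t) y = \<zero>}"
  proof (intro equalityI subsetI)
    fix y assume "y \<in> (\<lambda>\<rho>. \<rho> t) ` carrier (Gal K E)"
    then obtain \<rho> where s: "\<rho> \<in> carrier (Gal K E)" "y = \<rho> t" by blast
    have "eval (Irr K t) y = \<rho> (eval (Irr K t) t)"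
      using Gal_eval[OF d(7,3) s(1) poly_coeffs[OF IrrE(1)[OF d(1) tR ta]] t(1)] s(2) by simp
    also have "\<dots> = \<zero>" using IrrE(4)[OF d(1) tR ta] Gal_minus(2)[OF d(7) s(1)] by simp
    finally show "y \<in> {y \<in> carrier R. eval (Irr K t) y = \<zero>}"
      using Gal_memD(1)[OF s(1) t(1)] s(2) d(9) by auto
  next
    fix y assume "y \<in> {y \<in> carrier R. eval (Irr K t) y = \<zero>}"
    then have y: "y \<in> carrier R" "eval (Irr K t) y = \<zero>" by auto
    obtain \<rho> where s: "\<rho> \<in> ring_hom (R\<lparr>carrier := E\<rparr>) R" "\<And>q. q \<in> carrier (K[X]) \<Longrightarrow> \<rho> (eval q t) = eval q y"
      using simple_extension_hom[OF d(1) tR ta y] t(2) by auto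
    have yE: "y \<in> E" using r y by blast
    have "\<rho> ` E \<subseteq> E"
      using img s(2) eval_in_subring[OF d(7) _ yE] poly_coeffs d(3) by (auto, meson order_trans)
    moreover have "\<rho> x = x" if "x \<in> K" for x
    proof -
      let ?q = "poly_of_const x"
      have "?q \<in> carrier (K[X])" unfolding poly_of_const_def
        using normalize_gives_polynomial[of "[x]" K] that by (simp add: univ_poly_carrier)
      moreover have "eval ?q z = x" if "z \<in> carrier R" for z
        unfolding poly_of_const_def using that \<open>x \<in> K\<close> d(8) by auto
      ultimately show ?thesis using s(2)[of ?q] tR y(1) by simp
    qed
    ultimately have "restrict \<rho> E \<in> carrier (Gal K E)"
      using restrict_in_Gal[OF d(1-3,5) s(1)] by simp
    moreover have "restrict \<rho> E t = y"
      using s(2)[of "X"] var_closed(1)[OF d(6)] eval_var[OF tR] eval_var[OF y(1)] t(1) by simp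
    ultimately show "y \<in> (\<lambda>\<rho>. \<rho> t) ` carrier (Gal K E)" by (intro image_eqI[of _ _ "restrict \<rho> E"]) auto
  qed
qed

lemma galois_card:
  assumes g: "galois K E"
  shows "dimension (card (carrier (Gal K E))) K E" "finite (carrier (Gal K E))" "card (carrier (Gal K E)) > 0"
proof -
  note d = galoisD[OF g]
  obtain t where t: "t \<in> E" "(algebraic over K) t" "simple_extension K t = E"
    "\<And>y. y \<in> carrier R \<Longrightarrow> eval (Irr K t) y = \<zero> \<Longrightarrow> y \<in> E" using g unfolding galois_def by blast
  have tR: "t \<in> carrier R" using t(1) d(9) by auto
  have b: "bij_betw (\<lambda>\<rho>. \<rho> t) (carrier (Gal K E)) {y \<in> carrier R. eval (Irr K t) y = \<zero>}"
    using Gal_bij_roots[OF g t(1,3,4)] by blast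
  note c = card_roots_Irr[OF d(1) tR t(2)]
  show "finite (carrier (Gal K E))" using b c(2) bij_betw_finite by blast
  have e: "card (carrier (Gal K E)) = degree (Irr K t)" using bij_betw_same_card[OF b] c(1) by simp
  show "dimension (card (carrier (Gal K E))) K E" "card (carrier (Gal K E)) > 0"
    unfolding e using dimension_simple_extension[OF d(1) tR t(2)] t(3) Irr_not_empty(3)[OF d(1) tR t(2)] by auto
qed

lemma galois_intermediate:
  assumes g: "galois K E" and F: "subfield F R" "K \<subseteq> F" "F \<subseteq> E"
  shows "galois F E"
proof -
  note d = galoisD[OF g]
  obtain t where t: "t \<in> E" "(algebraic over K) t" "simple_extension K t = E"
    "\<And>y. y \<in> carrier R \<Longrightarrow> eval (Irr K t) y = \<zero> \<Longrightarrow> y \<in> E" using g unfolding galois_def by blast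
  have tR: "t \<in> carrier R" using t(1) d(9) by auto
  have "simple_extension F t = E"
    using mono_simple_extension[OF F(2), of t] simple_extension_subring_incl[OF d(7) F(3) t(1)] t(3) by blast
  moreover have "(algebraic over F) t" using algebraic_mono[OF F(2) t(2)] .
  ultimately show ?thesis unfolding galois_def
    using F d(2) t(1) roots_Irr_mono[OF d(1) F(1,2) tR t(2)] t(4) by blast
qed

text \<open>If the whole group fixes \<open>x\<close>, then \<open>E\<close> has the same
  automorphisms over \<open>K(x)\<close> as over \<open>K\<close>. Both degrees equal the order of
  the group, so \<open>K(x)\<close> has degree one over \<open>K\<close>.\<close>

lemma galois_fixed:
  assumes g: "galois K E" and x: "x \<in> E" "\<And>\<rho>. \<rho> \<in> carrier (Gal K E) \<Longrightarrow> \<rho> x = x"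
  shows "x \<in> K"
proof -
  note d = galoisD[OF g]
  have xR: "x \<in> carrier R" using x(1) d(9) by auto
  let ?F = "simple_extension K x"
  note F = subfield_simple_extension[OF d(1) xR d(5)[OF x(1)]]
  have FE: "?F \<subseteq> E" using simple_extension_subring_incl[OF d(7,3) x(1)] .
  have "carrier (Gal K E) \<subseteq> carrier (Gal ?F E)"
  proof
    fix \<rho> assume s: "\<rho> \<in> carrier (Gal K E)"
    have "\<rho> y = y" if "y \<in> ?F" for y
    proof -
      obtain q where q: "q \<in> carrier (K[X])" "y = eval q x"
        using \<open>y \<in> ?F\<close> simple_extension_as_eval_img[OF d(8) xR] by blast
      show ?thesis using Gal_eval[OF d(7,3) s poly_coeffs[OF q(1)] x(1)] q(2) x(2)[OF s] by simp
    qed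
    then show "\<rho> \<in> carrier (Gal ?F E)" using s unfolding Gal_iff by blast
  qed
  then have eq: "carrier (Gal K E) = carrier (Gal ?F E)" using Gal_carrier_mono[OF F(2)] by blast
  let ?n = "card (carrier (Gal K E))"
  have n: "dimension ?n K E" "?n > 0" using galois_card[OF g] by auto
  have nF: "dimension ?n ?F E" using galois_card(1)[OF galois_intermediate[OF g F(1,2) FE]] eq by simp
  have m: "dimension (degree (Irr K x)) K ?F" using dimension_simple_extension[OF d(1) xR d(5)[OF x(1)]] .
  have "degree (Irr K x) * ?n = ?n"
    using dimension_is_inj[OF d(1) telescopic_base[OF d(1) F(1) m nF] n(1)] .
  then have "degree (Irr K x) = 1" using n(2) by simp
  then have "dimension 1 K ?F" using m by simp
  then have "K = ?F" using dimension_subset_eq[OF d(1) dimension_one[OF d(1)] _ F(2)] by blast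
  then show ?thesis using F(3) by simp
qed

end

lemma (in domain) prod_linear_poly:
  assumes E: "subring E R" and "finite S" "g \<in> S \<rightarrow> E"
  shows "\<exists>q \<in> carrier (E[X]). q \<noteq> [] \<and> (\<forall>x \<in> carrier R. eval q x = (\<Otimes>s\<in>S. x \<ominus> g s)
    \<and> (eval q x = \<zero> \<longleftrightarrow> (\<exists>s\<in>S. x = g s)))"
  using assms(2,3)
proof (induction S)
  case empty
  have "[\<one>] \<in> carrier (E[X])" using subringE(3)[OF E] by (simp add: univ_poly_def polynomial_def)
  then show ?case by (intro bexI[of _ "[\<one>]"]) auto
next
  case (insert a S)
  then obtain q where q: "q \<in> carrier (E[X])" "q \<noteq> []"
    "\<And>x. x \<in> carrier R \<Longrightarrow> eval q x = (\<Otimes>s\<in>S. x \<ominus> g s) \<and> (eval q x = \<zero> \<longleftrightarrow> (\<exists>s\<in>S. x = g s))"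
    by (auto simp: Pi_def)
  have gE: "g \<in> insert a S \<rightarrow> carrier R" using insert.prems subringE(1)[OF E] by auto
  have ga: "g a \<in> E" "g a \<in> carrier R" using insert.prems gE by auto
  interpret UP: domain "E[X]" using univ_poly_is_domain[OF E] .
  let ?l = "[\<one>, \<ominus> g a]"
  have l: "?l \<in> carrier (E[X])" using ga subringE(3,5)[OF E] by (simp add: univ_poly_def polynomial_def)
  let ?q = "?l \<otimes>\<^bsub>E[X]\<^esub> q"
  have "?q \<in> carrier (E[X])" using l q by simp
  moreover have "?q \<noteq> []" using UP.integral[OF _ l q(1)] q(2) unfolding univ_poly_zero by auto
  moreover have "eval ?q x = (\<Otimes>s\<in>insert a S. x \<ominus> g s) \<and> (eval ?q x = \<zero> \<longleftrightarrow> (\<exists>s\<in>insert a S. x = g s))"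
    if x: "x \<in> carrier R" for x
  proof -
    interpret e: ring_hom_ring "E[X]" R "\<lambda>p. eval p x" using eval_ring_hom[OF E x] .
    have "eval ?l x = x \<ominus> g a" using x ga by (simp add: a_minus_def)
    then have ev: "eval ?q x = (x \<ominus> g a) \<otimes> eval q x" using e.hom_mult[OF l q(1)] by simp
    have "(\<Otimes>s\<in>insert a S. x \<ominus> g s) = (x \<ominus> g a) \<otimes> (\<Otimes>s\<in>S. x \<ominus> g s)"
      using finprod_insert[OF insert.hyps, of "\<lambda>s. x \<ominus> g s"] gE x by (auto simp: Pi_def)
    then show ?thesis using ev q(3)[OF x] integral_iff[of "x \<ominus> g a" "eval q x"] x ga e.hom_closed[OF q(1)] by auto
  qed
  ultimately show ?case by blast
qed

lemma (in cring) finprod_in_subring: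
  assumes E: "subring E R" and "finite S" "g \<in> S \<rightarrow> E"
  shows "(\<Otimes>s\<in>S. g s) \<in> E"
  using assms(2,3)
proof (induction S)
  case (insert a S)
  have "g \<in> S \<rightarrow> carrier R" "g a \<in> carrier R" "g a \<in> E" "g \<in> S \<rightarrow> E"
    using insert.prems subringE(1)[OF E] by auto
  then show ?case using finprod_insert[of S a g] insert.hyps insert.IH subringE(6)[OF E] by simp
qed (simp add: subringE(3)[OF E])

lemma (in cring) finprod_subring_hom:
  assumes E: "subring E R" and h: "h \<in> ring_hom (R\<lparr>carrier := E\<rparr>) R" and "finite S" "g \<in> S \<rightarrow> E"
  shows "h (\<Otimes>s\<in>S. g s) = (\<Otimes>s\<in>S. h (g s))"
  using assms(3,4)
proof (induction S)
  case empty
  then show ?case using ring_hom_one[OF h] by simp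
next
  case (insert a S)
  have g: "g \<in> S \<rightarrow> carrier R" "g a \<in> carrier R" "g a \<in> E" "g \<in> S \<rightarrow> E"
    using insert.prems subringE(1)[OF E] by auto
  have hg: "(\<lambda>s. h (g s)) \<in> S \<rightarrow> carrier R" "h (g a) \<in> carrier R"
    using g(3,4) ring_hom_closed[OF h] by auto
  have "(\<Otimes>s\<in>S. g s) \<in> E" using finprod_in_subring[OF E insert.hyps(1) g(4)] .
  then show ?case
    using finprod_insert[of S a g] finprod_insert[of S a "\<lambda>s. h (g s)"] insert.hyps insert.IH g hg
      ring_hom_mult[OF h, of "g a" "\<Otimes>s\<in>S. g s"] by simp
qed

lemma (in field) splitted_if_card_roots:
  assumes "q \<in> carrier (poly_ring R)" "q \<noteq> []" "finite S" "card S \<ge> degree q"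
    "\<And>x. x \<in> S \<Longrightarrow> x \<in> carrier R \<and> eval q x = \<zero>"
  shows "splitted q"
proof -
  have "S \<subseteq> set_mset (roots q)"
    using assms(2,5) roots_mem_iff_is_root[OF assms(1)] unfolding is_root_def by auto
  then have "card S \<le> card (set_mset (roots q))" by (simp add: card_mono)
  also have "\<dots> = (\<Sum>a\<in>set_mset (roots q). 1)" by simp
  also have "\<dots> \<le> (\<Sum>a\<in>set_mset (roots q). count (roots q) a)"
    by (rule sum_mono) (simp add: Suc_leI)
  also have "\<dots> = size (roots q)" by (simp only: size_multiset_overloaded_eq)
  finally show ?thesis using size_roots_le_degree[OF assms(1)] assms(4) unfolding splitted_def by linarith
qed

text \<open>The roots in \<open>N\<close>, with multiplicity, form a submultiset of all roots;
  splitting over \<open>N\<close> makes it as large as the degree, so the two multisets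
  coincide.\<close>

lemma (in field) root_in_subfield_if_splitted:
  assumes N: "subfield N R" and q: "q \<in> carrier (N[X])" "q \<noteq> []"
    and s: "ring.splitted (R\<lparr>carrier := N\<rparr>) q" and x: "x \<in> carrier R" "eval q x = \<zero>"
  shows "x \<in> N"
proof -
  let ?N = "R\<lparr>carrier := N\<rparr>"
  interpret N: field ?N using subfield_iff(2)[OF N] .
  note NR = subfieldE(1,3)[OF N]
  have "id \<in> ring_hom ?N R" using NR(2) by (intro ring_hom_memI) auto
  then interpret i: ring_hom_ring ?N R id using ring_hom_ringI2[OF N.is_ring is_ring] by blast
  have qR: "q \<in> carrier (poly_ring R)" using carrier_polynomial_shell[OF NR(1) q(1)] .
  have qN: "q \<in> carrier (poly_ring ?N)" using q(1) univ_poly_consistent[OF NR(1)] by simp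
  have le: "N.alg_mult q a \<le> alg_mult q a" for a
  proof (cases "a \<in> N")
    case True
    then have aR: "a \<in> carrier R" using NR by blast
    have m: "\<ominus>\<^bsub>?N\<^esub> a = \<ominus> a" using i.hom_a_inv[of a] True by simp
    have "([\<one>, \<ominus> a] [^]\<^bsub>poly_ring R\<^esub> (N.alg_mult q a)) pdivides q"
    proof -
      have "([\<one>, \<ominus> a] [^]\<^bsub>poly_ring ?N\<^esub> (N.alg_mult q a)) pdivides\<^bsub>?N\<^esub> q"
        using N.alg_multE(1)[OF _ qN q(2), of a] True m by simp
      moreover have "[\<one>, \<ominus> a] [^]\<^bsub>poly_ring ?N\<^esub> (k::nat) = [\<one>, \<ominus> a] [^]\<^bsub>poly_ring R\<^esub> k" for k
        using univ_poly_consistent[OF NR(1)] by (simp add: nat_pow_def univ_poly_mult univ_poly_one)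
      ultimately show ?thesis
        using univ_poly_consistent[OF NR(1)] carrier_polynomial_shell[OF NR(1)]
        unfolding pdivides_def factor_def by (auto simp: univ_poly_mult)
    qed
    then show ?thesis using alg_multE(2)[OF aR qR q(2)] by blast
  qed (simp add: N.alg_mult_def)
  have sub: "N.roots q \<subseteq># roots q"
    using le N.alg_mult_eq_count_roots[OF qN] alg_mult_eq_count_roots[OF qR] by (simp add: subseteq_mset_def)
  have "size (N.roots q) \<ge> size (roots q)"
    using s size_roots_le_degree[OF qR] unfolding N.splitted_def by simp
  then have "\<not> N.roots q \<subset># roots q" using mset_subset_size by fastforce
  then have "N.roots q = roots q" using sub unfolding subset_mset_def by blast
  moreover have "x \<in># roots q" using roots_mem_iff_is_root[OF qR] x q(2) unfolding is_root_def by simp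
  ultimately have "N.is_root q x" using N.roots_mem_iff_is_root[OF qN] by simp
  then show ?thesis unfolding N.is_root_def by simp
qed

context char0_closed begin

lemma fixed_field_subfield:
  assumes g: "galois K E" and H: "H \<subseteq> carrier (Gal K E)"
  shows "subfield (fixed_field E H) R" "K \<subseteq> fixed_field E H" "fixed_field E H \<subseteq> E"
proof -
  note d = galoisD[OF g]
  note cl = subringE[OF d(7)]
  let ?F = "fixed_field E H"
  show KF: "K \<subseteq> ?F" using Gal_memD(5) H d(3) unfolding fixed_field_def by blast
  show FE: "?F \<subseteq> E" unfolding fixed_field_def by auto
  have "subring ?F R"
  proof (rule subringI)
    show "?F \<subseteq> carrier R" using FE d(9) by blast
    show "\<one> \<in> ?F" using KF subringE(3)[OF d(6)] by blast
  next
    fix x assume "x \<in> ?F"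
    then have x: "x \<in> E" "\<And>\<rho>. \<rho> \<in> H \<Longrightarrow> \<rho> x = x" unfolding fixed_field_def by auto
    have "\<rho> (\<ominus> x) = \<ominus> x" if "\<rho> \<in> H" for \<rho>
      using Gal_minus(3)[OF d(7) subsetD[OF H that] x(1)] x(2)[OF that] by simp
    then show "\<ominus> x \<in> ?F" using cl(5)[OF x(1)] unfolding fixed_field_def by blast
    fix y assume "y \<in> ?F"
    then have y: "y \<in> E" "\<And>\<rho>. \<rho> \<in> H \<Longrightarrow> \<rho> y = y" unfolding fixed_field_def by auto
    have "\<rho> (x \<otimes> y) = x \<otimes> y" "\<rho> (x \<oplus> y) = x \<oplus> y" if "\<rho> \<in> H" for \<rho>
      using Gal_memD(6,7)[OF subsetD[OF H that] x(1) y(1)] x(2)[OF that] y(2)[OF that] by simp_all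
    then show "x \<otimes> y \<in> ?F" "x \<oplus> y \<in> ?F" using cl(6,7)[OF x(1) y(1)] unfolding fixed_field_def by blast+
  qed
  then show "subfield ?F R"
  proof (rule subfieldI')
    fix x assume x: "x \<in> ?F - {\<zero>}"
    then have xE: "x \<in> E - {\<zero>}" "x \<in> carrier R" using FE d(9) by auto
    note i = subfield_m_inv[OF d(2) xE(1)]
    have "\<rho> (inv x) = inv x" if r: "\<rho> \<in> H" for \<rho>
    proof -
      have rG: "\<rho> \<in> carrier (Gal K E)" using r H by blast
      have "x \<otimes> \<rho> (inv x) = \<rho> (x \<otimes> inv x)"
        using Gal_memD(7)[OF rG, of x "inv x"] xE i x r unfolding fixed_field_def by auto
      also have "\<dots> = \<one>" using i Gal_memD(8)[OF rG] by simp
      finally have "x \<otimes> \<rho> (inv x) = \<one>" .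
      then show ?thesis using comm_inv_char[of x "\<rho> (inv x)"] xE(2) Gal_memD(1)[OF rG, of "inv x"] i(1) d(9) by auto
    qed
    then show "inv x \<in> ?F" using i(1) unfolding fixed_field_def by auto
  qed
qed

text \<open>Artin's polynomial, the product of \<open>X - \<rho> x\<close> over \<open>H\<close>.
  Indexing by the group rather than by the orbit merely repeats factors, and translation by an
  element of \<open>H\<close> permutes the index set.\<close>

lemma fixed_field_orbit_poly:
  assumes g: "galois K E" and H: "subgroup H (Gal K E)" and x: "x \<in> E"
  shows "\<exists>q \<in> carrier ((fixed_field E H)[X]). q \<noteq> [] \<and> (\<forall>y \<in> carrier R. eval q y = \<zero> \<longleftrightarrow> (\<exists>\<rho> \<in> H. y = \<rho> x))"
proof -
  note d = galoisD[OF g]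
  interpret G: group "Gal K E" using Gal_group[OF d(7,3)] .
  note HG = subgroup.subset[OF H]
  have fin: "finite H" using HG galois_card(2)[OF g] finite_subset by blast
  have Hx: "\<rho> x \<in> E" if "\<rho> \<in> H" for \<rho> using Gal_memD(1)[OF _ x] HG that by blast
  obtain q where q: "q \<in> carrier (E[X])" "q \<noteq> []"
    "\<And>y. y \<in> carrier R \<Longrightarrow> eval q y = (\<Otimes>\<rho>\<in>H. y \<ominus> \<rho> x)"
    "\<And>y. y \<in> carrier R \<Longrightarrow> eval q y = \<zero> \<longleftrightarrow> (\<exists>\<rho>\<in>H. y = \<rho> x)"
    using prod_linear_poly[OF d(7) fin funcsetI, of "\<lambda>\<rho>. \<rho> x"] Hx by blast
  have qE: "set q \<subseteq> E" using poly_coeffs[OF q(1)] .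
  have qR: "q \<in> carrier (poly_ring R)" using carrier_polynomial_shell[OF d(7) q(1)] .
  \<comment> \<open>Invariance of the coefficients is read off from values: at
    \<open>z = \<tau> y\<close> the transformed polynomial takes the value
    \<open>\<tau> (q(y))\<close>, which is the product for \<open>z\<close> reindexed by left
    multiplication with \<open>\<tau>\<close>. The infinite field \<open>E\<close> supplies enough
    points.\<close>
  have "map \<tau> q = q" if t: "\<tau> \<in> H" for \<tau>
  proof (rule poly_eq_if_eval_eq[OF _ qR infinite_subfield[OF d(7)] d(9)])
    have tG: "\<tau> \<in> carrier (Gal K E)" using t HG by blast
    interpret h: ring_hom_ring "R\<lparr>carrier := E\<rparr>" R \<tau> using Gal_ring_hom_ring[OF d(7) tG] .
    interpret EF: field "R\<lparr>carrier := E\<rparr>" using subfield_iff(2)[OF d(2)] .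
    note e = Gal_memD[OF tG]
    have tz: "\<tau> \<zero> = \<zero>" using Gal_minus(2)[OF d(7) tG] .
    have ld: "lead_coeff q \<in> E" "lead_coeff q \<noteq> \<zero>" using q(1,2) qE by (auto simp: univ_poly_def polynomial_def)
    have "\<tau> (lead_coeff q) \<noteq> \<zero>"
      using inj_onD[OF e(3), of "lead_coeff q" \<zero>] ld tz subringE(2)[OF d(7)] by auto
    then have "lead_coeff (map \<tau> q) \<noteq> \<zero>" using q(2) by (simp add: hd_map)
    moreover have "set (map \<tau> q) \<subseteq> carrier R" using qE e(1) d(9) by auto
    ultimately show "map \<tau> q \<in> carrier (poly_ring R)"
      by (auto simp: univ_poly_def polynomial_def)
    fix z assume z: "z \<in> E"
    then obtain y where y: "y \<in> E" "z = \<tau> y" using e(4) by blast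
    have yR: "y \<in> carrier R" "z \<in> carrier R" using y z d(9) by auto
    have c: "y \<ominus> \<rho> x \<in> E" if "\<rho> \<in> H" for \<rho>
      using y(1) Hx[OF that] subringE(5,7)[OF d(7)] unfolding a_minus_def by blast
    have tr: "z \<ominus> (\<tau> \<otimes>\<^bsub>Gal K E\<^esub> \<rho>) x \<in> carrier R" if "\<rho> \<in> H" for \<rho>
    proof -
      have "\<rho> \<in> carrier (Gal K E)" using that HG by blast
      then have "(\<tau> \<otimes>\<^bsub>Gal K E\<^esub> \<rho>) x \<in> E" using Gal_memD(1)[OF G.m_closed[OF tG] x] by blast
      then show ?thesis using yR(2) d(9) by blast
    qed
    have "eval (map \<tau> q) z = \<tau> (eval q y)"
      using h.eval_hom'[of y q] y qE eval_consistent[OF d(7)] by simp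
    also have "eval q y = (\<Otimes>\<rho>\<in>H. y \<ominus> \<rho> x)" using q(3)[OF yR(1)] .
    also have "\<tau> (\<Otimes>\<rho>\<in>H. y \<ominus> \<rho> x) = (\<Otimes>\<rho>\<in>H. \<tau> (y \<ominus> \<rho> x))"
      using finprod_subring_hom[OF d(7) Gal_hom[OF d(7) tG] fin, of "\<lambda>\<rho>. y \<ominus> \<rho> x"] c by blast
    also have "\<dots> = (\<Otimes>\<rho>\<in>H. z \<ominus> (\<tau> \<otimes>\<^bsub>Gal K E\<^esub> \<rho>) x)"
    proof (rule finprod_cong')
      fix \<rho> assume r: "\<rho> \<in> H"
      then show "\<tau> (y \<ominus> \<rho> x) = z \<ominus> (\<tau> \<otimes>\<^bsub>Gal K E\<^esub> \<rho>) x"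
        using Gal_minus(1)[OF d(7) tG y(1) Hx[OF r]] Gal_mult_apply[OF tG _ x] HG y(2) by auto
    qed (use tr in \<open>auto simp: Pi_def\<close>)
    also have "\<dots> = (\<Otimes>\<rho>\<in>(\<lambda>\<rho>. \<tau> \<otimes>\<^bsub>Gal K E\<^esub> \<rho>) ` H. z \<ominus> \<rho> x)"
    proof (rule finprod_reindex[symmetric])
      show "(\<lambda>\<rho>. z \<ominus> \<rho> x) \<in> (\<lambda>\<rho>. \<tau> \<otimes>\<^bsub>Gal K E\<^esub> \<rho>) ` H \<rightarrow> carrier R"
        using tr by auto
      show "inj_on (\<lambda>\<rho>. \<tau> \<otimes>\<^bsub>Gal K E\<^esub> \<rho>) H"
        using HG tG by (intro inj_onI) (simp add: subset_iff)
    qed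
    also have "(\<lambda>\<rho>. \<tau> \<otimes>\<^bsub>Gal K E\<^esub> \<rho>) ` H = H"
    proof (rule endo_inj_surj[OF fin])
      show "(\<lambda>\<rho>. \<tau> \<otimes>\<^bsub>Gal K E\<^esub> \<rho>) ` H \<subseteq> H" using t subgroup.m_closed[OF H] by blast
      show "inj_on (\<lambda>\<rho>. \<tau> \<otimes>\<^bsub>Gal K E\<^esub> \<rho>) H"
        using HG tG by (intro inj_onI) (simp add: subset_iff)
    qed
    also have "(\<Otimes>\<rho>\<in>H. z \<ominus> \<rho> x) = eval q z" using q(3)[OF yR(2)] by simp
    finally show "eval (map \<tau> q) z = eval q z" .
  qed
  then have "\<tau> c = c" if "\<tau> \<in> H" "c \<in> set q" for \<tau> c
    using that map_eq_conv[of \<tau> q id] by simp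
  then have "set q \<subseteq> fixed_field E H" using qE unfolding fixed_field_def by auto
  then have "q \<in> carrier ((fixed_field E H)[X])" using q(1) by (auto simp: univ_poly_def polynomial_def)
  then show ?thesis using q(2,4) by blast
qed

text \<open>With \<open>t\<close> primitive over the fixed field, an automorphism sends
  \<open>t\<close> to a root of the orbit polynomial, that is, to some \<open>\<rho> t\<close> with
  \<open>\<rho>\<close> in \<open>H\<close>; and the image of \<open>t\<close> determines the
  automorphism.\<close>

lemma Gal_fixed_field:
  assumes g: "galois K E" and H: "subgroup H (Gal K E)"
  shows "carrier (Gal (fixed_field E H) E) = H"
proof
  note d = galoisD[OF g]
  let ?F = "fixed_field E H"
  note HG = subgroup.subset[OF H]
  note F = fixed_field_subfield[OF g HG]
  show "H \<subseteq> carrier (Gal ?F E)" using HG unfolding fixed_field_def subset_iff Gal_iff by blast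
  have gF: "galois ?F E" using galois_intermediate[OF g F] .
  obtain t where t: "t \<in> E" "simple_extension ?F t = E"
    "\<And>y. y \<in> carrier R \<Longrightarrow> eval (Irr ?F t) y = \<zero> \<Longrightarrow> y \<in> E" using gF unfolding galois_def by blast
  have inj: "inj_on (\<lambda>\<rho>. \<rho> t) (carrier (Gal ?F E))"
    using Gal_bij_roots[OF gF t] unfolding bij_betw_def by blast
  obtain q where q: "q \<in> carrier (?F[X])" "\<And>y. y \<in> carrier R \<Longrightarrow> eval q y = \<zero> \<longleftrightarrow> (\<exists>\<rho> \<in> H. y = \<rho> t)"
    using fixed_field_orbit_poly[OF g H t(1)] by blast
  have "eval q t = \<zero>" using q(2)[of t] subgroup.one_closed[OF H] t(1) d(9) unfolding Gal_one by force
  show "carrier (Gal ?F E) \<subseteq> H"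
  proof
    fix \<tau> assume u: "\<tau> \<in> carrier (Gal ?F E)"
    have "eval q (\<tau> t) = \<tau> (eval q t)"
      using Gal_eval[OF d(7) F(3) u poly_coeffs[OF q(1)] t(1)] by simp
    also have "\<dots> = \<zero>" using \<open>eval q t = \<zero>\<close> Gal_minus(2)[OF d(7) u] by simp
    finally obtain \<rho> where r: "\<rho> \<in> H" "\<tau> t = \<rho> t" using q(2) Gal_memD(1)[OF u t(1)] d(9) by blast
    then show "\<tau> \<in> H" using inj_onD[OF inj, of \<tau> \<rho>] u \<open>H \<subseteq> carrier (Gal ?F E)\<close> by auto
  qed
qed

lemma fixed_field_Gal:
  assumes g: "galois K E" and F: "subfield F R" "K \<subseteq> F" "F \<subseteq> E"
  shows "fixed_field E (carrier (Gal F E)) = F"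
  using galois_fixed[OF galois_intermediate[OF g F]] F(3) Gal_memD(5) unfolding fixed_field_def by blast

lemma subgroup_Gal:
  assumes g: "galois K E" and F: "K \<subseteq> F" "F \<subseteq> E"
  shows "subgroup (carrier (Gal F E)) (Gal K E)"
proof -
  note d = galoisD[OF g]
  interpret G: group "Gal K E" using Gal_group[OF d(7,3)] .
  interpret GF: group "Gal F E" using Gal_group[OF d(7) F(2)] .
  note sub = Gal_carrier_mono[OF F(1)]
  show ?thesis
  proof (rule G.subgroupI)
    show "carrier (Gal F E) \<subseteq> carrier (Gal K E)" by (rule sub)
    show "carrier (Gal F E) \<noteq> {}" using GF.one_closed by blast
    fix \<rho> assume r: "\<rho> \<in> carrier (Gal F E)"
    then have rG: "\<rho> \<in> carrier (Gal K E)" using sub by blast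
    have "inv\<^bsub>Gal K E\<^esub> \<rho> = inv\<^bsub>Gal F E\<^esub> \<rho>"
      by (rule Gal_ext[OF G.inv_closed[OF rG] GF.inv_closed[OF r]])
        (metis Gal_inv_apply Gal_memD(1,3) d(3,7) F(2) r rG G.inv_closed GF.inv_closed inj_onD)
    then show "inv\<^bsub>Gal K E\<^esub> \<rho> \<in> carrier (Gal F E)" using GF.inv_closed[OF r] by simp
    fix \<tau> assume t: "\<tau> \<in> carrier (Gal F E)"
    show "\<rho> \<otimes>\<^bsub>Gal K E\<^esub> \<tau> \<in> carrier (Gal F E)"
      using GF.m_closed[OF r t] Gal_subset_mult[OF F(1) r t] by simp
  qed
qed

text \<open>The orbit polynomial of the full group has coefficients in \<open>K\<close>, so it is a
  multiple of the minimal polynomial of \<open>x\<close>: every conjugate of \<open>x\<close> lies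
  in its orbit.\<close>

lemma galois_conj:
  assumes g: "galois K E" and x: "x \<in> E" and y: "y \<in> carrier R" "eval (Irr K x) y = \<zero>"
  shows "\<exists>\<rho> \<in> carrier (Gal K E). y = \<rho> x"
proof -
  note d = galoisD[OF g]
  interpret G: group "Gal K E" using Gal_group[OF d(7,3)] .
  have xR: "x \<in> carrier R" using x d(9) by blast
  obtain q where q: "q \<in> carrier ((fixed_field E (carrier (Gal K E)))[X])"
    "\<And>y. y \<in> carrier R \<Longrightarrow> eval q y = \<zero> \<longleftrightarrow> (\<exists>\<rho> \<in> carrier (Gal K E). y = \<rho> x)"
    using fixed_field_orbit_poly[OF g G.subgroup_self x] by blast
  have "eval q x = \<zero>" using q(2)[OF xR] G.one_closed x unfolding Gal_one by force
  moreover have "q \<in> carrier (K[X])" using q(1) unfolding fixed_field_Gal[OF g d(1) order_refl d(3)] .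
  ultimately have "eval q y = \<zero>" using root_of_multiple_Irr[OF d(1) xR d(5)[OF x] _ _ y] by blast
  then show ?thesis using q(2)[OF y(1)] by blast
qed

lemma Gal_conj_root:
  assumes g: "galois K E" and x: "x \<in> E" and r: "\<rho> \<in> carrier (Gal K E)"
  shows "eval (Irr K x) (\<rho> x) = \<zero>"
proof -
  note d = galoisD[OF g]
  have xR: "x \<in> carrier R" using x d(9) by blast
  show ?thesis
    using Gal_eval[OF d(7,3) r poly_coeffs[OF IrrE(1)[OF d(1) xR d(5)[OF x]]] x] IrrE(4)[OF d(1) xR d(5)[OF x]]
      Gal_minus(2)[OF d(7) r] by simp
qed

lemma galois_if_stable:
  assumes g: "galois K E" and F: "subfield F R" "K \<subseteq> F" "F \<subseteq> E"
    and st: "\<And>\<rho> x. \<rho> \<in> carrier (Gal K E) \<Longrightarrow> x \<in> F \<Longrightarrow> \<rho> x \<in> F"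
  shows "galois K F"
proof -
  note d = galoisD[OF g]
  have "subalgebra K F R"
    using subringE(6)[OF subfieldE(1)[OF F(1)]] F(2) subring.axioms(1)[OF subfieldE(1)[OF F(1)]]
    by (auto simp: subalgebra_def subalgebra_axioms_def)
  then have fd: "finite_dimension K F"
    using subalbegra_incl_imp_finite_dimension[OF d(1,4) _ F(3)] by blast
  obtain t where t: "t \<in> F" "simple_extension K t = F" using primitive_element[OF d(1) F(1,2) fd] by blast
  have "y \<in> F" if "y \<in> carrier R" "eval (Irr K t) y = \<zero>" for y
    using galois_conj[OF g _ that] t(1) F(3) st by blast
  then show ?thesis unfolding galois_def using d(1,5) F t by blast
qed

lemma galois_stable:
  assumes gE: "galois K E" and gF: "galois K F" and FE: "F \<subseteq> E"
    and r: "\<rho> \<in> carrier (Gal K E)" and x: "x \<in> F"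
  shows "\<rho> x \<in> F"
proof -
  have xE: "x \<in> E" using x FE by blast
  have "\<rho> x \<in> carrier R" using Gal_memD(1)[OF r xE] galoisD(9)[OF gE] by blast
  then obtain \<tau> where "\<tau> \<in> carrier (Gal K F)" "\<rho> x = \<tau> x"
    using galois_conj[OF gF x _ Gal_conj_root[OF gE xE r]] by blast
  then show ?thesis using Gal_memD(1) x by metis
qed

text \<open>Restriction is onto because an automorphism of \<open>F\<close> is determined by the
  image of a primitive element, and \<open>galois_conj\<close> in \<open>E\<close> reaches every
  conjugate of that element.\<close>

lemma restrict_Gal:
  assumes gE: "galois K E" and gF: "galois K F" and FE: "F \<subseteq> E"
  shows "(\<lambda>\<rho>. restrict \<rho> F) \<in> epi (Gal K E) (Gal K F)"
    "kernel (Gal K E) (Gal K F) (\<lambda>\<rho>. restrict \<rho> F) = carrier (Gal F E)"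
proof -
  note d = galoisD[OF gE] and f = galoisD[OF gF]
  let ?r = "\<lambda>\<rho>. restrict \<rho> F"
  have cl: "?r \<rho> \<in> carrier (Gal K F)" if r: "\<rho> \<in> carrier (Gal K E)" for \<rho>
  proof (rule restrict_in_Gal[OF f(1-3,5)])
    show "\<rho> \<in> ring_hom (R\<lparr>carrier := F\<rparr>) R"
      using Gal_memD(1,6,7,8)[OF r] subsetD[OF FE] subsetD[OF d(9)] by (intro ring_hom_memI) auto
    show "\<rho> ` F \<subseteq> F" using galois_stable[OF gE gF FE r] by blast
  qed (use Gal_memD(5)[OF r] in auto)
  have hom: "?r \<in> hom (Gal K E) (Gal K F)"
  proof (rule homI)
    fix \<rho> \<tau> assume r: "\<rho> \<in> carrier (Gal K E)" and t: "\<tau> \<in> carrier (Gal K E)"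
    show "?r (\<rho> \<otimes>\<^bsub>Gal K E\<^esub> \<tau>) = ?r \<rho> \<otimes>\<^bsub>Gal K F\<^esub> ?r \<tau>"
      unfolding Gal_mult[OF r t] Gal_mult[OF cl[OF r] cl[OF t]]
      using galois_stable[OF gE gF FE t] FE by (auto simp: compose_def fun_eq_iff)
  qed (rule cl)
  moreover have "carrier (Gal K F) \<subseteq> ?r ` carrier (Gal K E)"
  proof
    fix \<tau> assume t: "\<tau> \<in> carrier (Gal K F)"
    obtain x where x: "x \<in> F" "simple_extension K x = F"
      "\<And>y. y \<in> carrier R \<Longrightarrow> eval (Irr K x) y = \<zero> \<Longrightarrow> y \<in> F" using gF unfolding galois_def by blast
    have xE: "x \<in> E" using x FE by blast
    obtain \<rho> where r: "\<rho> \<in> carrier (Gal K E)" "\<tau> x = \<rho> x"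
      using galois_conj[OF gE xE _ Gal_conj_root[OF gF x(1) t]] Gal_memD(1)[OF t x(1)] f(9) by blast
    have "inj_on (\<lambda>\<rho>. \<rho> x) (carrier (Gal K F))" using Gal_bij_roots[OF gF x] unfolding bij_betw_def by blast
    then have "\<tau> = ?r \<rho>" using inj_onD[of "\<lambda>\<rho>. \<rho> x" _ \<tau> "?r \<rho>"] t cl[OF r(1)] r(2) x(1) by auto
    then show "\<tau> \<in> ?r ` carrier (Gal K E)" using r(1) by blast
  qed
  ultimately show "?r \<in> epi (Gal K E) (Gal K F)" using cl unfolding epi_def by auto
  show "kernel (Gal K E) (Gal K F) ?r = carrier (Gal F E)"
  proof (intro equalityI subsetI)
    fix \<rho> assume "\<rho> \<in> kernel (Gal K E) (Gal K F) ?r"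
    then have r: "\<rho> \<in> carrier (Gal K E)" "?r \<rho> = (\<lambda>x\<in>F. x)" unfolding kernel_def Gal_one by auto
    have "\<rho> x = x" if "x \<in> F" for x using fun_cong[OF r(2), of x] that by simp
    then show "\<rho> \<in> carrier (Gal F E)" using r(1) unfolding Gal_iff by blast
  next
    fix \<rho> assume r: "\<rho> \<in> carrier (Gal F E)"
    then have "?r \<rho> = (\<lambda>x\<in>F. x)" using Gal_memD(5)[OF r] by (auto simp: restrict_def)
    then show "\<rho> \<in> kernel (Gal K E) (Gal K F) ?r"
      using r Gal_carrier_mono[OF f(3)] unfolding kernel_def Gal_one by auto
  qed
qed

text \<open>An irreducible polynomial with a root \<open>x\<close> in \<open>E\<close> is an
  associate of \<open>Irr K x\<close>, whose roots are distinct, as many as its degree, and all in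
  the orbit of \<open>x\<close>.\<close>

lemma normal_extension_galois:
  assumes g: "galois K E"
  shows "normal_extension K E"
  unfolding normal_extension_def
proof (intro conjI ballI impI)
  note d = galoisD[OF g]
  show "subfield K R" "subfield E R" "K \<subseteq> E" "\<And>x. x \<in> E \<Longrightarrow> (algebraic over K) x" using d by auto
  fix P assume P: "P \<in> carrier (K[X])" "pirreducible K P" and "\<exists>x\<in>E. eval P x = \<zero>"
  then obtain x where x: "x \<in> E" "eval P x = \<zero>" by blast
  have xR: "x \<in> carrier R" using x d(9) by blast
  note xa = d(5)[OF x(1)]
  note I = IrrE[OF d(1) xR xa]
  have "Irr K x divides\<^bsub>K[X]\<^esub> P"
    using Irr_minimal[OF d(1) xR xa P(1) x(2)] pdivides_iff_shell[OF d(1) I(1) P(1)] by simp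
  then have "Irr K x \<sim>\<^bsub>K[X]\<^esub> P"
    using divides_pirreducible_condition[OF P(2) I(1)] pirreducibleE(2)[OF d(6) I(1,2)] by blast
  then have len: "length (Irr K x) = length P"
    using associated_polynomials_imp_same_length[OF d(6) I(1) P(1)] by simp
  interpret EF: field "R\<lparr>carrier := E\<rparr>" using subfield_iff(2)[OF d(2)] .
  have PE: "P \<in> carrier (poly_ring (R\<lparr>carrier := E\<rparr>))"
    using P(1) d(3) unfolding univ_poly_consistent[OF d(7)] by (auto simp: univ_poly_def polynomial_def)
  let ?S = "{y \<in> carrier R. eval (Irr K x) y = \<zero>}"
  have S: "y \<in> E" "eval P y = \<zero>" if "y \<in> ?S" for y
    using that galois_conj[OF g x(1)] Gal_memD(1)[OF _ x(1)] root_of_multiple_Irr[OF d(1) xR xa P(1) x(2)] by auto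
  show "EF.splitted P"
  proof (rule EF.splitted_if_card_roots[OF PE])
    show "P \<noteq> []" using pirreducibleE(1)[OF d(6) P] .
    show "finite ?S" using card_roots_Irr(2)[OF d(1) xR xa] .
    show "degree P \<le> card ?S" using card_roots_Irr(1)[OF d(1) xR xa] len by simp
    show "y \<in> carrier (R\<lparr>carrier := E\<rparr>) \<and> EF.eval P y = \<zero>\<^bsub>R\<lparr>carrier := E\<rparr>\<^esub>" if "y \<in> ?S" for y
      using S[OF that] eval_consistent[OF d(7)] by simp
  qed
qed

text \<open>For a conjugate \<open>y\<close> of the primitive element \<open>t\<close>, the
  embedding sending \<open>t\<close> to \<open>y\<close> permutes the roots of \<open>q\<close>, so
  the splitting field is contained in \<open>K(y)\<close>. Equal degrees give equality, and
  \<open>y\<close> lies in it.\<close>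

lemma galois_splitting_field:
  assumes K: "subfield K R" and q: "q \<in> carrier (K[X])" "q \<noteq> []"
    and rs: "set rs = {x \<in> carrier R. eval q x = \<zero>}"
  shows "galois K (finite_extension K rs)"
proof -
  let ?E = "finite_extension K rs"
  have rsR: "set rs \<subseteq> carrier R" using rs by auto
  have alg: "(algebraic over K) x" if "x \<in> set rs" for x using algebraicI[OF q] that rs by blast
  have E: "subfield ?E R" using finite_extension_is_subfield[OF K rsR alg] .
  have KE: "K \<subseteq> ?E" using finite_extension_incl[OF subfieldE(3)[OF K] rsR] .
  obtain t where t: "t \<in> carrier R" "(algebraic over K) t" "simple_extension K t = ?E"
    using primitive_element_list[OF K rsR alg] by blast
  have "y \<in> ?E" if y: "y \<in> carrier R" "eval (Irr K t) y = \<zero>" for y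
  proof -
    obtain \<rho> where r: "\<rho> \<in> ring_hom (R\<lparr>carrier := ?E\<rparr>) R" "\<And>q. q \<in> carrier (K[X]) \<Longrightarrow> \<rho> (eval q t) = eval q y"
      using simple_extension_hom[OF K t(1,2) y] t(3) by auto
    note ya = Irr_eq_if_root[OF K t(1,2) y]
    have img: "?E = (\<lambda>p. eval p t) ` carrier (K[X])" "simple_extension K y = (\<lambda>p. eval p y) ` carrier (K[X])"
      using simple_extension_as_eval_img[OF subfieldE(3)[OF K]] t y(1) by auto
    have rE: "\<rho> ` ?E = simple_extension K y" unfolding img using r(2) by (auto simp: image_iff)
    have fx: "\<rho> x = x" if x: "x \<in> K" for x
    proof -
      let ?q = "poly_of_const x"
      have "?q \<in> carrier (K[X])" unfolding poly_of_const_def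
        using normalize_gives_polynomial[of "[x]" K] x by (simp add: univ_poly_carrier)
      moreover have "eval ?q z = x" if "z \<in> carrier R" for z
        unfolding poly_of_const_def using that x subfieldE(3)[OF K] by auto
      ultimately show ?thesis using r(2)[of ?q] t(1) y(1) by simp
    qed
    interpret EF: field "R\<lparr>carrier := ?E\<rparr>" using subfield_iff(2)[OF E] .
    interpret h: ring_hom_ring "R\<lparr>carrier := ?E\<rparr>" R \<rho>
      using ring_hom_ringI2[OF EF.ring_axioms ring_axioms r(1)] .
    have inj: "inj_on \<rho> ?E" using h.img_is_subfield(1)[OF EF.carrier_is_subfield] by simp
    have rsE: "set rs \<subseteq> ?E" using finite_extension_mem[OF subfieldE(1)[OF K] rsR] .
    have "\<rho> ` set rs \<subseteq> set rs"
    proof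
      fix z assume "z \<in> \<rho> ` set rs"
      then obtain x where x: "x \<in> set rs" "z = \<rho> x" by blast
      have "eval q z = \<rho> (eval q x)"
        using ring_hom_eval_fixed[OF subfieldE(1)[OF E] r(1) fx poly_coeffs[OF q(1)] KE] x rsE by auto
      also have "\<dots> = \<zero>" using x(1) rs h.hom_zero by simp
      finally have ez: "eval q z = \<zero>" .
      have "z \<in> carrier R" using x rsE h.hom_closed[of x] by auto
      with ez show "z \<in> set rs" unfolding rs by simp
    qed
    then have "\<rho> ` set rs = set rs"
      using endo_inj_surj[of "set rs" \<rho>] inj_on_subset[OF inj rsE] by simp
    then have "set rs \<subseteq> simple_extension K y" using rE rsE by blast
    note Fy = subfield_simple_extension[OF K y(1) ya(1)]
    have "?E \<subseteq> simple_extension K y"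
      using finite_extension_subring_incl[OF subfieldE(1)[OF Fy(1)] Fy(2) \<open>set rs \<subseteq> simple_extension K y\<close>] .
    moreover have "dimension (degree (Irr K t)) K ?E" "dimension (degree (Irr K t)) K (simple_extension K y)"
      using dimension_simple_extension[OF K t(1,2)] dimension_simple_extension[OF K y(1) ya(1)] t(3) ya(2) by auto
    ultimately have "?E = simple_extension K y" using dimension_subset_eq[OF K] by blast
    then show ?thesis using Fy(3) by simp
  qed
  moreover have "t \<in> ?E" using simple_extension_mem[OF subfieldE(1)[OF K] t(1)] t(3) by simp
  ultimately show ?thesis unfolding galois_def using K E KE t by blast
qed

end

section \<open>Valued fields\<close>

locale valued_field = field R for R (structure) +
  fixes v :: "'a \<Rightarrow> ereal"
  assumes valuation: "valuation v"
begin

lemma v_not_minf [simp]: "x \<in> carrier R \<Longrightarrow> v x \<noteq> -\<infinity>"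
  and v_inf_iff: "x \<in> carrier R \<Longrightarrow> v x = \<infinity> \<longleftrightarrow> x = \<zero>"
  and v_mult: "x \<in> carrier R \<Longrightarrow> y \<in> carrier R \<Longrightarrow> v (x \<otimes> y) = v x + v y"
  and v_add_min: "x \<in> carrier R \<Longrightarrow> y \<in> carrier R \<Longrightarrow> min (v x) (v y) \<le> v (x \<oplus> y)"
  using valuation unfolding valuation_def by auto

lemma v_zero [simp]: "v \<zero> = \<infinity>"
  using v_inf_iff by simp

lemma v_realE:
  assumes "x \<in> carrier R" "x \<noteq> \<zero>"
  obtains r where "v x = ereal r"
  using assms v_not_minf v_inf_iff by (cases "v x") auto

lemma v_one [simp]: "v \<one> = 0"
proof -
  obtain r where r: "v \<one> = ereal r" using v_realE[of \<one>] by auto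
  have "v \<one> = v \<one> + v \<one>" using v_mult[of \<one> \<one>] by simp
  then show ?thesis using r by simp
qed

lemma v_a_inv [simp]:
  assumes "x \<in> carrier R" shows "v (\<ominus> x) = v x"
proof -
  have "(\<ominus> \<one>) \<otimes> (\<ominus> \<one>) = \<one>" by (simp add: l_minus r_minus)
  then have "v (\<ominus> \<one>) + v (\<ominus> \<one>) = 0" using v_mult[of "\<ominus> \<one>" "\<ominus> \<one>"] by simp
  then have "v (\<ominus> \<one>) = 0" by (cases "v (\<ominus> \<one>)") auto
  moreover have "\<ominus> x = (\<ominus> \<one>) \<otimes> x" using assms by (simp add: l_minus)
  ultimately show ?thesis using v_mult[of "\<ominus> \<one>" x] assms by simp
qed

lemma v_minus_commute:
  assumes "x \<in> carrier R" "y \<in> carrier R" shows "v (x \<ominus> y) = v (y \<ominus> x)"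
proof -
  have "y \<ominus> x = \<ominus> (x \<ominus> y)" using assms by (simp add: a_minus_def minus_add a_comm)
  then show ?thesis using assms by simp
qed

lemma v_add_ge:
  assumes "x \<in> carrier R" "y \<in> carrier R" "c \<le> v x" "c \<le> v y" shows "c \<le> v (x \<oplus> y)"
  using v_add_min[OF assms(1,2)] assms(3,4) by (metis min.boundedI order_trans)

lemma v_add_gt:
  assumes "x \<in> carrier R" "y \<in> carrier R" "c < v x" "c < v y" shows "c < v (x \<oplus> y)"
  using v_add_min[OF assms(1,2)] assms(3,4) by (metis less_le_trans min_less_iff_conj)

lemma v_diff_ge:
  assumes "x \<in> carrier R" "y \<in> carrier R" "c \<le> v x" "c \<le> v y" shows "c \<le> v (x \<ominus> y)"
  unfolding a_minus_def using v_add_ge[of x "\<ominus> y"] assms by simp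

lemma v_diff_gt:
  assumes "x \<in> carrier R" "y \<in> carrier R" "c < v x" "c < v y" shows "c < v (x \<ominus> y)"
  unfolding a_minus_def using v_add_gt[of x "\<ominus> y"] assms by simp

lemma v_add_eq:
  assumes "x \<in> carrier R" "y \<in> carrier R" "v x < v y" shows "v (x \<oplus> y) = v x"
proof (rule antisym)
  show "v x \<le> v (x \<oplus> y)" using v_add_ge[of x y "v x"] assms by simp
  show "v (x \<oplus> y) \<le> v x"
  proof (rule ccontr)
    assume "\<not> ?thesis"
    then have "v x < v ((x \<oplus> y) \<ominus> y)" using v_diff_gt[of "x \<oplus> y" y "v x"] assms by simp
    moreover have "(x \<oplus> y) \<ominus> y = x" using assms by (simp add: a_minus_def a_assoc r_neg)
    ultimately show False by simp
  qed
qed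

lemma v_eq_if_diff:
  assumes "x \<in> carrier R" "y \<in> carrier R" "v x < v (y \<ominus> x)" shows "v y = v x"
proof -
  have "y = x \<oplus> (y \<ominus> x)" using assms(1,2) a_lcomm[of x y "\<ominus> x"] by (simp add: a_minus_def r_neg)
  then show ?thesis using v_add_eq[of x "y \<ominus> x"] assms by simp
qed

lemma v_diff_trans:
  assumes "x \<in> carrier R" "y \<in> carrier R" "z \<in> carrier R"
  shows "c \<le> v (x \<ominus> y) \<Longrightarrow> c \<le> v (y \<ominus> z) \<Longrightarrow> c \<le> v (x \<ominus> z)"
    "c < v (x \<ominus> y) \<Longrightarrow> c < v (y \<ominus> z) \<Longrightarrow> c < v (x \<ominus> z)"
proof -
  have "x \<ominus> z = (x \<ominus> y) \<oplus> (y \<ominus> z)"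
    using assms by (simp add: a_minus_def a_assoc r_neg1)
  then show "c \<le> v (x \<ominus> y) \<Longrightarrow> c \<le> v (y \<ominus> z) \<Longrightarrow> c \<le> v (x \<ominus> z)"
    "c < v (x \<ominus> y) \<Longrightarrow> c < v (y \<ominus> z) \<Longrightarrow> c < v (x \<ominus> z)"
    using v_add_ge[of "x \<ominus> y" "y \<ominus> z"] v_add_gt[of "x \<ominus> y" "y \<ominus> z"] assms by auto
qed

lemma v_inv:
  assumes "x \<in> carrier R" "x \<noteq> \<zero>" shows "v (inv x) = - v x" "inv x \<in> carrier R" "inv x \<noteq> \<zero>"
proof -
  have U: "x \<in> Units R" using assms field_Units by simp
  show c: "inv x \<in> carrier R" using U by simp
  show "inv x \<noteq> \<zero>" using U by (metis Units_inv_Units field_Units DiffD2 insertCI)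
  have "v x + v (inv x) = 0" using v_mult[OF assms(1) c] U by simp
  then show "v (inv x) = - v x" by (cases "v x"; cases "v (inv x)") auto
qed

lemma v_pow_real:
  assumes "x \<in> carrier R" "v x = ereal r" shows "v (x [^] (n::nat)) = ereal (n * r)"
  using assms by (induction n) (auto simp: v_mult algebra_simps)

lemma v_pow_ge:
  assumes "x \<in> carrier R" "ereal r \<le> v x" shows "ereal (n * r) \<le> v (x [^] (n::nat))"
proof (cases "x = \<zero>")
  case True
  then show ?thesis by (cases n) (auto simp: nat_pow_zero zero_ereal_def)
next
  case False
  then obtain s where s: "v x = ereal s" using v_realE assms by blast
  then show ?thesis using v_pow_real[OF assms(1) s] assms(2) by (simp add: mult_left_mono)
qed

lemma v_mult_ge:
  assumes "x \<in> carrier R" "y \<in> carrier R" "ereal a \<le> v x" "ereal b \<le> v y"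
  shows "ereal (a + b) \<le> v (x \<otimes> y)"
  using v_mult[OF assms(1,2)] add_mono[OF assms(3,4)] by simp

lemma v_nat_mult_ge:
  assumes "x \<in> carrier R" "c \<le> v x" shows "c \<le> v ([(n::nat)] \<cdot> x)"
  using assms by (induction n) (auto intro: v_add_ge)

lemma v_finsum_ge:
  assumes "finite S" "g \<in> S \<rightarrow> carrier R" "\<And>s. s \<in> S \<Longrightarrow> c \<le> v (g s)"
  shows "c \<le> v (\<Oplus>s\<in>S. g s)"
  using assms
proof (induction S)
  case (insert a S)
  have g: "g \<in> S \<rightarrow> carrier R" "g a \<in> carrier R" using insert.prems by auto
  have "c \<le> v (\<Oplus>s\<in>S. g s)" using insert.IH[OF g(1)] insert.prems(2) by blast
  then show ?case
    using finsum_insert[OF insert.hyps g] v_add_ge[OF g(2) finsum_closed[OF g(1)]] insert.prems(2) by simp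
qed simp

subsection \<open>The valuation ring and its residue field\<close>

abbreviation OR where "OR \<equiv> R\<lparr>carrier := {x \<in> carrier R. 0 \<le> v x}\<rparr>"

definition M :: "'a set" where "M = {x \<in> carrier R. 0 < v x}"

text \<open>The residue field of the whole ambient field. Residue fields of subfields become subsets
  of it, so residues coming from \<open>K\<close>, \<open>L\<close> and \<open>E\<close> can be
  compared directly.\<close>

definition kR :: "'a set ring" where "kR = OR Quot M"

definition \<phi> :: "'a \<Rightarrow> 'a set" where "\<phi> x = M +>\<^bsub>OR\<^esub> x"

lemma subring_O: "subring {x \<in> carrier R. 0 \<le> v x} R"
  by (rule subringI) (auto simp: v_mult intro: v_add_ge)

lemma OR_domain: "domain OR"
  using subring_is_domain[OF subring_O] .

lemma M_maximal: "maximalideal M OR"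
proof -
  interpret D: domain OR using OR_domain .
  have "ideal M OR"
  proof (rule idealI)
    show "ring OR" by (rule D.ring_axioms)
    have "subgroup M (add_monoid OR)"
    proof (rule D.add.subgroupI)
      show "M \<subseteq> carrier OR" unfolding M_def by auto
      show "M \<noteq> {}" unfolding M_def by (auto intro: exI[of _ \<zero>])
      fix x assume x: "x \<in> M"
      have "\<ominus>\<^bsub>OR\<^esub> x = \<ominus> x"
      proof (rule D.minus_equality)
        show "\<ominus> x \<oplus>\<^bsub>OR\<^esub> x = \<zero>\<^bsub>OR\<^esub>" using x l_neg unfolding M_def by simp
      qed (use x in \<open>auto simp: M_def\<close>)
      then show "\<ominus>\<^bsub>OR\<^esub> x \<in> M" using x unfolding M_def by simp
      fix y assume "y \<in> M"
      then show "x \<oplus>\<^bsub>OR\<^esub> y \<in> M" using x v_add_gt[of x y 0] unfolding M_def by simp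
    qed
    then show "subgroup M (add_monoid OR)" .
    fix a x assume a: "a \<in> M" and x: "x \<in> carrier OR"
    have "0 < v a + v x" using a x v_not_minf[of a] v_not_minf[of x] unfolding M_def
      by (cases "v a"; cases "v x") auto
    then show "x \<otimes>\<^bsub>OR\<^esub> a \<in> M" "a \<otimes>\<^bsub>OR\<^esub> x \<in> M" using a x unfolding M_def
      by (auto simp: v_mult add.commute)
  qed
  then show ?thesis
  proof (rule maximalidealI)
    show "carrier OR \<noteq> M"
    proof
      assume "carrier OR = M"
      moreover have "\<one> \<in> carrier OR" by simp
      ultimately have "\<one> \<in> M" by blast
      then show False unfolding M_def by simp
    qed
    fix J assume J: "ideal J OR" "M \<subseteq> J" "J \<subseteq> carrier OR"
    show "J = M \<or> J = carrier OR"
    proof (rule ccontr)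
      assume n: "\<not> ?thesis"
      then obtain x where x: "x \<in> J" "x \<notin> M" using J(2) by blast
      then have xR: "x \<in> carrier R" "v x = 0" using J(3) unfolding M_def by auto
      have x0: "x \<noteq> \<zero>" using xR(2) by auto
      note i = v_inv[OF xR(1) x0]
      have "inv x \<otimes>\<^bsub>OR\<^esub> x \<in> J" using ideal.I_l_closed[OF J(1) x(1), of "inv x"] i xR(2) by simp
      moreover have "inv x \<otimes>\<^bsub>OR\<^esub> x = \<one>\<^bsub>OR\<^esub>" using xR(1) x0 field_Units by simp
      ultimately have "J = carrier OR" using ideal.one_imp_carrier[OF J(1)] by simp
      then show False using n by simp
    qed
  qed
qed

lemma kR_field: "field kR"
proof -
  interpret D: domain OR using OR_domain .
  show ?thesis unfolding kR_def using maximalideal.quotient_is_field[OF M_maximal D.is_cring] .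
qed

sublocale k: field kR by (rule kR_field)

lemma \<phi>_hom: "\<phi> \<in> ring_hom OR kR"
  unfolding kR_def \<phi>_def using ideal.rcos_ring_hom[OF maximalideal.axioms(1)[OF M_maximal]] by (simp add: eta_contract_eq)

lemma \<phi>_simps:
  assumes "x \<in> carrier R" "0 \<le> v x"
  shows "\<phi> x \<in> carrier kR"
    and "y \<in> carrier R \<Longrightarrow> 0 \<le> v y \<Longrightarrow> \<phi> (x \<otimes> y) = \<phi> x \<otimes>\<^bsub>kR\<^esub> \<phi> y"
    and "y \<in> carrier R \<Longrightarrow> 0 \<le> v y \<Longrightarrow> \<phi> (x \<oplus> y) = \<phi> x \<oplus>\<^bsub>kR\<^esub> \<phi> y"
  using ring_hom_memE[OF \<phi>_hom] assms by auto

lemma \<phi>_one [simp]: "\<phi> \<one> = \<one>\<^bsub>kR\<^esub>"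
  using ring_hom_memE[OF \<phi>_hom] by simp

lemma \<phi>_surj:
  assumes "C \<in> carrier kR" obtains x where "x \<in> carrier R" "0 \<le> v x" "\<phi> x = C"
  using assms unfolding kR_def FactRing_def A_RCOSETS_def' \<phi>_def by auto

lemma \<phi>_ring_hom_ring: "ring_hom_ring OR kR \<phi>"
proof -
  interpret D: domain OR using OR_domain .
  show ?thesis using ring_hom_ringI2[OF D.ring_axioms k.ring_axioms \<phi>_hom] .
qed

lemma O_a_inv: "x \<in> carrier R \<Longrightarrow> 0 \<le> v x \<Longrightarrow> \<ominus>\<^bsub>OR\<^esub> x = \<ominus> x"
proof -
  assume x: "x \<in> carrier R" "0 \<le> v x"
  interpret D: domain OR using OR_domain .
  show ?thesis by (rule D.minus_equality) (use x l_neg in auto)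
qed

lemma \<phi>_zero [simp]: "\<phi> \<zero> = \<zero>\<^bsub>kR\<^esub>"
proof -
  interpret h: ring_hom_ring OR kR \<phi> by (rule \<phi>_ring_hom_ring)
  show ?thesis using h.hom_zero by simp
qed

lemma \<phi>_minus:
  assumes "x \<in> carrier R" "0 \<le> v x"
  shows "\<phi> (\<ominus> x) = \<ominus>\<^bsub>kR\<^esub> \<phi> x"
    and "y \<in> carrier R \<Longrightarrow> 0 \<le> v y \<Longrightarrow> \<phi> (x \<ominus> y) = \<phi> x \<ominus>\<^bsub>kR\<^esub> \<phi> y"
    and "\<phi> (x [^] (n::nat)) = \<phi> x [^]\<^bsub>kR\<^esub> n"
    and "\<phi> ([n] \<cdot> x) = [n] \<cdot>\<^bsub>kR\<^esub> \<phi> x"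
proof -
  interpret h: ring_hom_ring OR kR \<phi> by (rule \<phi>_ring_hom_ring)
  have m: "\<phi> (\<ominus> x) = \<ominus>\<^bsub>kR\<^esub> \<phi> x" if "x \<in> carrier R" "0 \<le> v x" for x
    using h.hom_a_inv[of x] O_a_inv[OF that] that by simp
  show "\<phi> (\<ominus> x) = \<ominus>\<^bsub>kR\<^esub> \<phi> x" using m assms by blast
  show "\<phi> (x \<ominus> y) = \<phi> x \<ominus>\<^bsub>kR\<^esub> \<phi> y" if "y \<in> carrier R" "0 \<le> v y"
    unfolding a_minus_def using \<phi>_simps(3)[OF assms, of "\<ominus> y"] m that by simp
  show "\<phi> (x [^] n) = \<phi> x [^]\<^bsub>kR\<^esub> n"
  proof (induction n)
    case (Suc n)
    have "0 \<le> v (x [^] n)" using v_pow_ge[of x 0 n] assms by (simp add: zero_ereal_def)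
    then show ?case using Suc \<phi>_simps(2)[of "x [^] n" x] assms by simp
  qed simp
  show "\<phi> ([n] \<cdot> x) = [n] \<cdot>\<^bsub>kR\<^esub> \<phi> x"
  proof (induction n)
    case (Suc n)
    then show ?case using \<phi>_simps(3)[of "[n] \<cdot> x" x] v_nat_mult_ge[of x 0 n] assms by simp
  qed simp
qed

lemma \<phi>_eq_iff:
  assumes "x \<in> carrier R" "0 \<le> v x" "y \<in> carrier R" "0 \<le> v y"
  shows "\<phi> x = \<phi> y \<longleftrightarrow> 0 < v (x \<ominus> y)"
proof -
  interpret D: domain OR using OR_domain .
  have I: "ideal M OR" using maximalideal.axioms(1)[OF M_maximal] .
  have e: "x \<ominus>\<^bsub>OR\<^esub> y = x \<ominus> y" unfolding a_minus_def using O_a_inv assms by simp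
  have "\<phi> x = \<phi> y \<longleftrightarrow> x \<ominus>\<^bsub>OR\<^esub> y \<in> M"
    unfolding \<phi>_def using D.quotient_eq_iff_same_a_r_cos[OF I, of x y] assms by auto
  then show ?thesis unfolding e M_def using assms by simp
qed

lemma \<phi>_zero_iff:
  assumes "x \<in> carrier R" "0 \<le> v x"
  shows "\<phi> x = \<zero>\<^bsub>kR\<^esub> \<longleftrightarrow> 0 < v x"
proof -
  have "x \<ominus> \<zero> = x" using assms(1) by (simp add: a_minus_def)
  then show ?thesis using \<phi>_eq_iff[OF assms, of \<zero>] by simp
qed

lemma subfield_residues:
  assumes E: "subfield E R"
  shows "subfield (\<phi> ` {x \<in> E. 0 \<le> v x}) kR"
proof (rule k.subfieldI'[OF k.subringI])
  note ER = subfieldE(3)[OF E] and cl = subringE[OF subfieldE(1)[OF E]]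
  let ?S = "{x \<in> E. 0 \<le> v x}"
  have SR: "x \<in> carrier R" "0 \<le> v x" if "x \<in> ?S" for x using that ER by auto
  show "\<phi> ` ?S \<subseteq> carrier kR" using \<phi>_simps(1) SR by blast
  show "\<one>\<^bsub>kR\<^esub> \<in> \<phi> ` ?S" using cl(3) by (intro image_eqI[of _ _ \<one>]) auto
  show "\<ominus>\<^bsub>kR\<^esub> C \<in> \<phi> ` ?S" if C: "C \<in> \<phi> ` ?S" for C
  proof -
    obtain x where x: "x \<in> ?S" "C = \<phi> x" using C by blast
    then show ?thesis using \<phi>_minus(1)[OF SR[OF x(1)]] SR[OF x(1)] cl(5) by (intro image_eqI[of _ _ "\<ominus> x"]) auto
  qed
  fix C B assume "C \<in> \<phi> ` ?S" "B \<in> \<phi> ` ?S"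
  then obtain x y where x: "x \<in> ?S" "C = \<phi> x" and y: "y \<in> ?S" "B = \<phi> y" by blast
  have "0 \<le> v (x \<otimes> y)" "0 \<le> v (x \<oplus> y)" using SR[OF x(1)] SR[OF y(1)] v_mult v_add_ge by auto
  then have "x \<otimes> y \<in> ?S" "x \<oplus> y \<in> ?S" using x y cl(6,7) by auto
  then have "\<phi> (x \<otimes> y) \<in> \<phi> ` ?S" "\<phi> (x \<oplus> y) \<in> \<phi> ` ?S" by blast+
  then show "C \<otimes>\<^bsub>kR\<^esub> B \<in> \<phi> ` ?S" "C \<oplus>\<^bsub>kR\<^esub> B \<in> \<phi> ` ?S"
    using \<phi>_simps(2,3)[OF SR[OF x(1)] SR[OF y(1)]] x y by simp_all
next
  note ER = subfieldE(3)[OF E]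
  let ?S = "{x \<in> E. 0 \<le> v x}"
  fix C assume "C \<in> \<phi> ` ?S - {\<zero>\<^bsub>kR\<^esub>}"
  then obtain x where x: "x \<in> E" "0 \<le> v x" "C = \<phi> x" "C \<noteq> \<zero>\<^bsub>kR\<^esub>" by blast
  have xR: "x \<in> carrier R" using x ER by blast
  have vx: "v x = 0" using \<phi>_zero_iff[OF xR x(2)] x by force
  have x0: "x \<noteq> \<zero>" using vx by auto
  note i = v_inv[OF xR x0]
  have iE: "inv x \<in> E" using subfield_m_inv(1)[OF E] x(1) x0 by blast
  have vi: "0 \<le> v (inv x)" using i(1) vx by simp
  have "C \<otimes>\<^bsub>kR\<^esub> \<phi> (inv x) = \<one>\<^bsub>kR\<^esub>"
    using \<phi>_simps(2)[OF xR x(2) i(2) vi] x(3) xR x0 field_Units by simp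
  then have "inv\<^bsub>kR\<^esub> C = \<phi> (inv x)"
    using k.comm_inv_char[of C "\<phi> (inv x)"] \<phi>_simps(1)[OF xR x(2)] \<phi>_simps(1)[OF i(2) vi] x(3) by simp
  then show "inv\<^bsub>kR\<^esub> C \<in> \<phi> ` ?S" using iE vi by blast
qed

section \<open>Completeness, bounded linear maps and invariance of the valuation\<close>

definition v_cauchy :: "(nat \<Rightarrow> 'a) \<Rightarrow> bool" where
  "v_cauchy s \<longleftrightarrow> (\<forall>C::real. \<exists>N. \<forall>i\<ge>N. \<forall>j\<ge>N. ereal C \<le> v (s i \<ominus> s j))"

definition v_lim :: "(nat \<Rightarrow> 'a) \<Rightarrow> 'a \<Rightarrow> bool" where
  "v_lim s x \<longleftrightarrow> (\<forall>C::real. \<exists>N. \<forall>i\<ge>N. ereal C \<le> v (s i \<ominus> x))"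

definition v_complete :: "'a set \<Rightarrow> bool" where
  "v_complete W \<longleftrightarrow> (\<forall>s. range s \<subseteq> W \<longrightarrow> v_cauchy s \<longrightarrow> (\<exists>x \<in> W. v_lim s x))"

lemma add_minus_cancel: "x \<in> carrier R \<Longrightarrow> t \<in> carrier R \<Longrightarrow> (t \<oplus> x) \<ominus> t = x"
  using a_comm[of t x] by (simp add: a_minus_def a_assoc r_neg)

lemma zero_if_v_unbounded:
  assumes "x \<in> carrier R" "\<And>C. ereal C \<le> v x" shows "x = \<zero>"
proof (rule ccontr)
  assume "x \<noteq> \<zero>"
  then obtain r where "v x = ereal r" using v_realE assms(1) by blast
  then show False using assms(2)[of "r + 1"] by simp
qed

text \<open>Otherwise points of \<open>W\<close> ever closer to \<open>w\<close> would form a Cauchy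
  sequence, and its limit in \<open>W\<close> would be \<open>w\<close> itself.\<close>

lemma distance_bounded:
  assumes W: "v_complete W" "W \<subseteq> carrier R" and w: "w \<in> carrier R" "w \<notin> W"
  shows "\<exists>C::real. \<forall>x \<in> W. v (w \<ominus> x) \<le> ereal C"
proof (rule ccontr)
  assume "\<not> ?thesis"
  then have "\<forall>n::nat. \<exists>x \<in> W. ereal (real n) < v (w \<ominus> x)" by (meson not_le)
  then obtain s where s: "\<And>n::nat. s n \<in> W" "\<And>n. ereal (real n) < v (w \<ominus> s n)" by metis
  have sR: "s n \<in> carrier R" for n using s(1) W(2) by blast
  have "v_cauchy s"
    unfolding v_cauchy_def
  proof
    fix C :: real
    obtain N :: nat where N: "C \<le> real N" using real_arch_simple by blast
    have c: "ereal C \<le> v (w \<ominus> s i)" if "i \<ge> N" for i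
      using s(2)[of i] that N by (intro order_trans[OF _ less_imp_le[OF s(2)]]) simp
    have "ereal C \<le> v (s i \<ominus> s j)" if "i \<ge> N" "j \<ge> N" for i j
      using v_diff_trans(1)[OF sR w(1) sR, of "ereal C" i j] c that v_minus_commute[OF w(1) sR] by simp
    then show "\<exists>N. \<forall>i\<ge>N. \<forall>j\<ge>N. ereal C \<le> v (s i \<ominus> s j)" by blast
  qed
  then obtain x where x: "x \<in> W" "v_lim s x" using W(1) s(1) unfolding v_complete_def by blast
  have xR: "x \<in> carrier R" using x(1) W(2) by blast
  have "w \<ominus> x = \<zero>"
  proof (rule zero_if_v_unbounded)
    fix C :: real
    obtain N where N: "\<And>i. i \<ge> N \<Longrightarrow> ereal C \<le> v (s i \<ominus> x)" using x(2) unfolding v_lim_def by blast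
    obtain K :: nat where K: "C \<le> real K" using real_arch_simple by blast
    let ?i = "max N K"
    have "ereal C \<le> v (w \<ominus> s ?i)" using K by (intro order_trans[OF _ less_imp_le[OF s(2)]]) simp
    then show "ereal C \<le> v (w \<ominus> x)" using v_diff_trans(1)[OF w(1) sR xR, of "ereal C" ?i] N[of ?i] by simp
  qed (use w xR in simp)
  then have "w = x" using w(1) xR by simp
  then show False using x(1) w(2) by simp
qed

text \<open>Completeness of \<open>W\<close> and boundedness of every \<open>K\<close>-linear map on
  it are proved together by splitting off a line. Completeness of the hyperplane \<open>W'\<close>
  keeps \<open>w\<close> at bounded distance from it, so a vector controls its two components. The
  bound says that \<open>h\<close> lowers valuations by at most a constant.\<close>

lemma complete_finite_dimension:
  assumes K: "subfield K R" "v_complete K" and d: "dimension n K W"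
  shows "v_complete W \<and> (\<forall>h. (\<forall>x \<in> W. h x \<in> carrier R) \<longrightarrow> (\<forall>x \<in> W. \<forall>y \<in> W. h (x \<oplus> y) = h x \<oplus> h y) \<longrightarrow>
     (\<forall>a \<in> K. \<forall>x \<in> W. h (a \<otimes> x) = a \<otimes> h x) \<longrightarrow> (\<exists>C::real. \<forall>x \<in> W. v x \<le> v (h x) + ereal C))"
  using d
proof (induction n arbitrary: W)
  case 0
  then have W: "W = {\<zero>}" using dimension_zero[OF K(1)] by blast
  have "v_lim s \<zero>" if "range s \<subseteq> W" for s
  proof -
    have "s i = \<zero>" for i using that W by (metis rangeI singletonD subsetD)
    then show ?thesis unfolding v_lim_def by (simp add: a_minus_def)
  qed
  then have "v_complete W" unfolding v_complete_def using W by blast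
  moreover have "\<exists>C::real. \<forall>x \<in> W. v x \<le> v (h x) + ereal C"
    if "\<forall>x \<in> W. h x \<in> carrier R" "\<forall>x \<in> W. \<forall>y \<in> W. h (x \<oplus> y) = h x \<oplus> h y" for h :: "'a \<Rightarrow> 'a"
  proof -
    have "h \<zero> \<oplus> h \<zero> = h \<zero>" "h \<zero> \<in> carrier R" using that W by auto
    then have "h \<zero> = \<zero>" by simp
    then show ?thesis using W by auto
  qed
  ultimately show ?case by blast
next
  case (Suc n)
  obtain w W' where w: "w \<in> carrier R" "dimension n K W'" "w \<notin> W'" "W = line_extension K w W'"
    using dimension_backwards[OF K(1) Suc.prems] by blast
  note IH = Suc.IH[OF w(2)]
  note sp = space_subgroup_props[OF K(1) w(2)] and sW = space_subgroup_props[OF K(1) Suc.prems]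
  note KR = subfieldE(3)[OF K(1)] and Kc = subringE[OF subfieldE(1)[OF K(1)]]
  have Wm: "u \<in> W \<longleftrightarrow> (\<exists>a\<in>K. \<exists>x\<in>W'. u = a \<otimes> w \<oplus> x)" for u
    unfolding w(4) line_extension_mem_iff ..
  have w0: "w \<noteq> \<zero>" using w(3) sp(2) by blast
  obtain vw where vw: "v w = ereal vw" using v_realE[OF w(1) w0] by blast
  obtain C where C: "\<And>x. x \<in> W' \<Longrightarrow> v (w \<ominus> x) \<le> ereal C"
    using distance_bounded[OF conjunct1[OF IH] sp(1) w(1,3)] by blast
  \<comment> \<open>Scaling by \<open>inv a\<close> reduces this to the bounded distance between
    \<open>w\<close> and \<open>W'\<close>.\<close>
  have gap: "v (a \<otimes> w \<oplus> x) \<le> v a + ereal C" if a: "a \<in> K" and x: "x \<in> W'" for a x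
  proof (cases "a = \<zero>")
    case False
    have aR: "a \<in> carrier R" and xR: "x \<in> carrier R" using a x KR sp(1) by auto
    have ia: "inv a \<in> K" using subfield_m_inv(1)[OF K(1)] a False by blast
    note i = v_inv[OF aR False]
    let ?y = "\<ominus> (inv a \<otimes> x)"
    have y: "?y \<in> W'" using sp(4)[OF sp(5)[OF ia x]] .
    have "a \<otimes> (w \<ominus> ?y) = a \<otimes> w \<oplus> (a \<otimes> inv a) \<otimes> x"
      using aR i(2) xR w(1) by (simp add: a_minus_def r_distr m_assoc)
    also have "a \<otimes> inv a = \<one>" using aR False field_Units by simp
    finally have "a \<otimes> w \<oplus> x = a \<otimes> (w \<ominus> ?y)" using xR by simp
    moreover have "w \<ominus> ?y \<in> carrier R" using w(1) y sp(1) by blast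
    ultimately have "v (a \<otimes> w \<oplus> x) = v a + v (w \<ominus> ?y)" using v_mult[OF aR] by simp
    then show ?thesis using C[OF y] by (simp add: add_left_mono)
  qed simp
  \<comment> \<open>\<open>C\<close> bounds the loss for the coefficient \<open>a\<close>.
    Multiplication by \<open>w\<close> shifts valuations by \<open>vw\<close>, and \<open>B\<close>
    absorbs that shift when the component \<open>x\<close> is recovered as a difference.\<close>
  obtain B where B: "0 \<le> B" "C - vw \<le> B" "C \<le> B" by (metis linear max.bounded_iff max.cobounded1 max.cobounded2)
  have part: "v a \<ge> v (a \<otimes> w \<oplus> x) - ereal C" "v x \<ge> v (a \<otimes> w \<oplus> x) - ereal B"
    if a: "a \<in> K" and x: "x \<in> W'" for a x
  proof -
    have aR: "a \<in> carrier R" and xR: "x \<in> carrier R" using a x KR sp(1) by auto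
    let ?u = "a \<otimes> w \<oplus> x"
    have uR: "?u \<in> carrier R" using aR xR w(1) by simp
    show g: "v a \<ge> v ?u - ereal C" using gap[OF a x] by (cases "v a"; cases "v ?u") auto
    have "v (a \<otimes> w) \<ge> v ?u - ereal B"
      using g v_mult[OF aR w(1)] vw v_not_minf[OF aR] v_not_minf[OF uR] B
      by (cases "v a"; cases "v ?u") auto
    moreover have "v ?u \<ge> v ?u - ereal B" using v_not_minf[OF uR] B(1) by (cases "v ?u") auto
    moreover have "x = ?u \<ominus> a \<otimes> w" using add_minus_cancel[of x "a \<otimes> w"] aR xR w(1) by simp
    ultimately show "v x \<ge> v ?u - ereal B"
      using v_diff_ge[OF uR, of "a \<otimes> w"] aR w(1) by simp
  qed
  have "v_complete W"
    unfolding v_complete_def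
  proof (intro allI impI)
    fix s assume s: "range s \<subseteq> W" "v_cauchy s"
    have "\<forall>n. \<exists>a x. a \<in> K \<and> x \<in> W' \<and> s n = a \<otimes> w \<oplus> x" using s(1) Wm by (metis rangeI subsetD)
    then obtain a x where ax: "\<And>n. a n \<in> K" "\<And>n. x n \<in> W'" "\<And>n. s n = a n \<otimes> w \<oplus> x n" by metis
    have aR: "a n \<in> carrier R" and xR: "x n \<in> carrier R" for n using ax KR sp(1) by auto
    have d: "a i \<ominus> a j \<in> K" "x i \<ominus> x j \<in> W'" "s i \<ominus> s j = (a i \<ominus> a j) \<otimes> w \<oplus> (x i \<ominus> x j)" for i j
    proof -
      show "a i \<ominus> a j \<in> K" using ax(1) Kc(5,7) unfolding a_minus_def by blast
      show "x i \<ominus> x j \<in> W'" using ax(2) sp(3,4) unfolding a_minus_def by blast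
      show "s i \<ominus> s j = (a i \<ominus> a j) \<otimes> w \<oplus> (x i \<ominus> x j)"
        unfolding ax(3) a_minus_def using aR xR w(1)
        by (simp add: l_distr l_minus minus_add a_ac)
    qed
    have pc: "ereal D \<le> v (a i \<ominus> a j)" "ereal D \<le> v (x i \<ominus> x j)"
      if "ereal (D + B) \<le> v (s i \<ominus> s j)" for D i j
    proof -
      have "ereal D \<le> v (s i \<ominus> s j) - ereal B" "ereal D \<le> v (s i \<ominus> s j) - ereal C"
        using that B(3) by (cases "v (s i \<ominus> s j)"; simp)+
      then show "ereal D \<le> v (a i \<ominus> a j)" "ereal D \<le> v (x i \<ominus> x j)"
        using part[OF d(1) d(2), of i j i j] unfolding d(3)[symmetric] by (blast intro: order_trans)+
    qed
    have ca: "v_cauchy a" "v_cauchy x"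
    proof -
      have "\<exists>N. \<forall>i\<ge>N. \<forall>j\<ge>N. ereal D \<le> v (a i \<ominus> a j) \<and> ereal D \<le> v (x i \<ominus> x j)" for D
      proof -
        obtain N where "\<And>i j. i \<ge> N \<Longrightarrow> j \<ge> N \<Longrightarrow> ereal (D + B) \<le> v (s i \<ominus> s j)"
          using s(2) unfolding v_cauchy_def by blast
        then show ?thesis using pc[of D] by blast
      qed
      then show "v_cauchy a" "v_cauchy x" unfolding v_cauchy_def by meson+
    qed
    obtain b where b: "b \<in> K" "v_lim a b"
      using K(2) ca(1) ax(1) unfolding v_complete_def by blast
    obtain y where y: "y \<in> W'" "v_lim x y"
      using conjunct1[OF IH] ca(2) ax(2) unfolding v_complete_def by blast
    have bR: "b \<in> carrier R" and yR: "y \<in> carrier R" using b y KR sp(1) by auto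
    have "v_lim s (b \<otimes> w \<oplus> y)"
      unfolding v_lim_def
    proof
      fix D :: real
      obtain N where N: "\<And>i. i \<ge> N \<Longrightarrow> ereal (D - vw) \<le> v (a i \<ominus> b)" using b(2) unfolding v_lim_def by blast
      obtain N' where N': "\<And>i. i \<ge> N' \<Longrightarrow> ereal D \<le> v (x i \<ominus> y)" using y(2) unfolding v_lim_def by blast
      have "ereal D \<le> v (s i \<ominus> (b \<otimes> w \<oplus> y))" if i: "i \<ge> max N N'" for i
      proof -
        have e: "s i \<ominus> (b \<otimes> w \<oplus> y) = (a i \<ominus> b) \<otimes> w \<oplus> (x i \<ominus> y)"
          unfolding ax(3) a_minus_def using aR xR bR yR w(1) by (simp add: l_distr l_minus minus_add a_ac)
        have "ereal (D - vw + vw) \<le> v ((a i \<ominus> b) \<otimes> w)"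
          using v_mult_ge[of "a i \<ominus> b" w "D - vw" vw] N i vw aR bR w(1) by simp
        then show ?thesis unfolding e using v_add_ge[of "(a i \<ominus> b) \<otimes> w" "x i \<ominus> y"] N' i aR xR bR yR w(1) by simp
      qed
      then show "\<exists>N. \<forall>i\<ge>N. ereal D \<le> v (s i \<ominus> (b \<otimes> w \<oplus> y))" by blast
    qed
    then show "\<exists>x\<in>W. v_lim s x" using Wm b(1) y(1) by blast
  qed
  moreover have "\<exists>C::real. \<forall>x \<in> W. v x \<le> v (h x) + ereal C"
    if h: "\<forall>x \<in> W. h x \<in> carrier R" "\<forall>x \<in> W. \<forall>y \<in> W. h (x \<oplus> y) = h x \<oplus> h y" "\<forall>a \<in> K. \<forall>x \<in> W. h (a \<otimes> x) = a \<otimes> h x" for h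
  proof -
    have W'W: "x \<in> W" if "x \<in> W'" for x
      using that Kc(2) w(1) subsetD[OF sp(1) that] by (intro iffD2[OF Wm] bexI[of _ \<zero>] bexI[of _ x]) auto
    have wW: "w \<in> W"
      using Kc(3) w(1) sp(2) by (intro iffD2[OF Wm] bexI[of _ \<one>] bexI[of _ \<zero>]) auto
    obtain D where D: "\<And>x. x \<in> W' \<Longrightarrow> v x \<le> v (h x) + ereal D"
      using conjunct2[OF IH, rule_format, of h] h W'W by blast
    obtain vh where vh: "ereal vh \<le> v (h w)"
      using h(1) wW v_not_minf[of "h w"] by (cases "v (h w)") (auto intro: that[of 0])
    obtain A where A: "C - vh \<le> A" "B + D \<le> A" by (metis linear)
    have "v u \<le> v (h u) + ereal A" if u: "u \<in> W" for u
    proof -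
      obtain a x where ax: "a \<in> K" "x \<in> W'" "u = a \<otimes> w \<oplus> x" using u Wm by blast
      have R: "a \<in> carrier R" "x \<in> carrier R" "h w \<in> carrier R" "h x \<in> carrier R" "u \<in> carrier R" "h u \<in> carrier R"
        using ax KR sp(1) h(1) wW W'W u sW(1) by auto
      have "a \<otimes> w \<in> W" using sW(5)[OF ax(1) wW] .
      then have hu: "h u = a \<otimes> h w \<oplus> h x" using h(2,3) ax wW W'W by auto
      note pt = part[OF ax(1,2), folded ax(3)]
      have 1: "v u - ereal A \<le> v (a \<otimes> h w)"
        using pt(1) vh v_mult[OF R(1,3)] v_not_minf[OF R(1)] v_not_minf[OF R(3)] v_not_minf[OF R(5)] A(1)
        by (cases "v a"; cases "v u"; cases "v (h w)") auto
      have 2: "v u - ereal A \<le> v (h x)"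
        using pt(2) D[OF ax(2)] v_not_minf[OF R(2)] v_not_minf[OF R(4)] v_not_minf[OF R(5)] A(2)
        by (cases "v x"; cases "v u"; cases "v (h x)") auto
      have "v u - ereal A \<le> v (h u)" unfolding hu using v_add_ge[of "a \<otimes> h w" "h x"] 1 2 R by simp
      then show ?thesis using v_not_minf[OF R(5)] v_not_minf[OF R(6)] by (cases "v u"; cases "v (h u)") auto
    qed
    then show ?thesis by blast
  qed
  ultimately show ?case by blast
qed

text \<open>Boundedness with one constant \<open>C\<close>, applied to all powers of
  \<open>x\<close>, bounds \<open>n (v x - v (\<rho> x))\<close> by \<open>C\<close> for every
  \<open>n\<close>, so an automorphism cannot lower the valuation. Its inverse gives the other
  inequality.\<close>

lemma Gal_isometry:
  assumes K: "subfield K R" "v_complete K" and E: "subfield E R" "K \<subseteq> E" "finite_dimension K E"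
    and r: "\<rho> \<in> carrier (Gal K E)" and x: "x \<in> E"
  shows "v (\<rho> x) = v x"
proof -
  have le: "v x \<le> v (\<rho> x)" if r: "\<rho> \<in> carrier (Gal K E)" and x: "x \<in> E" for \<rho> x
  proof (cases "x = \<zero>")
    case True
    then show ?thesis using Gal_minus(2)[OF subfieldE(1)[OF E(1)] r] by simp
  next
    case False
    note ER = subfieldE(3)[OF E(1)] and cl = subringE[OF subfieldE(1)[OF E(1)]]
    note d = Gal_memD[OF r]
    have xR: "x \<in> carrier R" "\<rho> x \<in> carrier R" using x d(1)[OF x] ER by auto
    obtain n where n: "dimension n K E" using E(3) by auto
    have "\<forall>y\<in>E. \<rho> y \<in> carrier R" "\<forall>y\<in>E. \<forall>z\<in>E. \<rho> (y \<oplus> z) = \<rho> y \<oplus> \<rho> z"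
      "\<forall>a\<in>K. \<forall>y\<in>E. \<rho> (a \<otimes> y) = a \<otimes> \<rho> y" using d E(2) ER by auto
    then obtain C where C: "\<And>y. y \<in> E \<Longrightarrow> v y \<le> v (\<rho> y) + ereal C"
      using complete_finite_dimension[OF K n, THEN conjunct2, rule_format, of \<rho>] by blast
    have "\<rho> x \<noteq> \<zero>"
      using inj_onD[OF d(3), of x \<zero>] Gal_minus(2)[OF subfieldE(1)[OF E(1)] r] x cl(2) False by auto
    then obtain a b where ab: "v x = ereal a" "v (\<rho> x) = ereal b"
      using v_realE[OF xR(1) False] v_realE[OF xR(2)] by metis
    have "real n * (a - b) \<le> C" for n :: nat
    proof -
      have "x [^] n \<in> E" using x cl(3,6) by (induction n) auto
      then have "v (x [^] n) \<le> v (\<rho> (x [^] n)) + ereal C" using C by blast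
      then show ?thesis using Gal_minus(4)[OF subfieldE(1)[OF E(1)] r x, of n]
          v_pow_real[OF xR(1) ab(1), of n] v_pow_real[OF xR(2) ab(2), of n] by (simp add: algebra_simps)
    qed
    then have "\<not> a - b > 0" using ex_less_of_nat_mult[of "a - b" C] by (metis not_le)
    then show ?thesis using ab by simp
  qed
  have E': "subring E R" using subfieldE(1)[OF E(1)] .
  interpret G: group "Gal K E" using Gal_group[OF E' E(2)] .
  have "v (\<rho> x) \<le> v ((inv\<^bsub>Gal K E\<^esub> \<rho>) (\<rho> x))" using le[OF G.inv_closed[OF r] Gal_memD(1)[OF r x]] .
  then show ?thesis using le[OF r x] Gal_inv_apply(1)[OF E' E(2) r x] by simp
qed

end

section \<open>The p-adic numbers and their unramified extensions\<close>

locale padic_closure = char0_closed R + valued_field R v for R (structure) and v +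
  fixes p :: nat and Qp :: "'a set"
  assumes prime_p: "Factorial_Ring.prime p" and odd_p: "odd p" and padic: "padic_numbers v p Qp"
begin

lemma Qp_subfield: "subfield Qp R" and Qp_complete: "v_complete Qp"
  using padic unfolding padic_numbers_def v_complete_def v_cauchy_def v_lim_def by auto

lemma v_int: "n \<noteq> (0::int) \<Longrightarrow> v ([n] \<cdot> \<one>) = ereal (real (multiplicity (int p) n))"
  using padic unfolding padic_numbers_def by blast

lemma v_nat: "n \<noteq> (0::nat) \<Longrightarrow> v ([n] \<cdot> \<one>) = ereal (real (multiplicity (int p) (int n)))"
  using v_int[of "int n"] by (simp add: add_pow_int_ge)

lemma v_p: "v ([p] \<cdot> \<one>) = 1"
  using v_nat[of p] prime_gt_1_nat[OF prime_p] by (simp add: one_ereal_def multiplicity_self)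

text \<open>A rational number approximating \<open>x\<close> to a precision better than
  \<open>v x\<close> has the same valuation as \<open>x\<close>, and that valuation is a difference
  of two multiplicities.\<close>

lemma v_Qp:
  assumes "x \<in> Qp" "x \<noteq> \<zero>" shows "\<exists>z::int. v x = ereal (of_int z)"
proof -
  have xR: "x \<in> carrier R" using assms subfieldE(3)[OF Qp_subfield] by blast
  obtain r where r: "v x = ereal r" using v_realE[OF xR assms(2)] by blast
  obtain m n :: int where mn: "n \<noteq> 0" "ereal (r + 1) \<le> v (x \<ominus> ([m] \<cdot> \<one>) \<otimes> inv ([n] \<cdot> \<one>))"
    using padic assms(1) unfolding padic_numbers_def by meson
  have nR: "[n] \<cdot> \<one> \<in> carrier R" "[n] \<cdot> \<one> \<noteq> \<zero>" "[m] \<cdot> \<one> \<in> carrier R"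
    using v_int[OF mn(1)] by auto
  note i = v_inv[OF nR(1,2)]
  let ?q = "([m] \<cdot> \<one>) \<otimes> inv ([n] \<cdot> \<one>)"
  have q: "?q \<in> carrier R" using nR i by simp
  have "v x < v (x \<ominus> ?q)" using mn(2) r by (intro less_le_trans[OF _ mn(2)]) simp
  then have "v ?q = v x" using v_eq_if_diff[OF xR q] v_minus_commute[OF xR q] by simp
  moreover have "m \<noteq> 0"
  proof
    assume "m = 0"
    then have "?q = \<zero>" using i by (simp add: add_pow_int_ge)
    then show False using \<open>v ?q = v x\<close> r by simp
  qed
  ultimately have "v x = ereal (real (multiplicity (int p) m)) + - ereal (real (multiplicity (int p) n))"
    using v_mult[OF nR(3) i(2)] i(1) v_int mn(1) by simp
  then have "v x = ereal (of_int (int (multiplicity (int p) m) - int (multiplicity (int p) n)))" by simp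
  then show ?thesis by blast
qed

lemma unramifiedD:
  assumes "unramified v Qp K"
  shows "subfield K R" "Qp \<subseteq> K" "finite_dimension Qp K" "v_complete K"
    "\<And>x. x \<in> K \<Longrightarrow> x \<noteq> \<zero> \<Longrightarrow> \<exists>z::int. v x = ereal (of_int z)"
proof -
  show K: "subfield K R" "Qp \<subseteq> K" "finite_dimension Qp K" using assms unfolding unramified_def by auto
  obtain n where "dimension n Qp K" using K(3) by auto
  then show "v_complete K" using complete_finite_dimension[OF Qp_subfield Qp_complete] by blast
  let ?c = "\<lambda>x. {v x + v y | y. y \<in> Qp - {\<zero>}}"
  \<comment> \<open>Ramification index one leaves a single coset, that of \<open>\<one>\<close>;
    hence every value taken on \<open>K\<close> is already taken on \<open>Qp\<close>.\<close>
  have "card (?c ` (K - {\<zero>})) = 1" using assms unfolding unramified_def ram_index_def by simp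
  then obtain S where S: "?c ` (K - {\<zero>}) = {S}" by (auto simp: card_1_singleton_iff)
  note KR = subfieldE(3)[OF K(1)]
  fix x assume x: "x \<in> K" "x \<noteq> \<zero>"
  have oK: "\<one> \<in> K - {\<zero>}" using subringE(3)[OF subfieldE(1)[OF K(1)]] by simp
  have oQ: "\<one> \<in> Qp - {\<zero>}" using subringE(3)[OF subfieldE(1)[OF Qp_subfield]] by simp
  have "?c x \<in> ?c ` (K - {\<zero>})" using x by (intro imageI) simp
  moreover have "?c \<one> \<in> ?c ` (K - {\<zero>})" using oK by (rule imageI)
  ultimately have "?c x = ?c \<one>" unfolding S by simp
  moreover have "v x + v \<one> \<in> ?c x" using oQ by blast
  ultimately have "v x \<in> ?c \<one>" by simp
  then obtain y where "y \<in> Qp - {\<zero>}" "v x = v y" by auto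
  then show "\<exists>z::int. v x = ereal (of_int z)" using v_Qp by auto
qed

end

section \<open>Binomial expansions with integral remainders\<close>

lemma (in cring) binomial:
  assumes a: "a \<in> carrier R" and b: "b \<in> carrier R"
  shows "(a \<oplus> b) [^] m = (\<Oplus>k\<in>{..m}. [(m choose k)] \<cdot> (a [^] k \<otimes> b [^] (m - k)))"
proof (induction m)
  case 0
  show ?case using a b by (simp add: finsum_0)
next
  case (Suc m)
  let ?B = "\<Oplus>k\<in>{..m}. [(m choose k)] \<cdot> (a [^] k \<otimes> b [^] (m - k))"
  have cl: "(\<lambda>k. [(c k :: nat)] \<cdot> (a [^] (d k :: nat) \<otimes> b [^] (e k :: nat))) \<in> S \<rightarrow> carrier R" for c d e and S :: "nat set"
    using a b by auto
  have aB: "a \<otimes> ?B = (\<Oplus>k\<in>{..m}. [(m choose k)] \<cdot> (a [^] Suc k \<otimes> b [^] (m - k)))"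
    unfolding finsum_rdistr[OF finite_atMost a cl]
    using a b by (intro finsum_cong') (auto simp: add_pow_rdistr m_ac)
  have "b \<otimes> ?B = (\<Oplus>k\<in>{..m}. [(m choose k)] \<cdot> (a [^] k \<otimes> b [^] (Suc m - k)))"
    unfolding finsum_rdistr[OF finite_atMost b cl]
  proof (rule finsum_cong')
    fix k assume "k \<in> {..m}"
    then have "Suc m - k = Suc (m - k)" by auto
    then show "b \<otimes> ([(m choose k)] \<cdot> (a [^] k \<otimes> b [^] (m - k))) = [(m choose k)] \<cdot> (a [^] k \<otimes> b [^] (Suc m - k))"
      using a b by (simp add: add_pow_rdistr m_ac)
  qed (use a b in auto)
  also have "\<dots> = (\<Oplus>k\<in>{..Suc m}. [(m choose k)] \<cdot> (a [^] k \<otimes> b [^] (Suc m - k)))"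
    using finsum_Suc[of "\<lambda>k. [(m choose k)] \<cdot> (a [^] k \<otimes> b [^] (Suc m - k))" m] a b
    by (simp add: binomial_eq_0)
  also have "\<dots> = (\<Oplus>k\<in>{..m}. [(m choose Suc k)] \<cdot> (a [^] Suc k \<otimes> b [^] (m - k))) \<oplus> b [^] Suc m"
    using finsum_Suc2[of "\<lambda>k. [(m choose k)] \<cdot> (a [^] k \<otimes> b [^] (Suc m - k))" m] a b by simp
  finally have bB: "b \<otimes> ?B = \<dots>" .
  have "(a \<oplus> b) [^] Suc m = a \<otimes> ?B \<oplus> b \<otimes> ?B"
  proof -
    have B: "?B \<in> carrier R" using finsum_closed[OF cl] .
    have "(a \<oplus> b) [^] Suc m = ?B \<otimes> (a \<oplus> b)" using Suc by simp
    then show ?thesis using r_distr[OF a b B] m_comm[OF B a] m_comm[OF B b] by simp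
  qed
  also have "\<dots> = ((\<Oplus>k\<in>{..m}. [(m choose k)] \<cdot> (a [^] Suc k \<otimes> b [^] (m - k)))
     \<oplus> (\<Oplus>k\<in>{..m}. [(m choose Suc k)] \<cdot> (a [^] Suc k \<otimes> b [^] (m - k)))) \<oplus> b [^] Suc m"
    unfolding aB bB using a b by (intro a_assoc[symmetric] finsum_closed cl) (auto simp del: nat_pow_Suc)
  also have "(\<Oplus>k\<in>{..m}. [(m choose k)] \<cdot> (a [^] Suc k \<otimes> b [^] (m - k)))
     \<oplus> (\<Oplus>k\<in>{..m}. [(m choose Suc k)] \<cdot> (a [^] Suc k \<otimes> b [^] (m - k)))
     = (\<Oplus>k\<in>{..m}. [(Suc m choose Suc k)] \<cdot> (a [^] Suc k \<otimes> b [^] (m - k)))"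
    unfolding finsum_addf[OF cl cl, symmetric]
    using a b by (intro finsum_cong') (auto simp: add.nat_pow_mult)
  also have "\<dots> \<oplus> b [^] Suc m = (\<Oplus>k\<in>{..Suc m}. [(Suc m choose k)] \<cdot> (a [^] k \<otimes> b [^] (Suc m - k)))"
    using finsum_Suc2[of "\<lambda>k. [(Suc m choose k)] \<cdot> (a [^] k \<otimes> b [^] (Suc m - k))" m] a b by simp
  finally show ?case .
qed

context valued_field begin

lemma v_nonneg_closed:
  assumes "x \<in> carrier R" "0 \<le> v x"
  shows "y \<in> carrier R \<Longrightarrow> 0 \<le> v y \<Longrightarrow> 0 \<le> v (x \<otimes> y)" "y \<in> carrier R \<Longrightarrow> 0 \<le> v y \<Longrightarrow> 0 \<le> v (x \<oplus> y)"
    "0 \<le> v (x [^] (n::nat))" "0 \<le> v ([n] \<cdot> x)"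
  using assms v_pow_ge[of x 0 n] v_nat_mult_ge[of x 0 n]
  by (auto simp: v_mult zero_ereal_def[symmetric] intro: v_add_ge)

text \<open>The inner binomial coefficients are divisible by \<open>q\<close>. The factor
  \<open>a \<otimes> b\<close> is extracted as well, so that later error terms stay divisible by the
  increment \<open>t\<close>, hence by \<open>y\<close>.\<close>

lemma freshman:
  assumes a: "a \<in> carrier R" "0 \<le> v a" and b: "b \<in> carrier R" "0 \<le> v b" and q: "Factorial_Ring.prime (q::nat)"
  shows "\<exists>s \<in> carrier R. 0 \<le> v s \<and> (a \<oplus> b) [^] q = a [^] q \<oplus> b [^] q \<oplus> ([q] \<cdot> \<one>) \<otimes> (a \<otimes> b \<otimes> s)"
proof -
  define g where "g k = [(q choose k)] \<cdot> (a [^] k \<otimes> b [^] (q - k))" for k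
  have g: "g \<in> S \<rightarrow> carrier R" for S unfolding g_def using a b by auto
  have q1: "1 < q" using prime_gt_1_nat[OF q] .
  define I where "I = {1..<q}"
  have "\<exists>s \<in> carrier R. 0 \<le> v s \<and> (\<Oplus>k\<in>S. g k) = ([q] \<cdot> \<one>) \<otimes> (a \<otimes> b \<otimes> s)" if "finite S" "S \<subseteq> I" for S
    using that
  proof (induction S)
    case empty
    show ?case using a b by (intro bexI[of _ \<zero>]) auto
  next
    case (insert k S)
    obtain s where s: "s \<in> carrier R" "0 \<le> v s" "(\<Oplus>k\<in>S. g k) = ([q] \<cdot> \<one>) \<otimes> (a \<otimes> b \<otimes> s)" using insert by auto
    have k: "0 < k" "k < q" using insert.prems unfolding I_def by auto
    obtain c where c: "q choose k = q * c" using dvd_choose_prime[OF k(2) _ _ q] k by (auto elim: dvdE)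
    let ?t = "[c] \<cdot> (a [^] (k - 1) \<otimes> b [^] (q - k - 1))"
    have t: "?t \<in> carrier R" "0 \<le> v ?t" using a b v_nonneg_closed by auto
    have "a [^] k = a [^] (k - 1) \<otimes> a" "b [^] (q - k) = b [^] (q - k - 1) \<otimes> b"
      using k nat_pow_Suc[of a "k - 1"] nat_pow_Suc[of b "q - k - 1"] by (auto simp del: nat_pow_Suc simp: Suc_diff_Suc)
    then have "g k = [(q * c)] \<cdot> (a [^] (k - 1) \<otimes> a \<otimes> (b [^] (q - k - 1) \<otimes> b))" unfolding g_def c by simp
    also have "\<dots> = [q] \<cdot> ([c] \<cdot> (a [^] (k - 1) \<otimes> a \<otimes> (b [^] (q - k - 1) \<otimes> b)))"
      using a b by (simp add: add.nat_pow_pow mult.commute)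
    also have "[c] \<cdot> (a [^] (k - 1) \<otimes> a \<otimes> (b [^] (q - k - 1) \<otimes> b)) = a \<otimes> b \<otimes> ?t"
      using a b add_pow_rdistr[of "a \<otimes> b" "a [^] (k - 1) \<otimes> b [^] (q - k - 1)" c] by (simp add: m_ac)
    also have "[q] \<cdot> (a \<otimes> b \<otimes> ?t) = ([q] \<cdot> \<one>) \<otimes> (a \<otimes> b \<otimes> ?t)"
      using add_pow_ldistr[of \<one> "a \<otimes> b \<otimes> ?t" q] a b t by simp
    finally have gk: "g k = ([q] \<cdot> \<one>) \<otimes> (a \<otimes> b \<otimes> ?t)" .
    have "g k \<in> carrier R" "g \<in> S \<rightarrow> carrier R" using g[of "{k}"] g by auto
    then have "(\<Oplus>k\<in>insert k S. g k) = g k \<oplus> (\<Oplus>k\<in>S. g k)" using finsum_insert[of S k g] insert.hyps by simp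
    also have "\<dots> = ([q] \<cdot> \<one>) \<otimes> (a \<otimes> b \<otimes> (?t \<oplus> s))"
      unfolding gk s(3) using a b s(1) t(1) by (simp add: r_distr)
    finally show ?case using s(1,2) t v_nonneg_closed(2) by blast
  qed
  from this[of I] obtain s where s: "s \<in> carrier R" "0 \<le> v s" "(\<Oplus>k\<in>I. g k) = ([q] \<cdot> \<one>) \<otimes> (a \<otimes> b \<otimes> s)"
    unfolding I_def by auto
  have set: "{..q} = insert 0 (insert q I)" using q1 unfolding I_def by auto
  have "0 \<notin> insert q I" "q \<notin> I" "finite I" using q1 unfolding I_def by auto
  have gc: "g k \<in> carrier R" for k using g[of "{k}"] by simp
  have "(a \<oplus> b) [^] q = (\<Oplus>k\<in>insert 0 (insert q I). g k)"
    using binomial[OF a(1) b(1), of q] unfolding set g_def .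
  also have "\<dots> = g 0 \<oplus> (g q \<oplus> (\<Oplus>k\<in>I. g k))"
    using finsum_insert[of "insert q I" 0 g] finsum_insert[of I q g] g gc \<open>0 \<notin> insert q I\<close> \<open>q \<notin> I\<close> \<open>finite I\<close> by simp
  finally have "(a \<oplus> b) [^] q = g 0 \<oplus> (g q \<oplus> (\<Oplus>k\<in>I. g k))" .
  moreover have "g 0 = b [^] q" "g q = a [^] q" unfolding g_def using a b by auto
  ultimately have "(a \<oplus> b) [^] q = a [^] q \<oplus> b [^] q \<oplus> (\<Oplus>k\<in>I. g k)"
    using a b s by (simp add: a_ac)
  then show ?thesis using s by auto
qed

text \<open>Two orders at once: integrality of \<open>g\<close> gives the crude estimate for a
  general exponent, and \<open>g = m + t h\<close> gives the leading coefficient where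
  \<open>m\<close> matters.\<close>

lemma one_plus_power:
  assumes t: "t \<in> carrier R" "0 \<le> v t"
  shows "\<exists>g \<in> carrier R. \<exists>h \<in> carrier R. 0 \<le> v g \<and> 0 \<le> v h \<and> (\<one> \<oplus> t) [^] (m::nat) = \<one> \<oplus> t \<otimes> g \<and> g = [m] \<cdot> \<one> \<oplus> t \<otimes> h"
proof (induction m)
  case 0
  show ?case using t by (intro bexI[of _ \<zero>]) auto
next
  case (Suc m)
  then obtain g h where gh: "g \<in> carrier R" "h \<in> carrier R" "0 \<le> v g" "0 \<le> v h"
    "(\<one> \<oplus> t) [^] m = \<one> \<oplus> t \<otimes> g" "g = [m] \<cdot> \<one> \<oplus> t \<otimes> h" by blast
  let ?g = "g \<oplus> \<one> \<oplus> t \<otimes> g" and ?h = "h \<oplus> g"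
  have "(\<one> \<oplus> t) [^] Suc m = \<one> \<oplus> t \<otimes> ?g"
    using gh(1,5) t by (simp add: ring_ac_distr)
  moreover have "?g = [Suc m] \<cdot> \<one> \<oplus> t \<otimes> ?h"
  proof -
    have "[m] \<cdot> \<one> \<oplus> t \<otimes> h \<oplus> \<one> \<oplus> t \<otimes> g = [Suc m] \<cdot> \<one> \<oplus> t \<otimes> ?h"
      using gh(1,2) t by (simp add: ring_ac_distr)
    then show ?thesis using gh(6) by simp
  qed
  moreover have "?g \<in> carrier R" "?h \<in> carrier R" "0 \<le> v ?g" "0 \<le> v ?h"
    using gh t v_nonneg_closed by auto
  ultimately show ?case by blast
qed

text \<open>Congruence modulo \<open>y\<close> times the elements of valuation at least \<open>c\<close>; keeping the factor \<open>y\<close> in the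
  error terms makes the estimates usable both for unit and for small \<open>y\<close>.\<close>

definition near :: "'a \<Rightarrow> real \<Rightarrow> 'a \<Rightarrow> 'a \<Rightarrow> bool" where
  "near y c a b \<longleftrightarrow> (\<exists>e \<in> carrier R. ereal c \<le> v e \<and> a = b \<oplus> y \<otimes> e)"

lemma near_refl: "b \<in> carrier R \<Longrightarrow> y \<in> carrier R \<Longrightarrow> near y c b b"
  unfolding near_def by (intro bexI[of _ \<zero>]) auto

lemma near_add:
  assumes "near y c a b" "near y c a' b'" "y \<in> carrier R" "b \<in> carrier R" "b' \<in> carrier R"
  shows "near y c (a \<oplus> a') (b \<oplus> b')"
proof -
  obtain e e' where e: "e \<in> carrier R" "ereal c \<le> v e" "a = b \<oplus> y \<otimes> e"
    and e': "e' \<in> carrier R" "ereal c \<le> v e'" "a' = b' \<oplus> y \<otimes> e'" using assms(1,2) unfolding near_def by blast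
  have "a \<oplus> a' = (b \<oplus> b') \<oplus> y \<otimes> (e \<oplus> e')" unfolding e(3) e'(3) using e(1) e'(1) assms(3-5) by (simp add: ring_ac_distr)
  then show ?thesis unfolding near_def using v_add_ge[OF e(1) e'(1) e(2) e'(2)] e(1) e'(1) by blast
qed

lemma near_finsum_zero:
  assumes "finite S" "g \<in> S \<rightarrow> carrier R" "\<And>s. s \<in> S \<Longrightarrow> near y c (g s) \<zero>" "y \<in> carrier R"
  shows "near y c (\<Oplus>s\<in>S. g s) \<zero>"
  using assms
proof (induction S)
  case (insert a S)
  have g: "g \<in> S \<rightarrow> carrier R" "g a \<in> carrier R" using insert.prems by auto
  have "near y c (\<Oplus>s\<in>S. g s) \<zero>" using insert.IH[OF g(1)] insert.prems by blast
  then have "near y c (g a \<oplus> (\<Oplus>s\<in>S. g s)) (\<zero> \<oplus> \<zero>)"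
    using near_add[of y c "g a" \<zero>] insert.prems by simp
  then show ?case using finsum_insert[OF insert.hyps g] by simp
qed (simp add: near_refl)

end

lemma (in cring) eval_finsum:
  assumes "set q \<subseteq> carrier R" "x \<in> carrier R"
  shows "eval q x = (\<Oplus>i\<in>{..<length q}. q ! i \<otimes> x [^] (length q - 1 - i))"
  using assms(1)
proof (induction q rule: rev_induct)
  case Nil
  then show ?case by simp
next
  case (snoc b q)
  let ?g = "\<lambda>i. (q @ [b]) ! i \<otimes> x [^] (length (q @ [b]) - 1 - i)"
  have qi: "q ! i \<in> carrier R" if "i < length q" for i using that snoc.prems nth_mem by fastforce
  have b: "b \<in> carrier R" and qs: "set q \<subseteq> carrier R" using snoc.prems by auto
  have cl: "(\<lambda>i. q ! i \<otimes> x [^] (length q - 1 - i)) \<in> {..<length q} \<rightarrow> carrier R"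
    using qi assms(2) by auto
  have "eval (q @ [b]) x = eval q x \<otimes> x \<oplus> b" using eval_append_aux[OF qs b assms(2)] .
  also have "eval q x \<otimes> x = (\<Oplus>i\<in>{..<length q}. (q ! i \<otimes> x [^] (length q - 1 - i)) \<otimes> x)"
    using snoc.IH[OF qs] finsum_ldistr[OF _ assms(2) cl] by simp
  also have "\<dots> = (\<Oplus>i\<in>{..<length q}. ?g i)"
  proof (rule finsum_cong')
    fix i assume i: "i \<in> {..<length q}"
    then have "length q - i = Suc (length q - 1 - i)" by auto
    then show "(q ! i \<otimes> x [^] (length q - 1 - i)) \<otimes> x = ?g i"
      using i qi assms(2) by (simp add: nth_append m_assoc)
  qed (use qi assms(2) in \<open>auto simp: nth_append\<close>)
  also have "(\<Oplus>i\<in>{..<length q}. ?g i) \<oplus> b = (\<Oplus>i\<in>insert (length q) {..<length q}. ?g i)"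
    using finsum_insert[of "{..<length q}" "length q" ?g] qi b assms(2) a_comm[of b]
    by (auto simp: nth_append Pi_def intro!: a_comm finsum_closed)
  also have "insert (length q) {..<length q} = {..<length (q @ [b])}" by auto
  finally show ?case .
qed

section \<open>Valuation estimates for the roots of the Eisenstein polynomial\<close>

locale eisenstein_case = padic_closure +
  fixes K :: "'a set" and f :: "'a list"
  assumes unram: "unramified v Qp K"
    and f_mem: "set f \<subseteq> K" and f_len: "length f = p\<^sup>2 + 1" and f_eis: "eisenstein v f"
    and f_p: "1 \<le> v (f ! p)"
    and f_pi: "i \<in> coprime_range p 2 (p - 1) \<Longrightarrow> 2 \<le> v (f ! (p * i))"
    and f_1: "v (f ! 1) = 1"
    and f_i: "i \<in> coprime_range p 2 (p\<^sup>2 - 1) \<Longrightarrow> 2 \<le> v (f ! i)"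
begin

definition N :: nat where "N = p\<^sup>2"
definition P :: 'a where "P = [p] \<cdot> \<one>"
text \<open>The indices whose coefficients have valuation at least 2; with the four exceptional
  indices \<open>0\<close>, \<open>1\<close>, \<open>p\<close>, \<open>N\<close> they exhaust
  \<open>{..N}\<close>.\<close>

definition I :: "nat set" where "I = {1..<N} - {1, p}"

lemma p_gt: "3 \<le> p" "p < N" "3 \<le> N" "N = p * p" "0 < p" "p + 1 < N" "2 * p < N" "1 < p"
proof -
  have "2 \<le> p" using prime_ge_2_nat[OF prime_p] .
  then show p3: "3 \<le> p" using odd_p by (cases "p = 2") auto
  show N: "N = p * p" unfolding N_def by (simp add: Power.power2_eq_square)
  have "3 * p \<le> N" unfolding N using p3 by (intro mult_right_mono) auto
  then show "p < N" "3 \<le> N" "0 < p" "p + 1 < N" "2 * p < N" "1 < p" using p3 by auto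
qed

lemmas KD = unramifiedD[OF unram]

lemma K_carrier: "x \<in> K \<Longrightarrow> x \<in> carrier R"
  using subfieldE(3)[OF KD(1)] by blast

lemma f_nth: assumes "i \<le> N" shows "f ! i \<in> K" "f ! i \<in> carrier R"
proof -
  show "f ! i \<in> K" using f_mem f_len nth_mem[of i f] assms unfolding N_def by auto
  then show "f ! i \<in> carrier R" by (rule K_carrier)
qed

lemma f_0: "f ! 0 = \<one>"
  using f_eis f_len unfolding eisenstein_def by (metis hd_conv_nth length_0_conv not_one_less_zero)

lemma f_N: "v (f ! N) = 1"
  using f_eis f_len unfolding eisenstein_def N_def by (metis add_diff_cancel_right' last_conv_nth length_0_conv not_one_less_zero)

lemma f_ge_1: "1 \<le> i \<Longrightarrow> i \<le> N \<Longrightarrow> 1 \<le> v (f ! i)"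
  using f_eis f_len unfolding eisenstein_def N_def by auto

text \<open>A multiple of \<open>p\<close> in \<open>I\<close> is \<open>p * j\<close> with
  \<open>2 \<le> j < p\<close>, so one of the two coefficient hypotheses always applies.\<close>

lemma f_I: assumes "i \<in> I" shows "2 \<le> v (f ! i)"
proof (cases "p dvd i")
  case True
  then obtain j where j: "i = p * j" by auto
  have "j \<noteq> 0" "j \<noteq> 1" "p * j < p * p" using assms j unfolding I_def p_gt(4) by auto
  then have "2 \<le> j" "j \<le> p - 1" by auto
  moreover have "gcd j p = 1"
    using prime_p \<open>2 \<le> j\<close> \<open>j \<le> p - 1\<close> p_gt(5) by (metis One_nat_def Suc_pred coprime_commute coprime_iff_gcd_eq_1 gcd.commute le_imp_less_Suc nat_dvd_not_less not_less_eq_eq numeral_2_eq_2 prime_imp_coprime zero_less_Suc less_le_trans)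
  ultimately show ?thesis using f_pi unfolding j coprime_range_def by auto
next
  case False
  then have "gcd i p = 1" using prime_imp_coprime[OF prime_p False] by (simp add: coprime_iff_gcd_eq_1 gcd.commute)
  moreover have "2 \<le> i" "i \<le> p\<^sup>2 - 1" using assms unfolding I_def N_def by auto
  ultimately show ?thesis using f_i unfolding coprime_range_def by auto
qed

lemma P_facts: "P \<in> carrier R" "v P = 1" "P \<noteq> \<zero>" "P \<in> K"
proof -
  show "P \<in> carrier R" "v P = 1" unfolding P_def using v_p by auto
  then show "P \<noteq> \<zero>" by auto
  show "P \<in> K" unfolding P_def using subring_nat_mult_one[OF subfieldE(1)[OF KD(1)]] .
qed

lemma f_eval:
  assumes x: "x \<in> carrier R"
  shows "eval f x = (\<Oplus>i\<in>{..N}. f ! i \<otimes> x [^] (N - i))"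
proof -
  have "set f \<subseteq> carrier R" using f_mem K_carrier by blast
  then show ?thesis using eval_finsum[of f x] x f_len unfolding N_def by (simp add: lessThan_Suc_atMost)
qed

lemma f_eval_split:
  assumes g: "\<And>i. i \<le> N \<Longrightarrow> g i \<in> carrier R"
  shows "(\<Oplus>i\<in>{..N}. g i) = g 0 \<oplus> (g 1 \<oplus> (g p \<oplus> (g N \<oplus> (\<Oplus>i\<in>I. g i))))"
proof -
  have set: "{..N} = insert 0 (insert 1 (insert p (insert N I)))" unfolding I_def using p_gt by auto
  have n: "0 \<notin> insert 1 (insert p (insert N I))" "1 \<notin> insert p (insert N I)" "p \<notin> insert N I" "N \<notin> I" "finite I"
    unfolding I_def using p_gt by auto
  have IN: "I \<subseteq> {..N}" unfolding I_def by auto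
  have gI: "g \<in> I \<rightarrow> carrier R" using g IN by auto
  have gs: "g 0 \<in> carrier R" "g 1 \<in> carrier R" "g p \<in> carrier R" "g N \<in> carrier R" using g p_gt by auto
  have gN: "g \<in> insert N I \<rightarrow> carrier R" "g \<in> insert p (insert N I) \<rightarrow> carrier R" "g \<in> insert 1 (insert p (insert N I)) \<rightarrow> carrier R"
    using gI gs by auto
  show ?thesis unfolding set
    using finsum_insert[of "insert 1 (insert p (insert N I))" 0 g] finsum_insert[of "insert p (insert N I)" 1 g]
      finsum_insert[of "insert N I" p g] finsum_insert[of I N g] n gI gN gs by simp
qed

lemma finite_I: "finite I" and I_bounds: "i \<in> I \<Longrightarrow> 1 \<le> i \<and> i < N"
  unfolding I_def by auto

text \<open>The Newton polygon of an Eisenstein polynomial is a single segment: only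
  \<open>x [^] N\<close> and \<open>f ! N\<close> can balance. The second estimate later lets
  \<open>x [^] N\<close> be replaced by \<open>\<ominus> (f ! N)\<close> in the leading term of
  \<open>key_estimate\<close>.\<close>

lemma root_val:
  assumes x: "x \<in> carrier R" "eval f x = \<zero>"
  shows "v x = ereal (1 / N)" "v (x [^] N \<oplus> f ! N) \<ge> ereal (1 + 1 / N)"
proof -
  have N0: "real N > 0" using p_gt by simp
  let ?g = "\<lambda>i. f ! i \<otimes> x [^] (N - i)"
  let ?J = "{1..<N}"
  have gc: "?g i \<in> carrier R" if "i \<le> N" for i using f_nth(2)[OF that] x by simp
  have set: "{..N} = insert 0 (insert N ?J)" using p_gt by auto
  have gJ: "?g \<in> ?J \<rightarrow> carrier R" "?g \<in> insert N ?J \<rightarrow> carrier R"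
    by (rule funcsetI, rule gc, force)+
  define S where "S = (\<Oplus>i\<in>?J. ?g i)"
  have S: "S \<in> carrier R" unfolding S_def using finsum_closed[OF gJ(1)] .
  have fN: "f ! N \<in> carrier R" using f_nth by simp
  have xN: "x [^] N \<in> carrier R" using x by simp
  have "eval f x = x [^] N \<oplus> (f ! N \<oplus> S)"
    unfolding f_eval[OF x(1)] set S_def
    using finsum_insert[of "insert N ?J" 0 ?g] finsum_insert[of ?J N ?g] gJ gc p_gt f_0 x(1) fN by simp
  then have eq: "x [^] N \<oplus> (f ! N \<oplus> S) = \<zero>" using x(2) by simp
  have x0: "x \<noteq> \<zero>"
  proof
    assume "x = \<zero>"
    have "S = \<zero>" unfolding S_def
      using \<open>x = \<zero>\<close> by (intro add.finprod_one_eqI) (auto simp: nat_pow_zero f_nth)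
    then have "f ! N = \<zero>" using eq \<open>x = \<zero>\<close> p_gt fN by (simp add: nat_pow_zero)
    then show False using f_N by simp
  qed
  obtain r where r: "v x = ereal r" using v_realE[OF x(1) x0] by blast
  have gv: "ereal (1 + (N - i) * r) \<le> v (?g i)" if "1 \<le> i" "i \<le> N" for i
    using v_mult_ge[OF f_nth(2)[OF that(2)], of "x [^] (N - i)" 1 "real (N - i) * r"] f_ge_1[OF that] v_pow_real[OF x(1) r, of "N - i"]
      x(1) that by (simp add: one_ereal_def of_nat_diff)
  have vxN: "v (x [^] N) = ereal (N * r)" using v_pow_real[OF x(1) r] .
  have "x [^] N = \<ominus> (f ! N \<oplus> S)" using eq xN fN S by (simp add: minus_equality)
  then have vS: "v (x [^] N) = v (f ! N \<oplus> S)" using fN S by simp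
  \<comment> \<open>For \<open>r \<le> 0\<close> every term with \<open>i \<ge> 1\<close> has value
    at least \<open>1 + N * r\<close>, so \<open>x [^] N\<close> alone would have the least value
    and could not cancel.\<close>
  have r0: "r > 0"
  proof (rule ccontr)
    assume "\<not> r > 0"
    then have rn: "r \<le> 0" by simp
    have b: "ereal (1 + N * r) \<le> v (?g i)" if "1 \<le> i" "i \<le> N" for i
    proof -
      have "N * r \<le> (N - i) * r" using rn that by (intro mult_right_mono_neg) auto
      then show ?thesis using gv[OF that] by (meson add_left_mono ereal_less_eq(3) order_trans)
    qed
    have "ereal (1 + N * r) \<le> v S" unfolding S_def using v_finsum_ge[OF _ gJ(1)] b by simp
    moreover have "ereal (1 + N * r) \<le> v (f ! N)" using b[of N] fN p_gt by simp
    ultimately have "ereal (1 + N * r) \<le> v (f ! N \<oplus> S)" using v_add_ge[OF fN S] by blast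
    then show False unfolding vS[symmetric] vxN by simp
  qed
  have "ereal (1 + r) \<le> v S" unfolding S_def
  proof (rule v_finsum_ge[OF _ gJ(1)])
    fix i assume i: "i \<in> ?J"
    then have "1 * r \<le> (N - i) * r" using r0 by (intro mult_right_mono) auto
    then show "ereal (1 + r) \<le> v (?g i)" using i by (intro order_trans[OF _ gv[of i]]) auto
  qed simp
  then have Sv: "ereal (1 + r) \<le> v S" .
  then have "v (f ! N) < v S" using f_N r0 by (intro less_le_trans[OF _ Sv]) (simp add: one_ereal_def)
  then have "v (x [^] N) = 1" using vS v_add_eq[OF fN S] f_N by simp
  then have "N * r = 1" using vxN by (simp add: one_ereal_def)
  then have rr: "r = 1 / N" using N0 by (simp add: field_simps)
  then show "v x = ereal (1 / N)" using r by simp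
  have "x [^] N \<oplus> f ! N = \<ominus> S" using eq xN fN S by (simp add: a_assoc[symmetric] minus_equality)
  then show "v (x [^] N \<oplus> f ! N) \<ge> ereal (1 + 1 / N)" using Sv S rr by simp
qed

text \<open>\<open>\<one> \<oplus> d\<close> is the \<open>p\<close>-th power of
  \<open>\<one> \<oplus> t\<close>; raising it to \<open>p\<close> and to \<open>p - 1\<close> gives
  the exponents \<open>N\<close> and \<open>N - p\<close>. The coefficient \<open>p - 1\<close> is
  written as \<open>-1 + p\<close>: the \<open>-1\<close> is the sign of a main term, the
  \<open>p\<close> belongs to the error.\<close>

lemma power_expansions:
  assumes t: "t \<in> carrier R" "0 \<le> v t"
  shows "\<exists>d \<in> carrier R. \<exists>s \<in> carrier R. \<exists>s' \<in> carrier R. \<exists>h \<in> carrier R. 0 \<le> v s \<and> 0 \<le> v s' \<and> 0 \<le> v h \<and>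
    d = t [^] p \<oplus> P \<otimes> (t \<otimes> s) \<and>
    (\<one> \<oplus> t) [^] N = \<one> \<oplus> (d [^] p \<oplus> P \<otimes> (d \<otimes> s')) \<and>
    (\<one> \<oplus> t) [^] (N - p) = \<one> \<oplus> d \<otimes> (\<ominus> \<one> \<oplus> (P \<oplus> d \<otimes> h))"
proof -
  have o: "\<one> \<in> carrier R" "0 \<le> v \<one>" by auto
  note Pf = P_facts(1)
  obtain s where s: "s \<in> carrier R" "0 \<le> v s" "(\<one> \<oplus> t) [^] p = \<one> [^] p \<oplus> t [^] p \<oplus> P \<otimes> (\<one> \<otimes> t \<otimes> s)"
    using freshman[OF o t prime_p] unfolding P_def by blast
  define d where "d = t [^] p \<oplus> P \<otimes> (t \<otimes> s)"
  have d: "d \<in> carrier R" "0 \<le> v d" unfolding d_def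
    using t s Pf P_facts(2) v_nonneg_closed by auto
  have e: "(\<one> \<oplus> t) [^] p = \<one> \<oplus> d" unfolding s(3) d_def using t s(1) Pf by (simp add: a_assoc)
  obtain s' where s': "s' \<in> carrier R" "0 \<le> v s'" "(\<one> \<oplus> d) [^] p = \<one> [^] p \<oplus> d [^] p \<oplus> P \<otimes> (\<one> \<otimes> d \<otimes> s')"
    using freshman[OF o d prime_p] unfolding P_def by blast
  have "(\<one> \<oplus> t) [^] N = (\<one> \<oplus> d) [^] p" unfolding p_gt(4) e[symmetric] using t by (simp add: nat_pow_pow)
  then have 1: "(\<one> \<oplus> t) [^] N = \<one> \<oplus> (d [^] p \<oplus> P \<otimes> (d \<otimes> s'))"
    unfolding s'(3) using d s'(1) Pf by (simp add: a_assoc)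
  obtain g h where gh: "g \<in> carrier R" "h \<in> carrier R" "0 \<le> v h" "(\<one> \<oplus> d) [^] (p - 1) = \<one> \<oplus> d \<otimes> g" "g = [(p - 1)] \<cdot> \<one> \<oplus> d \<otimes> h"
    using one_plus_power[OF d, of "p - 1"] by blast
  have Np: "N - p = p * (p - 1)" unfolding p_gt(4) by (simp add: algebra_simps)
  have "(\<one> \<oplus> t) [^] (N - p) = (\<one> \<oplus> d) [^] (p - 1)" unfolding Np e[symmetric] using t by (simp add: nat_pow_pow)
  moreover have "[(p - 1)] \<cdot> \<one> = \<ominus> \<one> \<oplus> P"
  proof -
    have "P = [(p - 1)] \<cdot> \<one> \<oplus> \<one>" unfolding P_def using p_gt(5) add.nat_pow_Suc[of "p - 1" \<one>] by simp
    then show ?thesis by (simp add: a_comm[of _ \<one>] r_neg1 r_neg2)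
  qed
  ultimately have 2: "(\<one> \<oplus> t) [^] (N - p) = \<one> \<oplus> d \<otimes> (\<ominus> \<one> \<oplus> (P \<oplus> d \<otimes> h))"
    using gh d Pf by (simp add: a_assoc)
  show ?thesis using 1 2 d_def d(1) s(1,2) s'(1,2) gh(2,3) by blast
qed

definition T :: "'a \<Rightarrow> 'a" where
  "T y = f ! N \<otimes> y [^] N \<oplus> (f ! p \<otimes> y [^] p \<oplus> f ! 1 \<otimes> y)"

text \<open>Subtracting the vanishing sum for \<open>x\<close> leaves in each term only the
  increment of the power of \<open>\<one> \<oplus> t\<close>, which is divisible by
  \<open>t\<close>.\<close>

lemma shifted_eval:
  assumes x: "x \<in> carrier R" "eval f x = \<zero>" and t: "t \<in> carrier R"
  shows "eval f (x \<otimes> (\<one> \<oplus> t)) = (\<Oplus>i\<in>{..N}. f ! i \<otimes> x [^] (N - i) \<otimes> ((\<one> \<oplus> t) [^] (N - i) \<ominus> \<one>))"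
proof -
  let ?u = "\<one> \<oplus> t"
  have u: "?u \<in> carrier R" using t by simp
  let ?g = "\<lambda>i. f ! i \<otimes> x [^] (N - i)" and ?h = "\<lambda>i. f ! i \<otimes> x [^] (N - i) \<otimes> (?u [^] (N - i) \<ominus> \<one>)"
  have g: "?g \<in> {..N} \<rightarrow> carrier R" and h: "?h \<in> {..N} \<rightarrow> carrier R" using f_nth(2) x u by auto
  have "eval f (x \<otimes> ?u) = (\<Oplus>i\<in>{..N}. ?g i \<oplus> ?h i)"
    unfolding f_eval[OF m_closed[OF x(1) u]]
  proof (rule finsum_cong')
    fix i assume i: "i \<in> {..N}"
    define a where "a = ?g i"
    define b where "b = ?u [^] (N - i)"
    have a: "a \<in> carrier R" "b \<in> carrier R" unfolding a_def b_def using f_nth(2)[of i] i x u by auto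
    have "f ! i \<otimes> (x \<otimes> ?u) [^] (N - i) = a \<otimes> b"
      unfolding a_def b_def using f_nth(2)[of i] i x u by (simp add: nat_pow_distrib m_assoc)
    also have "\<dots> = a \<oplus> a \<otimes> (b \<ominus> \<one>)" using a by (simp add: a_minus_def r_distr r_minus a_lcomm[of a] r_neg)
    finally show "f ! i \<otimes> (x \<otimes> ?u) [^] (N - i) = ?g i \<oplus> ?h i" unfolding a_def b_def .
  qed (use g h in auto)
  also have "\<dots> = (\<Oplus>i\<in>{..N}. ?g i) \<oplus> (\<Oplus>i\<in>{..N}. ?h i)" using finsum_addf[OF g h] .
  also have "(\<Oplus>i\<in>{..N}. ?g i) = \<zero>" using x f_eval[OF x(1)] by simp
  finally show ?thesis using finsum_closed[OF h] by simp
qed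

end

context valued_field begin

definition vge :: "real \<Rightarrow> 'a \<Rightarrow> bool" where "vge c x \<longleftrightarrow> x \<in> carrier R \<and> ereal c \<le> v x"

lemma vge_mult: "vge a x \<Longrightarrow> vge b y \<Longrightarrow> vge (a + b) (x \<otimes> y)"
  unfolding vge_def using v_mult_ge by simp

lemma vge_add: "vge a x \<Longrightarrow> vge a y \<Longrightarrow> vge a (x \<oplus> y)"
  unfolding vge_def using v_add_ge by simp

lemma vge_minus: "vge a x \<Longrightarrow> vge a (\<ominus> x)"
  unfolding vge_def by simp

lemma vge_pow: "vge a x \<Longrightarrow> vge (n * a) (x [^] (n::nat))"
  unfolding vge_def using v_pow_ge by simp

lemma vge_pow0: "vge 0 x \<Longrightarrow> vge 0 (x [^] (n::nat))"
  using vge_pow[of 0 x n] by simp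

lemma vge_mono: "vge a x \<Longrightarrow> b \<le> a \<Longrightarrow> vge b x"
  unfolding vge_def by (meson ereal_less_eq(3) order_trans)

lemma vge_carrier: "vge a x \<Longrightarrow> x \<in> carrier R"
  unfolding vge_def by simp

lemma near_vge: "near y c a b \<longleftrightarrow> (\<exists>e. vge c e \<and> a = b \<oplus> y \<otimes> e)"
  unfolding near_def vge_def by blast

end

context eisenstein_case begin

lemma vge_P: "vge 1 P" and vge_f: "1 \<le> i \<Longrightarrow> i \<le> N \<Longrightarrow> vge 1 (f ! i)" and vge_fI: "i \<in> I \<Longrightarrow> vge 2 (f ! i)"
  unfolding vge_def using P_facts f_ge_1 f_nth(2) f_I I_bounds by (auto simp: one_ereal_def less_imp_le)

lemmas p_gtN = p_gt(1-3,5-8)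

text \<open>Put \<open>t = x y\<close>. The terms of index 1 and p yield
  \<open>- x^(N-1) f_1 t\<close> and \<open>- x^(N-p) f_p t^p\<close>; the term of index 0 yields
  \<open>x^N t^N\<close>, in which one factor \<open>x^N\<close> is traded for \<open>- f_N\<close>.
  Each is \<open>- x^N\<close> times a term of \<open>T y\<close>. Index N contributes nothing, and
  the indices in \<open>I\<close> contribute only error.\<close>

lemma key_estimate:
  assumes x: "x \<in> carrier R" "eval f x = \<zero>" and y: "y \<in> carrier R" "0 \<le> v y"
  shows "near y (2 + 1 / N) (eval f (x \<otimes> (\<one> \<oplus> x \<otimes> y))) (\<ominus> (x [^] N \<otimes> T y))"
proof -
  have N0: "real N > 0" "real p > 0" "real p \<le> real N" "real N \<ge> 3" "real p \<ge> 3" using p_gt(1,2,3,5) by auto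
  have frac: "1 / N \<le> p / N" "p / N \<le> 1" "1 / N \<le> 1" "0 \<le> 1 / N" using N0 by (auto simp: field_simps)
  define t where "t = x \<otimes> y"
  let ?c = "2 + 1 / real N"
  define D where "D i = (\<one> \<oplus> t) [^] (N - i) \<ominus> \<one>" for i :: nat
  define g where "g i = f ! i \<otimes> x [^] (N - i) \<otimes> D i" for i
  have gx: "vge (1 / N) x" unfolding vge_def using x root_val(1)[OF x] by simp
  have gy: "vge 0 y" unfolding vge_def using y by (simp add: zero_ereal_def)
  have gt: "vge (1 / N) t" unfolding t_def using vge_mult[OF gx gy] by simp
  have t: "t \<in> carrier R" "0 \<le> v t" using gt frac(4) unfolding vge_def by (auto intro: order_trans[rotated] simp: zero_ereal_def)
  have xp: "vge (real n / N) (x [^] n)" for n using vge_pow[OF gx, of n] by simp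
  have xpc: "x [^] n \<in> carrier R" "y [^] n \<in> carrier R" for n :: nat using x y by auto
  have DI: "D i = z" if "(\<one> \<oplus> t) [^] (N - i) = \<one> \<oplus> z" "z \<in> carrier R" for i z
    unfolding D_def that(1) using add_minus_cancel[OF that(2), of \<one>] by simp
  have Dc: "D i \<in> carrier R" for i unfolding D_def using t by simp
  have gc: "g i \<in> carrier R" if "i \<le> N" for i unfolding g_def using f_nth(2)[OF that] xpc Dc by simp
  have ev: "eval f (x \<otimes> (\<one> \<oplus> t)) = g 0 \<oplus> (g 1 \<oplus> (g p \<oplus> (g N \<oplus> (\<Oplus>i\<in>I. g i))))"
    using shifted_eval[OF x t(1)] f_eval_split[of g, OF gc] unfolding g_def D_def by simp
  \<comment> \<open>Coefficient, power of \<open>x\<close> and increment contribute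
    \<open>2\<close>, \<open>(N - i) / N\<close> and \<open>1 / N\<close>; the first and the last
    already reach the bound.\<close>
  have nI: "near y ?c (\<Oplus>i\<in>I. g i) \<zero>"
  proof (rule near_finsum_zero[OF finite_I])
    show "g \<in> I \<rightarrow> carrier R" using gc I_bounds by (meson Pi_I less_imp_le)
    fix i assume i: "i \<in> I"
    note ib = I_bounds[OF i]
    obtain w where w: "w \<in> carrier R" "0 \<le> v w" "(\<one> \<oplus> t) [^] (N - i) = \<one> \<oplus> t \<otimes> w"
      using one_plus_power[OF t, of "N - i"] by blast
    have gw: "vge 0 w" unfolding vge_def using w by (simp add: zero_ereal_def)
    have "D i = t \<otimes> w" using DI[OF w(3)] t w by simp
    then have "g i = \<zero> \<oplus> y \<otimes> (f ! i \<otimes> (x [^] (N - i) \<otimes> (x \<otimes> w)))"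
      unfolding g_def t_def using f_nth(2)[of i] ib x y w xpc by (simp add: m_ac)
    moreover have "vge (2 + (real (N - i) / N + (1 / N + 0))) (f ! i \<otimes> (x [^] (N - i) \<otimes> (x \<otimes> w)))"
      by (intro vge_mult vge_fI[OF i] xp gx gw)
    then have "vge ?c (f ! i \<otimes> (x [^] (N - i) \<otimes> (x \<otimes> w)))" by (rule vge_mono) simp
    ultimately show "near y ?c (g i) \<zero>" unfolding near_vge by blast
  qed (use y in simp)
  have "D N = \<zero>" unfolding D_def using t by (simp add: a_minus_def r_neg)
  then have gN: "g N = \<zero>" unfolding g_def using f_nth(2)[of N] xpc by simp
  have n1: "near y ?c (g 1) (\<ominus> (x [^] N \<otimes> (f ! 1 \<otimes> y)))"
  proof -
    obtain w h where w: "w \<in> carrier R" "h \<in> carrier R" "0 \<le> v h" "(\<one> \<oplus> t) [^] (N - 1) = \<one> \<oplus> t \<otimes> w"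
      "w = [(N - 1)] \<cdot> \<one> \<oplus> t \<otimes> h"
      using one_plus_power[OF t, of "N - 1"] by blast
    \<comment> \<open>\<open>N - 1 = -1 + p^2\<close> turns the linear coefficient into the sign of
      the main term plus an error.\<close>
    define e where "e = P \<otimes> P \<oplus> t \<otimes> h"
    have gh: "vge 0 h" unfolding vge_def using w by (simp add: zero_ereal_def)
    have ge: "vge (1 / N) e" unfolding e_def
      using vge_mono[OF vge_mult[OF vge_P vge_P], of "1 / N"] vge_mult[OF gt gh] frac by (intro vge_add) auto
    have "P \<otimes> P = [N] \<cdot> \<one>" unfolding P_def p_gt(4)
      using add_pow_ldistr[of \<one> "[p] \<cdot> \<one>" p] add.nat_pow_pow[of \<one> p p] by simp
    also have "\<dots> = [(N - 1)] \<cdot> \<one> \<oplus> \<one>" using p_gtN add.nat_pow_Suc[of "N - 1" \<one>] by (simp del: add.nat_pow_Suc)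
    finally have "[(N - 1)] \<cdot> \<one> = \<ominus> \<one> \<oplus> P \<otimes> P" by (simp add: a_comm[of _ \<one>] r_neg1 r_neg2)
    then have "w = \<ominus> \<one> \<oplus> e" unfolding w(5) e_def using P_facts(1) t w(2) by (simp add: a_assoc)
    then have "D 1 = t \<otimes> (\<ominus> \<one> \<oplus> e)" using DI[OF w(4)] t w by simp
    moreover have "x [^] N = x [^] (N - 1) \<otimes> x" using p_gtN nat_pow_Suc[of x "N - 1"] by simp
    ultimately have "g 1 = \<ominus> (x [^] N \<otimes> (f ! 1 \<otimes> y)) \<oplus> y \<otimes> (f ! 1 \<otimes> (x [^] N \<otimes> e))"
      unfolding g_def t_def using f_nth(2)[of 1] p_gtN x y vge_carrier[OF ge] xpc
      by (simp add: r_distr l_minus r_minus m_ac)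
    moreover have "vge (1 + (real N / N + 1 / N)) (f ! 1 \<otimes> (x [^] N \<otimes> e))"
      using p_gtN by (intro vge_mult vge_f xp ge) auto
    ultimately show ?thesis unfolding near_vge using N0 by auto
  qed
  obtain d s s' h where ds: "d \<in> carrier R" "s \<in> carrier R" "s' \<in> carrier R" "h \<in> carrier R" "0 \<le> v s" "0 \<le> v s'" "0 \<le> v h"
    "d = t [^] p \<oplus> P \<otimes> (t \<otimes> s)" "(\<one> \<oplus> t) [^] N = \<one> \<oplus> (d [^] p \<oplus> P \<otimes> (d \<otimes> s'))"
    "(\<one> \<oplus> t) [^] (N - p) = \<one> \<oplus> d \<otimes> (\<ominus> \<one> \<oplus> (P \<oplus> d \<otimes> h))"
    using power_expansions[OF t] by blast
  have gs: "vge 0 s" "vge 0 s'" "vge 0 h" unfolding vge_def using ds by (auto simp: zero_ereal_def)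
  \<comment> \<open>\<open>d = y (A + B)\<close>, where \<open>y A = t^p\<close> is the main part
    and \<open>B\<close> carries an extra factor \<open>p\<close>. Pulling out \<open>y\<close> here
    is what makes the later errors multiples of \<open>y\<close>.\<close>
  define A where "A = x [^] p \<otimes> y [^] (p - 1)"
  define B where "B = P \<otimes> (x \<otimes> s)"
  have gA: "vge (p / N) A" unfolding A_def using vge_mult[OF xp vge_pow0[OF gy]] by simp
  have gB: "vge (1 + 1 / N) B" unfolding B_def using vge_mult[OF vge_P vge_mult[OF gx gs(1)]] by simp
  note AB = vge_carrier[OF gA] vge_carrier[OF gB]
  have yp: "y [^] p = y \<otimes> y [^] (p - 1)" using p_gtN nat_pow_Suc[of y "p - 1"] y by (simp add: m_comm)
  have yN: "y [^] N = y \<otimes> y [^] (N - 1)" using p_gtN nat_pow_Suc[of y "N - 1"] y by (simp add: m_comm)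
  have tA: "t [^] p = y \<otimes> A" unfolding t_def A_def using x y xpc by (simp add: nat_pow_distrib yp m_ac)
  have tB: "P \<otimes> (t \<otimes> s) = y \<otimes> B" unfolding t_def B_def using x y ds(2) P_facts(1) by (simp add: m_ac)
  have gq: "vge (p / N) (A \<oplus> B)" using gA vge_mono[OF gB, of "p / N"] frac by (intro vge_add) auto
  have dq: "d = y \<otimes> (A \<oplus> B)" unfolding ds(8) tA tB using y AB by (simp add: r_distr)
  have gd: "vge (p / N) d" unfolding dq using vge_mult[OF gy gq] by simp
  have np: "near y ?c (g p) (\<ominus> (x [^] N \<otimes> (f ! p \<otimes> y [^] p)))"
  proof -
    define e where "e = P \<oplus> d \<otimes> h"
    have ge: "vge (1 / N) e" unfolding e_def
      using vge_mono[OF vge_P, of "1 / N"] vge_mono[OF vge_mult[OF gd gs(3)], of "1 / N"] frac by (intro vge_add) auto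
    define Xp where "Xp = x [^] (N - p)"
    have Xp: "vge (real (N - p) / N) Xp" unfolding Xp_def by (rule xp)
    have XpN: "x [^] N = Xp \<otimes> x [^] p" unfolding Xp_def using p_gtN x nat_pow_mult[of x "N - p" p] by simp
    have fp: "vge 1 (f ! p)" using p_gtN by (intro vge_f) auto
    note c = vge_carrier[OF ge] vge_carrier[OF Xp] vge_carrier[OF fp]
    have "D p = d \<otimes> (\<ominus> \<one> \<oplus> e)" using DI[OF ds(10)] ds(1) c(1) unfolding e_def[symmetric] by simp
    then have "g p = f ! p \<otimes> Xp \<otimes> (y \<otimes> (A \<oplus> B) \<otimes> (\<ominus> \<one> \<oplus> e))" unfolding g_def Xp_def[symmetric] dq[symmetric] by simp
    also have "\<dots> = \<ominus> (f ! p \<otimes> Xp \<otimes> (y \<otimes> A)) \<oplus> y \<otimes> (\<ominus> (f ! p \<otimes> Xp \<otimes> B) \<oplus> f ! p \<otimes> Xp \<otimes> (A \<oplus> B) \<otimes> e)"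
      using c AB y by (simp add: r_distr l_distr l_minus r_minus minus_add a_ac m_ac)
    also have "f ! p \<otimes> Xp \<otimes> (y \<otimes> A) = x [^] N \<otimes> (f ! p \<otimes> y [^] p)"
      unfolding A_def XpN yp using c y x xpc by (simp add: m_ac)
    finally have 1: "g p = \<ominus> (x [^] N \<otimes> (f ! p \<otimes> y [^] p)) \<oplus> y \<otimes> (\<ominus> (f ! p \<otimes> Xp \<otimes> B) \<oplus> f ! p \<otimes> Xp \<otimes> (A \<oplus> B) \<otimes> e)" .
    have NpN: "real (N - p) / N = 1 - p / N" using p_gtN N0 by (simp add: of_nat_diff field_simps)
    have "vge (1 + real (N - p) / N + (1 + 1 / N)) (f ! p \<otimes> Xp \<otimes> B)" "vge (1 + real (N - p) / N + p / N + 1 / N) (f ! p \<otimes> Xp \<otimes> (A \<oplus> B) \<otimes> e)"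
      by (intro vge_mult fp Xp gB gq ge)+
    then have "vge ?c (\<ominus> (f ! p \<otimes> Xp \<otimes> B) \<oplus> f ! p \<otimes> Xp \<otimes> (A \<oplus> B) \<otimes> e)"
      unfolding NpN using frac by (intro vge_add vge_minus) (auto elim!: vge_mono)
    then show ?thesis using 1 unfolding near_vge by blast
  qed
  have n0: "near y ?c (g 0) (\<ominus> (x [^] N \<otimes> (f ! N \<otimes> y [^] N)))"
  proof -
    have g0A: "vge 0 (t [^] p)" using vge_mono[OF vge_mult[OF gy gA]] frac(4) unfolding tA by simp
    have g0B: "vge 0 (P \<otimes> (t \<otimes> s))" using vge_mono[OF vge_mult[OF gy gB]] frac(4) unfolding tB by simp
    \<comment> \<open>The power \<open>d^p\<close> is expanded once more, which isolates
      \<open>(t^p)^p = t^N\<close> from terms that contain \<open>p\<close>.\<close>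
    obtain s'' where s'': "s'' \<in> carrier R" "0 \<le> v s''"
      "d [^] p = (t [^] p) [^] p \<oplus> (P \<otimes> (t \<otimes> s)) [^] p \<oplus> ([p] \<cdot> \<one>) \<otimes> (t [^] p \<otimes> (P \<otimes> (t \<otimes> s)) \<otimes> s'')"
      using freshman[of "t [^] p" "P \<otimes> (t \<otimes> s)" p] g0A g0B prime_p unfolding ds(8) vge_def by (auto simp: zero_ereal_def)
    have gs'': "vge 0 s''" unfolding vge_def using s'' by (simp add: zero_ereal_def)
    define b where "b = (P \<otimes> (t \<otimes> s)) [^] (p - 1)"
    have gb: "vge 0 b" unfolding b_def by (rule vge_pow0[OF g0B])
    have pb0: "(P \<otimes> (t \<otimes> s)) [^] p = b \<otimes> (P \<otimes> (t \<otimes> s))"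
      unfolding b_def using nat_pow_Suc[of "P \<otimes> (t \<otimes> s)" "p - 1"] p_gtN by (simp del: nat_pow_Suc)
    have "b \<otimes> (P \<otimes> (t \<otimes> s)) = y \<otimes> (B \<otimes> b)"
      unfolding tB using vge_carrier[OF gb] AB y by (simp add: m_ac)
    with pb0 have pb: "(P \<otimes> (t \<otimes> s)) [^] p = y \<otimes> (B \<otimes> b)" by (rule trans)
    have tp: "(t [^] p) [^] p = x [^] N \<otimes> y [^] N" unfolding t_def p_gt(4) using x y by (simp add: nat_pow_pow nat_pow_distrib)
    define e0 where "e0 = B \<otimes> b \<oplus> P \<otimes> (A \<otimes> (P \<otimes> (t \<otimes> s)) \<otimes> s'') \<oplus> P \<otimes> ((A \<oplus> B) \<otimes> s')"
    have c: "b \<in> carrier R" "P \<otimes> (t \<otimes> s) \<in> carrier R" using gb g0B vge_carrier by auto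
    have "vge (1 + 1 / N + 0) (B \<otimes> b)" "vge (1 + (p / N + 0 + 0)) (P \<otimes> (A \<otimes> (P \<otimes> (t \<otimes> s)) \<otimes> s''))"
      "vge (1 + (p / N + 0)) (P \<otimes> ((A \<oplus> B) \<otimes> s'))"
      by (intro vge_mult gB gb vge_P gA g0B gs'' gq gs)+
    then have ge0: "vge (1 + 1 / N) e0" unfolding e0_def using frac by (intro vge_add) (auto elim!: vge_mono)
    have E: "d [^] p \<oplus> P \<otimes> (d \<otimes> s') = x [^] N \<otimes> y [^] N \<oplus> y \<otimes> e0"
    proof -
      have dp: "d [^] p = x [^] N \<otimes> y [^] N \<oplus> y \<otimes> (B \<otimes> b) \<oplus> P \<otimes> (y \<otimes> A \<otimes> (P \<otimes> (t \<otimes> s)) \<otimes> s'')"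
        using s''(3) unfolding pb tp P_def[symmetric] unfolding tA .
      have ds': "P \<otimes> (d \<otimes> s') = P \<otimes> (y \<otimes> (A \<oplus> B) \<otimes> s')" using dq by simp
      show ?thesis
        unfolding dp ds' e0_def using c y AB ds(3) s''(1) P_facts(1) xpc
        by (simp add: r_distr l_distr a_ac m_ac)
    qed
    have "D 0 = x [^] N \<otimes> y [^] N \<oplus> y \<otimes> e0" using DI[of 0] ds(9) E vge_carrier[OF ge0] y xpc by simp
    then have g0: "g 0 = x [^] N \<otimes> (x [^] N \<otimes> y [^] N) \<oplus> y \<otimes> (x [^] N \<otimes> e0)"
      unfolding g_def f_0 using vge_carrier[OF ge0] y xpc by (simp add: r_distr m_ac)
    \<comment> \<open>The relation \<open>x^N = - f_N + e1\<close> converts one factor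
      \<open>x^N\<close> into the top coefficient of \<open>T\<close>.\<close>
    define e1 where "e1 = x [^] N \<oplus> f ! N"
    have ge1: "vge (1 + 1 / N) e1" unfolding vge_def e1_def using root_val(2)[OF x] f_nth(2)[of N] xpc by simp
    have fN: "f ! N \<in> carrier R" using f_nth by simp
    have xN: "x [^] N = \<ominus> (f ! N) \<oplus> e1" unfolding e1_def using fN xpc a_comm[of "x [^] N"] by (simp add: r_neg1)
    have xNy: "x [^] N \<otimes> y [^] N = \<ominus> (f ! N \<otimes> y [^] N) \<oplus> y \<otimes> (e1 \<otimes> y [^] (N - 1))"
    proof -
      have "x [^] N \<otimes> y [^] N = (\<ominus> (f ! N) \<oplus> e1) \<otimes> y [^] N" using xN by simp
      also have "\<dots> = \<ominus> (f ! N \<otimes> y [^] N) \<oplus> y \<otimes> (e1 \<otimes> y [^] (N - 1))"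
        unfolding yN using fN vge_carrier[OF ge1] xpc y by (simp add: l_distr r_distr l_minus r_minus m_ac)
      finally show ?thesis .
    qed
    have "g 0 = \<ominus> (x [^] N \<otimes> (f ! N \<otimes> y [^] N)) \<oplus> y \<otimes> (x [^] N \<otimes> (e1 \<otimes> y [^] (N - 1)) \<oplus> x [^] N \<otimes> e0)"
      unfolding g0 xNy using fN vge_carrier[OF ge1] vge_carrier[OF ge0] xpc y by (simp add: r_distr r_minus a_ac m_ac)
    moreover have "vge (real N / N + (1 + 1 / N + 0)) (x [^] N \<otimes> (e1 \<otimes> y [^] (N - 1)))"
      "vge (real N / N + (1 + 1 / N)) (x [^] N \<otimes> e0)"
      by (intro vge_mult xp ge1 ge0 vge_pow0[OF gy])+
    then have "vge ?c (x [^] N \<otimes> (e1 \<otimes> y [^] (N - 1)) \<oplus> x [^] N \<otimes> e0)"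
      using N0 by (intro vge_add) (auto elim!: vge_mono)
    ultimately show ?thesis unfolding near_vge by blast
  qed
  have fc: "f ! N \<in> carrier R" "f ! p \<in> carrier R" "f ! 1 \<in> carrier R" using f_nth p_gtN by auto
  have "near y ?c (eval f (x \<otimes> (\<one> \<oplus> t)))
    (\<ominus> (x [^] N \<otimes> (f ! N \<otimes> y [^] N)) \<oplus> (\<ominus> (x [^] N \<otimes> (f ! 1 \<otimes> y)) \<oplus> (\<ominus> (x [^] N \<otimes> (f ! p \<otimes> y [^] p)) \<oplus> (\<zero> \<oplus> \<zero>))))"
    unfolding ev gN
    by (intro near_add n0 n1 np nI near_refl) (use fc xpc y in auto)
  moreover have "\<ominus> (x [^] N \<otimes> (f ! N \<otimes> y [^] N)) \<oplus> (\<ominus> (x [^] N \<otimes> (f ! 1 \<otimes> y)) \<oplus> (\<ominus> (x [^] N \<otimes> (f ! p \<otimes> y [^] p)) \<oplus> (\<zero> \<oplus> \<zero>)))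
    = \<ominus> (x [^] N \<otimes> T y)"
    unfolding T_def using fc xpc y by (simp add: r_distr minus_add a_ac)
  ultimately show ?thesis unfolding t_def by simp
qed

text \<open>If \<open>\<tau> = v t\<close> were below \<open>1 / N\<close>, the increment of the
  term of index 0 would have value exactly \<open>1 + N \<tau>\<close> and everything else a
  strictly larger one, so the sum could not vanish.\<close>

lemma root_diff_ge:
  assumes x: "x \<in> carrier R" "eval f x = \<zero>" and z: "z \<in> carrier R" "eval f z = \<zero>"
  shows "\<exists>t. vge (1 / N) t \<and> z = x \<otimes> (\<one> \<oplus> t)"
proof -
  have N0: "real N > 0" "real p > 0" "real p \<le> real N" "real N \<ge> 3" "real p \<ge> 3" "real p < real N" using p_gt(1,2,3,5) by auto
  note vx = root_val(1)[OF x] and vz = root_val(1)[OF z]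
  have x0: "x \<noteq> \<zero>" using vx by auto
  note ix = v_inv[OF x(1) x0]
  define t where "t = z \<otimes> inv x \<ominus> \<one>"
  have zi: "z \<otimes> inv x \<in> carrier R" "v (z \<otimes> inv x) = 0" using z ix v_mult vx vz by auto
  have t: "t \<in> carrier R" "0 \<le> v t" unfolding t_def using zi v_diff_ge[of "z \<otimes> inv x" \<one> 0] by auto
  have ut: "\<one> \<oplus> t = z \<otimes> inv x" unfolding t_def using zi by (simp add: a_minus_def a_lcomm[of \<one>] r_neg)
  have zt: "z = x \<otimes> (\<one> \<oplus> t)" unfolding ut using x(1) z(1) ix x0 field_Units by (simp add: m_lcomm[of x])
  have "ereal (1 / N) \<le> v t"
  proof (rule ccontr)
    assume "\<not> ?thesis"
    then have lt: "v t < ereal (1 / N)" by simp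
    then have "t \<noteq> \<zero>" by auto
    then obtain \<tau> where tau: "v t = ereal \<tau>" using v_realE t(1) by blast
    have tau0: "0 \<le> \<tau>" "\<tau> < 1 / N" using t(2) lt tau by (auto simp: zero_ereal_def)
    have Ntau: "N * \<tau> < 1" "p * \<tau> < 1"
    proof -
      show "N * \<tau> < 1" using tau0(2) N0 by (simp add: field_simps)
      moreover have "p * \<tau> \<le> N * \<tau>" using tau0(1) N0 by (intro mult_right_mono) auto
      ultimately show "p * \<tau> < 1" by simp
    qed
    let ?c = "ereal (1 + N * \<tau>)"
    define D where "D i = (\<one> \<oplus> t) [^] (N - i) \<ominus> \<one>" for i :: nat
    define g where "g i = f ! i \<otimes> x [^] (N - i) \<otimes> D i" for i
    have gx: "vge (1 / N) x" unfolding vge_def using x vx by simp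
    have gt: "vge \<tau> t" unfolding vge_def using t tau by simp
    have xp: "vge (real n / N) (x [^] n)" for n using vge_pow[OF gx, of n] by simp
    have xpc: "x [^] n \<in> carrier R" for n :: nat using x by auto
    have DI: "D i = w" if "(\<one> \<oplus> t) [^] (N - i) = \<one> \<oplus> w" "w \<in> carrier R" for i w
      unfolding D_def that(1) using add_minus_cancel[OF that(2), of \<one>] by simp
    have Dc: "D i \<in> carrier R" for i unfolding D_def using t by simp
    have gc: "g i \<in> carrier R" if "i \<le> N" for i unfolding g_def using f_nth(2)[OF that] xpc Dc by simp
    have gI: "g \<in> I \<rightarrow> carrier R" using gc I_bounds by (meson Pi_I less_imp_le)
    have ev: "g 0 \<oplus> (g 1 \<oplus> (g p \<oplus> (g N \<oplus> (\<Oplus>i\<in>I. g i)))) = \<zero>"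
    proof -
      have "eval f z = (\<Oplus>i\<in>{..N}. g i)"
        using shifted_eval[OF x t(1)] unfolding zt[symmetric] g_def D_def .
      then show ?thesis using f_eval_split[of g, OF gc] z(2) by simp
    qed
    have Dt: "vge \<tau> (D i)" for i
    proof -
      obtain w where w: "w \<in> carrier R" "0 \<le> v w" "(\<one> \<oplus> t) [^] (N - i) = \<one> \<oplus> t \<otimes> w"
        using one_plus_power[OF t, of "N - i"] by blast
      have "vge 0 w" unfolding vge_def using w by (simp add: zero_ereal_def)
      then show ?thesis using DI[OF w(3)] t w vge_mult[OF gt, of 0 w] by simp
    qed
    have strict: "?c < v u" if "vge b u" "1 + N * \<tau> < b" for b u
      using that unfolding vge_def by (auto intro: less_le_trans[of _ "ereal b"])
    have 1: "?c < v (g 1)"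
    proof (rule strict)
      show "vge (1 + real (N - 1) / N + \<tau>) (g 1)" unfolding g_def
        using p_gt(3) by (intro vge_mult vge_f xp Dt) auto
      have "N * \<tau> - \<tau> < (real N - 1) / N"
        using mult_strict_left_mono[OF tau0(2), of "real N - 1"] N0 by (simp add: algebra_simps)
      then show "1 + N * \<tau> < 1 + real (N - 1) / N + \<tau>" using N0 by (simp add: of_nat_diff)
    qed
    obtain d s s' h where ds: "d \<in> carrier R" "s \<in> carrier R" "s' \<in> carrier R" "h \<in> carrier R" "0 \<le> v s" "0 \<le> v s'" "0 \<le> v h"
      "d = t [^] p \<oplus> P \<otimes> (t \<otimes> s)" "(\<one> \<oplus> t) [^] N = \<one> \<oplus> (d [^] p \<oplus> P \<otimes> (d \<otimes> s'))"
      "(\<one> \<oplus> t) [^] (N - p) = \<one> \<oplus> d \<otimes> (\<ominus> \<one> \<oplus> (P \<oplus> d \<otimes> h))"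
      using power_expansions[OF t] by blast
    have gs: "vge 0 s" "vge 0 s'" "vge 0 h" "vge 0 \<one>" "vge 0 P" unfolding vge_def using ds P_facts by (auto simp: zero_ereal_def)
    have vtp: "v (t [^] p) = ereal (p * \<tau>)" using v_pow_real[OF t(1) tau] .
    have "vge 1 (P \<otimes> (t \<otimes> s))" using vge_mono[OF vge_mult[OF vge_P vge_mult[OF gt gs(1)]], of 1] tau0 by simp
    then have "v (t [^] p) < v (P \<otimes> (t \<otimes> s))" unfolding vtp vge_def using Ntau(2)
      by (auto intro: less_le_trans[of _ "ereal 1"])
    then have vd: "v d = ereal (p * \<tau>)" unfolding ds(8) using v_add_eq[of "t [^] p" "P \<otimes> (t \<otimes> s)"] t ds(2) P_facts(1) vtp by simp
    then have gd: "vge (p * \<tau>) d" unfolding vge_def using ds(1) by simp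
    have vdp: "v (d [^] p) = ereal (N * \<tau>)" using v_pow_real[OF ds(1) vd, of p] unfolding p_gt(4) by (simp add: mult.assoc)
    have gdh: "vge 0 (d \<otimes> h)" using vge_mono[OF vge_mult[OF gd gs(3)], of 0] tau0 by simp
    have "vge 1 (P \<otimes> (d \<otimes> s'))" using vge_mono[OF vge_mult[OF vge_P vge_mult[OF gd gs(2)]], of 1] tau0 by simp
    then have "v (d [^] p) < v (P \<otimes> (d \<otimes> s'))" unfolding vdp vge_def using Ntau(1)
      by (auto intro: less_le_trans[of _ "ereal 1"])
    then have vD0: "v (d [^] p \<oplus> P \<otimes> (d \<otimes> s')) = ereal (N * \<tau>)"
      using v_add_eq[of "d [^] p" "P \<otimes> (d \<otimes> s')"] ds P_facts(1) vdp by simp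
    have D0: "D 0 = d [^] p \<oplus> P \<otimes> (d \<otimes> s')" using DI[of 0] ds P_facts(1) by simp
    have vg0: "v (g 0) = ?c"
    proof -
      have "v (x [^] N) = ereal 1" using v_pow_real[OF x(1) vx, of N] N0 by simp
      then show ?thesis unfolding g_def f_0 using v_mult[of "x [^] N" "D 0"] Dc[of 0] xpc[of N] vD0 D0 by simp
    qed
    have 2: "?c < v (g p)"
    proof (rule strict)
      have "D p = d \<otimes> (\<ominus> \<one> \<oplus> (P \<oplus> d \<otimes> h))" using DI[OF ds(10)] ds P_facts(1) by simp
      moreover have "vge (p * \<tau> + 0) (d \<otimes> (\<ominus> \<one> \<oplus> (P \<oplus> d \<otimes> h)))"
        by (intro vge_mult gd vge_add vge_minus gs gdh)
      ultimately have "vge (p * \<tau>) (D p)" by simp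
      then show "vge (1 + real (N - p) / N + p * \<tau>) (g p)" unfolding g_def
        using p_gt(1,2) by (intro vge_mult vge_f xp) auto
      have "N * \<tau> - p * \<tau> < (real N - p) / N"
        using mult_strict_left_mono[OF tau0(2), of "real N - p"] N0 by (simp add: algebra_simps diff_divide_distrib)
      then show "1 + N * \<tau> < 1 + real (N - p) / N + p * \<tau>" using N0 by (simp add: of_nat_diff)
    qed
    have "D N = \<zero>" unfolding D_def using t by (simp add: a_minus_def r_neg)
    then have gN: "g N = \<zero>" unfolding g_def using f_nth(2)[of N] xpc by simp
    have 3: "vge 2 (\<Oplus>i\<in>I. g i)"
      unfolding vge_def
    proof (intro conjI v_finsum_ge[OF finite_I gI] finsum_closed[OF gI])
      fix i assume i: "i \<in> I"
      have "vge (2 + real (N - i) / N + \<tau>) (g i)" unfolding g_def by (intro vge_mult vge_fI[OF i] xp Dt)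
      then have "vge 2 (g i)" by (rule vge_mono) (use tau0 in simp)
      then show "ereal 2 \<le> v (g i)" unfolding vge_def by simp
    qed
    have 4: "?c < v (\<Oplus>i\<in>I. g i)" using strict[OF 3] Ntau by simp
    have rest: "?c < v (g 1 \<oplus> (g p \<oplus> (g N \<oplus> (\<Oplus>i\<in>I. g i))))"
      unfolding gN using 1 2 4 gc p_gt(1,2,3) vge_carrier[OF 3] by (intro v_add_gt) auto
    have c: "g 0 \<in> carrier R" "g 1 \<oplus> (g p \<oplus> (g N \<oplus> (\<Oplus>i\<in>I. g i))) \<in> carrier R"
      using gc p_gt(1,2,3) vge_carrier[OF 3] by auto
    have "v \<zero> = ?c" using v_add_eq[OF c] rest ev vg0 by simp
    then show False by simp
  qed
  then show ?thesis unfolding vge_def using t(1) zt by blast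
qed

text \<open>The factor \<open>y\<close> in the error gives
  \<open>v (T y) \<ge> 1 + 1/N + v y\<close>. If \<open>v y\<close> were positive and finite, the
  linear term would dominate and \<open>v (T y) = 1 + v y\<close>, a contradiction; so distinct
  roots have \<open>v y = 0\<close>.\<close>

lemma root_shift:
  assumes x: "x \<in> carrier R" "eval f x = \<zero>" and z: "z \<in> carrier R" "eval f z = \<zero>"
  shows "\<exists>y. vge 0 y \<and> z = x \<otimes> (\<one> \<oplus> x \<otimes> y) \<and> z \<ominus> x = x [^] (2::nat) \<otimes> y \<and> ereal (1 + 1 / N) + v y \<le> v (T y)
    \<and> (z \<noteq> x \<longrightarrow> v y = 0)"
proof -
  have N0: "real N > 0" "real p > 0" "real p \<le> real N" "real N \<ge> 3" "real p \<ge> 3" using p_gt(1,2,3,5) by auto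
  note vx = root_val(1)[OF x]
  have x0: "x \<noteq> \<zero>" using vx by auto
  note ix = v_inv[OF x(1) x0]
  obtain t where t: "vge (1 / N) t" "z = x \<otimes> (\<one> \<oplus> t)" using root_diff_ge[OF x z] by blast
  note tR = vge_carrier[OF t(1)]
  define y where "y = inv x \<otimes> t"
  have yR: "y \<in> carrier R" unfolding y_def using ix tR by simp
  have "vge (- 1 / N) (inv x)" unfolding vge_def using ix vx by simp
  then have gy: "vge 0 y" unfolding y_def using vge_mult[OF _ t(1), of "- 1 / N" "inv x"] by simp
  have xy: "x \<otimes> y = t" unfolding y_def using x(1) x0 ix tR field_Units by (simp add: m_assoc[symmetric])
  have z1: "z = x \<otimes> (\<one> \<oplus> x \<otimes> y)" unfolding xy by (rule t(2))
  have zx: "z \<ominus> x = x [^] (2::nat) \<otimes> y"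
  proof -
    have "z = x \<oplus> x [^] (2::nat) \<otimes> y" unfolding z1 using x(1) yR by (simp add: r_distr numeral_2_eq_2 m_ac)
    then show ?thesis using add_minus_cancel[of "x [^] (2::nat) \<otimes> y" x] x(1) yR by simp
  qed
  have "near y (2 + 1 / N) (eval f z) (\<ominus> (x [^] N \<otimes> T y))"
    using key_estimate[OF x yR] gy unfolding z1[symmetric] vge_def by (simp add: zero_ereal_def)
  then obtain e where e: "vge (2 + 1 / N) e" "\<zero> = \<ominus> (x [^] N \<otimes> T y) \<oplus> y \<otimes> e" unfolding near_vge z(2) by blast
  have f: "f ! N \<in> carrier R" "f ! p \<in> carrier R" "f ! 1 \<in> carrier R" using f_nth p_gt(2,3) by auto
  have TR: "T y \<in> carrier R" unfolding T_def using f yR by simp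
  have xN: "x [^] N \<in> carrier R" "v (x [^] N) = 1" using x(1) v_pow_real[OF x(1) vx, of N] N0 by (auto simp: one_ereal_def)
  have "x [^] N \<otimes> T y = y \<otimes> e"
    using minus_equality[of "y \<otimes> e" "\<ominus> (x [^] N \<otimes> T y)"] e(2) xN(1) TR yR vge_carrier[OF e(1)]
      a_comm[of "\<ominus> (x [^] N \<otimes> T y)" "y \<otimes> e"] by simp
  then have "1 + v (T y) = v y + v e" using v_mult[OF xN(1) TR] v_mult[OF yR vge_carrier[OF e(1)]] xN(2) by simp
  moreover have "ereal (2 + 1 / N) \<le> v e" using e(1) unfolding vge_def by simp
  ultimately have vT: "ereal (1 + 1 / N) + v y \<le> v (T y)"
    using v_not_minf[OF yR] v_not_minf[OF TR] v_not_minf[OF vge_carrier[OF e(1)]]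
    by (cases "v y"; cases "v (T y)"; cases "v e") (auto simp: one_ereal_def)
  have "v y = 0" if zx': "z \<noteq> x"
  proof (rule ccontr)
    assume n: "v y \<noteq> 0"
    have "y \<noteq> \<zero>" using zx zx' x(1) z(1) by auto
    then obtain r where r: "v y = ereal r" using v_realE yR by blast
    have r0: "r > 0" using gy n r unfolding vge_def by (auto simp: zero_ereal_def)
    have "vge (1 + N * r) (f ! N \<otimes> y [^] N)" "vge (1 + p * r) (f ! p \<otimes> y [^] p)"
      using r yR p_gt(2,3,5) by (intro vge_mult vge_f vge_pow; simp add: vge_def)+
    moreover have "1 + r < 1 + N * r" "1 + r < 1 + p * r" using r0 N0 by (simp_all add: mult_less_cancel_right1)
    ultimately have "ereal (1 + r) < v (f ! N \<otimes> y [^] N)" "ereal (1 + r) < v (f ! p \<otimes> y [^] p)"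
      unfolding vge_def by (auto intro: less_le_trans[of _ "ereal (1 + N * r)"] less_le_trans[of _ "ereal (1 + p * r)"])
    moreover have v1: "v (f ! 1 \<otimes> y) = ereal (1 + r)" using v_mult[OF f(3) yR] f_1 r by (simp add: one_ereal_def)
    ultimately have "v (f ! p \<otimes> y [^] p \<oplus> f ! 1 \<otimes> y) = ereal (1 + r)" "ereal (1 + r) < v (f ! N \<otimes> y [^] N)"
      using v_add_eq[of "f ! 1 \<otimes> y" "f ! p \<otimes> y [^] p"] f yR a_comm[of "f ! p \<otimes> y [^] p" "f ! 1 \<otimes> y"] by auto
    then have "v (T y) = ereal (1 + r)" unfolding T_def
      using v_add_eq[of "f ! p \<otimes> y [^] p \<oplus> f ! 1 \<otimes> y" "f ! N \<otimes> y [^] N"] f yR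
        a_comm[of "f ! N \<otimes> y [^] N" "f ! p \<otimes> y [^] p \<oplus> f ! 1 \<otimes> y"] by auto
    then show False using vT r N0 by simp
  qed
  then show ?thesis using gy z1 zx vT by blast
qed

end

section \<open>Additive polynomials in characteristic \<open>p\<close>\<close>

locale frobenius_field = field k for k (structure) +
  fixes p :: nat
  assumes p_prime: "Factorial_Ring.prime p" and char_p: "[p] \<cdot> \<one> = \<zero>"
    and frob_add: "x \<in> carrier k \<Longrightarrow> y \<in> carrier k \<Longrightarrow> (x \<oplus> y) [^] p = x [^] p \<oplus> y [^] p"
begin

text \<open>The prime field, described as the fixed points of Frobenius so that membership is a
  single equation; \<open>Fp_eq\<close> recovers the multiples of \<open>\<one>\<close>.\<close>

definition Fp :: "'a set" where "Fp = {x \<in> carrier k. x [^] p = x}"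

lemma p_pos: "0 < p" "1 < p" using prime_gt_1_nat[OF p_prime] by auto

lemma frob_zero: "\<zero> [^] p = \<zero>" using p_pos by (simp add: nat_pow_zero)

lemma frob_a_inv: assumes x: "x \<in> carrier k" shows "(\<ominus> x) [^] p = \<ominus> (x [^] p)"
proof -
  have "(\<ominus> x) [^] p \<oplus> x [^] p = \<zero>" using frob_add[of "\<ominus> x" x] x frob_zero by (simp add: l_neg)
  then show ?thesis using minus_equality[of "(\<ominus> x) [^] p" "x [^] p"] x by simp
qed

lemma Fp_closed:
  "\<zero> \<in> Fp" "\<one> \<in> Fp" "x \<in> Fp \<Longrightarrow> y \<in> Fp \<Longrightarrow> x \<oplus> y \<in> Fp" "x \<in> Fp \<Longrightarrow> y \<in> Fp \<Longrightarrow> x \<otimes> y \<in> Fp"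
  "x \<in> Fp \<Longrightarrow> \<ominus> x \<in> Fp" "Fp \<subseteq> carrier k" "x \<in> Fp \<Longrightarrow> [(n::nat)] \<cdot> x \<in> Fp"
proof -
  show z: "\<zero> \<in> Fp" "\<one> \<in> Fp" "Fp \<subseteq> carrier k" unfolding Fp_def using frob_zero by auto
  show a: "x \<oplus> y \<in> Fp" if "x \<in> Fp" "y \<in> Fp" for x y using that frob_add unfolding Fp_def by simp
  show "x \<in> Fp \<Longrightarrow> y \<in> Fp \<Longrightarrow> x \<otimes> y \<in> Fp" unfolding Fp_def by (simp add: nat_pow_distrib)
  show "x \<in> Fp \<Longrightarrow> \<ominus> x \<in> Fp" unfolding Fp_def using frob_a_inv by simp
  show "[n] \<cdot> x \<in> Fp" if "x \<in> Fp" using that a z(1) by (induction n) auto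
qed

lemma Fp_inv: assumes "x \<in> Fp" "x \<noteq> \<zero>" shows "inv x \<in> Fp" "inv x \<in> carrier k" "x \<otimes> inv x = \<one>"
proof -
  have U: "x \<in> Units k" using assms field_Units unfolding Fp_def by auto
  show i: "inv x \<in> carrier k" "x \<otimes> inv x = \<one>" using U by auto
  have x: "x \<in> carrier k" "x [^] p = x" using assms unfolding Fp_def by auto
  have "x \<otimes> inv x [^] p = (x \<otimes> inv x) [^] p" using x i(1) by (simp add: nat_pow_distrib)
  then have "x \<otimes> inv x [^] p = \<one>" using i by simp
  then have "inv x [^] p = inv x" using comm_inv_char[of x "inv x [^] p"] x i by simp
  then show "inv x \<in> Fp" unfolding Fp_def using i by simp
qed

lemma nat_mult_eq_zero: "0 < n \<Longrightarrow> n < p \<Longrightarrow> [(n::nat)] \<cdot> \<one> \<noteq> \<zero>"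
proof
  assume n: "0 < n" "n < p" and z: "[n] \<cdot> \<one> = \<zero>"
  have "coprime n p" using n p_prime by (metis coprime_commute nat_dvd_not_less prime_imp_coprime)
  then obtain a b where ab: "a * n = b * p + 1" using bezout_nat[of n p] n by (metis coprime_iff_gcd_eq_1 less_not_refl mult.commute)
  have "[(a * n)] \<cdot> \<one> = [a] \<cdot> ([n] \<cdot> \<one>)" using add.nat_pow_pow[of \<one> a n] by (simp add: mult.commute)
  then have "[(a * n)] \<cdot> \<one> = \<zero>" using z by simp
  moreover have "[(b * p)] \<cdot> \<one> = [b] \<cdot> ([p] \<cdot> \<one>)" using add.nat_pow_pow[of \<one> b p] by (simp add: mult.commute)
  ultimately have "\<zero> = \<one>" using ab char_p by simp
  then show False using zero_not_one by simp
qed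

lemma inj_Fp: "inj_on (\<lambda>n::nat. [n] \<cdot> \<one>) {..<p}"
proof (rule linorder_inj_onI)
  fix m n :: nat assume mn: "m < n" "m \<in> {..<p}" "n \<in> {..<p}"
  show "[m] \<cdot> \<one> \<noteq> [n] \<cdot> \<one>"
  proof
    assume eq: "[m] \<cdot> \<one> = [n] \<cdot> \<one>"
    have "[n] \<cdot> \<one> = [m] \<cdot> \<one> \<oplus> [(n - m)] \<cdot> \<one>"
      using add.nat_pow_mult[of \<one> m "n - m"] mn by simp
    then have "[(n - m)] \<cdot> \<one> = \<zero>"
      using eq add.r_cancel_one[of "[m] \<cdot> \<one>" "[(n - m)] \<cdot> \<one>"] by (metis add.l_cancel_one' add.nat_pow_closed one_closed)
    then show False using nat_mult_eq_zero[of "n - m"] mn by (simp add: less_imp_diff_less)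
  qed
qed auto

text \<open>The \<open>p\<close> multiples of \<open>\<one>\<close> are distinct fixed points, and
  \<open>X^p - X\<close> has at most \<open>p\<close> roots.\<close>

lemma Fp_eq: "Fp = (\<lambda>n::nat. [n] \<cdot> \<one>) ` {..<p}" and card_Fp: "card Fp = p" and finite_Fp: "finite Fp"
proof -
  let ?F = "(\<lambda>n::nat. [n] \<cdot> \<one>) ` {..<p}"
  have sub: "?F \<subseteq> Fp" using Fp_closed(7)[OF Fp_closed(2)] by auto
  have cF: "card ?F = p" using card_image[OF inj_Fp] by simp
  let ?q = "[\<one>] @ (replicate (p - 2) \<zero> @ [\<ominus> \<one>, \<zero>])"
  have len: "length ?q = p + 1" using p_pos by simp
  have q: "?q \<in> carrier (poly_ring k)" by (auto simp: univ_poly_def polynomial_def)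
  have ev: "eval ?q x = x [^] p \<ominus> x" if x: "x \<in> carrier k" for x
  proof -
    have "eval ?q x = eval [\<one>] x \<otimes> x [^] length (replicate (p - 2) \<zero> @ [\<ominus> \<one>, \<zero>]) \<oplus> eval (replicate (p - 2) \<zero> @ [\<ominus> \<one>, \<zero>]) x"
      by (rule eval_append) (use x in auto)
    also have "eval (replicate (p - 2) \<zero> @ [\<ominus> \<one>, \<zero>]) x = eval [\<ominus> \<one>, \<zero>] x"
      by (rule eval_replicate) (use x in auto)
    also have "length (replicate (p - 2) \<zero> @ [\<ominus> \<one>, \<zero>]) = p" using p_pos by simp
    finally show ?thesis using x by (simp add: a_minus_def l_minus)
  qed
  have "x \<in> carrier k \<and> eval ?q x = \<zero>" if "x \<in> Fp" for x
    using that ev[of x] unfolding Fp_def by (simp add: a_minus_def r_neg)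
  note roots = card_roots_le_degree[OF q _ this]
  have fin: "finite Fp" using roots(1) by simp
  have "card Fp \<le> card ?F" using roots(2) len cF by simp
  then have eq: "?F = Fp" using card_seteq[OF fin sub] by blast
  show "Fp = ?F" "card Fp = p" "finite Fp" using eq cF fin by auto
qed

lemma Fp_multiples:
  assumes a: "a \<in> Fp" "a \<noteq> \<zero>" and b: "b \<in> Fp" shows "\<exists>n::nat. b = [n] \<cdot> a"
proof -
  have "b \<otimes> inv a \<in> Fp" using Fp_closed(4)[OF b Fp_inv(1)[OF a]] .
  then obtain n :: nat where n: "b \<otimes> inv a = [n] \<cdot> \<one>" using Fp_eq by auto
  have R: "a \<in> carrier k" "b \<in> carrier k" using a b Fp_closed(6) by auto
  have "b = b \<otimes> (inv a \<otimes> a)" using Fp_inv[OF a] R m_comm[of a "inv a"] by simp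
  also have "\<dots> = (b \<otimes> inv a) \<otimes> a" using Fp_inv[OF a] R by (simp add: m_assoc)
  also have "\<dots> = [n] \<cdot> a" unfolding n using add_pow_ldistr[of \<one> a n] R by simp
  finally show ?thesis by blast
qed

text \<open>\<open>Fp\<close>-linear in \<open>y\<close>, and for nonzero \<open>w\<close> its
  kernel consists of the \<open>Fp\<close>-multiples of \<open>w\<close>.\<close>

definition S :: "'a \<Rightarrow> 'a \<Rightarrow> 'a" where "S w y = y [^] p \<ominus> w [^] (p - 1) \<otimes> y"

lemma S_add:
  assumes "w \<in> carrier k" "x \<in> carrier k" "y \<in> carrier k" shows "S w (x \<oplus> y) = S w x \<oplus> S w y"
  using assms frob_add unfolding S_def by (simp add: a_minus_def r_distr minus_add a_ac)

lemma S_closed: "w \<in> carrier k \<Longrightarrow> x \<in> carrier k \<Longrightarrow> S w x \<in> carrier k"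
  unfolding S_def by simp

lemma S_a_inv:
  assumes "w \<in> carrier k" "x \<in> carrier k" shows "S w (\<ominus> x) = \<ominus> S w x"
  using assms frob_a_inv unfolding S_def by (simp add: a_minus_def r_minus minus_add)

lemma S_smult:
  assumes "w \<in> carrier k" "x \<in> carrier k" "a \<in> Fp" shows "S w (a \<otimes> x) = a \<otimes> S w x"
proof -
  have a: "a \<in> carrier k" "a [^] p = a" using assms(3) unfolding Fp_def by auto
  show ?thesis unfolding S_def a_minus_def using assms(1,2) a by (simp add: nat_pow_distrib r_distr r_minus m_lcomm)
qed

lemma Fp_if_scaled:
  assumes s: "s \<in> carrier k" and d: "d \<in> carrier k" "d \<noteq> \<zero>" and eq: "s [^] p = d [^] (p - 1) \<otimes> s"
  shows "s \<otimes> inv d \<in> Fp"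
proof -
  have U: "inv d \<in> carrier k" "d \<otimes> inv d = \<one>" using d field_Units by auto
  have e: "d [^] (p - 1) \<otimes> inv d [^] (p - 1) = \<one>" using d U nat_pow_distrib[of d "inv d" "p - 1"] by simp
  have "(s \<otimes> inv d) [^] p = s [^] p \<otimes> inv d [^] p" using s U by (simp add: nat_pow_distrib)
  also have "inv d [^] p = inv d [^] (p - 1) \<otimes> inv d" using p_pos nat_pow_Suc[of "inv d" "p - 1"] by simp
  also have "s [^] p \<otimes> (inv d [^] (p - 1) \<otimes> inv d) = (d [^] (p - 1) \<otimes> inv d [^] (p - 1)) \<otimes> (s \<otimes> inv d)"
    unfolding eq using s d U by (simp add: m_ac)
  also have "\<dots> = s \<otimes> inv d" unfolding e using s U by simp
  finally show ?thesis unfolding Fp_def using s U by simp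
qed

lemma S_zero_imp:
  assumes w: "w \<in> carrier k" "w \<noteq> \<zero>" and y: "y \<in> carrier k" and S0: "S w y = \<zero>"
  shows "y \<otimes> inv w \<in> Fp" "y = (y \<otimes> inv w) \<otimes> w"
proof -
  have "y [^] p = w [^] (p - 1) \<otimes> y" using S0 w y unfolding S_def by simp
  then show "y \<otimes> inv w \<in> Fp" using Fp_if_scaled[OF y w] by simp
  show "y = (y \<otimes> inv w) \<otimes> w" using y w field_Units by (simp add: m_assoc)
qed

text \<open>If the additive polynomial \<open>aN Y\<^sup>N + ap Y\<^sup>p + a1 Y\<close> with \<open>N = p\<^sup>2\<close> has the root \<open>w \<noteq> 0\<close>, then up to the factor
  \<open>aN\<close> it is \<open>S\<^sup>p - (a1 / (aN w\<^sup>p\<^sup>-\<^sup>1)) S\<close>.\<close>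

lemma additive_poly_roots:
  assumes a: "aN \<in> carrier k" "ap \<in> carrier k" "a1 \<in> carrier k" "aN \<noteq> \<zero>"
    and w: "w \<in> carrier k" "w \<noteq> \<zero>" "aN \<otimes> w [^] (p * p) \<oplus> (ap \<otimes> w [^] p \<oplus> a1 \<otimes> w) = \<zero>"
    and z: "z \<in> carrier k" "z \<noteq> \<zero>" "a1 = aN \<otimes> z [^] (p - 1)"
    and y: "y \<in> carrier k" "aN \<otimes> y [^] (p * p) \<oplus> (ap \<otimes> y [^] p \<oplus> a1 \<otimes> y) = \<zero>"
  shows "S w y \<otimes> inv (z \<otimes> inv w) \<in> Fp"
proof -
  have U: "inv w \<in> carrier k" "w \<otimes> inv w = \<one>" "inv w \<noteq> \<zero>" using w field_Units by (auto simp: zero_not_one)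
  have iw: "inv w \<noteq> \<zero>" using U(2) w(1) by auto
  define d where "d = z \<otimes> inv w"
  have d: "d \<in> carrier k" "d \<noteq> \<zero>" unfolding d_def using z U integral_iff iw by auto
  define u where "u = w [^] (p - 1)"
  have u: "u \<in> carrier k" unfolding u_def using w by simp
  have "u \<in> Units k" unfolding u_def using w Units_pow_closed[of w "p - 1"] field_Units by simp
  then have u0: "u \<noteq> \<zero>" using field_Units by simp
  \<comment> \<open>The two hypotheses meet here: \<open>u\<close> comes from the root
    \<open>w\<close>, and \<open>z [^] (p - 1)\<close> is the quotient of the outer coefficients, so
    \<open>d = z / w\<close> is a root of exponent \<open>p - 1\<close> of their ratio.\<close>
  have du: "d [^] (p - 1) \<otimes> u = z [^] (p - 1)"
    unfolding d_def u_def using z w U by (simp add: nat_pow_distrib[symmetric] m_assoc m_comm[of "inv w" w])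
  define s where "s = S w y"
  have s: "s \<in> carrier k" unfolding s_def using S_closed w y by simp
  define Y where "Y = y [^] p"
  define YN where "YN = y [^] (p * p)"
  define B where "B = u [^] p"
  have c: "Y \<in> carrier k" "YN \<in> carrier k" "B \<in> carrier k" unfolding Y_def YN_def B_def using y u by auto
  have wp: "w [^] p = u \<otimes> w" unfolding u_def using p_pos nat_pow_Suc[of w "p - 1"] by simp
  have wN: "w [^] (p * p) = B \<otimes> u \<otimes> w"
  proof -
    have "w [^] (p * p) = (w [^] p) [^] p" using w by (simp add: nat_pow_pow)
    also have "\<dots> = B \<otimes> (u \<otimes> w)" unfolding B_def using u w nat_pow_distrib[of u w p] by (simp add: wp)
    finally show ?thesis using c u w by (simp add: m_assoc)
  qed
  \<comment> \<open>Dividing the equation of \<open>w\<close> by \<open>w\<close> gives a linear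
    relation between the coefficients, which eliminates \<open>ap\<close> from the equation of
    \<open>y\<close>.\<close>
  have "(aN \<otimes> B \<otimes> u \<oplus> (ap \<otimes> u \<oplus> a1)) \<otimes> w = \<zero>"
    using w(3) unfolding wN wp using a w c u by (simp add: l_distr m_assoc)
  then have W: "aN \<otimes> B \<otimes> u \<oplus> (ap \<otimes> u \<oplus> a1) = \<zero>" using w a c u integral_iff by simp
  have sp: "s [^] p = YN \<ominus> B \<otimes> Y"
  proof -
    have "s [^] p = (Y \<oplus> \<ominus> (u \<otimes> y)) [^] p" unfolding s_def S_def Y_def u_def a_minus_def ..
    also have "\<dots> = Y [^] p \<oplus> \<ominus> ((u \<otimes> y) [^] p)" using frob_add[of Y "\<ominus> (u \<otimes> y)"] frob_a_inv[of "u \<otimes> y"] c u y by simp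
    finally show ?thesis unfolding Y_def YN_def B_def a_minus_def using y u by (simp add: nat_pow_pow nat_pow_distrib)
  qed
  have "aN \<otimes> u \<otimes> s [^] p \<oplus> aN \<otimes> u \<otimes> (B \<otimes> Y) = aN \<otimes> u \<otimes> YN"
    unfolding sp using a u c by (simp add: r_distr[symmetric] a_minus_def a_assoc l_neg)
  then have 1: "aN \<otimes> u \<otimes> s [^] p \<oplus> (aN \<otimes> B \<otimes> u) \<otimes> Y = u \<otimes> (aN \<otimes> YN)" using a u c by (simp add: m_ac)
  have 2: "(aN \<otimes> B \<otimes> u) \<otimes> Y \<oplus> (ap \<otimes> u \<oplus> a1) \<otimes> Y = \<zero>" using W a u c by (simp add: l_distr[symmetric])
  have 3: "u \<otimes> (aN \<otimes> YN) \<oplus> u \<otimes> (ap \<otimes> Y \<oplus> a1 \<otimes> y) = \<zero>"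
    using y(2) a u c y(1) unfolding Y_def[symmetric] YN_def[symmetric] by (simp add: r_distr[symmetric])
  define L where "L = aN \<otimes> u \<otimes> s [^] p"
  define Q where "Q = (aN \<otimes> B \<otimes> u) \<otimes> Y"
  have LQ: "L \<in> carrier k" "Q \<in> carrier k" unfolding L_def Q_def using a u s c by auto
  have "L \<oplus> Q \<oplus> u \<otimes> (ap \<otimes> Y \<oplus> a1 \<otimes> y) = \<zero>" using 1 3 unfolding L_def Q_def by simp
  then have "(L \<oplus> u \<otimes> a1 \<otimes> y) \<oplus> (Q \<oplus> (ap \<otimes> u) \<otimes> Y) = \<zero>" using LQ a u c y by (simp add: r_distr a_ac m_ac)
  moreover have "Q \<oplus> (ap \<otimes> u) \<otimes> Y = \<ominus> (a1 \<otimes> Y)"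
  proof -
    have "(Q \<oplus> (ap \<otimes> u) \<otimes> Y) \<oplus> a1 \<otimes> Y = \<zero>" using 2 LQ a u c unfolding Q_def by (simp add: l_distr a_assoc)
    then show ?thesis using minus_equality[of "Q \<oplus> (ap \<otimes> u) \<otimes> Y" "a1 \<otimes> Y"] LQ a u c by simp
  qed
  ultimately have "(L \<oplus> u \<otimes> a1 \<otimes> y) \<ominus> a1 \<otimes> Y = \<zero>" unfolding a_minus_def by simp
  then have "L \<oplus> u \<otimes> a1 \<otimes> y = a1 \<otimes> Y" using LQ a u c y by simp
  then have "a1 \<otimes> Y \<ominus> u \<otimes> a1 \<otimes> y = (L \<oplus> u \<otimes> a1 \<otimes> y) \<ominus> u \<otimes> a1 \<otimes> y" by simp
  also have "\<dots> = L" unfolding a_minus_def using LQ a u y by (simp add: a_assoc r_neg)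
  finally have "L = a1 \<otimes> Y \<ominus> u \<otimes> a1 \<otimes> y" ..
  also have "\<dots> = a1 \<otimes> s" unfolding s_def S_def Y_def[symmetric] u_def[symmetric] a_minus_def
    using a u c y by (simp add: r_distr r_minus m_ac)
  finally have "aN \<otimes> (u \<otimes> s [^] p) = aN \<otimes> (z [^] (p - 1) \<otimes> s)" unfolding L_def z(3) using a u s z by (simp add: m_assoc)
  then have "u \<otimes> s [^] p = z [^] (p - 1) \<otimes> s" using m_lcancel[OF a(4) a(1)] u s z by simp
  also have "\<dots> = u \<otimes> (d [^] (p - 1) \<otimes> s)" unfolding du[symmetric] using u d s by (simp add: m_ac)
  finally have "s [^] p = d [^] (p - 1) \<otimes> s" using m_lcancel[OF u0 u] d s by simp
  then show ?thesis using Fp_if_scaled[OF s d] unfolding s_def d_def by simp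
qed

end

section \<open>Frobenius on the residue field of the ambient field\<close>

context padic_closure begin

lemma \<phi>_p: "[p] \<cdot>\<^bsub>kR\<^esub> \<one>\<^bsub>kR\<^esub> = \<zero>\<^bsub>kR\<^esub>"
proof -
  have "\<phi> ([p] \<cdot> \<one>) = \<zero>\<^bsub>kR\<^esub>" using \<phi>_zero_iff[of "[p] \<cdot> \<one>"] v_p by simp
  then show ?thesis using \<phi>_minus(4)[of \<one> p] by simp
qed

sublocale k: frobenius_field kR p
proof
  show "Factorial_Ring.prime p" by (rule prime_p)
  show "[p] \<cdot>\<^bsub>kR\<^esub> \<one>\<^bsub>kR\<^esub> = \<zero>\<^bsub>kR\<^esub>" by (rule \<phi>_p)
  fix x y assume "x \<in> carrier kR" "y \<in> carrier kR"
  then obtain a b where a: "a \<in> carrier R" "0 \<le> v a" "\<phi> a = x" and b: "b \<in> carrier R" "0 \<le> v b" "\<phi> b = y"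
    using \<phi>_surj by metis
  obtain s where s: "s \<in> carrier R" "0 \<le> v s"
    "(a \<oplus> b) [^] p = a [^] p \<oplus> b [^] p \<oplus> ([p] \<cdot> \<one>) \<otimes> (a \<otimes> b \<otimes> s)"
    using freshman[OF a(1,2) b(1,2) prime_p] by blast
  have P: "[p] \<cdot> \<one> \<in> carrier R" "0 \<le> v ([p] \<cdot> \<one>)" "\<phi> ([p] \<cdot> \<one>) = \<zero>\<^bsub>kR\<^esub>"
    using v_p \<phi>_p \<phi>_minus(4)[of \<one> p] by auto
  have cl: "a [^] p \<in> carrier R" "0 \<le> v (a [^] p)" "b [^] p \<in> carrier R" "0 \<le> v (b [^] p)"
     "a \<otimes> b \<otimes> s \<in> carrier R" "0 \<le> v (a \<otimes> b \<otimes> s)" "a \<oplus> b \<in> carrier R" "0 \<le> v (a \<oplus> b)"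
    using v_nonneg_closed a b s by auto
  have cl2: "a [^] p \<oplus> b [^] p \<in> carrier R" "0 \<le> v (a [^] p \<oplus> b [^] p)"
    "([p] \<cdot> \<one>) \<otimes> (a \<otimes> b \<otimes> s) \<in> carrier R" "0 \<le> v (([p] \<cdot> \<one>) \<otimes> (a \<otimes> b \<otimes> s))"
    using v_nonneg_closed(1,2) cl P by auto
  have "(x \<oplus>\<^bsub>kR\<^esub> y) [^]\<^bsub>kR\<^esub> p = \<phi> ((a \<oplus> b) [^] p)"
    using \<phi>_simps(3)[OF a(1,2) b(1,2)] \<phi>_minus(3)[OF cl(7,8)] a b by simp
  also have "\<dots> = \<phi> (a [^] p) \<oplus>\<^bsub>kR\<^esub> \<phi> (b [^] p) \<oplus>\<^bsub>kR\<^esub> \<zero>\<^bsub>kR\<^esub> \<otimes>\<^bsub>kR\<^esub> \<phi> (a \<otimes> b \<otimes> s)"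
    unfolding s(3) using \<phi>_simps(3)[OF cl2] \<phi>_simps(3)[OF cl(1-4)] \<phi>_simps(2)[OF P(1,2) cl(5,6)] P(3) by simp
  also have "\<dots> = x [^]\<^bsub>kR\<^esub> p \<oplus>\<^bsub>kR\<^esub> y [^]\<^bsub>kR\<^esub> p"
    using \<phi>_minus(3)[OF a(1,2)] \<phi>_minus(3)[OF b(1,2)] \<phi>_simps(1)[OF a(1,2)] \<phi>_simps(1)[OF b(1,2)] \<phi>_simps(1)[OF cl(5,6)] a b cl by simp
  finally show "(x \<oplus>\<^bsub>kR\<^esub> y) [^]\<^bsub>kR\<^esub> p = x [^]\<^bsub>kR\<^esub> p \<oplus>\<^bsub>kR\<^esub> y [^]\<^bsub>kR\<^esub> p" .
qed

end

context char0_closed begin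

lemma dimension_quotient:
  assumes g: "galois K E" and F: "subfield F R" "K \<subseteq> F" "F \<subseteq> E"
  shows "\<exists>n. dimension n K F \<and> n * card (carrier (Gal F E)) = card (carrier (Gal K E))"
proof -
  note d = galoisD[OF g]
  have "subalgebra K F R" using F subfieldE(1)[OF F(1)] by (intro subalgebra.intro subalgebra_axioms.intro subring.axioms) (auto intro: subringE)
  then have "finite_dimension K F" using subalbegra_incl_imp_finite_dimension[OF d(1,4) _ F(3)] by simp
  then obtain n where n: "dimension n K F" using finite_dimension_def by blast
  have "dimension (n * card (carrier (Gal F E))) K E"
    using telescopic_base[OF d(1) F(1) n galois_card(1)[OF galois_intermediate[OF g F]]] .
  then have "n * card (carrier (Gal F E)) = card (carrier (Gal K E))"
    using dimension_is_inj[OF d(1) _ galois_card(1)[OF g]] by simp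
  with n show ?thesis by blast
qed

lemma simple_extension_rep:
  assumes K: "subfield K R" and x: "x \<in> carrier R" "(algebraic over K) x" and y: "y \<in> simple_extension K x"
  shows "\<exists>q. set q \<subseteq> K \<and> length q \<le> degree (Irr K x) \<and> y = eval q x"
proof -
  note sK = subfieldE(1)[OF K] and Irr = IrrE[OF K x] and ne = Irr_not_empty[OF K x]
  obtain q where q: "q \<in> carrier (K[X])" "y = eval q x"
    using y unfolding simple_extension_as_eval_img[OF subfieldE(3)[OF K] x(1)] by blast
  let ?r = "q pmod Irr K x"
  have r: "?r \<in> carrier (K[X])" "q pdiv Irr K x \<in> carrier (K[X])"
    using long_division_closed[OF K q(1) Irr(1)] by auto
  interpret e: ring_hom_ring "K[X]" R "\<lambda>p. eval p x" using eval_ring_hom[OF sK x(1)] .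
  have "eval q x = eval (Irr K x) x \<otimes> eval (q pdiv Irr K x) x \<oplus> eval ?r x"
    using pdiv_pmod[OF K q(1) Irr(1)] r Irr(1) e.hom_add e.hom_mult by (metis e.R.m_closed)
  also have "\<dots> = eval ?r x" using Irr(4) e.hom_closed[OF r(1)] e.hom_closed[OF r(2)] by simp
  finally have "y = eval ?r x" using q(2) by simp
  moreover have "length ?r \<le> degree (Irr K x)" using pmod_degree[OF K q(1) Irr(1) ne(1)] ne(3) by auto
  ultimately show ?thesis using poly_coeffs[OF r(1)] by blast
qed

end

section \<open>Valuations on the field generated by a root\<close>

context eisenstein_case begin

text \<open>Coefficients have integral values and the powers of \<open>t\<close> have values
  \<open>j / N\<close> with \<open>j < N\<close>, so nonzero terms have pairwise different
  valuations and the smallest one is the valuation of the sum.\<close>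

lemma power_basis_val:
  assumes t: "t \<in> carrier R" "v t = ereal (1 / N)" and q: "set q \<subseteq> K" "length q \<le> N"
  shows "(set q \<subseteq> {\<zero>} \<and> eval q t = \<zero>) \<or> (\<exists>(z::int) j. j < length q \<and> v (eval q t) = ereal (z + real j / N) \<and>
    (\<forall>i<length q. ereal (z + real j / N) \<le> v (q ! i \<otimes> t [^] (length q - 1 - i))))"
  using q
proof (induction q)
  case Nil
  then show ?case by simp
next
  case (Cons a q)
  have N0: "real N > 0" using p_gtN by simp
  have a: "a \<in> K" "a \<in> carrier R" "set q \<subseteq> K" "length q < N" using Cons.prems K_carrier by auto
  define A where "A = a \<otimes> t [^] (length q)"
  define B where "B = eval q t"
  have AB: "A \<in> carrier R" "B \<in> carrier R" unfolding A_def B_def using a t eval_in_carrier[of q t] K_carrier by auto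
  have ev: "eval (a # q) t = A \<oplus> B" unfolding A_def B_def by simp
  have idx: "(\<forall>i<length (a # q). c \<le> v ((a # q) ! i \<otimes> t [^] (length (a # q) - 1 - i))) \<longleftrightarrow>
    c \<le> v A \<and> (\<forall>i<length q. c \<le> v (q ! i \<otimes> t [^] (length q - 1 - i)))" for c
    unfolding A_def by (simp add: All_less_Suc2)
  note IH = Cons.IH[OF a(3) less_imp_le[OF a(4)], folded B_def]
  show ?case
  proof (cases "a = \<zero>")
    case True
    then have A0: "A = \<zero>" unfolding A_def using t by simp
    show ?thesis unfolding idx ev using IH True A0 AB by (auto simp: less_Suc_eq)
  next
    case False
    obtain z' :: int where z': "v a = ereal z'" using KD(5)[OF a(1) False] by auto
    have vA: "v A = ereal (z' + real (length q) / N)"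
      unfolding A_def using v_mult[OF a(2)] t z' v_pow_real[OF t, of "length q"] by simp
    from IH show ?thesis
    proof (elim disjE exE conjE)
      assume B: "B = \<zero>" "set q \<subseteq> {\<zero>}"
      have "q ! i \<otimes> t [^] (length q - 1 - i) = \<zero>" if "i < length q" for i
        using B(2) nth_mem[OF that] t by auto
      then have "\<exists>(z::int) j. j < length (a # q) \<and> v (A \<oplus> B) = ereal (z + real j / N) \<and>
        (ereal (z + real j / N) \<le> v A \<and> (\<forall>i<length q. ereal (z + real j / N) \<le> v (q ! i \<otimes> t [^] (length q - 1 - i))))"
        using vA B AB by (intro exI[of _ z'] exI[of _ "length q"]) simp
      then show ?thesis unfolding idx ev by blast
    next
      fix z :: int and j :: nat
      assume j: "j < length q" and vB: "v B = ereal (z + real j / N)"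
        and all: "\<forall>i<length q. ereal (z + real j / N) \<le> v (q ! i \<otimes> t [^] (length q - 1 - i))"
      \<comment> \<open>Equality would make \<open>N\<close> divide \<open>length q - j\<close>,
        which lies strictly between \<open>0\<close> and \<open>N\<close>.\<close>
      have "z + real j / N \<noteq> z' + real (length q) / N"
      proof
        assume "z + real j / N = z' + real (length q) / N"
        then have "real_of_int ((z - z') * int N) = real_of_int (int (length q) - int j)" using N0 by (simp add: field_simps)
        then have e: "(z - z') * int N = int (length q) - int j" by (simp only: of_int_eq_iff)
        have b: "0 < (z - z') * int N" "(z - z') * int N < 1 * int N" unfolding e using j a(4) by auto
        then have "0 < z - z'" "z - z' < 1" using N0 by (auto simp: zero_less_mult_iff mult_less_cancel_right)
        then show False by simp
      qed
      then consider "z + real j / N < z' + real (length q) / N" | "z' + real (length q) / N < z + real j / N" by linarith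
      then have "\<exists>(z::int) j. j < length (a # q) \<and> v (A \<oplus> B) = ereal (z + real j / N) \<and>
        (ereal (z + real j / N) \<le> v A \<and> (\<forall>i<length q. ereal (z + real j / N) \<le> v (q ! i \<otimes> t [^] (length q - 1 - i))))"
      proof cases
        case 1
        then have "v (A \<oplus> B) = v B" using v_add_eq[OF AB(2,1)] vA vB AB a_comm by simp
        then show ?thesis using j vA vB all 1 by (intro exI[of _ z] exI[of _ j]) simp
      next
        case 2
        then have "v (A \<oplus> B) = v A" using v_add_eq[OF AB] vA vB by simp
        moreover have "ereal (z' + real (length q) / N) \<le> v (q ! i \<otimes> t [^] (length q - 1 - i))" if "i < length q" for i
          using 2 all that by (meson ereal_less_eq(3) less_imp_le order_trans)
        ultimately show ?thesis using vA by (intro exI[of _ z'] exI[of _ "length q"]) simp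
      qed
      then show ?thesis unfolding idx ev by blast
    qed
  qed
qed

text \<open>Stated for any \<open>t\<close> of value \<open>1 / N\<close>: besides
  \<open>\<pi>\<close> it serves to restrict the values on the subfield \<open>F\<close>, whose
  degree over \<open>K\<close> is only \<open>p\<close>.\<close>

lemma degree_Irr_ge:
  assumes t: "t \<in> carrier R" "v t = ereal (1 / N)" "(algebraic over K) t"
  shows "N \<le> degree (Irr K t)"
proof (rule ccontr)
  note Irr = IrrE[OF KD(1) t(1,3)] and ne = Irr_not_empty[OF KD(1) t(1,3)]
  assume "\<not> ?thesis"
  then have len: "length (Irr K t) \<le> N" by simp
  have "hd (Irr K t) \<noteq> \<zero>" using Irr(1) ne(1) by (auto simp: univ_poly_def polynomial_def)
  then have "\<not> set (Irr K t) \<subseteq> {\<zero>}" using ne(1) hd_in_set by blast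
  then show False using power_basis_val[OF t(1,2) poly_coeffs[OF Irr(1)] len] Irr(4) by auto
qed

lemma f_poly: "f \<in> carrier (K[X])" "f \<noteq> []" "degree f = N" "f \<in> carrier (poly_ring R)" "set f \<subseteq> carrier R"
proof -
  show ne: "f \<noteq> []" using f_len by auto
  have "hd f \<noteq> \<zero>" using f_0 ne by (simp add: hd_conv_nth)
  then show "f \<in> carrier (K[X])" "f \<in> carrier (poly_ring R)"
    using f_mem K_carrier by (auto simp: univ_poly_def polynomial_def)
  show "degree f = N" using f_len unfolding N_def by simp
  show "set f \<subseteq> carrier R" using f_mem K_carrier by blast
qed

end

locale eis_root = eisenstein_case +
  fixes \<pi> :: 'a
  assumes pi: "\<pi> \<in> carrier R" "eval f \<pi> = \<zero>"
begin

definition Z :: "'a set" where "Z = {x \<in> carrier R. eval f x = \<zero>}"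
definition L :: "'a set" where "L = simple_extension K \<pi>"

lemma pi_Z: "\<pi> \<in> Z" and Z_carrier: "x \<in> Z \<Longrightarrow> x \<in> carrier R" and Z_val: "x \<in> Z \<Longrightarrow> v x = ereal (1 / N)"
  unfolding Z_def using pi root_val by auto

lemma pi_alg: "(algebraic over K) \<pi>"
  using algebraicI[OF f_poly(1,2) pi(2)] .

lemma degree_Irr_pi: "degree (Irr K \<pi>) = N"
  using degree_Irr_ge[OF pi(1) root_val(1)[OF pi] pi_alg]
    degree_Irr_le[OF KD(1) pi(1) pi_alg f_poly(1,2) pi(2)] f_poly(3) by simp

text \<open>Separability of \<open>Irr K \<pi>\<close> provides \<open>N\<close> distinct roots, and
  \<open>f\<close> cannot have more.\<close>

lemma Z_Irr: "Z = {x \<in> carrier R. eval (Irr K \<pi>) x = \<zero>}" and card_Z: "card Z = N" and finite_Z: "finite Z"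
proof -
  let ?S = "{x \<in> carrier R. eval (Irr K \<pi>) x = \<zero>}"
  have sub: "?S \<subseteq> Z" unfolding Z_def using root_of_multiple_Irr[OF KD(1) pi(1) pi_alg f_poly(1) pi(2)] by auto
  have c: "card ?S = N" using card_roots_Irr(1)[OF KD(1) pi(1) pi_alg] degree_Irr_pi by simp
  note Z = card_roots_le_degree[OF f_poly(4,2), of Z]
  show fin: "finite Z" using Z(1) unfolding Z_def by simp
  have "card Z \<le> N" using Z(2) f_poly(3) unfolding Z_def by simp
  then have "?S = Z" using card_seteq[OF fin sub] c by simp
  then show "Z = ?S" "card Z = N" using c by auto
qed

lemma L_facts: "subfield L R" "K \<subseteq> L" "\<pi> \<in> L" "dimension N K L" "\<And>x. x \<in> L \<Longrightarrow> x \<in> carrier R"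
  unfolding L_def using subfield_simple_extension[OF KD(1) pi(1) pi_alg] subfieldE(3)
    dimension_simple_extension[OF KD(1) pi(1) pi_alg] degree_Irr_pi by auto

lemma L_eq: "L = generate_field R (insert \<pi> K)"
proof (rule generate_fieldI)
  show "insert \<pi> K \<subseteq> carrier R" using pi(1) K_carrier by blast
  show "subfield L R" "insert \<pi> K \<subseteq> L" using L_facts by auto
  fix I assume I: "subfield I R" "insert \<pi> K \<subseteq> I"
  show "L \<subseteq> I" unfolding L_def using simple_extension_subring_incl[OF subfieldE(1)[OF I(1)], of K \<pi>] I(2) by simp
qed

lemma L_rep:
  assumes "x \<in> L" shows "\<exists>q. set q \<subseteq> K \<and> length q \<le> N \<and> x = eval q \<pi>"
  using simple_extension_rep[OF KD(1) pi(1) pi_alg, of x] assms degree_Irr_pi unfolding L_def by simp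

lemma L_val:
  assumes x: "x \<in> L" "x \<noteq> \<zero>" shows "\<exists>m::int. v x = ereal (m / N)"
proof -
  have N0: "real N > 0" using p_gtN by simp
  obtain q where q: "set q \<subseteq> K" "length q \<le> N" "x = eval q \<pi>" using L_rep[OF x(1)] by blast
  obtain z :: int and j :: nat where "v x = ereal (z + real j / N)"
    using power_basis_val[OF pi(1) root_val(1)[OF pi] q(1,2)] x(2) q(3) by auto
  then have "v x = ereal (real_of_int (z * int N + int j) / N)" using N0 by (simp add: field_simps)
  then show ?thesis by blast
qed

text \<open>The integers of \<open>L\<close> are the polynomials in \<open>\<pi>\<close> with
  integral coefficients: no term has smaller value than the sum, and an integer \<open>m\<close>
  with \<open>m + j / N \<ge> 0\<close> and \<open>j < N\<close> is nonnegative.\<close>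

lemma L_int:
  assumes x: "x \<in> L" "0 \<le> v x" shows "\<exists>q. set q \<subseteq> {c \<in> K. 0 \<le> v c} \<and> x = eval q \<pi>"
proof -
  have N0: "real N > 0" using p_gtN by simp
  obtain q where q: "set q \<subseteq> K" "length q \<le> N" "x = eval q \<pi>" using L_rep[OF x(1)] by blast
  have "0 \<le> v c" if c: "c \<in> set q" for c
  proof (cases "c = \<zero>")
    case False
    obtain i where i: "i < length q" "c = q ! i" using c by (metis in_set_conv_nth)
    have cK: "c \<in> K" "c \<in> carrier R" using c q(1) K_carrier by auto
    obtain m :: int where m: "v c = ereal m" using KD(5)[OF cK(1) False] by auto
    let ?n = "length q - 1 - i"
    have "\<not> set q \<subseteq> {\<zero>}" using c False by blast
    then have "0 \<le> v (c \<otimes> \<pi> [^] ?n)"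
      using power_basis_val[OF pi(1) root_val(1)[OF pi] q(1,2)] x(2) i unfolding q(3) by (auto intro: order_trans)
    then have "0 \<le> m + real ?n / N"
      using v_mult[OF cK(2)] pi(1) m v_pow_real[OF pi(1) root_val(1)[OF pi], of ?n] by (simp add: zero_ereal_def)
    moreover have "real ?n / N < 1" using i q(2) N0 by (simp add: field_simps)
    ultimately have "0 \<le> m" by linarith
    then show ?thesis unfolding m by (simp add: zero_ereal_def)
  qed simp
  then have "set q \<subseteq> {c \<in> K. 0 \<le> v c}" using q(1) by blast
  then show ?thesis using q(3) by blast
qed

text \<open>Only the constant term of a polynomial in \<open>\<pi>\<close> survives reduction, so
  \<open>L\<close> has no residues beyond those of \<open>K\<close>.\<close>

lemma K_residue:
  assumes x: "x \<in> L" "0 \<le> v x" shows "\<exists>c \<in> K. 0 \<le> v c \<and> \<phi> x = \<phi> c"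
proof -
  obtain q where q: "set q \<subseteq> {c \<in> K. 0 \<le> v c}" "x = eval q \<pi>" using L_int[OF x] by blast
  show ?thesis
  proof (cases q rule: rev_cases)
    case Nil
    then show ?thesis using q(2) subringE(2)[OF subfieldE(1)[OF KD(1)]] by (intro bexI[of _ \<zero>]) auto
  next
    case (snoc q' c)
    let ?O = "{x \<in> carrier R. 0 \<le> v x}"
    have c: "c \<in> K" "0 \<le> v c" "c \<in> carrier R" using q(1) snoc K_carrier by auto
    have piO: "\<pi> \<in> ?O" "0 < v \<pi>" "\<phi> \<pi> = \<zero>\<^bsub>kR\<^esub>"
      using pi(1) root_val(1)[OF pi] p_gtN \<phi>_zero_iff[OF pi(1)] by (auto simp: zero_ereal_def)
    have q': "set q' \<subseteq> ?O" using q(1) snoc K_carrier by auto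
    have "eval q' \<pi> \<in> ?O" using eval_in_subring[OF subring_O q' piO(1)] .
    then have e: "eval q' \<pi> \<in> carrier R" "0 \<le> v (eval q' \<pi>)" by auto
    have pc: "\<pi> \<in> carrier R" "0 \<le> v \<pi>" using piO by auto
    have "x = eval q' \<pi> \<otimes> \<pi> \<oplus> c" unfolding q(2) snoc
      using q(1) snoc K_carrier c pi(1) by (intro eval_append_aux) auto
    then have "\<phi> x = \<phi> c" using \<phi>_simps(3)[OF m_closed[OF e(1) pc(1)] v_nonneg_closed(1)[OF e pc] c(3,2)] \<phi>_simps(2)[OF e pc] \<phi>_simps(1)[OF e] \<phi>_simps(1)[OF c(3,2)]
      v_nonneg_closed e pc piO(3) by simp
    then show ?thesis using c by blast
  qed
qed

end

lemma (in ring) minus_add_minus: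
  assumes "a \<in> carrier R" "b \<in> carrier R" "c \<in> carrier R" shows "a \<ominus> c = (a \<ominus> b) \<oplus> (b \<ominus> c)"
  using assms r_neg1[of b "\<ominus> c"] by (simp add: a_minus_def a_assoc)

section \<open>The normal closure and its Galois group\<close>

context eis_root begin

text \<open>The splitting field of \<open>f\<close>. \<open>finite_extension\<close> expects a list,
  hence the arbitrary enumeration of \<open>Z\<close>.\<close>

definition E :: "'a set" where "E = finite_extension K (SOME rs. set rs = Z)"

abbreviation "G \<equiv> Gal K E"

lemma galoisE: "galois K E" and Z_E: "Z \<subseteq> E" and E_minimal: "subring J R \<Longrightarrow> K \<subseteq> J \<Longrightarrow> Z \<subseteq> J \<Longrightarrow> E \<subseteq> J"
proof -
  have rs: "set (SOME rs. set rs = Z) = Z" using someI_ex[OF finite_list[OF finite_Z]] .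
  show "galois K E" unfolding E_def using galois_splitting_field[OF KD(1) f_poly(1,2)] rs unfolding Z_def by simp
  show "Z \<subseteq> E" unfolding E_def using finite_extension_mem[OF subfieldE(1)[OF KD(1)], of "SOME rs. set rs = Z"] rs Z_carrier by auto
  show "E \<subseteq> J" if "subring J R" "K \<subseteq> J" "Z \<subseteq> J" unfolding E_def using finite_extension_subring_incl[OF that(1,2)] rs that(3) by simp
qed

lemmas ED = galoisD[OF galoisE]

lemma E_carrier: "x \<in> E \<Longrightarrow> x \<in> carrier R" using ED(9) by blast

lemma L_E: "L \<subseteq> E"
  unfolding L_def using simple_extension_subring_incl[OF ED(7,3)] Z_E pi_Z by blast

lemma normal_closure_L: "normal_closure K L = E"
proof
  show "normal_closure K L \<subseteq> E" unfolding normal_closure_def using normal_extension_galois[OF galoisE] L_E by blast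
  show "E \<subseteq> normal_closure K L" unfolding normal_closure_def
  proof (rule Inter_greatest)
    fix J assume "J \<in> {J. normal_extension K J \<and> L \<subseteq> J}"
    then have J: "normal_extension K J" "L \<subseteq> J" by auto
    then have Jd: "subfield J R" "K \<subseteq> J" unfolding normal_extension_def by auto
    note Irr = IrrE[OF KD(1) pi(1) pi_alg]
    have "ring.splitted (R\<lparr>carrier := J\<rparr>) (Irr K \<pi>)"
      using J Irr L_facts(3) unfolding normal_extension_def by blast
    moreover have "Irr K \<pi> \<in> carrier (J[X])" using Irr(1) Jd(2) by (auto simp: univ_poly_def polynomial_def)
    ultimately have "Z \<subseteq> J"
      unfolding Z_Irr using root_in_subfield_if_splitted[OF Jd(1) _ Irr_not_empty(1)[OF KD(1) pi(1) pi_alg]] by blast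
    then show "E \<subseteq> J" using E_minimal[OF subfieldE(1)[OF Jd(1)] Jd(2)] by blast
  qed
qed

lemma groupG: "group G" using Gal_group[OF ED(7,3)] .

lemma isometry: "\<rho> \<in> carrier G \<Longrightarrow> x \<in> E \<Longrightarrow> v (\<rho> x) = v x"
  using Gal_isometry[OF KD(1,4) ED(2-4)] .

lemma Z_stable:
  assumes r: "\<rho> \<in> carrier G" and x: "x \<in> Z" shows "\<rho> x \<in> Z"
proof -
  have xE: "x \<in> E" using x Z_E by blast
  have "eval f (\<rho> x) = \<rho> (eval f x)" using Gal_eval[OF ED(7,3) r f_mem xE] by simp
  then show ?thesis using x Gal_minus(2)[OF ED(7) r] Gal_memD(1)[OF r xE] E_carrier unfolding Z_def by simp
qed

lemma Gal_one_if_fixes_Z: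
  assumes r: "\<rho> \<in> carrier G" and fx: "\<And>z. z \<in> Z \<Longrightarrow> \<rho> z = z" shows "\<rho> = \<one>\<^bsub>G\<^esub>"
proof -
  note F = fixed_field_subfield[OF galoisE, of "{\<rho>}"]
  have "E \<subseteq> fixed_field E {\<rho>}"
    using F r fx Z_E by (intro E_minimal subfieldE(1)) (auto simp: fixed_field_def)
  then have fE: "\<rho> x = x" if "x \<in> E" for x using that unfolding fixed_field_def by auto
  show ?thesis
    by (rule Gal_ext[OF r group.is_monoid[OF groupG, THEN monoid.one_closed]]) (simp add: fE Gal_one)
qed

lemma transitive: "z \<in> Z \<Longrightarrow> \<exists>\<rho> \<in> carrier G. z = \<rho> \<pi>"
  using galois_conj[OF galoisE, of \<pi> z] pi_Z Z_E Z_Irr by auto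

subsection \<open>The differences of the roots\<close>

definition yy :: "'a \<Rightarrow> 'a" where "yy z = (z \<ominus> \<pi>) \<otimes> inv (\<pi> [^] (2::nat))"

lemma pi_facts: "\<pi> \<in> E" "v \<pi> = ereal (1 / N)" "\<pi> \<noteq> \<zero>" "\<pi> [^] (2::nat) \<in> carrier R" "\<pi> [^] (2::nat) \<noteq> \<zero>"
  "inv (\<pi> [^] (2::nat)) \<in> carrier R" "inv (\<pi> [^] (2::nat)) \<otimes> \<pi> [^] (2::nat) = \<one>" "v (\<pi> [^] (2::nat)) = ereal (2 / N)" "0 < v \<pi>"
proof -
  show pE: "\<pi> \<in> E" using pi_Z Z_E by blast
  show vp: "v \<pi> = ereal (1 / N)" using root_val(1)[OF pi] .
  then show "0 < v \<pi>" using p_gtN by (simp add: zero_ereal_def)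
  show p0: "\<pi> \<noteq> \<zero>" using vp by auto
  show p2: "\<pi> [^] (2::nat) \<in> carrier R" using pi by simp
  have u: "\<pi> \<in> Units R" using pi(1) p0 field_Units by simp
  have u2: "\<pi> [^] (2::nat) \<in> Units R" using Units_pow_closed[OF u] .
  then show "\<pi> [^] (2::nat) \<noteq> \<zero>" "inv (\<pi> [^] (2::nat)) \<in> carrier R" "inv (\<pi> [^] (2::nat)) \<otimes> \<pi> [^] (2::nat) = \<one>"
    using field_Units by auto
  show "v (\<pi> [^] (2::nat)) = ereal (2 / N)" using v_pow_real[OF pi(1) vp, of 2] by simp
qed

lemma yy_unique: assumes y: "y \<in> carrier R" "z \<ominus> \<pi> = \<pi> [^] (2::nat) \<otimes> y" shows "yy z = y"
  unfolding yy_def y(2) using y(1) pi_facts by (metis m_assoc m_comm l_one)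

lemma yy:
  assumes z: "z \<in> Z"
  shows "yy z \<in> carrier R" "0 \<le> v (yy z)" "z \<ominus> \<pi> = \<pi> [^] (2::nat) \<otimes> yy z" "z = \<pi> \<otimes> (\<one> \<oplus> \<pi> \<otimes> yy z)"
    "ereal (1 + 1 / N) \<le> v (T (yy z))" "yy z \<in> E"
proof -
  obtain y where y: "vge 0 y" "z = \<pi> \<otimes> (\<one> \<oplus> \<pi> \<otimes> y)" "z \<ominus> \<pi> = \<pi> [^] (2::nat) \<otimes> y" "ereal (1 + 1 / N) + v y \<le> v (T y)"
    using root_shift[OF pi, of z] z unfolding Z_def by blast
  note yR = vge_carrier[OF y(1)]
  have e: "yy z = y" using yy_unique[OF yR y(3)] .
  have y0: "0 \<le> v y" using y(1) unfolding vge_def by (simp add: zero_ereal_def)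
  then show "yy z \<in> carrier R" "0 \<le> v (yy z)" "z \<ominus> \<pi> = \<pi> [^] (2::nat) \<otimes> yy z" "z = \<pi> \<otimes> (\<one> \<oplus> \<pi> \<otimes> yy z)"
    unfolding e using y yR by auto
  have "ereal (1 + 1 / N) + 0 \<le> ereal (1 + 1 / N) + v y" by (rule add_left_mono[OF y0])
  then show "ereal (1 + 1 / N) \<le> v (T (yy z))" unfolding e using y(4) by simp
  have "z \<ominus> \<pi> \<in> E" "inv (\<pi> [^] (2::nat)) \<in> E"
    using z Z_E pi_facts subringE(3,5,7)[OF ED(7)] subfield_m_inv(1)[OF ED(2), of "\<pi> [^] (2::nat)"] subringE(6)[OF ED(7)]
    by (auto simp: a_minus_def numeral_2_eq_2)
  then show "yy z \<in> E" unfolding yy_def using subringE(6)[OF ED(7)] by blast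
qed

text \<open>Centring \<open>root_shift\<close> at \<open>z\<close> gives distinct roots a distance
  of value exactly \<open>2 / N\<close>, which is the value of \<open>\<pi> [^] 2\<close>; so
  \<open>yy z'\<close> and \<open>yy z\<close> differ by a unit.\<close>

lemma yy_inj:
  assumes z: "z \<in> Z" "z' \<in> Z" and e: "\<phi> (yy z) = \<phi> (yy z')" shows "z = z'"
proof (rule ccontr)
  assume n: "z \<noteq> z'"
  obtain y where y: "vge 0 y" "z' \<ominus> z = z [^] (2::nat) \<otimes> y" "z' \<noteq> z \<longrightarrow> v y = 0"
    using root_shift[of z z'] z unfolding Z_def by blast
  have vy: "v y = 0" using y(3) n by simp
  note Y = yy[OF z(1)] yy[OF z(2)]
  note zR = Z_carrier[OF z(1)] Z_carrier[OF z(2)]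
  have "v (z' \<ominus> z) = ereal (2 / N)"
    unfolding y(2) using v_mult vge_carrier[OF y(1)] zR(1) v_pow_real[OF zR(1) Z_val[OF z(1)], of 2] vy by simp
  moreover have "z' \<ominus> z = \<pi> [^] (2::nat) \<otimes> (yy z' \<ominus> yy z)"
  proof -
    have "z' \<ominus> z = (z' \<ominus> \<pi>) \<ominus> (z \<ominus> \<pi>)"
      unfolding a_minus_def using zR pi(1) by (simp add: minus_add a_ac r_neg2 r_neg1)
    also have "\<dots> = \<pi> [^] (2::nat) \<otimes> (yy z' \<ominus> yy z)"
      unfolding Y(3,9) unfolding a_minus_def using Y(1,7) pi_facts(4) by (simp add: r_distr r_minus)
    finally show ?thesis .
  qed
  ultimately have "ereal (2 / N) = ereal (2 / N) + v (yy z' \<ominus> yy z)"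
    using v_mult[OF pi_facts(4)] pi_facts(8) Y(1,7) by simp
  then have "v (yy z' \<ominus> yy z) = 0" by (cases "v (yy z' \<ominus> yy z)") (auto simp: zero_ereal_def)
  then show False using e \<phi>_eq_iff[OF Y(7,8) Y(1,2)] by simp
qed

text \<open>The reduced coefficient of index \<open>i\<close>, placed in the ambient residue field
  \<open>kR\<close>; later \<open>\<psi>\<close> carries \<open>red_coeff\<close> to it.\<close>

definition ab :: "nat \<Rightarrow> 'a set" where "ab i = \<phi> (f ! i \<otimes> inv P)"

lemma ab_mem:
  assumes "1 \<le> i" "i \<le> N" shows "f ! i \<otimes> inv P \<in> K" "f ! i \<otimes> inv P \<in> carrier R" "0 \<le> v (f ! i \<otimes> inv P)" "ab i \<in> carrier kR"
proof -
  note iP = v_inv[OF P_facts(1,3)]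
  have "inv P \<in> K" using subfield_m_inv(1)[OF KD(1)] P_facts by simp
  then show m: "f ! i \<otimes> inv P \<in> K" using f_nth(1)[OF assms(2)] subringE(6)[OF subfieldE(1)[OF KD(1)]] by blast
  then show c: "f ! i \<otimes> inv P \<in> carrier R" by (rule K_carrier)
  have "ereal (1 + - 1) \<le> v (f ! i \<otimes> inv P)"
    using f_ge_1[OF assms] f_nth(2)[OF assms(2)] iP P_facts by (intro v_mult_ge) (auto simp: one_ereal_def)
  then show v0: "0 \<le> v (f ! i \<otimes> inv P)" by (simp add: zero_ereal_def)
  show "ab i \<in> carrier kR" unfolding ab_def using \<phi>_simps(1)[OF c v0] .
qed

lemma ab_nonzero: "ab 1 \<noteq> \<zero>\<^bsub>kR\<^esub>" "ab N \<noteq> \<zero>\<^bsub>kR\<^esub>"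
proof -
  note iP = v_inv[OF P_facts(1,3)]
  have "v (f ! i \<otimes> inv P) = 0" if "v (f ! i) = 1" "i \<le> N" for i
    using v_mult[OF f_nth(2)[OF that(2)] iP(2)] iP(1) that(1) P_facts(2) by (simp add: one_ereal_def zero_ereal_def)
  then show "ab 1 \<noteq> \<zero>\<^bsub>kR\<^esub>" "ab N \<noteq> \<zero>\<^bsub>kR\<^esub>"
    unfolding ab_def using \<phi>_zero_iff[OF ab_mem(2,3)] f_1 f_N p_gtN by auto
qed

text \<open>\<open>T (yy z)\<close> has value greater than \<open>1\<close>, so it still reduces to
  zero after division by \<open>p\<close>.\<close>

lemma residue_root:
  assumes z: "z \<in> Z"
  shows "ab N \<otimes>\<^bsub>kR\<^esub> \<phi> (yy z) [^]\<^bsub>kR\<^esub> N \<oplus>\<^bsub>kR\<^esub> (ab p \<otimes>\<^bsub>kR\<^esub> \<phi> (yy z) [^]\<^bsub>kR\<^esub> p \<oplus>\<^bsub>kR\<^esub> ab 1 \<otimes>\<^bsub>kR\<^esub> \<phi> (yy z)) = \<zero>\<^bsub>kR\<^esub>"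
proof -
  note y = yy[OF z]
  note iP = v_inv[OF P_facts(1,3)]
  have one: "1 \<le> N" "1 \<le> p" "p \<le> N" using p_gtN by auto
  have f: "f ! N \<in> carrier R" "f ! p \<in> carrier R" "f ! 1 \<in> carrier R" using f_nth one by auto
  let ?g = "\<lambda>i. f ! i \<otimes> inv P" and ?y = "yy z"
  have pw: "?y [^] n \<in> carrier R" "0 \<le> v (?y [^] n)" "\<phi> (?y [^] n) = \<phi> ?y [^]\<^bsub>kR\<^esub> n" for n :: nat
    using y v_nonneg_closed(3)[OF y(1,2)] \<phi>_minus(3)[OF y(1,2)] by auto
  note g = ab_mem(2,3)[OF one(1) order_refl] ab_mem(2,3)[OF one(2,3)] ab_mem(2,3)[OF order_refl one(1)]
  have t: "?g N \<otimes> ?y [^] N \<in> carrier R" "0 \<le> v (?g N \<otimes> ?y [^] N)" "?g p \<otimes> ?y [^] p \<in> carrier R" "0 \<le> v (?g p \<otimes> ?y [^] p)"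
    "?g 1 \<otimes> ?y \<in> carrier R" "0 \<le> v (?g 1 \<otimes> ?y)"
    using v_nonneg_closed(1)[OF g(1,2) pw(1,2)] v_nonneg_closed(1)[OF g(3,4) pw(1,2)] v_nonneg_closed(1)[OF g(5,6) y(1,2)] g pw y by auto
  have s: "?g p \<otimes> ?y [^] p \<oplus> ?g 1 \<otimes> ?y \<in> carrier R" "0 \<le> v (?g p \<otimes> ?y [^] p \<oplus> ?g 1 \<otimes> ?y)"
    using v_nonneg_closed(2)[OF t(3-6)] t by auto
  have TR: "T ?y \<in> carrier R" unfolding T_def using f y by simp
  have TP: "T ?y \<otimes> inv P = ?g N \<otimes> ?y [^] N \<oplus> (?g p \<otimes> ?y [^] p \<oplus> ?g 1 \<otimes> ?y)"
    unfolding T_def using f pw(1) y(1) iP(2) by (simp add: ring_ac_distr)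
  have "0 < v (T ?y \<otimes> inv P)"
  proof -
    have "ereal (1 + 1 / N + - 1) \<le> v (T ?y \<otimes> inv P)"
      using y(5) TR iP P_facts(2) by (intro v_mult_ge) (auto simp: one_ereal_def)
    moreover have "0 < ereal (1 + 1 / N + - 1)" using one by (simp add: zero_ereal_def)
    ultimately show ?thesis by (rule less_le_trans[rotated])
  qed
  then have "\<phi> (T ?y \<otimes> inv P) = \<zero>\<^bsub>kR\<^esub>"
    using \<phi>_zero_iff[OF m_closed[OF TR iP(2)]] less_imp_le by blast
  then have "\<phi> (?g N \<otimes> ?y [^] N \<oplus> (?g p \<otimes> ?y [^] p \<oplus> ?g 1 \<otimes> ?y)) = \<zero>\<^bsub>kR\<^esub>" unfolding TP .
  then show ?thesis unfolding ab_def
    using \<phi>_simps(3)[OF t(1,2) s] \<phi>_simps(3)[OF t(3-6)] \<phi>_simps(2)[OF g(1,2) pw(1,2)] \<phi>_simps(2)[OF g(3,4) pw(1,2)]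
      \<phi>_simps(2)[OF g(5,6) y(1,2)] pw(3) by simp
qed

subsection \<open>The action on the residue field\<close>

definition \<kappa> :: "'a set set" where "\<kappa> = \<phi> ` {x \<in> K. 0 \<le> v x}"
definition \<kappa>E :: "'a set set" where "\<kappa>E = \<phi> ` {x \<in> E. 0 \<le> v x}"

definition act :: "('a \<Rightarrow> 'a) \<Rightarrow> 'a set \<Rightarrow> 'a set"
  where "act \<rho> c = \<phi> (\<rho> (SOME x. x \<in> E \<and> 0 \<le> v x \<and> \<phi> x = c))"

definition Y :: "('a \<Rightarrow> 'a) \<Rightarrow> 'a set" where "Y \<rho> = \<phi> (yy (\<rho> \<pi>))"

lemma Gal_O:
  assumes "\<rho> \<in> carrier G" "x \<in> E" "0 \<le> v x"
  shows "\<rho> x \<in> E" "\<rho> x \<in> carrier R" "0 \<le> v (\<rho> x)" "x \<in> carrier R"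
  using Gal_memD(1)[OF assms(1,2)] isometry[OF assms(1,2)] assms(3) E_carrier assms(2) by auto

text \<open>The chosen lift does not matter, since an isometry preserves congruence modulo the
  maximal ideal.\<close>

lemma act_\<phi>:
  assumes r: "\<rho> \<in> carrier G" and x: "x \<in> E" "0 \<le> v x" shows "act \<rho> (\<phi> x) = \<phi> (\<rho> x)"
proof -
  let ?s = "SOME x'. x' \<in> E \<and> 0 \<le> v x' \<and> \<phi> x' = \<phi> x"
  have "?s \<in> E \<and> 0 \<le> v ?s \<and> \<phi> ?s = \<phi> x" by (rule someI[of _ x]) (use x in simp)
  then have s: "?s \<in> E" "0 \<le> v ?s" "\<phi> ?s = \<phi> x" by auto
  note gs = Gal_O[OF r s(1,2)] and gx = Gal_O[OF r x]
  have "0 < v (?s \<ominus> x)" using \<phi>_eq_iff[OF gs(4) s(2) gx(4) x(2)] s(3) by simp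
  moreover have "?s \<ominus> x \<in> E" using s(1) x(1) subringE(5,7)[OF ED(7)] by (simp add: a_minus_def)
  ultimately have "0 < v (\<rho> ?s \<ominus> \<rho> x)" using isometry[OF r] Gal_minus(1)[OF ED(7) r s(1) x(1)] by metis
  then show ?thesis unfolding act_def using \<phi>_eq_iff[OF gs(2,3) gx(2,3)] by simp
qed

lemma K_le_E: "K \<subseteq> E" using ED(3) .

lemma \<kappa>_facts: "subfield \<kappa> kR" "subfield \<kappa>E kR" "\<kappa> \<subseteq> \<kappa>E"
  unfolding \<kappa>_def \<kappa>E_def using subfield_residues[OF KD(1)] subfield_residues[OF ED(2)] K_le_E by auto

lemma act_facts:
  assumes r: "\<rho> \<in> carrier G"
  shows "c \<in> \<kappa>E \<Longrightarrow> act \<rho> c \<in> \<kappa>E" "c \<in> \<kappa> \<Longrightarrow> act \<rho> c = c"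
    "c \<in> \<kappa>E \<Longrightarrow> e \<in> \<kappa>E \<Longrightarrow> act \<rho> (c \<oplus>\<^bsub>kR\<^esub> e) = act \<rho> c \<oplus>\<^bsub>kR\<^esub> act \<rho> e"
    "c \<in> \<kappa>E \<Longrightarrow> e \<in> \<kappa>E \<Longrightarrow> act \<rho> (c \<otimes>\<^bsub>kR\<^esub> e) = act \<rho> c \<otimes>\<^bsub>kR\<^esub> act \<rho> e"
    "\<tau> \<in> carrier G \<Longrightarrow> c \<in> \<kappa>E \<Longrightarrow> act (\<rho> \<otimes>\<^bsub>G\<^esub> \<tau>) c = act \<rho> (act \<tau> c)"
proof -
  show "act \<rho> c \<in> \<kappa>E" if "c \<in> \<kappa>E" using that act_\<phi>[OF r] Gal_O[OF r] unfolding \<kappa>E_def by auto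
  show "act \<rho> c = c" if "c \<in> \<kappa>" using that act_\<phi>[OF r] K_le_E Gal_memD(5)[OF r] unfolding \<kappa>_def by auto
  assume "c \<in> \<kappa>E"
  then obtain x where x: "x \<in> E" "0 \<le> v x" "c = \<phi> x" unfolding \<kappa>E_def by auto
  note gx = Gal_O[OF r x(1,2)]
  {
    assume "e \<in> \<kappa>E"
    then obtain y where y: "y \<in> E" "0 \<le> v y" "e = \<phi> y" unfolding \<kappa>E_def by auto
    note gy = Gal_O[OF r y(1,2)]
    have m: "x \<otimes> y \<in> E" "x \<oplus> y \<in> E" "0 \<le> v (x \<otimes> y)" "0 \<le> v (x \<oplus> y)"
      using x y subringE(6,7)[OF ED(7)] v_nonneg_closed(1,2)[OF gx(4) x(2) gy(4) y(2)] by auto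
    note s = \<phi>_simps[OF gx(4) x(2)] \<phi>_simps[OF gx(2,3)]
    show "act \<rho> (c \<oplus>\<^bsub>kR\<^esub> e) = act \<rho> c \<oplus>\<^bsub>kR\<^esub> act \<rho> e" "act \<rho> (c \<otimes>\<^bsub>kR\<^esub> e) = act \<rho> c \<otimes>\<^bsub>kR\<^esub> act \<rho> e"
      using act_\<phi>[OF r m(1,3)] act_\<phi>[OF r m(2,4)] act_\<phi>[OF r x(1,2)] act_\<phi>[OF r y(1,2)]
        Gal_memD(6,7)[OF r x(1) y(1)] s(2)[OF gy(4) y(2)] s(3)[OF gy(4) y(2)] s(5)[OF gy(2,3)] s(6)[OF gy(2,3)] x(3) y(3)
      by auto
  }
  assume t: "\<tau> \<in> carrier G"
  note hx = Gal_O[OF t x(1,2)]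
  have "\<rho> \<otimes>\<^bsub>G\<^esub> \<tau> \<in> carrier G" using r t groupG by (simp add: group.is_monoid monoid.m_closed)
  then show "act (\<rho> \<otimes>\<^bsub>G\<^esub> \<tau>) c = act \<rho> (act \<tau> c)"
    using act_\<phi>[of "\<rho> \<otimes>\<^bsub>G\<^esub> \<tau>", OF _ x(1,2)] act_\<phi>[OF t x(1,2)] act_\<phi>[OF r hx(1,3)] Gal_mult_apply[OF r t x(1)] x(3) by simp
qed

lemma Y_mem: assumes r: "\<rho> \<in> carrier G" shows "Y \<rho> \<in> \<kappa>E"
  unfolding Y_def \<kappa>E_def using yy[OF Z_stable[OF r pi_Z]] by blast

text \<open>Apply \<open>\<rho>\<close> to
  \<open>\<tau> \<pi> - \<pi> = \<pi>^2 yy (\<tau> \<pi>)\<close>. Since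
  \<open>\<rho> \<pi> = \<pi> u\<close> with \<open>u\<close> congruent to \<open>1\<close>, the
  square of \<open>\<rho> \<pi>\<close> may be replaced by that of \<open>\<pi>\<close>: residues do
  not see \<open>u\<close>.\<close>

lemma Y_mult:
  assumes r: "\<rho> \<in> carrier G" and t: "\<tau> \<in> carrier G"
  shows "Y (\<rho> \<otimes>\<^bsub>G\<^esub> \<tau>) = Y \<rho> \<oplus>\<^bsub>kR\<^esub> act \<rho> (Y \<tau>)"
proof -
  note zr = Z_stable[OF r pi_Z] and zt = Z_stable[OF t pi_Z]
  note yr = yy[OF zr] and yt = yy[OF zt]
  note gy = Gal_O[OF r yt(6,2)]
  define u where "u = \<one> \<oplus> \<pi> \<otimes> yy (\<rho> \<pi>)"
  have py: "\<pi> \<otimes> yy (\<rho> \<pi>) \<in> carrier R" "0 < v (\<pi> \<otimes> yy (\<rho> \<pi>))"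
    using pi(1) yr(1,2) v_mult[OF pi(1) yr(1)] pi_facts(9) by (auto simp: add_pos_nonneg)
  have u: "u \<in> carrier R" "0 \<le> v u" unfolding u_def using py v_nonneg_closed(2)[of \<one> "\<pi> \<otimes> yy (\<rho> \<pi>)"] by auto
  have "u \<ominus> \<one> = \<pi> \<otimes> yy (\<rho> \<pi>)" unfolding u_def using add_minus_cancel[OF py(1), of \<one>] by simp
  then have fu: "\<phi> u = \<one>\<^bsub>kR\<^esub>" using \<phi>_eq_iff[OF u, of \<one>] py(2) by simp
  define X2 where "X2 = u [^] (2::nat) \<otimes> \<rho> (yy (\<tau> \<pi>))"
  have u2: "u [^] (2::nat) \<in> carrier R" "0 \<le> v (u [^] (2::nat))" using u v_nonneg_closed(3)[OF u] by auto
  have X2: "X2 \<in> carrier R" "0 \<le> v X2" unfolding X2_def using u2 gy v_nonneg_closed(1)[OF u2 gy(2,3)] by auto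
  have tE: "\<tau> \<pi> \<in> E" using zt Z_E by blast
  have rR: "\<rho> \<pi> \<in> carrier R" "\<rho> (\<tau> \<pi>) \<in> carrier R" using Z_carrier zr Z_stable[OF r zt] by auto
  have pE2: "\<pi> [^] (2::nat) \<in> E" using pi_facts subringE(3,6)[OF ED(7)] by (simp add: numeral_2_eq_2)
  have "\<rho> (\<tau> \<pi>) \<ominus> \<rho> \<pi> = \<rho> (\<pi> [^] (2::nat) \<otimes> yy (\<tau> \<pi>))"
    using Gal_minus(1)[OF ED(7) r tE pi_facts(1)] yt(3) by simp
  also have "\<dots> = \<rho> \<pi> [^] (2::nat) \<otimes> \<rho> (yy (\<tau> \<pi>))"
    using Gal_memD(7)[OF r pE2 yt(6)] Gal_minus(4)[OF ED(7) r pi_facts(1)] by simp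
  also have "\<rho> \<pi> = \<pi> \<otimes> u" using yr(4) unfolding u_def .
  also have "(\<pi> \<otimes> u) [^] (2::nat) \<otimes> \<rho> (yy (\<tau> \<pi>)) = \<pi> [^] (2::nat) \<otimes> X2"
    unfolding X2_def using pi(1) u gy by (simp add: nat_pow_distrib m_assoc)
  finally have 1: "\<rho> (\<tau> \<pi>) \<ominus> \<pi> \<otimes> u = \<pi> [^] (2::nat) \<otimes> X2" .
  have ru: "\<rho> \<pi> = \<pi> \<otimes> u" using yr(4) unfolding u_def .
  have "\<rho> (\<tau> \<pi>) \<ominus> \<pi> = (\<rho> (\<tau> \<pi>) \<ominus> \<rho> \<pi>) \<oplus> (\<rho> \<pi> \<ominus> \<pi>)"
    using minus_add_minus[OF rR(2,1) pi(1)] .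
  also have "\<dots> = \<pi> [^] (2::nat) \<otimes> (X2 \<oplus> yy (\<rho> \<pi>))"
    using 1 yr(3) X2 yr(1) pi_facts(4) unfolding ru[symmetric] by (simp add: r_distr)
  finally have "yy (\<rho> (\<tau> \<pi>)) = X2 \<oplus> yy (\<rho> \<pi>)" using yy_unique X2 yr(1) by simp
  then have "Y (\<rho> \<otimes>\<^bsub>G\<^esub> \<tau>) = \<phi> X2 \<oplus>\<^bsub>kR\<^esub> Y \<rho>"
    unfolding Y_def Gal_mult_apply[OF r t pi_facts(1)] using \<phi>_simps(3)[OF X2 yr(1,2)] by simp
  also have "\<phi> X2 = act \<rho> (Y \<tau>)"
    unfolding X2_def Y_def act_\<phi>[OF r yt(6,2)]
    using \<phi>_simps(2)[OF u2 gy(2,3)] \<phi>_minus(3)[OF u, of 2] fu \<phi>_simps(1)[OF gy(2,3)] by simp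
  finally show ?thesis
    using k.a_comm[of "act \<rho> (Y \<tau>)" "Y \<rho>"] act_facts(1)[OF r Y_mem[OF t]] Y_mem[OF r] subfieldE(3)[OF \<kappa>_facts(2)] by auto
qed

lemma card_Y: "card (Y ` carrier G) = N"
proof -
  have "Y ` carrier G = (\<phi> \<circ> yy) ` Z" unfolding Y_def using Z_stable[OF _ pi_Z] transitive by (auto simp: image_iff)
  moreover have "inj_on (\<phi> \<circ> yy) Z" using yy_inj by (intro inj_onI) simp
  ultimately show ?thesis using card_image card_Z by metis
qed

text \<open>Roots are determined by their residues, so \<open>\<rho>\<close> fixes every
  \<open>\<tau> \<pi>\<close>, and by transitivity these are all the roots.\<close>

lemma Y_faithful:
  assumes r: "\<rho> \<in> carrier G" and e: "\<And>\<tau>. \<tau> \<in> carrier G \<Longrightarrow> Y (\<rho> \<otimes>\<^bsub>G\<^esub> \<tau>) = Y \<tau>"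
  shows "\<rho> = \<one>\<^bsub>G\<^esub>"
proof (rule Gal_one_if_fixes_Z[OF r])
  fix z assume "z \<in> Z"
  then obtain \<tau> where t: "\<tau> \<in> carrier G" "z = \<tau> \<pi>" using transitive by blast
  note z = Z_stable[OF t(1) pi_Z]
  show "\<rho> z = z" unfolding t(2)
    using e[OF t(1)] yy_inj[OF Z_stable[OF r z] z] unfolding Y_def Gal_mult_apply[OF r t(1) pi_facts(1)] by simp
qed

lemma Y_zero_iff:
  assumes r: "\<rho> \<in> carrier G" shows "Y \<rho> = \<zero>\<^bsub>kR\<^esub> \<longleftrightarrow> \<rho> \<pi> = \<pi>"
proof -
  have y: "yy \<pi> = \<zero>" using yy_unique[of \<zero> \<pi>] pi pi_facts by (simp add: a_minus_def r_neg)
  then have "Y \<rho> = \<zero>\<^bsub>kR\<^esub> \<longleftrightarrow> \<phi> (yy (\<rho> \<pi>)) = \<phi> (yy \<pi>)" unfolding Y_def by simp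
  also have "\<dots> \<longleftrightarrow> \<rho> \<pi> = \<pi>" using yy_inj[OF Z_stable[OF r pi_Z] pi_Z] by auto
  finally show ?thesis .
qed

lemma Gal_L: "carrier (Gal L E) = {\<rho> \<in> carrier G. \<rho> \<pi> = \<pi>}"
proof
  show "carrier (Gal L E) \<subseteq> {\<rho> \<in> carrier G. \<rho> \<pi> = \<pi>}"
    using Gal_carrier_mono[OF L_facts(2)] Gal_memD(5) L_facts(3) by blast
  show "{\<rho> \<in> carrier G. \<rho> \<pi> = \<pi>} \<subseteq> carrier (Gal L E)"
  proof
    fix \<rho> assume "\<rho> \<in> {\<rho> \<in> carrier G. \<rho> \<pi> = \<pi>}"
    then have r: "\<rho> \<in> carrier G" "\<rho> \<pi> = \<pi>" by auto
    have "\<rho> x = x" if x: "x \<in> L" for x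
    proof -
      obtain q where q: "set q \<subseteq> K" "x = eval q \<pi>" using L_rep[OF x] by blast
      show ?thesis unfolding q(2) using Gal_eval[OF ED(7,3) r(1) q(1) pi_facts(1)] r(2) by simp
    qed
    then show "\<rho> \<in> carrier (Gal L E)" using r unfolding Gal_iff by blast
  qed
qed

text \<open>\<open>Y \<rho>\<close> vanishes exactly when \<open>\<rho>\<close> fixes
  \<open>\<pi>\<close>. If only the identity does, then \<open>E = L\<close>, which has the residues
  of \<open>K\<close>. The use is contrapositive: a residue outside \<open>\<kappa>\<close> forces a
  nontrivial stabiliser of \<open>\<pi>\<close>.\<close>

lemma inert: assumes "\<And>\<rho>. \<rho> \<in> carrier G \<Longrightarrow> Y \<rho> = \<zero>\<^bsub>kR\<^esub> \<Longrightarrow> \<rho> = \<one>\<^bsub>G\<^esub>" shows "\<kappa>E = \<kappa>" "E = L"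
proof -
  have "fixed_field E (carrier (Gal L E)) = L" using fixed_field_Gal[OF galoisE L_facts(1,2) L_E] .
  moreover have "carrier (Gal L E) \<subseteq> {\<one>\<^bsub>G\<^esub>}" unfolding Gal_L using assms Y_zero_iff by auto
  ultimately show EL: "E = L" using L_E unfolding fixed_field_def Gal_one by fastforce
  have "\<phi> x \<in> \<kappa>" if "x \<in> E" "0 \<le> v x" for x
    using K_residue[of x] that unfolding EL \<kappa>_def by auto
  then have "\<kappa>E \<subseteq> \<kappa>" unfolding \<kappa>E_def by auto
  then show "\<kappa>E = \<kappa>" using \<kappa>_facts(3) by simp
qed

lemma Y_res: assumes "\<rho> \<in> carrier G"
  shows "ab N \<otimes>\<^bsub>kR\<^esub> Y \<rho> [^]\<^bsub>kR\<^esub> (p * p) \<oplus>\<^bsub>kR\<^esub> (ab p \<otimes>\<^bsub>kR\<^esub> Y \<rho> [^]\<^bsub>kR\<^esub> p \<oplus>\<^bsub>kR\<^esub> ab 1 \<otimes>\<^bsub>kR\<^esub> Y \<rho>) = \<zero>\<^bsub>kR\<^esub>"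
  using residue_root[OF Z_stable[OF assms pi_Z]] p_gt(4) unfolding Y_def by simp

end

section \<open>The Galois group from its action on residues\<close>

text \<open>Everything that the group theory takes from the fields. \<open>cardY\<close> accounts
  for \<open>p * p\<close> elements of the group; in the unsplit case the remaining factor
  \<open>p\<close> comes from \<open>inert\<close>.\<close>

locale residue_action = frobenius_field k p + G: group G for k (structure) and p and G :: "('g, 'm) monoid_scheme" +
  fixes \<kappa> \<kappa>E :: "'a set" and act :: "'g \<Rightarrow> 'a \<Rightarrow> 'a" and Y :: "'g \<Rightarrow> 'a" and w d :: 'a
  assumes kap: "subfield \<kappa> k" "subfield \<kappa>E k" "\<kappa> \<subseteq> \<kappa>E"
    and act_closed: "\<rho> \<in> carrier G \<Longrightarrow> c \<in> \<kappa>E \<Longrightarrow> act \<rho> c \<in> \<kappa>E"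
    and act_fix: "\<rho> \<in> carrier G \<Longrightarrow> c \<in> \<kappa> \<Longrightarrow> act \<rho> c = c"
    and act_add: "\<rho> \<in> carrier G \<Longrightarrow> c \<in> \<kappa>E \<Longrightarrow> e \<in> \<kappa>E \<Longrightarrow> act \<rho> (c \<oplus> e) = act \<rho> c \<oplus> act \<rho> e"
    and act_mult: "\<rho> \<in> carrier G \<Longrightarrow> c \<in> \<kappa>E \<Longrightarrow> e \<in> \<kappa>E \<Longrightarrow> act \<rho> (c \<otimes> e) = act \<rho> c \<otimes> act \<rho> e"
    and act_comp: "\<rho> \<in> carrier G \<Longrightarrow> \<tau> \<in> carrier G \<Longrightarrow> c \<in> \<kappa>E \<Longrightarrow> act (\<rho> \<otimes>\<^bsub>G\<^esub> \<tau>) c = act \<rho> (act \<tau> c)"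
    and Y_closed: "\<rho> \<in> carrier G \<Longrightarrow> Y \<rho> \<in> \<kappa>E"
    and Y_cocycle: "\<rho> \<in> carrier G \<Longrightarrow> \<tau> \<in> carrier G \<Longrightarrow> Y (\<rho> \<otimes>\<^bsub>G\<^esub> \<tau>) = Y \<rho> \<oplus> act \<rho> (Y \<tau>)"
    and w: "w \<in> \<kappa>" "w \<noteq> \<zero>" and d: "d \<in> \<kappa>" "d \<noteq> \<zero>"
    and S_Fp: "\<rho> \<in> carrier G \<Longrightarrow> S w (Y \<rho>) \<otimes> inv d \<in> Fp"
    and cardY: "card (Y ` carrier G) = p * p"
    and faithful: "\<rho> \<in> carrier G \<Longrightarrow> (\<And>\<tau>. \<tau> \<in> carrier G \<Longrightarrow> Y (\<rho> \<otimes>\<^bsub>G\<^esub> \<tau>) = Y \<tau>) \<Longrightarrow> \<rho> = \<one>\<^bsub>G\<^esub>"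
    and finG: "finite (carrier G)"
    and inert: "(\<And>\<rho>. \<rho> \<in> carrier G \<Longrightarrow> Y \<rho> = \<zero> \<Longrightarrow> \<rho> = \<one>\<^bsub>G\<^esub>) \<Longrightarrow> \<kappa>E = \<kappa>"
begin

lemma kE: "x \<in> \<kappa>E \<Longrightarrow> x \<in> carrier k" "x \<in> \<kappa> \<Longrightarrow> x \<in> \<kappa>E" "x \<in> \<kappa> \<Longrightarrow> x \<in> carrier k"
  using kap(3) subfieldE(3)[OF kap(2)] by blast+

lemmas sk = subringE(2-7)[OF subfieldE(1)[OF kap(1)]] and sE = subringE(2-7)[OF subfieldE(1)[OF kap(2)]]

lemma Fp_kappa: "Fp \<subseteq> \<kappa>"
proof -
  have "[n] \<cdot> \<one> \<in> \<kappa>" for n :: nat by (induction n) (use sk in auto)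
  then show ?thesis unfolding Fp_eq by blast
qed

lemma wd: "w \<in> carrier k" "d \<in> carrier k" "inv w \<in> carrier k" "inv d \<in> carrier k" "w \<otimes> inv w = \<one>" "d \<otimes> inv d = \<one>"
  "inv w \<otimes> w = \<one>" "inv d \<otimes> d = \<one>" "inv w \<in> \<kappa>" "inv d \<in> \<kappa>"
proof -
  show c: "w \<in> carrier k" "d \<in> carrier k" using w d kE by auto
  then have u: "w \<in> Units k" "d \<in> Units k" using w d field_Units by auto
  show "inv w \<in> carrier k" "inv d \<in> carrier k" "w \<otimes> inv w = \<one>" "d \<otimes> inv d = \<one>" "inv w \<otimes> w = \<one>" "inv d \<otimes> d = \<one>"
    using u by auto
  show "inv w \<in> \<kappa>" "inv d \<in> \<kappa>" using subfield_m_inv(1)[OF kap(1)] w d by auto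
qed

lemma sE_pow: "c \<in> \<kappa>E \<Longrightarrow> c [^] (n::nat) \<in> \<kappa>E"
  by (induction n) (use sE in auto)

lemma sk_pow: "c \<in> \<kappa> \<Longrightarrow> c [^] (n::nat) \<in> \<kappa>"
  by (induction n) (use sk in auto)

lemma act_pow:
  assumes "\<rho> \<in> carrier G" "c \<in> \<kappa>E" shows "act \<rho> (c [^] (n::nat)) = act \<rho> c [^] n"
proof (induction n)
  case 0
  then show ?case using act_fix[OF assms(1) sk(2)] by simp
next
  case (Suc n)
  then show ?case using act_mult[OF assms(1) sE_pow[OF assms(2)] assms(2)] by simp
qed

lemma act_a_inv:
  assumes "\<rho> \<in> carrier G" "c \<in> \<kappa>E" shows "act \<rho> (\<ominus> c) = \<ominus> act \<rho> c"
proof -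
  have "act \<rho> (\<ominus> c) \<oplus> act \<rho> c = \<zero>"
    using act_add[OF assms(1) sE(4)[OF assms(2)] assms(2)] act_fix[OF assms(1) sk(1)] kE(1)[OF assms(2)] by (simp add: l_neg)
  then show ?thesis using minus_equality kE act_closed assms sE(4) by metis
qed

lemma S_act:
  assumes "\<rho> \<in> carrier G" "c \<in> \<kappa>E" shows "S w (act \<rho> c) = act \<rho> (S w c)"
proof -
  have wp: "w [^] (p - 1) \<in> \<kappa>" using sk_pow w by simp
  have "act \<rho> (S w c) = act \<rho> (c [^] p) \<oplus> \<ominus> (act \<rho> (w [^] (p - 1) \<otimes> c))"
    unfolding S_def a_minus_def using act_add[OF assms(1) sE_pow[OF assms(2)] sE(4)[OF sE(5)[OF kE(2)[OF wp] assms(2)]]]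
      act_a_inv[OF assms(1) sE(5)[OF kE(2)[OF wp] assms(2)]] by simp
  also have "\<dots> = S w (act \<rho> c)"
    unfolding S_def a_minus_def using act_pow[OF assms] act_mult[OF assms(1) kE(2)[OF wp] assms(2)] act_fix[OF assms(1) wp] by simp
  finally show ?thesis ..
qed

definition alpha :: "'g \<Rightarrow> 'a" where "alpha \<rho> = S w (Y \<rho>) \<otimes> inv d"

lemma alpha_Fp: "\<rho> \<in> carrier G \<Longrightarrow> alpha \<rho> \<in> Fp"
  unfolding alpha_def by (rule S_Fp)

lemma S_Y: assumes "\<rho> \<in> carrier G" shows "S w (Y \<rho>) = alpha \<rho> \<otimes> d"
  unfolding alpha_def using S_closed[OF wd(1) kE(1)[OF Y_closed[OF assms]]] wd by (simp add: m_assoc)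

text \<open>Applying \<open>S w\<close> to the cocycle removes the twist:
  \<open>S w (Y \<tau>)\<close> is a prime field multiple of \<open>d\<close>, hence lies in
  \<open>\<kappa>\<close> and is fixed by the action.\<close>

lemma alpha_mult:
  assumes r: "\<rho> \<in> carrier G" and t: "\<tau> \<in> carrier G"
  shows "alpha (\<rho> \<otimes>\<^bsub>G\<^esub> \<tau>) = alpha \<rho> \<oplus> alpha \<tau>"
proof -
  have yr: "Y \<rho> \<in> carrier k" and yt: "Y \<tau> \<in> \<kappa>E" and ay: "act \<rho> (Y \<tau>) \<in> carrier k"
    using Y_closed r t act_closed kE(1) by auto
  have ad: "alpha \<tau> \<otimes> d \<in> \<kappa>" using alpha_Fp[OF t] Fp_kappa d sk(5) by blast
  have "S w (Y (\<rho> \<otimes>\<^bsub>G\<^esub> \<tau>)) = S w (Y \<rho>) \<oplus> S w (Y \<tau>)"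
    unfolding Y_cocycle[OF r t] using S_add[OF wd(1) yr ay] S_act[OF r yt] S_Y[OF t] act_fix[OF r ad] by simp
  then show ?thesis unfolding alpha_def using S_closed[OF wd(1)] yr kE(1)[OF yt] wd(4) by (simp add: l_distr)
qed

text \<open>Injectivity is \<open>faithful\<close>: once the cocycle is untwisted,
  \<open>Y \<rho> = 0\<close> already makes left multiplication by \<open>\<rho>\<close> invisible
  to \<open>Y\<close>. Commutativity and exponent \<open>p\<close> are then inherited from the
  additive group.\<close>

lemma rational_case:
  assumes rat: "\<And>\<rho>. \<rho> \<in> carrier G \<Longrightarrow> Y \<rho> \<in> \<kappa>"
  shows "comm_group G" "\<And>\<rho>. \<rho> \<in> carrier G \<Longrightarrow> \<rho> [^]\<^bsub>G\<^esub> p = \<one>\<^bsub>G\<^esub>" "card (carrier G) = p * p" "\<And>\<rho>. \<rho> \<in> carrier G \<Longrightarrow> Y \<rho> = \<zero> \<Longrightarrow> \<rho> = \<one>\<^bsub>G\<^esub>"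
proof -
  have c: "Y \<rho> \<in> carrier k" if "\<rho> \<in> carrier G" for \<rho> using Y_closed[OF that] kE by blast
  have hom: "Y (\<rho> \<otimes>\<^bsub>G\<^esub> \<tau>) = Y \<rho> \<oplus> Y \<tau>" if "\<rho> \<in> carrier G" "\<tau> \<in> carrier G" for \<rho> \<tau>
    using Y_cocycle[OF that] act_fix[OF that(1) rat[OF that(2)]] by simp
  have Y1: "Y \<one>\<^bsub>G\<^esub> = \<zero>" using hom[of "\<one>\<^bsub>G\<^esub>" "\<one>\<^bsub>G\<^esub>"] c[of "\<one>\<^bsub>G\<^esub>"] add.l_cancel_one by auto
  show ker: "\<rho> = \<one>\<^bsub>G\<^esub>" if r: "\<rho> \<in> carrier G" "Y \<rho> = \<zero>" for \<rho>
    by (rule faithful[OF r(1)]) (use hom[OF r(1)] c r(2) in simp)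
  have inj: "inj_on Y (carrier G)"
  proof (rule inj_onI)
    fix \<rho> \<tau> assume r: "\<rho> \<in> carrier G" and t: "\<tau> \<in> carrier G" and e: "Y \<rho> = Y \<tau>"
    have "Y (inv\<^bsub>G\<^esub> \<rho> \<otimes>\<^bsub>G\<^esub> \<tau>) = \<zero>"
      using hom[OF G.inv_closed[OF r] t] hom[OF G.inv_closed[OF r] r] e r Y1 by simp
    then have "inv\<^bsub>G\<^esub> \<rho> \<otimes>\<^bsub>G\<^esub> \<tau> = \<one>\<^bsub>G\<^esub>" using ker r t by simp
    then show "\<rho> = \<tau>" using r t by (metis G.inv_closed G.inv_equality G.inv_inv)
  qed
  show "card (carrier G) = p * p" using card_image[OF inj] cardY by simp
  show "comm_group G"
  proof (rule G.group_comm_groupI)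
    fix \<rho> \<tau> assume r: "\<rho> \<in> carrier G" and t: "\<tau> \<in> carrier G"
    show "\<rho> \<otimes>\<^bsub>G\<^esub> \<tau> = \<tau> \<otimes>\<^bsub>G\<^esub> \<rho>" using inj_onD[OF inj, of "\<rho> \<otimes>\<^bsub>G\<^esub> \<tau>" "\<tau> \<otimes>\<^bsub>G\<^esub> \<rho>"] hom r t c a_comm by simp
  qed
  fix \<rho> assume r: "\<rho> \<in> carrier G"
  have "Y (\<rho> [^]\<^bsub>G\<^esub> n) = [n] \<cdot> Y \<rho>" for n :: nat
    by (induction n) (use Y1 hom r c in \<open>auto\<close>)
  moreover have "[p] \<cdot> Y \<rho> = \<zero>" using add_pow_ldistr[of \<one> "Y \<rho>" p] char_p c[OF r] by simp
  ultimately show "\<rho> [^]\<^bsub>G\<^esub> p = \<one>\<^bsub>G\<^esub>" using ker[of "\<rho> [^]\<^bsub>G\<^esub> p"] r by simp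
qed

end

section \<open>Heisenberg coordinates in the unsplit case\<close>

locale residue_action_unsplit = residue_action k p G \<kappa> \<kappa>E act Y w d
  for k :: "('a, 'b) ring_scheme" (structure) and p and G :: "('g, 'm) monoid_scheme" and \<kappa> \<kappa>E act Y w d +
  assumes unsplit: "\<exists>\<rho> \<in> carrier G. Y \<rho> \<notin> \<kappa>"
begin

definition \<eta> :: 'a where "\<eta> = (SOME e. e \<in> \<kappa>E \<and> S w e = d)"

text \<open>If \<open>Y \<rho>\<close> is outside \<open>\<kappa>\<close>, then
  \<open>alpha \<rho>\<close> is nonzero, as otherwise \<open>Y \<rho>\<close> would be a prime
  field multiple of \<open>w\<close>. Dividing \<open>Y \<rho>\<close> by
  \<open>alpha \<rho>\<close> gives a solution of \<open>S w e = d\<close>.\<close>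

lemma eta: "\<eta> \<in> \<kappa>E" "S w \<eta> = d" "\<eta> \<in> carrier k"
proof -
  obtain \<rho> where r: "\<rho> \<in> carrier G" "Y \<rho> \<notin> \<kappa>" using unsplit by blast
  have yE: "Y \<rho> \<in> \<kappa>E" "Y \<rho> \<in> carrier k" using Y_closed[OF r(1)] kE by auto
  have a0: "alpha \<rho> \<noteq> \<zero>"
  proof
    assume "alpha \<rho> = \<zero>"
    then have "S w (Y \<rho>) = \<zero>" using S_Y[OF r(1)] wd by simp
    from S_zero_imp[OF wd(1) w(2) yE(2) this] have "Y \<rho> \<in> \<kappa>" using Fp_kappa w(1) sk(5) by (metis subset_iff)
    then show False using r by simp
  qed
  note i = Fp_inv[OF alpha_Fp[OF r(1)] a0]
  have aR: "alpha \<rho> \<in> carrier k" using alpha_Fp[OF r(1)] Fp_closed(6) by blast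
  have "S w (inv (alpha \<rho>) \<otimes> Y \<rho>) = inv (alpha \<rho>) \<otimes> (alpha \<rho> \<otimes> d)"
    using S_smult[OF wd(1) yE(2) i(1)] S_Y[OF r(1)] by simp
  also have "\<dots> = d" using i aR wd by (simp add: m_assoc[symmetric] m_comm[of "inv (alpha \<rho>)"])
  finally have "S w (inv (alpha \<rho>) \<otimes> Y \<rho>) = d" .
  moreover have "inv (alpha \<rho>) \<otimes> Y \<rho> \<in> \<kappa>E" using i(1) Fp_kappa kE(2) yE(1) sE(5) by blast
  ultimately have "\<eta> \<in> \<kappa>E \<and> S w \<eta> = d" unfolding \<eta>_def by (intro someI[of "\<lambda>e. e \<in> \<kappa>E \<and> S w e = d"]) simp
  then show "\<eta> \<in> \<kappa>E" "S w \<eta> = d" "\<eta> \<in> carrier k" using kE by auto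
qed

definition beta :: "'g \<Rightarrow> 'a" where "beta \<rho> = (Y \<rho> \<ominus> alpha \<rho> \<otimes> \<eta>) \<otimes> inv w"
definition gamma :: "'g \<Rightarrow> 'a" where "gamma \<rho> = (act \<rho> \<eta> \<ominus> \<eta>) \<otimes> inv w"

lemma S_minus: "x \<in> carrier k \<Longrightarrow> y \<in> carrier k \<Longrightarrow> S w (x \<ominus> y) = S w x \<ominus> S w y"
  unfolding a_minus_def using S_add[OF wd(1), of x "\<ominus> y"] S_a_inv[OF wd(1), of y] by simp

lemma add_minus_self: "x \<in> carrier k \<Longrightarrow> y \<in> carrier k \<Longrightarrow> x = y \<oplus> (x \<ominus> y)"
  by (simp add: a_minus_def a_lcomm[of y] r_neg)

lemma beta: assumes r: "\<rho> \<in> carrier G" shows "beta \<rho> \<in> Fp" "Y \<rho> = alpha \<rho> \<otimes> \<eta> \<oplus> beta \<rho> \<otimes> w"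
proof -
  have y: "Y \<rho> \<in> carrier k" and a: "alpha \<rho> \<in> Fp" "alpha \<rho> \<in> carrier k"
    using Y_closed[OF r] kE alpha_Fp[OF r] Fp_closed(6) by auto
  let ?x = "Y \<rho> \<ominus> alpha \<rho> \<otimes> \<eta>"
  have x: "?x \<in> carrier k" using y a eta by simp
  have "S w ?x = \<zero>" using S_minus[OF y, of "alpha \<rho> \<otimes> \<eta>"] S_smult[OF wd(1) eta(3) a(1)] S_Y[OF r] eta a(2) wd
    by (simp add: a_minus_def r_neg)
  note z = S_zero_imp[OF wd(1) w(2) x this]
  show "beta \<rho> \<in> Fp" unfolding beta_def using z(1) .
  show "Y \<rho> = alpha \<rho> \<otimes> \<eta> \<oplus> beta \<rho> \<otimes> w" unfolding beta_def using z(2) add_minus_self[of "Y \<rho>" "alpha \<rho> \<otimes> \<eta>"] y a(2) eta(3) by simp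
qed

lemma gamma: assumes r: "\<rho> \<in> carrier G" shows "gamma \<rho> \<in> Fp" "act \<rho> \<eta> = \<eta> \<oplus> gamma \<rho> \<otimes> w"
proof -
  have y: "act \<rho> \<eta> \<in> carrier k" using act_closed[OF r eta(1)] kE by auto
  let ?x = "act \<rho> \<eta> \<ominus> \<eta>"
  have x: "?x \<in> carrier k" using y eta by simp
  have "S w ?x = \<zero>" using S_minus[OF y eta(3)] S_act[OF r eta(1)] eta(2) act_fix[OF r d(1)] wd by (simp add: a_minus_def r_neg)
  note z = S_zero_imp[OF wd(1) w(2) x this]
  show "gamma \<rho> \<in> Fp" unfolding gamma_def using z(1) .
  show "act \<rho> \<eta> = \<eta> \<oplus> gamma \<rho> \<otimes> w" unfolding gamma_def using z(2) add_minus_self[OF y eta(3)] by simp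
qed

lemma coord_closed:
  assumes "\<rho> \<in> carrier G" shows "alpha \<rho> \<in> carrier k" "beta \<rho> \<in> carrier k" "gamma \<rho> \<in> carrier k"
    "alpha \<rho> \<in> \<kappa>" "beta \<rho> \<otimes> w \<in> \<kappa>" "gamma \<rho> \<otimes> w \<in> \<kappa>"
  using alpha_Fp[OF assms] beta(1)[OF assms] gamma(1)[OF assms] Fp_closed(6) Fp_kappa w(1) sk(5) by auto

lemma gamma_mult:
  assumes r: "\<rho> \<in> carrier G" and t: "\<tau> \<in> carrier G"
  shows "gamma (\<rho> \<otimes>\<^bsub>G\<^esub> \<tau>) = gamma \<rho> \<oplus> gamma \<tau>"
proof -
  note cr = coord_closed[OF r] and ct = coord_closed[OF t] and crt = coord_closed[OF G.m_closed[OF r t]]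
  have "act (\<rho> \<otimes>\<^bsub>G\<^esub> \<tau>) \<eta> = act \<rho> (\<eta> \<oplus> gamma \<tau> \<otimes> w)" using act_comp[OF r t eta(1)] gamma(2)[OF t] by simp
  also have "\<dots> = \<eta> \<oplus> gamma \<rho> \<otimes> w \<oplus> gamma \<tau> \<otimes> w"
    using act_add[OF r eta(1) kE(2)[OF ct(6)]] act_fix[OF r ct(6)] gamma(2)[OF r] by simp
  also have "\<dots> = \<eta> \<oplus> (gamma \<rho> \<oplus> gamma \<tau>) \<otimes> w" using eta wd cr ct by (simp add: l_distr a_assoc)
  finally have "gamma (\<rho> \<otimes>\<^bsub>G\<^esub> \<tau>) \<otimes> w = (gamma \<rho> \<oplus> gamma \<tau>) \<otimes> w"
    using gamma(2)[OF G.m_closed[OF r t]] eta(3) wd cr ct crt by simp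
  then show ?thesis using m_rcancel[OF w(2) wd(1)] cr ct crt by simp
qed

text \<open>\<open>\<rho>\<close> moves \<open>\<eta>\<close> by
  \<open>gamma \<rho> \<otimes> w\<close>, so the \<open>\<eta>\<close>-part of
  \<open>Y \<tau>\<close> adds \<open>alpha \<tau> \<otimes> gamma \<rho>\<close> to the coordinate
  along \<open>w\<close>. This mixed term is what makes the group a Heisenberg group.\<close>

lemma beta_mult:
  assumes r: "\<rho> \<in> carrier G" and t: "\<tau> \<in> carrier G"
  shows "beta (\<rho> \<otimes>\<^bsub>G\<^esub> \<tau>) = beta \<rho> \<oplus> beta \<tau> \<oplus> alpha \<tau> \<otimes> gamma \<rho>"
proof -
  note cr = coord_closed[OF r] and ct = coord_closed[OF t] and crt = coord_closed[OF G.m_closed[OF r t]]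
  have ae: "alpha \<tau> \<otimes> \<eta> \<in> \<kappa>E" using kE(2)[OF ct(4)] eta(1) sE(5) by blast
  have "act \<rho> (Y \<tau>) = alpha \<tau> \<otimes> (\<eta> \<oplus> gamma \<rho> \<otimes> w) \<oplus> beta \<tau> \<otimes> w"
    unfolding beta(2)[OF t] using act_add[OF r ae kE(2)[OF ct(5)]] act_mult[OF r kE(2)[OF ct(4)] eta(1)]
      act_fix[OF r ct(4)] act_fix[OF r ct(5)] gamma(2)[OF r] by simp
  then have "Y (\<rho> \<otimes>\<^bsub>G\<^esub> \<tau>) = (alpha \<rho> \<otimes> \<eta> \<oplus> beta \<rho> \<otimes> w) \<oplus> (alpha \<tau> \<otimes> (\<eta> \<oplus> gamma \<rho> \<otimes> w) \<oplus> beta \<tau> \<otimes> w)"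
    using Y_cocycle[OF r t] beta(2)[OF r] by simp
  also have "\<dots> = (alpha \<rho> \<oplus> alpha \<tau>) \<otimes> \<eta> \<oplus> (beta \<rho> \<oplus> beta \<tau> \<oplus> alpha \<tau> \<otimes> gamma \<rho>) \<otimes> w"
    using eta(3) wd(1) cr(1-3) ct(1-3) by (simp add: l_distr r_distr a_ac m_ac)
  finally have "beta (\<rho> \<otimes>\<^bsub>G\<^esub> \<tau>) \<otimes> w = (beta \<rho> \<oplus> beta \<tau> \<oplus> alpha \<tau> \<otimes> gamma \<rho>) \<otimes> w"
    using beta(2)[OF G.m_closed[OF r t]] alpha_mult[OF r t] eta(3) wd(1) cr(1-3) ct(1-3) crt(1-3) by simp
  then show ?thesis using m_rcancel[OF w(2) wd(1)] cr ct crt by simp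
qed

lemma coord_one: "alpha \<one>\<^bsub>G\<^esub> = \<zero>" "beta \<one>\<^bsub>G\<^esub> = \<zero>" "gamma \<one>\<^bsub>G\<^esub> = \<zero>"
proof -
  note c = coord_closed[OF G.one_closed]
  show a: "alpha \<one>\<^bsub>G\<^esub> = \<zero>" using alpha_mult[of "\<one>\<^bsub>G\<^esub>" "\<one>\<^bsub>G\<^esub>"] c add.l_cancel_one by auto
  show "gamma \<one>\<^bsub>G\<^esub> = \<zero>" using gamma_mult[of "\<one>\<^bsub>G\<^esub>" "\<one>\<^bsub>G\<^esub>"] c add.l_cancel_one by auto
  show "beta \<one>\<^bsub>G\<^esub> = \<zero>" using beta_mult[of "\<one>\<^bsub>G\<^esub>" "\<one>\<^bsub>G\<^esub>"] a c add.l_cancel_one by auto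
qed

lemma eta_not_kappa: "\<eta> \<notin> \<kappa>"
proof
  assume "\<eta> \<in> \<kappa>"
  then have "Y \<rho> \<in> \<kappa>" if "\<rho> \<in> carrier G" for \<rho>
    unfolding beta(2)[OF that] using coord_closed[OF that] sk(5,6) by blast
  then show False using unsplit by blast
qed

lemma one_if_zero:
  assumes r: "\<rho> \<in> carrier G" "alpha \<rho> = \<zero>" "beta \<rho> = \<zero>" "gamma \<rho> = \<zero>" shows "\<rho> = \<one>\<^bsub>G\<^esub>"
proof (rule faithful[OF r(1)])
  fix \<tau> assume t: "\<tau> \<in> carrier G"
  note rt = G.m_closed[OF r(1) t] and c = coord_closed[OF t]
  show "Y (\<rho> \<otimes>\<^bsub>G\<^esub> \<tau>) = Y \<tau>"
    unfolding beta(2)[OF t] beta(2)[OF rt] using alpha_mult[OF r(1) t] beta_mult[OF r(1) t] r c by simp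
qed

lemma Y_zero_iff_coord: assumes r: "\<rho> \<in> carrier G" shows "Y \<rho> = \<zero> \<longleftrightarrow> alpha \<rho> = \<zero> \<and> beta \<rho> = \<zero>"
proof
  assume y: "Y \<rho> = \<zero>"
  have "S w \<zero> = \<zero>" unfolding S_def using frob_zero wd by (simp add: a_minus_def)
  then have a: "alpha \<rho> = \<zero>" unfolding alpha_def y using wd by simp
  moreover have "beta \<rho> = \<zero>" unfolding beta_def y a using wd eta by (simp add: a_minus_def)
  ultimately show "alpha \<rho> = \<zero> \<and> beta \<rho> = \<zero>" by simp
qed (use beta(2)[OF r] eta wd in simp)

definition Psi :: "'g \<Rightarrow> 'a \<times> 'a \<times> 'a" where "Psi \<rho> = (alpha \<rho>, beta \<rho>, gamma \<rho>)"

lemma coord_inj: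
  assumes r: "\<rho> \<in> carrier G" and t: "\<tau> \<in> carrier G" and e: "alpha \<rho> = alpha \<tau>" "beta \<rho> = beta \<tau>" "gamma \<rho> = gamma \<tau>"
  shows "\<rho> = \<tau>"
proof -
  define \<delta> where "\<delta> = inv\<^bsub>G\<^esub> \<rho> \<otimes>\<^bsub>G\<^esub> \<tau>"
  have dG: "\<delta> \<in> carrier G" unfolding \<delta>_def using r t by simp
  have td: "\<tau> = \<rho> \<otimes>\<^bsub>G\<^esub> \<delta>" unfolding \<delta>_def using r t by (simp add: G.m_assoc[symmetric])
  note c = coord_closed[OF r] coord_closed[OF dG]
  have a: "alpha \<delta> = \<zero>" using alpha_mult[OF r dG] e(1) c unfolding td[symmetric] by simp
  have "gamma \<delta> = \<zero>" using gamma_mult[OF r dG] e(3) c unfolding td[symmetric] by simp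
  moreover have "beta \<delta> = \<zero>" using beta_mult[OF r dG] e(2) a c unfolding td[symmetric] by simp
  ultimately have "\<delta> = \<one>\<^bsub>G\<^esub>" using one_if_zero[OF dG a] by simp
  then show ?thesis using td r by simp
qed

text \<open>The \<open>p * p\<close> values of \<open>Y\<close> force \<open>(alpha, beta)\<close>
  onto \<open>Fp \<times> Fp\<close>. Since \<open>\<eta>\<close> is a residue outside
  \<open>\<kappa>\<close>, \<open>inert\<close> gives \<open>h\<close> different from the identity
  with \<open>alpha\<close> and \<open>beta\<close> zero, hence \<open>gamma h\<close> nonzero;
  powers of \<open>h\<close> then adjust the third coordinate.\<close>

lemma coord_surj:
  assumes abc: "a \<in> Fp" "b \<in> Fp" "c \<in> Fp" shows "\<exists>\<rho> \<in> carrier G. alpha \<rho> = a \<and> beta \<rho> = b \<and> gamma \<rho> = c"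
proof -
  let ?AB = "(\<lambda>\<rho>. (alpha \<rho>, beta \<rho>)) ` carrier G"
  have "Y ` carrier G = (\<lambda>(a, b). a \<otimes> \<eta> \<oplus> b \<otimes> w) ` ?AB" using beta(2) by (auto simp: image_iff)
  then have "p * p \<le> card ?AB" using card_image_le[of ?AB "\<lambda>(a, b). a \<otimes> \<eta> \<oplus> b \<otimes> w"] finG cardY by simp
  moreover have "?AB \<subseteq> Fp \<times> Fp" using alpha_Fp beta(1) by auto
  moreover have "card (Fp \<times> Fp) = p * p" "finite (Fp \<times> Fp)" using card_Fp finite_Fp by (auto simp: card_cartesian_product)
  ultimately have "?AB = Fp \<times> Fp" using card_seteq[of "Fp \<times> Fp" ?AB] by simp
  then obtain \<rho> where r: "\<rho> \<in> carrier G" "alpha \<rho> = a" "beta \<rho> = b" using abc by (auto simp: image_iff set_eq_iff) (metis (full_types))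
  have "\<kappa>E \<noteq> \<kappa>" using eta(1) eta_not_kappa by auto
  then obtain h where h: "h \<in> carrier G" "Y h = \<zero>" "h \<noteq> \<one>\<^bsub>G\<^esub>" using inert by blast
  have h0: "alpha h = \<zero>" "beta h = \<zero>" using Y_zero_iff_coord[OF h(1)] h(2) by auto
  have g0: "gamma h \<noteq> \<zero>" using one_if_zero[OF h(1) h0] h(3) by blast
  have hn: "alpha (h [^]\<^bsub>G\<^esub> n) = \<zero> \<and> beta (h [^]\<^bsub>G\<^esub> n) = \<zero> \<and> gamma (h [^]\<^bsub>G\<^esub> n) = [n] \<cdot> gamma h" for n :: nat
  proof (induction n)
    case 0
    then show ?case using coord_one by simp
  next
    case (Suc n)
    have hnG: "h [^]\<^bsub>G\<^esub> n \<in> carrier G" using h by simp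
    show ?case using Suc alpha_mult[OF hnG h(1)] beta_mult[OF hnG h(1)] gamma_mult[OF hnG h(1)] h0 coord_closed[OF h(1)] by simp
  qed
  have "c \<oplus> \<ominus> gamma \<rho> \<in> Fp" using Fp_closed(3,5) abc(3) gamma(1)[OF r(1)] by simp
  then obtain n :: nat where n: "c \<oplus> \<ominus> gamma \<rho> = [n] \<cdot> gamma h" using Fp_multiples[OF gamma(1)[OF h(1)] g0] by blast
  \<comment> \<open>Multiplication by a power of \<open>h\<close> on the right leaves
    \<open>beta\<close> alone, because the mixed term contains
    \<open>alpha \<tau> = \<zero>\<close>.\<close>
  define \<tau> where "\<tau> = h [^]\<^bsub>G\<^esub> n"
  have t: "\<tau> \<in> carrier G" "alpha \<tau> = \<zero>" "beta \<tau> = \<zero>" "gamma \<tau> = c \<oplus> \<ominus> gamma \<rho>" unfolding \<tau>_def n using hn h by auto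
  note cl = coord_closed[OF r(1)]
  have cR: "c \<in> carrier k" using abc Fp_closed(6) by blast
  have "gamma (\<rho> \<otimes>\<^bsub>G\<^esub> \<tau>) = c" using gamma_mult[OF r(1) t(1)] t cl cR by (simp add: a_lcomm[of _ c] r_neg)
  moreover have "alpha (\<rho> \<otimes>\<^bsub>G\<^esub> \<tau>) = a" "beta (\<rho> \<otimes>\<^bsub>G\<^esub> \<tau>) = b"
    using alpha_mult[OF r(1) t(1)] beta_mult[OF r(1) t(1)] t(2,3) cl r(2,3) by auto
  ultimately show ?thesis using r(1) t(1) G.m_closed by blast
qed

lemma card_coords:
  assumes "A \<subseteq> Fp" "B \<subseteq> Fp" "C \<subseteq> Fp"
  shows "card {\<rho> \<in> carrier G. alpha \<rho> \<in> A \<and> beta \<rho> \<in> B \<and> gamma \<rho> \<in> C} = card A * (card B * card C)"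
proof -
  have "bij_betw Psi {\<rho> \<in> carrier G. alpha \<rho> \<in> A \<and> beta \<rho> \<in> B \<and> gamma \<rho> \<in> C} (A \<times> (B \<times> C))"
    unfolding bij_betw_def
  proof
    show "inj_on Psi {\<rho> \<in> carrier G. alpha \<rho> \<in> A \<and> beta \<rho> \<in> B \<and> gamma \<rho> \<in> C}"
      unfolding Psi_def by (intro inj_onI coord_inj) auto
    show "Psi ` {\<rho> \<in> carrier G. alpha \<rho> \<in> A \<and> beta \<rho> \<in> B \<and> gamma \<rho> \<in> C} = A \<times> (B \<times> C)"
    proof
      show "A \<times> (B \<times> C) \<subseteq> Psi ` {\<rho> \<in> carrier G. alpha \<rho> \<in> A \<and> beta \<rho> \<in> B \<and> gamma \<rho> \<in> C}"
      proof
        fix u assume "u \<in> A \<times> (B \<times> C)"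
        then obtain a b c where u: "u = (a, b, c)" "a \<in> A" "b \<in> B" "c \<in> C" by auto
        obtain \<rho> where "\<rho> \<in> carrier G" "alpha \<rho> = a" "beta \<rho> = b" "gamma \<rho> = c" using coord_surj[of a b c] u assms by blast
        then show "u \<in> Psi ` {\<rho> \<in> carrier G. alpha \<rho> \<in> A \<and> beta \<rho> \<in> B \<and> gamma \<rho> \<in> C}"
          using u unfolding Psi_def by (intro image_eqI[of _ _ \<rho>]) auto
      qed
    qed (auto simp: Psi_def)
  qed
  then show ?thesis using bij_betw_same_card by (force simp: card_cartesian_product)
qed

end

section \<open>Subgroups of the Heisenberg group\<close>

lemma (in group) card_subgroup_dvd:
  assumes "subgroup A G" "subgroup B G" "A \<subseteq> B" "finite B" shows "card A dvd card B"
proof -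
  interpret B: group "G\<lparr>carrier := B\<rparr>" using subgroup_imp_group[OF assms(2)] .
  have "subgroup A (G\<lparr>carrier := B\<rparr>)" using subgroup_incl[OF assms(1-3)] .
  then have "card A dvd order (G\<lparr>carrier := B\<rparr>)" using B.lagrange by (metis dvd_triv_right)
  then show ?thesis unfolding Coset.order_def by simp
qed

lemma (in group) subgroup_between:
  assumes p: "Factorial_Ring.prime (p::nat)" and s: "subgroup A G" "subgroup B G" "subgroup C G" "A \<subseteq> B" "B \<subseteq> C"
    and fin: "finite C" and card: "card C = p * card A"
  shows "B = A \<or> B = C"
proof -
  have finB: "finite B" "finite A" using finite_subset[OF s(5) fin] finite_subset[OF s(4)] by auto
  obtain a b where a: "card B = card A * a" and b: "card C = card B * b"
    using card_subgroup_dvd[OF s(1,2,4) finB(1)] card_subgroup_dvd[OF s(2,3,5) fin] unfolding dvd_def by blast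
  have A0: "card A > 0" using finB(2) subgroup.one_closed[OF s(1)] by (auto simp: card_gt_0_iff)
  have "p = a * b" using a b card A0 by (simp add: mult.assoc)
  then consider "a = 1" | "b = 1" using prime_product p by metis
  then show ?thesis
  proof cases
    case 1
    then show ?thesis using card_subset_eq[OF finB(1) s(4)] a by simp
  next
    case 2
    then show ?thesis using card_subset_eq[OF fin s(5)] b by simp
  qed
qed

context residue_action_unsplit begin

text \<open>\<open>Z0\<close> is the centre, \<open>H0\<close> the subgroup on which
  \<open>Y\<close> vanishes, \<open>I0\<close> the stabiliser of \<open>\<eta>\<close>, and
  \<open>C0\<close> a complement of \<open>M0\<close>.\<close>

definition "M0 = {\<rho> \<in> carrier G. alpha \<rho> = \<zero>}"
definition "Z0 = {\<rho> \<in> carrier G. alpha \<rho> = \<zero> \<and> gamma \<rho> = \<zero>}"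
definition "H0 = {\<rho> \<in> carrier G. alpha \<rho> = \<zero> \<and> beta \<rho> = \<zero>}"
definition "I0 = {\<rho> \<in> carrier G. gamma \<rho> = \<zero>}"
definition "C0 = {\<rho> \<in> carrier G. beta \<rho> = \<zero> \<and> gamma \<rho> = \<zero>}"

lemma coord_inv:
  assumes r: "\<rho> \<in> carrier G"
  shows "alpha \<rho> = \<zero> \<Longrightarrow> alpha (inv\<^bsub>G\<^esub> \<rho>) = \<zero>" "gamma \<rho> = \<zero> \<Longrightarrow> gamma (inv\<^bsub>G\<^esub> \<rho>) = \<zero>"
    "alpha \<rho> = \<zero> \<or> gamma \<rho> = \<zero> \<Longrightarrow> beta \<rho> = \<zero> \<Longrightarrow> beta (inv\<^bsub>G\<^esub> \<rho>) = \<zero>"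
proof -
  have i: "inv\<^bsub>G\<^esub> \<rho> \<in> carrier G" using r by simp
  note c = coord_closed[OF r] coord_closed[OF i]
  show a: "alpha (inv\<^bsub>G\<^esub> \<rho>) = \<zero>" if "alpha \<rho> = \<zero>" using alpha_mult[OF r i] coord_one r c that by simp
  show g: "gamma (inv\<^bsub>G\<^esub> \<rho>) = \<zero>" if "gamma \<rho> = \<zero>" using gamma_mult[OF r i] coord_one r c that by simp
  show "beta (inv\<^bsub>G\<^esub> \<rho>) = \<zero>" if h: "alpha \<rho> = \<zero> \<or> gamma \<rho> = \<zero>" "beta \<rho> = \<zero>"
  proof -
    have "alpha (inv\<^bsub>G\<^esub> \<rho>) \<otimes> gamma \<rho> = \<zero>" using h(1) a c by auto
    then show ?thesis using beta_mult[OF r i] coord_one r c h(2) by simp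
  qed
qed

lemma subgroups: "subgroup M0 G" "subgroup Z0 G" "subgroup H0 G" "subgroup I0 G" "subgroup C0 G"
  unfolding M0_def Z0_def H0_def I0_def C0_def
  by (rule G.subgroupI; use G.one_closed coord_one coord_inv alpha_mult beta_mult gamma_mult coord_closed in \<open>auto\<close>)+

lemma cards: "card M0 = p * p" "card Z0 = p" "card H0 = p" "card I0 = p * p" "card C0 = p" "card (carrier G) = p * (p * p)"
proof -
  have z: "{\<zero>} \<subseteq> Fp" using Fp_closed(1) by simp
  note m = alpha_Fp beta(1) gamma(1)
  have "M0 = {\<rho> \<in> carrier G. alpha \<rho> \<in> {\<zero>} \<and> beta \<rho> \<in> Fp \<and> gamma \<rho> \<in> Fp}"
    "Z0 = {\<rho> \<in> carrier G. alpha \<rho> \<in> {\<zero>} \<and> beta \<rho> \<in> Fp \<and> gamma \<rho> \<in> {\<zero>}}"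
    "H0 = {\<rho> \<in> carrier G. alpha \<rho> \<in> {\<zero>} \<and> beta \<rho> \<in> {\<zero>} \<and> gamma \<rho> \<in> Fp}"
    "I0 = {\<rho> \<in> carrier G. alpha \<rho> \<in> Fp \<and> beta \<rho> \<in> Fp \<and> gamma \<rho> \<in> {\<zero>}}"
    "C0 = {\<rho> \<in> carrier G. alpha \<rho> \<in> Fp \<and> beta \<rho> \<in> {\<zero>} \<and> gamma \<rho> \<in> {\<zero>}}"
    "carrier G = {\<rho> \<in> carrier G. alpha \<rho> \<in> Fp \<and> beta \<rho> \<in> Fp \<and> gamma \<rho> \<in> Fp}"
    unfolding M0_def Z0_def H0_def I0_def C0_def using m by auto
  then show "card M0 = p * p" "card Z0 = p" "card H0 = p" "card I0 = p * p" "card C0 = p" "card (carrier G) = p * (p * p)"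
    using card_coords[OF z order_refl order_refl] card_coords[OF z order_refl z] card_coords[OF z z order_refl]
      card_coords[OF order_refl order_refl z] card_coords[OF order_refl z z] card_coords[OF order_refl order_refl order_refl] card_Fp
    by auto
qed

lemma M0_mult:
  assumes "\<rho> \<in> M0" "\<tau> \<in> M0" shows "\<rho> \<otimes>\<^bsub>G\<^esub> \<tau> = \<tau> \<otimes>\<^bsub>G\<^esub> \<rho>"
  using assms unfolding M0_def
  by (intro coord_inj) (auto simp: alpha_mult beta_mult gamma_mult coord_closed intro: a_comm)

lemma char_p_mult: "x \<in> carrier k \<Longrightarrow> [p] \<cdot> x = \<zero>"
  using add_pow_ldistr[of \<one> x p] char_p by simp

lemma M0_pow: assumes r: "\<rho> \<in> M0" shows "\<rho> [^]\<^bsub>G\<^esub> p = \<one>\<^bsub>G\<^esub>"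
proof -
  have rG: "\<rho> \<in> carrier G" "alpha \<rho> = \<zero>" using r unfolding M0_def by auto
  have "alpha (\<rho> [^]\<^bsub>G\<^esub> n) = \<zero> \<and> beta (\<rho> [^]\<^bsub>G\<^esub> n) = [n] \<cdot> beta \<rho> \<and> gamma (\<rho> [^]\<^bsub>G\<^esub> n) = [n] \<cdot> gamma \<rho>" for n :: nat
  proof (induction n)
    case 0
    then show ?case using coord_one by simp
  next
    case (Suc n)
    have nG: "\<rho> [^]\<^bsub>G\<^esub> n \<in> carrier G" using rG by simp
    show ?case using Suc alpha_mult[OF nG rG(1)] beta_mult[OF nG rG(1)] gamma_mult[OF nG rG(1)] rG coord_closed[OF rG(1)] by simp
  qed
  then show ?thesis using one_if_zero[of "\<rho> [^]\<^bsub>G\<^esub> p"] rG(1) char_p_mult coord_closed[OF rG(1)] by simp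
qed

text \<open>\<open>alpha\<close> and \<open>gamma\<close> are homomorphisms into an abelian group,
  so subgroups cut out by them alone are normal; \<open>beta\<close> is not a homomorphism.\<close>

lemma conj_closed:
  assumes g: "\<rho> \<in> carrier G"
  shows "\<tau> \<in> M0 \<Longrightarrow> \<rho> \<otimes>\<^bsub>G\<^esub> \<tau> \<otimes>\<^bsub>G\<^esub> inv\<^bsub>G\<^esub> \<rho> \<in> M0" "\<tau> \<in> Z0 \<Longrightarrow> \<rho> \<otimes>\<^bsub>G\<^esub> \<tau> \<otimes>\<^bsub>G\<^esub> inv\<^bsub>G\<^esub> \<rho> \<in> Z0"
proof -
  have i: "inv\<^bsub>G\<^esub> \<rho> \<in> carrier G" using g by simp
  note c = coord_closed[OF g] coord_closed[OF i]
  have "alpha \<rho> \<oplus> alpha (inv\<^bsub>G\<^esub> \<rho>) = \<zero>" "gamma \<rho> \<oplus> gamma (inv\<^bsub>G\<^esub> \<rho>) = \<zero>"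
    using alpha_mult[OF g i] gamma_mult[OF g i] coord_one g by auto
  then show "\<tau> \<in> M0 \<Longrightarrow> \<rho> \<otimes>\<^bsub>G\<^esub> \<tau> \<otimes>\<^bsub>G\<^esub> inv\<^bsub>G\<^esub> \<rho> \<in> M0" "\<tau> \<in> Z0 \<Longrightarrow> \<rho> \<otimes>\<^bsub>G\<^esub> \<tau> \<otimes>\<^bsub>G\<^esub> inv\<^bsub>G\<^esub> \<rho> \<in> Z0"
    unfolding M0_def Z0_def using g i c by (auto simp: alpha_mult gamma_mult)
qed

lemma H0_nontrivial: "\<exists>h \<in> H0. gamma h \<noteq> \<zero>"
  using coord_surj[OF Fp_closed(1) Fp_closed(1) Fp_closed(2)] zero_not_one unfolding H0_def by force

text \<open>Suppose \<open>J\<close> contained \<open>\<rho>\<close> with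
  \<open>alpha \<rho>\<close> nonzero. Its commutator with a suitable \<open>h\<close> in
  \<open>H0\<close> has coordinates \<open>(0, alpha \<rho> \<otimes> gamma h, 0)\<close>, so
  \<open>J \<inter> M0\<close> would lie strictly between \<open>H0\<close> and \<open>J\<close>,
  although the index is the prime \<open>p\<close>.\<close>

lemma M0_unique:
  assumes J: "subgroup J G" "H0 \<subseteq> J" "card J = p * p" shows "J = M0"
proof -
  note JG = subgroup.subset[OF J(1)]
  have finJ: "finite J" using finite_subset[OF JG finG] .
  have "alpha \<rho> = \<zero>" if r: "\<rho> \<in> J" for \<rho>
  proof (rule ccontr)
    assume a: "alpha \<rho> \<noteq> \<zero>"
    obtain h where h: "h \<in> H0" "gamma h \<noteq> \<zero>" using H0_nontrivial by blast
    have hG: "h \<in> carrier G" "alpha h = \<zero>" "beta h = \<zero>" "h \<in> J" using h J(2) unfolding H0_def by auto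
    have rG: "\<rho> \<in> carrier G" using r JG by blast
    define x where "x = \<rho> \<otimes>\<^bsub>G\<^esub> h"
    define y where "y = h \<otimes>\<^bsub>G\<^esub> \<rho>"
    have xy: "x \<in> carrier G" "y \<in> carrier G" "x \<in> J" "y \<in> J" unfolding x_def y_def
      using hG rG r subgroup.m_closed[OF J(1)] by auto
    \<comment> \<open>The commutator of \<open>h\<close> and \<open>\<rho>\<close>, used only
      through \<open>y = \<tau> x\<close>, so that its coordinates follow without those of an
      inverse.\<close>
    define \<tau> where "\<tau> = y \<otimes>\<^bsub>G\<^esub> inv\<^bsub>G\<^esub> x"
    have t: "\<tau> \<in> carrier G" "\<tau> \<in> J" unfolding \<tau>_def using xy subgroup.m_closed[OF J(1)] subgroup.m_inv_closed[OF J(1)] by auto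
    have ty: "y = \<tau> \<otimes>\<^bsub>G\<^esub> x" unfolding \<tau>_def using xy by (simp add: G.m_assoc)
    note ch = coord_closed[OF hG(1)] and cr = coord_closed[OF rG] and ct = coord_closed[OF t(1)]
    have "alpha \<rho> = alpha \<tau> \<oplus> alpha \<rho>" using alpha_mult[OF t(1) xy(1)] alpha_mult[OF rG hG(1)] alpha_mult[OF hG(1) rG] hG ch cr
      unfolding ty[symmetric] unfolding x_def y_def by simp
    then have ta: "alpha \<tau> = \<zero>" using cr ct by (metis add.r_cancel_one')
    have "gamma h \<oplus> gamma \<rho> = gamma \<tau> \<oplus> (gamma \<rho> \<oplus> gamma h)"
      using gamma_mult[OF t(1) xy(1)] gamma_mult[OF rG hG(1)] gamma_mult[OF hG(1) rG] unfolding ty[symmetric] unfolding x_def y_def by simp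
    then have "gamma \<rho> \<oplus> gamma h = gamma \<tau> \<oplus> (gamma \<rho> \<oplus> gamma h)" using a_comm[OF ch(3) cr(3)] by simp
    then have tg: "gamma \<tau> = \<zero>" using cr ct ch by (metis add.m_closed add.r_cancel_one')
    have "beta \<rho> \<oplus> alpha \<rho> \<otimes> gamma h = beta \<tau> \<oplus> beta \<rho>"
      using beta_mult[OF t(1) xy(1)] beta_mult[OF rG hG(1)] beta_mult[OF hG(1) rG] alpha_mult[OF rG hG(1)] hG(2,3) tg cr ch ct
      unfolding ty[symmetric] unfolding x_def y_def by simp
    then have "beta \<rho> \<oplus> alpha \<rho> \<otimes> gamma h = beta \<rho> \<oplus> beta \<tau>" using a_comm[OF cr(2) ct(2)] by simp
    then have "beta \<tau> = alpha \<rho> \<otimes> gamma h" using cr(1,2) ch(3) ct(2) by simp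
    then have "\<tau> \<notin> H0" unfolding H0_def using a h(2) cr ch integral_iff by auto
    moreover have "\<tau> \<in> J \<inter> M0" using t ta unfolding M0_def by simp
    moreover have "subgroup (J \<inter> M0) G" using G.subgroups_Inter_pair[OF J(1) subgroups(1)] .
    moreover have "H0 \<subseteq> J \<inter> M0" using J(2) unfolding H0_def M0_def by auto
    moreover have "\<rho> \<notin> J \<inter> M0" using a unfolding M0_def by simp
    ultimately show False using G.subgroup_between[OF p_prime subgroups(3) _ J(1) _ _ finJ, of "J \<inter> M0"] J(3) cards(3) r by auto
  qed
  then have "J \<subseteq> M0" unfolding M0_def using JG by auto
  then show ?thesis using card_subset_eq[of M0 J] finite_subset[OF subgroup.subset[OF subgroups(1)] finG] J(3) cards(1) by simp
qed

text \<open>Lets invariance under \<open>M0\<close> be checked on \<open>Z0\<close> and on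
  \<open>H0\<close> separately.\<close>

lemma M0_decomp:
  assumes m: "\<mu> \<in> M0" shows "\<exists>\<zeta> \<in> Z0. \<exists>h \<in> H0. \<mu> = \<zeta> \<otimes>\<^bsub>G\<^esub> h"
proof -
  have mG: "\<mu> \<in> carrier G" "alpha \<mu> = \<zero>" using m unfolding M0_def by auto
  obtain \<zeta> where z: "\<zeta> \<in> carrier G" "alpha \<zeta> = \<zero>" "beta \<zeta> = beta \<mu>" "gamma \<zeta> = \<zero>"
    using coord_surj[OF Fp_closed(1) beta(1)[OF mG(1)] Fp_closed(1)] by blast
  obtain h where h: "h \<in> carrier G" "alpha h = \<zero>" "beta h = \<zero>" "gamma h = gamma \<mu>"
    using coord_surj[OF Fp_closed(1) Fp_closed(1) gamma(1)[OF mG(1)]] by blast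
  have "\<mu> = \<zeta> \<otimes>\<^bsub>G\<^esub> h"
    by (rule coord_inj) (use mG z h coord_closed[OF mG(1)] in \<open>auto simp: alpha_mult beta_mult gamma_mult\<close>)
  then show ?thesis using z h unfolding Z0_def H0_def by blast
qed

lemma C0_complement: "C0 \<inter> M0 = {\<one>\<^bsub>G\<^esub>}" "\<rho> \<in> carrier G \<Longrightarrow> \<exists>c \<in> C0. inv\<^bsub>G\<^esub> c \<otimes>\<^bsub>G\<^esub> \<rho> \<in> M0"
proof -
  show "C0 \<inter> M0 = {\<one>\<^bsub>G\<^esub>}" unfolding C0_def M0_def using one_if_zero coord_one by auto
  assume r: "\<rho> \<in> carrier G"
  obtain c where c: "c \<in> carrier G" "alpha c = alpha \<rho>" "beta c = \<zero>" "gamma c = \<zero>"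
    using coord_surj[OF alpha_Fp[OF r] Fp_closed(1) Fp_closed(1)] by blast
  have i: "inv\<^bsub>G\<^esub> c \<in> carrier G" using c by simp
  have "alpha (inv\<^bsub>G\<^esub> c) \<oplus> alpha c = \<zero>" using alpha_mult[OF i c(1)] coord_one c by simp
  then have "inv\<^bsub>G\<^esub> c \<otimes>\<^bsub>G\<^esub> \<rho> \<in> M0" unfolding M0_def using alpha_mult[OF i r] c i r by simp
  then show "\<exists>c \<in> C0. inv\<^bsub>G\<^esub> c \<otimes>\<^bsub>G\<^esub> \<rho> \<in> M0" using c unfolding C0_def by blast
qed

text \<open>A norm over \<open>I0\<close>, which has order \<open>p * p\<close>, raises the residue
  \<open>\<eta>\<close> to this power; the result is still affine in \<open>\<eta>\<close> over
  \<open>\<kappa>\<close> with nonzero slope. It follows by using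
  \<open>\<eta>^p = d + w^(p-1) \<eta>\<close> twice.\<close>

lemma eta_power: "\<exists>c \<in> \<kappa>. \<exists>u \<in> \<kappa>. u \<noteq> \<zero> \<and> \<eta> [^] (p * p) = c \<oplus> u \<otimes> \<eta>"
proof -
  let ?u = "w [^] (p - 1)"
  have u: "?u \<in> \<kappa>" "?u \<in> carrier k" using sk_pow w kE wd by auto
  have u0: "?u \<noteq> \<zero>" using Units_pow_closed[of w "p - 1"] field_Units wd w by auto
  have e: "\<eta> [^] p = d \<oplus> ?u \<otimes> \<eta>" using add_minus_self[of "\<eta> [^] p" "?u \<otimes> \<eta>"] eta u wd unfolding S_def by (simp add: a_comm)
  have "\<eta> [^] (p * p) = (\<eta> [^] p) [^] p" using eta by (simp add: nat_pow_pow)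
  also have "\<dots> = d [^] p \<oplus> (?u \<otimes> \<eta>) [^] p" unfolding e using frob_add[of d "?u \<otimes> \<eta>"] wd u eta by simp
  also have "(?u \<otimes> \<eta>) [^] p = ?u [^] p \<otimes> (d \<oplus> ?u \<otimes> \<eta>)" using u eta e by (simp add: nat_pow_distrib)
  also have "d [^] p \<oplus> \<dots> = (d [^] p \<oplus> ?u [^] p \<otimes> d) \<oplus> (?u [^] p \<otimes> ?u) \<otimes> \<eta>"
    using u eta wd by (simp add: r_distr a_assoc m_assoc)
  finally have "\<eta> [^] (p * p) = (d [^] p \<oplus> ?u [^] p \<otimes> d) \<oplus> (?u [^] p \<otimes> ?u) \<otimes> \<eta>" .
  moreover have "d [^] p \<oplus> ?u [^] p \<otimes> d \<in> \<kappa>" "?u [^] p \<otimes> ?u \<in> \<kappa>" using sk u d sk_pow by auto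
  moreover have "?u [^] p \<otimes> ?u \<noteq> \<zero>" using u u0 Units_pow_closed[of ?u p] field_Units integral_iff by auto
  ultimately show ?thesis by blast
qed

text \<open>The powers of an element generating \<open>\<kappa>E\<close> over \<open>\<kappa>\<close> are independent: a relation is stable under the \<open>p\<close>
  translations induced by \<open>H0\<close>.\<close>

lemma powers_independent:
  assumes c: "c \<in> \<kappa>" "u \<in> \<kappa>" "u \<noteq> \<zero>" and q: "set q \<subseteq> \<kappa>" "length q \<le> p" "eval q (c \<oplus> u \<otimes> \<eta>) = \<zero>"
  shows "set q \<subseteq> {\<zero>}"
proof (rule ccontr)
  assume n: "\<not> set q \<subseteq> {\<zero>}"
  let ?e = "c \<oplus> u \<otimes> \<eta>"
  have cR: "c \<in> carrier k" "u \<in> carrier k" using c kE by auto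
  have eE: "?e \<in> \<kappa>E" using c eta(1) sE kE(2) by auto
  have ev: "act h (eval r x) = eval r (act h x)" if "h \<in> carrier G" "set r \<subseteq> \<kappa>" "x \<in> \<kappa>E" for h r x
    using that(2)
  proof (induction r)
    case Nil
    then show ?case using act_fix[OF that(1) sk(1)] by simp
  next
    case (Cons a r)
    have a: "a \<in> \<kappa>" "set r \<subseteq> \<kappa>E" "a \<otimes> x [^] length r \<in> \<kappa>E" using Cons.prems kE(2) that(3) sE_pow sE(5) by auto
    have "eval r x \<in> \<kappa>E" using eval_in_subring[OF subfieldE(1)[OF kap(2)] a(2) that(3)] .
    then show ?case using act_add[OF that(1) a(3)] act_mult[OF that(1) kE(2)[OF a(1)] sE_pow[OF that(3)]]
      act_fix[OF that(1) a(1)] act_pow[OF that(1,3)] Cons by simp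
  qed
  define q' where "q' = normalize q"
  have qR: "set q \<subseteq> carrier k" using q(1) kE by auto
  have q': "q' \<in> carrier (poly_ring k)" unfolding q'_def univ_poly_carrier[symmetric] using normalize_gives_polynomial[OF qR] .
  have qn: "q' \<noteq> []" unfolding q'_def using n
  proof (induction q)
    case (Cons a q)
    then show ?case by (cases "a = \<zero>") auto
  qed simp
  have len: "degree q' < p" using normalize_length_le[of q] q(2) qn unfolding q'_def by (cases "normalize q") auto
  let ?X = "(\<lambda>m. ?e \<oplus> u \<otimes> (m \<otimes> w)) ` Fp"
  have root: "is_root q' x" if "x \<in> ?X" for x
  proof -
    obtain m where m: "m \<in> Fp" "x = ?e \<oplus> u \<otimes> (m \<otimes> w)" using \<open>x \<in> ?X\<close> by blast
    obtain h where h: "h \<in> carrier G" "gamma h = m" using coord_surj[OF Fp_closed(1) Fp_closed(1) m(1)] by blast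
    have mR: "m \<in> carrier k" using m Fp_closed(6) by blast
    have "act h ?e = c \<oplus> u \<otimes> (\<eta> \<oplus> m \<otimes> w)"
      using act_add[OF h(1) kE(2)[OF c(1)] sE(5)[OF kE(2)[OF c(2)] eta(1)]] act_mult[OF h(1) kE(2)[OF c(2)] eta(1)]
        act_fix[OF h(1)] c gamma(2)[OF h(1)] h(2) by simp
    also have "\<dots> = x" unfolding m(2) using cR eta wd mR by (simp add: r_distr a_assoc)
    finally have "act h ?e = x" .
    then have "eval q x = \<zero>" using ev[OF h(1) q(1) eE] q(3) act_fix[OF h(1) sk(1)] by simp
    moreover have "x \<in> carrier k" using m(2) cR eta wd mR by simp
    ultimately show ?thesis unfolding is_root_def q'_def using eval_normalize[OF qR] qn unfolding q'_def by simp
  qed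
  have "inj_on (\<lambda>m. ?e \<oplus> u \<otimes> (m \<otimes> w)) Fp"
  proof (rule inj_onI)
    fix m m' assume m: "m \<in> Fp" "m' \<in> Fp" "?e \<oplus> u \<otimes> (m \<otimes> w) = ?e \<oplus> u \<otimes> (m' \<otimes> w)"
    have mR: "m \<in> carrier k" "m' \<in> carrier k" using m Fp_closed(6) by auto
    have "u \<otimes> (m \<otimes> w) = u \<otimes> (m' \<otimes> w)" using m(3) cR eta wd mR by simp
    then have "m \<otimes> w = m' \<otimes> w" using m_lcancel[OF c(3) cR(2)] wd mR by simp
    then show "m = m'" using m_rcancel[OF w(2) wd(1)] mR by simp
  qed
  then have "card ?X = p" using card_image card_Fp by metis
  moreover have "card ?X \<le> degree q'" by (rule card_roots_le_degree(2)[OF q' qn]) (use root in \<open>auto simp: is_root_def\<close>)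
  ultimately show False using len by simp
qed

end

section \<open>Norms and fixed fields\<close>

context char0_closed begin

lemma dimension_mono:
  assumes g: "galois K E" and S: "subfield S R" "K \<subseteq> S" "dimension n K S" and C: "subfield C R" "C \<subseteq> E" "S \<subseteq> C" "dimension m K C"
  shows "n \<le> m"
proof -
  have KC: "K \<subseteq> C" "S \<subseteq> E" using S(2) C(2,3) by auto
  obtain n' where n: "dimension n' K S" "n' * card (carrier (Gal S E)) = card (carrier (Gal K E))"
    using dimension_quotient[OF g S(1,2) KC(2)] by blast
  obtain m' where m: "dimension m' K C" "m' * card (carrier (Gal C E)) = card (carrier (Gal K E))"
    using dimension_quotient[OF g C(1) KC(1) C(2)] by blast
  note K = galoisD(1)[OF g]
  have e: "n' = n" "m' = m" using dimension_is_inj[OF K] n(1) m(1) S(3) C(4) by auto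
  have le: "card (carrier (Gal C E)) \<le> card (carrier (Gal S E))"
    using card_mono[OF galois_card(2)[OF galois_intermediate[OF g S(1,2) KC(2)]] Gal_carrier_mono[OF C(3)]] .
  have pos: "card (carrier (Gal C E)) > 0" using galois_card(3)[OF galois_intermediate[OF g C(1) KC(1) C(2)]] .
  have "n * card (carrier (Gal C E)) \<le> n * card (carrier (Gal S E))" using le by simp
  also have "\<dots> = m * card (carrier (Gal C E))" using n(2) m(2) e by simp
  finally show ?thesis using pos by simp
qed

lemma normal_fixed_field:
  assumes g: "galois K E" and H: "subgroup H (Gal K E)"
    and n: "\<And>\<rho> \<tau>. \<rho> \<in> carrier (Gal K E) \<Longrightarrow> \<tau> \<in> H \<Longrightarrow> \<rho> \<otimes>\<^bsub>Gal K E\<^esub> \<tau> \<otimes>\<^bsub>Gal K E\<^esub> inv\<^bsub>Gal K E\<^esub> \<rho> \<in> H"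
  shows "galois K (fixed_field E H)"
proof (rule galois_if_stable[OF g])
  note d = galoisD[OF g]
  interpret G: group "Gal K E" using Gal_group[OF d(7,3)] .
  note HG = subgroup.subset[OF H]
  show "subfield (fixed_field E H) R" "K \<subseteq> fixed_field E H" "fixed_field E H \<subseteq> E" using fixed_field_subfield[OF g HG] .
  fix \<rho> x assume r: "\<rho> \<in> carrier (Gal K E)" and x: "x \<in> fixed_field E H"
  have xE: "x \<in> E" using x unfolding fixed_field_def by simp
  have "\<tau> (\<rho> x) = \<rho> x" if t: "\<tau> \<in> H" for \<tau>
  proof -
    let ?i = "inv\<^bsub>Gal K E\<^esub> \<rho>"
    have tG: "\<tau> \<in> carrier (Gal K E)" using t HG by blast
    define \<mu> where "\<mu> = ?i \<otimes>\<^bsub>Gal K E\<^esub> \<tau> \<otimes>\<^bsub>Gal K E\<^esub> \<rho>"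
    have m: "\<mu> \<in> H" using n[of ?i \<tau>] r t unfolding \<mu>_def by simp
    have "\<rho> \<otimes>\<^bsub>Gal K E\<^esub> \<mu> = \<tau> \<otimes>\<^bsub>Gal K E\<^esub> \<rho>" unfolding \<mu>_def using r tG by (simp add: G.m_assoc[symmetric])
    then have "\<tau> (\<rho> x) = \<rho> (\<mu> x)" using Gal_mult_apply[OF r _ xE, of \<mu>] Gal_mult_apply[OF tG r xE] m HG by (metis subsetD)
    moreover have "\<mu> x = x" using x m unfolding fixed_field_def by blast
    ultimately show ?thesis by simp
  qed
  then show "\<rho> x \<in> fixed_field E H" using Gal_memD(1)[OF r xE] unfolding fixed_field_def by simp
qed

text \<open>The permutation \<open>h\<close> is a parameter because two are used: left translation
  when \<open>\<mu>\<close> belongs to \<open>H\<close>, and the identity when \<open>\<mu>\<close>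
  commutes with \<open>H\<close> and fixes \<open>x\<close>.\<close>

lemma norm_fixed:
  assumes g: "galois K E" and H: "subgroup H (Gal K E)" and x: "x \<in> E" and \<mu>: "\<mu> \<in> carrier (Gal K E)"
    and b: "bij_betw h H H" "\<And>\<rho>. \<rho> \<in> H \<Longrightarrow> \<mu> (\<rho> x) = (h \<rho>) x"
  shows "\<mu> (\<Otimes>\<rho>\<in>H. \<rho> x) = (\<Otimes>\<rho>\<in>H. \<rho> x)"
proof -
  note d = galoisD[OF g]
  note HG = subgroup.subset[OF H]
  have fin: "finite H" using finite_subset[OF HG galois_card(2)[OF g]] .
  have cl: "(\<lambda>\<rho>. \<rho> x) \<in> H \<rightarrow> E" using HG Gal_memD(1)[OF _ x] by blast
  have clR: "(\<lambda>\<rho>. \<rho> x) \<in> H \<rightarrow> carrier R" using cl d(9) by blast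
  have "\<mu> (\<Otimes>\<rho>\<in>H. \<rho> x) = (\<Otimes>\<rho>\<in>H. \<mu> (\<rho> x))" using finprod_subring_hom[OF d(7) Gal_hom[OF d(7) \<mu>] fin cl] .
  also have "\<dots> = (\<Otimes>\<rho>\<in>H. (h \<rho>) x)"
    by (rule finprod_cong') (use b bij_betw_apply[OF b(1)] clR in auto)
  also have "\<dots> = (\<Otimes>\<rho>\<in>h ` H. \<rho> x)"
    using finprod_reindex[of "\<lambda>\<rho>. \<rho> x" h H] b(1) clR unfolding bij_betw_def by simp
  finally show ?thesis using b(1) unfolding bij_betw_def by simp
qed

end

lemma (in group) translation_bij: "subgroup H G \<Longrightarrow> \<mu> \<in> H \<Longrightarrow> bij_betw (\<lambda>\<rho>. \<mu> \<otimes> \<rho>) H H"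
  unfolding bij_betw_def
proof
  assume H: "subgroup H G" and m: "\<mu> \<in> H"
  note HG = subgroup.subset[OF H]
  show "inj_on (\<lambda>\<rho>. \<mu> \<otimes> \<rho>) H" using HG m by (intro inj_onI) (meson l_cancel subsetD)
  show "(\<lambda>\<rho>. \<mu> \<otimes> \<rho>) ` H = H"
  proof
    show "(\<lambda>\<rho>. \<mu> \<otimes> \<rho>) ` H \<subseteq> H" using subgroup.m_closed[OF H m] by blast
    show "H \<subseteq> (\<lambda>\<rho>. \<mu> \<otimes> \<rho>) ` H"
    proof
      fix x assume x: "x \<in> H"
      have "inv \<mu> \<otimes> x \<in> H" using subgroup.m_closed[OF H subgroup.m_inv_closed[OF H m] x] .
      moreover have "x = \<mu> \<otimes> (inv \<mu> \<otimes> x)" using x m HG by (simp add: m_assoc[symmetric] subset_iff)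
      ultimately show "x \<in> (\<lambda>\<rho>. \<mu> \<otimes> \<rho>) ` H" by blast
    qed
  qed
qed

context valued_field begin

lemma v_finprod:
  fixes r :: real
  assumes "finite A" "\<And>a. a \<in> A \<Longrightarrow> g a \<in> carrier R \<and> v (g a) = ereal r"
  shows "v (\<Otimes>a\<in>A. g a) = ereal (card A * r)"
  using assms
proof (induction A rule: finite_induct)
  case (insert a A)
  then have "g \<in> A \<rightarrow> carrier R" "g a \<in> carrier R" by auto
  then have "v (\<Otimes>a\<in>insert a A. g a) = v (g a) + v (\<Otimes>a\<in>A. g a)"
    using insert(1,2) v_mult[OF \<open>g a \<in> carrier R\<close> finprod_closed[OF \<open>g \<in> A \<rightarrow> carrier R\<close>]] by simp
  then show ?case using insert by (simp add: algebra_simps)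
qed (simp add: zero_ereal_def)

lemma \<phi>_finprod:
  assumes "finite A" "\<And>a. a \<in> A \<Longrightarrow> g a \<in> carrier R \<and> 0 \<le> v (g a) \<and> \<phi> (g a) = c" "c \<in> carrier kR"
  shows "(\<Otimes>a\<in>A. g a) \<in> carrier R \<and> 0 \<le> v (\<Otimes>a\<in>A. g a) \<and> \<phi> (\<Otimes>a\<in>A. g a) = c [^]\<^bsub>kR\<^esub> card A"
  using assms(1,2)
proof (induction A rule: finite_induct)
  case (insert a A)
  then have g: "g \<in> A \<rightarrow> carrier R" "g a \<in> carrier R" "0 \<le> v (g a)" "\<phi> (g a) = c" by auto
  have IH: "(\<Otimes>a\<in>A. g a) \<in> carrier R" "0 \<le> v (\<Otimes>a\<in>A. g a)" "\<phi> (\<Otimes>a\<in>A. g a) = c [^]\<^bsub>kR\<^esub> card A" using insert by auto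
  have e: "(\<Otimes>a\<in>insert a A. g a) = g a \<otimes> (\<Otimes>a\<in>A. g a)" using insert(1,2) g by simp
  show ?case unfolding e using \<phi>_simps(2)[OF g(2,3) IH(1,2)] v_nonneg_closed(1)[OF g(2,3) IH(1,2)] g IH insert(1,2) assms(3)
    by (simp add: k.m_comm)
qed simp

lemma \<phi>_eval:
  assumes "set q \<subseteq> {x \<in> carrier R. 0 \<le> v x}" "x \<in> carrier R" "0 \<le> v x"
  shows "eval q x \<in> carrier R \<and> 0 \<le> v (eval q x) \<and> \<phi> (eval q x) = k.eval (map \<phi> q) (\<phi> x)"
  using assms(1)
proof (induction q)
  case (Cons a q)
  then have a: "a \<in> carrier R" "0 \<le> v a" by auto
  have IH: "eval q x \<in> carrier R" "0 \<le> v (eval q x)" "\<phi> (eval q x) = k.eval (map \<phi> q) (\<phi> x)" using Cons by auto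
  have xn: "x [^] length q \<in> carrier R" "0 \<le> v (x [^] length q)" using assms v_nonneg_closed(3) by auto
  note m = v_nonneg_closed(1)[OF a xn]
  have mc: "a \<otimes> x [^] length q \<in> carrier R" using a xn by simp
  show ?case using \<phi>_simps(3)[OF mc m IH(1,2)] \<phi>_simps(2)[OF a xn] \<phi>_minus(3)[OF assms(2,3)] v_nonneg_closed(2)[OF mc m IH(1,2)] mc IH by simp
qed simp

end

lemma (in cring) eval_scale:
  assumes "set q \<subseteq> carrier R" "x \<in> carrier R" "c \<in> carrier R"
  shows "eval (map (\<lambda>a. a \<otimes> c) q) x = eval q x \<otimes> c"
  using assms(1)
proof (induction q)
  case (Cons a q)
  then have "a \<in> carrier R" "eval q x \<in> carrier R" using assms eval_in_carrier by auto
  then show ?case using Cons assms by (simp add: ring_ac_distr)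
qed (use assms in simp)

section \<open>The residue action in terms of a root of the additive polynomial\<close>

locale eis_data = eis_root +
  fixes W Zc
  assumes W: "W \<in> \<kappa>" "W \<noteq> \<zero>\<^bsub>kR\<^esub>"
      "ab N \<otimes>\<^bsub>kR\<^esub> W [^]\<^bsub>kR\<^esub> (p * p) \<oplus>\<^bsub>kR\<^esub> (ab p \<otimes>\<^bsub>kR\<^esub> W [^]\<^bsub>kR\<^esub> p \<oplus>\<^bsub>kR\<^esub> ab 1 \<otimes>\<^bsub>kR\<^esub> W) = \<zero>\<^bsub>kR\<^esub>"
    and Zc: "Zc \<in> \<kappa>" "Zc \<noteq> \<zero>\<^bsub>kR\<^esub>" "ab 1 = ab N \<otimes>\<^bsub>kR\<^esub> Zc [^]\<^bsub>kR\<^esub> (p - 1)"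
begin

text \<open>Chosen so that \<open>(D W)^(p-1)\<close> is the quotient of \<open>ab 1\<close> by
  \<open>ab N\<close>; with this constant \<open>S W (Y \<rho>)\<close> is a prime field multiple of
  \<open>D\<close>.\<close>

definition D where "D = Zc \<otimes>\<^bsub>kR\<^esub> inv\<^bsub>kR\<^esub> W"

lemma \<kappa>_carrier: "x \<in> \<kappa> \<Longrightarrow> x \<in> carrier kR" "x \<in> \<kappa>E \<Longrightarrow> x \<in> carrier kR"
  using subfieldE(3)[OF \<kappa>_facts(1)] subfieldE(3)[OF \<kappa>_facts(2)] by auto

lemma D: "D \<in> \<kappa>" "D \<noteq> \<zero>\<^bsub>kR\<^esub>"
proof -
  have i: "inv\<^bsub>kR\<^esub> W \<in> \<kappa>" "inv\<^bsub>kR\<^esub> W \<noteq> \<zero>\<^bsub>kR\<^esub>"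
    using k.subfield_m_inv[OF \<kappa>_facts(1)] W(1,2) by auto
  show "D \<in> \<kappa>" unfolding D_def using Zc(1) i(1) subringE(6)[OF subfieldE(1)[OF \<kappa>_facts(1)]] by blast
  show "D \<noteq> \<zero>\<^bsub>kR\<^esub>" unfolding D_def using k.integral_iff Zc i \<kappa>_carrier by simp
qed

sublocale r: residue_action kR p "Gal K E" \<kappa> \<kappa>E act Y W D
proof (intro residue_action.intro residue_action_axioms.intro)
  show "frobenius_field kR p" by (rule k.frobenius_field_axioms)
  show "group (Gal K E)" by (rule groupG)
  show "k.S W (Y \<rho>) \<otimes>\<^bsub>kR\<^esub> inv\<^bsub>kR\<^esub> D \<in> k.Fp" if r: "\<rho> \<in> carrier G" for \<rho>
    unfolding D_def
    by (rule k.additive_poly_roots[where aN = "ab N" and ap = "ab p" and ?a1.0 = "ab 1"])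
      (use ab_mem(4)[of N] ab_mem(4)[of p] ab_mem(4)[of 1] ab_nonzero p_gtN W Zc \<kappa>_carrier Y_res[OF r] Y_mem[OF r] in auto)
  show "card (Y ` carrier G) = p * p" using card_Y p_gt(4) by simp
  show "finite (carrier G)" using galois_card(2)[OF galoisE] .
  show "\<kappa>E = \<kappa>" if "\<And>\<rho>. \<rho> \<in> carrier G \<Longrightarrow> Y \<rho> = \<zero>\<^bsub>kR\<^esub> \<Longrightarrow> \<rho> = \<one>\<^bsub>G\<^esub>" using inert(1)[OF that] .
  show "act \<rho> c \<in> \<kappa>E" if "\<rho> \<in> carrier G" "c \<in> \<kappa>E" for \<rho> c using act_facts(1)[OF that] .
  show "act \<rho> c = c" if "\<rho> \<in> carrier G" "c \<in> \<kappa>" for \<rho> c using act_facts(2)[OF that] .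
  show "act \<rho> (c \<oplus>\<^bsub>kR\<^esub> e) = act \<rho> c \<oplus>\<^bsub>kR\<^esub> act \<rho> e" if "\<rho> \<in> carrier G" "c \<in> \<kappa>E" "e \<in> \<kappa>E" for \<rho> c e
    using act_facts(3)[OF that] .
  show "act \<rho> (c \<otimes>\<^bsub>kR\<^esub> e) = act \<rho> c \<otimes>\<^bsub>kR\<^esub> act \<rho> e" if "\<rho> \<in> carrier G" "c \<in> \<kappa>E" "e \<in> \<kappa>E" for \<rho> c e
    using act_facts(4)[OF that] .
  show "act (\<rho> \<otimes>\<^bsub>G\<^esub> \<tau>) c = act \<rho> (act \<tau> c)" if "\<rho> \<in> carrier G" "\<tau> \<in> carrier G" "c \<in> \<kappa>E" for \<rho> \<tau> c
    using act_facts(5)[OF that] .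
  show "\<rho> = \<one>\<^bsub>G\<^esub>" if "\<rho> \<in> carrier G" "\<And>\<tau>. \<tau> \<in> carrier G \<Longrightarrow> Y (\<rho> \<otimes>\<^bsub>G\<^esub> \<tau>) = Y \<tau>" for \<rho>
    using Y_faithful[OF that] .
qed (fact \<kappa>_facts W(1,2) D Y_mem Y_mult)+

end

section \<open>The tower of fixed fields in the unsplit case\<close>

locale eis_unsplit = eis_data +
  assumes unsplit: "\<exists>\<rho> \<in> carrier (Gal K E). Y \<rho> \<notin> \<kappa>"
begin

sublocale u: residue_action_unsplit kR p "Gal K E" \<kappa> \<kappa>E act Y W D
  by (intro residue_action_unsplit.intro residue_action_unsplit_axioms.intro r.residue_action_axioms unsplit)

lemma H0_Gal: "u.H0 = carrier (Gal L E)"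
  unfolding u.H0_def Gal_L using u.Y_zero_iff_coord Y_zero_iff by auto

definition F where "F = fixed_field E u.M0"
text \<open>The fixed field of the centre; it separates the unramified part over \<open>F\<close>
  from the totally ramified part up to \<open>E\<close>.\<close>

definition U where "U = fixed_field E u.Z0"

lemmas subG = u.subgroups[THEN subgroup.subset]

lemma F_facts: "subfield F R" "K \<subseteq> F" "F \<subseteq> E" "carrier (Gal F E) = u.M0" "galois F E" "galois K F"
proof -
  show s: "subfield F R" "K \<subseteq> F" "F \<subseteq> E" unfolding F_def using fixed_field_subfield[OF galoisE subG(1)] by auto
  show "carrier (Gal F E) = u.M0" unfolding F_def using Gal_fixed_field[OF galoisE u.subgroups(1)] .
  show "galois F E" using galois_intermediate[OF galoisE s] .
  show "galois K F" unfolding F_def using normal_fixed_field[OF galoisE u.subgroups(1)] u.conj_closed(1) by blast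
qed

lemma U_facts: "subfield U R" "K \<subseteq> U" "U \<subseteq> E" "carrier (Gal U E) = u.Z0" "galois U E" "F \<subseteq> U" "F \<subseteq> L"
proof -
  show s: "subfield U R" "K \<subseteq> U" "U \<subseteq> E" unfolding U_def using fixed_field_subfield[OF galoisE subG(2)] by auto
  show "carrier (Gal U E) = u.Z0" unfolding U_def using Gal_fixed_field[OF galoisE u.subgroups(2)] .
  show "galois U E" using galois_intermediate[OF galoisE s] .
  have "u.Z0 \<subseteq> u.M0" "u.H0 \<subseteq> u.M0" unfolding u.Z0_def u.M0_def u.H0_def by auto
  moreover have HL: "fixed_field E u.H0 = L" unfolding H0_Gal using fixed_field_Gal[OF galoisE L_facts(1,2) L_E] .
  ultimately have "F \<subseteq> U" "F \<subseteq> fixed_field E u.H0" unfolding F_def U_def fixed_field_def by blast+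
  then show "F \<subseteq> U" "F \<subseteq> L" unfolding HL by auto
qed

lemma dims: "dimension p K F" "dimension p F U" "dimension p U E" "dimension p L E"
proof -
  have p0: "p > 0" using p_gtN by simp
  obtain n where n: "dimension n K F" "n * card u.M0 = card (carrier G)"
    using dimension_quotient[OF galoisE F_facts(1-3)] F_facts(4) by auto
  then show "dimension p K F" using u.cards p0 by simp
  obtain n where n: "dimension n F U" "n * card u.Z0 = card u.M0"
    using dimension_quotient[OF F_facts(5) U_facts(1,6,3)] U_facts(4) F_facts(4) by auto
  then show "dimension p F U" using u.cards p0 by simp
  show "dimension p U E" using galois_card(1)[OF U_facts(5)] U_facts(4) u.cards by simp
  show "dimension p L E" using galois_card(1)[OF galois_intermediate[OF galoisE L_facts(1,2) L_E]] H0_Gal u.cards by simp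
qed

text \<open>A field \<open>J\<close> of degree \<open>p\<close> inside \<open>L\<close> has a group
  of order \<open>p * p\<close> containing that of \<open>L\<close>, which is \<open>H0\<close>;
  \<open>M0_unique\<close> leaves only \<open>M0\<close>.\<close>

lemma F_unique: assumes s: "subextension p K L J" shows "J = F"
proof -
  have J: "subfield J R" "K \<subseteq> J" "J \<subseteq> L" "dimension p K J" using s unfolding subextension_def by auto
  have JE: "J \<subseteq> E" using J(3) L_E by blast
  obtain n where n: "dimension n K J" "n * card (carrier (Gal J E)) = card (carrier G)"
    using dimension_quotient[OF galoisE J(1,2) JE] by blast
  have "n = p" using dimension_is_inj[OF KD(1) n(1) J(4)] .
  then have c: "card (carrier (Gal J E)) = p * p" using n(2) u.cards(6) p_gtN by simp
  have "u.H0 \<subseteq> carrier (Gal J E)" unfolding H0_Gal using Gal_carrier_mono[OF J(3)] .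
  then have "carrier (Gal J E) = u.M0" using u.M0_unique[OF subgroup_Gal[OF galoisE J(2) JE] _ c] by blast
  then show ?thesis using fixed_field_Gal[OF galoisE J(1,2) JE] unfolding F_def by simp
qed

subsection \<open>A unit with independent powers modulo the maximal ideal\<close>

text \<open>An arbitrary lift of \<open>\<eta>\<close> has no reason to lie in \<open>U\<close>. Its
  norm over \<open>I0\<close> is fixed by \<open>I0\<close>, which contains \<open>Z0\<close>; all
  factors reduce to \<open>\<eta>\<close>, so the residue of the norm is
  \<open>\<eta>^(p*p)\<close>.\<close>

lemma omega_exists: "\<exists>\<omega> \<in> fixed_field E u.I0. 0 \<le> v \<omega> \<and> (\<exists>c \<in> \<kappa>. \<exists>b \<in> \<kappa>. b \<noteq> \<zero>\<^bsub>kR\<^esub> \<and> \<phi> \<omega> = c \<oplus>\<^bsub>kR\<^esub> b \<otimes>\<^bsub>kR\<^esub> u.\<eta>)"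
proof -
  obtain y where y: "y \<in> E" "0 \<le> v y" "\<phi> y = u.\<eta>" using u.eta(1) unfolding \<kappa>E_def by auto
  let ?\<omega> = "\<Otimes>\<rho>\<in>u.I0. \<rho> y"
  have fin: "finite u.I0" using finite_subset[OF subG(4) galois_card(2)[OF galoisE]] .
  have I: "\<rho> \<in> carrier G" "\<rho> y \<in> E" "\<rho> y \<in> carrier R" "0 \<le> v (\<rho> y)" "\<phi> (\<rho> y) = u.\<eta>" if "\<rho> \<in> u.I0" for \<rho>
  proof -
    show r: "\<rho> \<in> carrier G" using that subG(4) by blast
    show "\<rho> y \<in> E" "\<rho> y \<in> carrier R" "0 \<le> v (\<rho> y)" using Gal_O[OF r y(1,2)] by auto
    show "\<phi> (\<rho> y) = u.\<eta>" using act_\<phi>[OF r y(1,2)] u.gamma(2)[OF r] that y(3) u.eta(3) r.wd(1) unfolding u.I0_def by simp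
  qed
  have w: "?\<omega> \<in> carrier R \<and> 0 \<le> v ?\<omega> \<and> \<phi> ?\<omega> = u.\<eta> [^]\<^bsub>kR\<^esub> card u.I0"
    by (rule \<phi>_finprod[OF fin]) (use I u.eta in auto)
  have wE: "?\<omega> \<in> E" by (rule finprod_in_subring[OF ED(7) fin]) (use I(2) in blast)
  have "\<mu> ?\<omega> = ?\<omega>" if m: "\<mu> \<in> u.I0" for \<mu>
    by (rule norm_fixed[OF galoisE u.subgroups(4) y(1) I(1)[OF m] r.G.translation_bij[OF u.subgroups(4) m]])
      (use Gal_mult_apply[OF I(1)[OF m] I(1) y(1)] in simp)
  then have "?\<omega> \<in> fixed_field E u.I0" using wE unfolding fixed_field_def by simp
  moreover obtain c b where cb: "c \<in> \<kappa>" "b \<in> \<kappa>" "b \<noteq> \<zero>\<^bsub>kR\<^esub>" "u.\<eta> [^]\<^bsub>kR\<^esub> (p * p) = c \<oplus>\<^bsub>kR\<^esub> b \<otimes>\<^bsub>kR\<^esub> u.\<eta>" using u.eta_power by blast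
  moreover have "\<phi> ?\<omega> = c \<oplus>\<^bsub>kR\<^esub> b \<otimes>\<^bsub>kR\<^esub> u.\<eta>" using w u.cards(4) cb(4) by simp
  ultimately show ?thesis using w by blast
qed

definition \<omega> where "\<omega> = (SOME \<omega>. \<omega> \<in> fixed_field E u.I0 \<and> 0 \<le> v \<omega> \<and> (\<exists>c \<in> \<kappa>. \<exists>b \<in> \<kappa>. b \<noteq> \<zero>\<^bsub>kR\<^esub> \<and> \<phi> \<omega> = c \<oplus>\<^bsub>kR\<^esub> b \<otimes>\<^bsub>kR\<^esub> u.\<eta>))"

lemma omega: "\<omega> \<in> fixed_field E u.I0" "0 \<le> v \<omega>" "\<exists>c \<in> \<kappa>. \<exists>b \<in> \<kappa>. b \<noteq> \<zero>\<^bsub>kR\<^esub> \<and> \<phi> \<omega> = c \<oplus>\<^bsub>kR\<^esub> b \<otimes>\<^bsub>kR\<^esub> u.\<eta>"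
  "\<omega> \<in> E" "\<omega> \<in> U" "\<omega> \<in> carrier R"
proof -
  have "\<exists>\<omega>. \<omega> \<in> fixed_field E u.I0 \<and> 0 \<le> v \<omega> \<and> (\<exists>c \<in> \<kappa>. \<exists>b \<in> \<kappa>. b \<noteq> \<zero>\<^bsub>kR\<^esub> \<and> \<phi> \<omega> = c \<oplus>\<^bsub>kR\<^esub> b \<otimes>\<^bsub>kR\<^esub> u.\<eta>)"
    using omega_exists by blast
  from someI_ex[OF this, folded \<omega>_def]
  show w: "\<omega> \<in> fixed_field E u.I0" "0 \<le> v \<omega>" "\<exists>c \<in> \<kappa>. \<exists>b \<in> \<kappa>. b \<noteq> \<zero>\<^bsub>kR\<^esub> \<and> \<phi> \<omega> = c \<oplus>\<^bsub>kR\<^esub> b \<otimes>\<^bsub>kR\<^esub> u.\<eta>"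
    by blast+
  have "u.Z0 \<subseteq> u.I0" unfolding u.Z0_def u.I0_def by auto
  then show "\<omega> \<in> U" "\<omega> \<in> E" "\<omega> \<in> carrier R" using w(1) E_carrier unfolding U_def fixed_field_def by auto
qed

text \<open>Coefficients from \<open>L\<close> are allowed because their residues already come from
  \<open>K\<close>.\<close>

lemma residue_independent:
  assumes q: "set q \<subseteq> {x \<in> L. 0 \<le> v x}" "length q \<le> p" "0 < v (eval q \<omega>)" and b: "b \<in> set q" shows "0 < v b"
proof -
  have qR: "set q \<subseteq> {x \<in> carrier R. 0 \<le> v x}" using q(1) L_facts(5) by auto
  note e = \<phi>_eval[OF qR omega(6,2)]
  then have "k.eval (map \<phi> q) (\<phi> \<omega>) = \<zero>\<^bsub>kR\<^esub>" using q(3) \<phi>_zero_iff[of "eval q \<omega>"] by simp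
  moreover obtain c u where cu: "c \<in> \<kappa>" "u \<in> \<kappa>" "u \<noteq> \<zero>\<^bsub>kR\<^esub>" "\<phi> \<omega> = c \<oplus>\<^bsub>kR\<^esub> u \<otimes>\<^bsub>kR\<^esub> u.\<eta>" using omega(3) by blast
  moreover have "set (map \<phi> q) \<subseteq> \<kappa>" using K_residue q(1) unfolding \<kappa>_def by fastforce
  ultimately have "set (map \<phi> q) \<subseteq> {\<zero>\<^bsub>kR\<^esub>}" using u.powers_independent[OF cu(1-3), of "map \<phi> q"] q(2) by simp
  then have "\<phi> b = \<zero>\<^bsub>kR\<^esub>" using b by auto
  then show ?thesis using \<phi>_zero_iff[of b] b qR by auto
qed

text \<open>Dividing by a coefficient of least value makes all coefficients integral and one of them
  \<open>\<one>\<close>; by independence of the residues the combination is then a unit.\<close>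

lemma basis_val:
  assumes q: "set q \<subseteq> L" "length q \<le> p" "\<not> set q \<subseteq> {\<zero>}"
  shows "\<exists>b \<in> set q. b \<noteq> \<zero> \<and> v (eval q \<omega>) = v b \<and> (\<forall>a \<in> set q. v b \<le> v a)"
proof -
  have qR: "set q \<subseteq> carrier R" using q(1) L_facts(5) by blast
  have "v ` set q \<noteq> {}" using q(3) by auto
  then have "Min (v ` set q) \<in> v ` set q" by (intro Min_in) auto
  then obtain b where b: "b \<in> set q" "v b = Min (v ` set q)" by auto
  then have min: "v b \<le> v a" if "a \<in> set q" for a using that by simp
  obtain a where "a \<in> set q" "a \<noteq> \<zero>" using q(3) by blast
  then have b0: "b \<noteq> \<zero>" using min[of a] v_inf_iff[of a] qR by auto
  have bR: "b \<in> carrier R" "b \<in> L" using b qR q by auto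
  obtain r where r: "v b = ereal r" using v_realE[OF bR(1) b0] .
  note ib = v_inv[OF bR(1) b0]
  have ibL: "inv b \<in> L" using subfield_m_inv(1)[OF L_facts(1)] bR b0 by simp
  let ?q = "map (\<lambda>a. a \<otimes> inv b) q"
  have "0 \<le> v (a \<otimes> inv b)" if "a \<in> set q" for a
    using v_mult_ge[of a "inv b" r "- r"] min[OF that] ib r qR that by (simp add: zero_ereal_def subset_iff)
  then have int: "set ?q \<subseteq> {x \<in> L. 0 \<le> v x}" using q(1) ibL subringE(6)[OF subfieldE(1)[OF L_facts(1)]] by auto
  have intR: "set ?q \<subseteq> {x \<in> carrier R. 0 \<le> v x}" using int L_facts(5) by auto
  have "b \<otimes> inv b \<in> set ?q" using b(1) by simp
  then have "\<one> \<in> set ?q" using bR(1) b0 field_Units by simp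
  then have "\<not> 0 < v (eval ?q \<omega>)" using residue_independent[OF int, of \<one>] q(2) by auto
  then have "v (eval ?q \<omega>) = 0" using \<phi>_eval[OF intR omega(6,2)] by auto
  moreover have "eval ?q \<omega> = eval q \<omega> \<otimes> inv b" using eval_scale[OF qR omega(6) ib(2)] .
  ultimately have "v (eval q \<omega>) + - v b = 0" using v_mult[OF _ ib(2), of "eval q \<omega>"] eval_in_carrier[OF qR omega(6)] ib(1) by simp
  then have "v (eval q \<omega>) = v b" using r by (cases "v (eval q \<omega>)") (auto simp: zero_ereal_def)
  then show ?thesis using b(1) b0 min by blast
qed

text \<open>No nontrivial relation of length at most \<open>p\<close> can hold, so
  \<open>\<omega>\<close> has degree exactly \<open>p\<close> over \<open>B\<close> and generates
  \<open>C\<close>. Applied to \<open>E\<close> over \<open>L\<close> and to \<open>U\<close> over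
  \<open>F\<close>.\<close>

lemma residue_basis:
  assumes B: "subfield B R" "K \<subseteq> B" "B \<subseteq> L" and C: "subfield C R" "B \<subseteq> C" "C \<subseteq> E" "\<omega> \<in> C" "dimension p B C" and x: "x \<in> C"
  shows "\<exists>q. set q \<subseteq> B \<and> length q \<le> p \<and> x = eval q \<omega>"
proof -
  have BE: "B \<subseteq> E" using C(2,3) by blast
  note gB = galois_intermediate[OF galoisE B(1,2) BE]
  note alg = galoisD(5)[OF gB omega(4)]
  note Irr = IrrE[OF B(1) omega(6) alg] and ne = Irr_not_empty[OF B(1) omega(6) alg]
  let ?S = "simple_extension B \<omega>"
  note S = subfield_simple_extension[OF B(1) omega(6) alg]
  have SC: "?S \<subseteq> C" using simple_extension_subring_incl[OF subfieldE(1)[OF C(1)] C(2,4)] .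
  have SE: "?S \<subseteq> E" using SC C(3) by blast
  have dS: "dimension (degree (Irr B \<omega>)) B ?S" using dimension_simple_extension[OF B(1) omega(6) alg] .
  have ge: "p \<le> degree (Irr B \<omega>)"
  proof (rule ccontr)
    assume "\<not> ?thesis"
    then have len: "length (Irr B \<omega>) \<le> p" by simp
    have "hd (Irr B \<omega>) \<in> set (Irr B \<omega>)" "hd (Irr B \<omega>) \<noteq> \<zero>" using hd_in_set[OF ne(1)] Irr(3) by auto
    then have nz: "\<not> set (Irr B \<omega>) \<subseteq> {\<zero>}" by blast
    have sub: "set (Irr B \<omega>) \<subseteq> L" using poly_coeffs[OF Irr(1)] B(3) by blast
    obtain b where "b \<in> set (Irr B \<omega>)" "b \<noteq> \<zero>" "v (eval (Irr B \<omega>) \<omega>) = v b" using basis_val[OF sub len nz] by blast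
    then show False using Irr(4) v_inf_iff[of b] sub L_facts(5) by auto
  qed
  have "degree (Irr B \<omega>) = p" using ge dimension_mono[OF gB S(1,2) dS C(1,3) SC C(5)] by simp
  then have "?S = C" using dimension_subset_eq[OF B(1) _ C(5) SC] dS by simp
  then show ?thesis using simple_extension_rep[OF B(1) omega(6) alg, of x] x \<open>degree (Irr B \<omega>) = p\<close> by auto
qed

end

section \<open>Upper ramification breaks\<close>

lemma (in ring) herbrand_single_break:
  fixes A :: "('a \<Rightarrow> 'a) set"
  assumes low: "\<And>u. lower_ram_group v K E u = (if u \<le> 1 then A else B)" and c: "card A = q" "card B = 1" "q > 0" and u: "-1 \<le> u"
  shows "herbrand v K E u = (if u \<le> 1 then u else 1 + (u - 1) / q)"
proof -
  let ?g = "\<lambda>t. real (card (lower_ram_group v K E t)) / real (card (lower_ram_group v K E 0))"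
  have g: "?g t = (if t \<le> 1 then 1 else 1 / q)" for t using low c by simp
  have one: "(?g has_integral a) {0..a}" if "0 \<le> a" "a \<le> 1" for a
    by (rule has_integral_eq[of _ "\<lambda>_. 1"]) (use g that has_integral_const_real[of "1::real" 0 a] in auto)
  \<comment> \<open>At the point \<open>1\<close> the integrand still has the value
    \<open>1\<close>; a single point does not affect the integral over
    \<open>{1..u}\<close>.\<close>
  have two: "(?g has_integral (u - 1) / q) {1..u}" if "1 < u"
    by (rule has_integral_spike_finite[of "{1}" _ _ "\<lambda>_. 1 / real q"])
      (use g that has_integral_const_real[of "1 / real q" 1 u] in auto)
  consider "u < 0" | "0 \<le> u" "u \<le> 1" | "1 < u" by linarith
  then show ?thesis
  proof cases
    case 1
    then show ?thesis unfolding herbrand_def by simp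
  next
    case 2
    then show ?thesis unfolding herbrand_def using integral_unique[OF one[OF 2]] by simp
  next
    case 3
    have "(?g has_integral (1 + (u - 1) / q)) {0..u}"
      by (rule has_integral_combine[of 0 1 u]) (use 3 one[of 1] two in auto)
    then have "integral {0..u} ?g = 1 + (u - 1) / q" by (rule integral_unique)
    moreover have "herbrand v K E u = integral {0..u} ?g" unfolding herbrand_def by (rule if_not_P) (use 3 in simp)
    ultimately have "herbrand v K E u = 1 + (u - 1) / q" by (rule trans[rotated])
    then show ?thesis using 3 by simp
  qed
qed

text \<open>The Herbrand function is the identity up to \<open>1\<close> and has slope
  \<open>1 / q\<close> beyond, so on \<open>{-1..}\<close> it is injective with an explicit inverse,
  and the break at \<open>1\<close> keeps its number.\<close>

lemma (in ring) upper_breaks_single: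
  fixes A :: "('a \<Rightarrow> 'a) set"
  assumes low: "\<And>u. lower_ram_group v K E u = (if u \<le> 1 then A else B)" and c: "card A = q" "card B = 1" "q > 1"
  shows "upper_breaks v K E = {1}"
proof -
  let ?h = "herbrand v K E"
  have q: "real q > 1" using c by simp
  have h: "?h u = (if u \<le> 1 then u else 1 + (u - 1) / q)" if "-1 \<le> u" for u
    by (rule herbrand_single_break[OF low]) (use c that in auto)
  have gt: "?h u > 1 \<longleftrightarrow> u > 1" if "-1 \<le> u" for u using h[OF that] q by (auto simp: field_simps)
  have inj: "inj_on ?h {-1..}"
  proof (rule inj_onI)
    fix x y :: real assume xy: "x \<in> {-1..}" "y \<in> {-1..}" "?h x = ?h y"
    then have "x > 1 \<longleftrightarrow> y > 1" using gt[of x] gt[of y] by auto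
    then show "x = y" using xy h[of x] h[of y] q by (auto split: if_splits)
  qed
  have up: "upper_ram_group v K E w = (if w \<le> 1 then A else B)" if w: "-1 \<le> w" for w
  proof -
    define x where "x = (if w \<le> 1 then w else 1 + q * (w - 1))"
    have x: "-1 \<le> x" "x \<le> 1 \<longleftrightarrow> w \<le> 1" unfolding x_def using w q by (auto intro: order_trans[of _ 0] simp: mult_le_0_iff)
    have "?h x = w" unfolding h[OF x(1)] using x(2) q unfolding x_def by auto
    then have "inv_into {-1..} ?h w = x" using inv_into_f_eq[OF inj, of x w] x(1) by simp
    then show ?thesis unfolding upper_ram_group_def using low x(2) by simp
  qed
  have AB: "A \<noteq> B" using c by auto
  show ?thesis
  proof (intro Set.set_eqI iffI)
    fix w assume "w \<in> upper_breaks v K E"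
    then have w: "-1 \<le> w" "\<And>e. e > 0 \<Longrightarrow> upper_ram_group v K E (w + e) \<noteq> upper_ram_group v K E w" unfolding upper_breaks_def by auto
    have "\<not> w > 1" using w(2)[of 1] up[of w] up[of "w + 1"] by auto
    moreover have "\<not> w < 1" using w(1) w(2)[of "1 - w"] up[of w] up[of 1] by auto
    ultimately show "w \<in> {1}" by simp
  next
    fix w :: real assume "w \<in> {1}"
    then show "w \<in> upper_breaks v K E" unfolding upper_breaks_def using AB up by simp
  qed
qed

lemma (in ring) eval_zeros: "set q \<subseteq> {\<zero>} \<Longrightarrow> x \<in> carrier R \<Longrightarrow> eval q x = \<zero>"
  by (induction q) auto

section \<open>Value groups of E, U and F\<close>

context eis_unsplit begin

lemma E_rep:
  assumes x: "x \<in> E" "x \<noteq> \<zero>"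
  shows "\<exists>q. set q \<subseteq> L \<and> x = eval q \<omega> \<and> (\<exists>b \<in> set q. b \<noteq> \<zero> \<and> v x = v b \<and> (\<forall>a \<in> set q. v b \<le> v a))"
proof -
  obtain q where q: "set q \<subseteq> L" "length q \<le> p" "x = eval q \<omega>"
    using residue_basis[OF L_facts(1,2) order_refl ED(2) L_E order_refl omega(4) dims(4) x(1)] by blast
  have "\<not> set q \<subseteq> {\<zero>}" using eval_zeros[OF _ omega(6)] x(2) q(3) by blast
  then show ?thesis using basis_val[OF q(1,2)] q by blast
qed

lemma E_val: assumes x: "x \<in> E" "x \<noteq> \<zero>" shows "\<exists>m::int. v x = ereal (m / N)"
  using E_rep[OF x] L_val by (metis subsetD)

text \<open>By \<open>basis_val\<close> a value on \<open>U\<close> is the value of a single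
  coefficient, and the coefficients lie in \<open>F\<close>.\<close>

lemma U_val: assumes x: "x \<in> U" "x \<noteq> \<zero>" shows "\<exists>b \<in> F. b \<noteq> \<zero> \<and> v x = v b"
proof -
  obtain q where q: "set q \<subseteq> F" "length q \<le> p" "x = eval q \<omega>"
    using residue_basis[OF F_facts(1,2) U_facts(7,1,6,3) omega(5) dims(2) x(1)] by blast
  have "\<not> set q \<subseteq> {\<zero>}" using eval_zeros[OF _ omega(6)] x(2) q(3) by blast
  moreover have "set q \<subseteq> L" using q(1) U_facts(7) by blast
  ultimately show ?thesis using basis_val[OF _ q(2)] q by blast
qed

lemma K_val_surj: "\<exists>c \<in> K. c \<noteq> \<zero> \<and> v c = ereal (real_of_int z)"
proof -
  note sK = subfieldE(1)[OF KD(1)]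
  have pw: "c [^] (n::nat) \<in> K" if "c \<in> K" for c n by (induction n) (use that subringE(3,6)[OF sK] in auto)
  note iP = v_inv[OF P_facts(1,3)]
  have iPK: "inv P \<in> K" using subfield_m_inv(1)[OF KD(1)] P_facts by simp
  have vP: "v P = ereal 1" "v (inv P) = ereal (- 1)" using P_facts(2) iP(1) by (auto simp: one_ereal_def)
  show ?thesis
  proof (cases "0 \<le> z")
    case True
    have "v (P [^] nat z) = ereal z" using v_pow_real[OF P_facts(1) vP(1), of "nat z"] True by simp
    then show ?thesis using pw[OF P_facts(4)] by (intro bexI[of _ "P [^] nat z"]) auto
  next
    case False
    have "v (inv P [^] nat (- z)) = ereal z" using v_pow_real[OF iP(2) vP(2), of "nat (- z)"] False by simp
    then show ?thesis using pw[OF iPK] by (intro bexI[of _ "inv P [^] nat (- z)"]) auto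
  qed
qed

text \<open>A value \<open>m / N\<close> with \<open>m\<close> prime to \<open>p\<close> would yield an element of value \<open>1 / N\<close>, whose degree over \<open>K\<close> is at least \<open>N\<close>.\<close>

lemma F_val: assumes x: "x \<in> F" "x \<noteq> \<zero>" shows "\<exists>m::int. v x = ereal (m / p)"
proof -
  have N0: "real N > 0" "real p > 0" "N = p * p" "p < N" using p_gtN p_gt(4) by auto
  have FR: "y \<in> carrier R" if "y \<in> F" for y using that U_facts(7) L_facts(5) by blast
  obtain m :: int where m: "v x = ereal (m / N)" using L_val x U_facts(7) by blast
  have "int p dvd m"
  proof (rule ccontr)
    assume nd: "\<not> int p dvd m"
    have "Factorial_Ring.prime (int p)" using prime_p by simp
    then have "coprime (int p) m" using nd prime_imp_coprime by blast
    then have "coprime (int p * int p) m" by simp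
    then have "gcd m (int N) = 1" unfolding N0(3) by (simp add: coprime_iff_gcd_eq_1 gcd.commute)
    then obtain r s where rs: "r * m + s * int N = 1" using bezout_int[of m "int N"] by metis
    \<comment> \<open>Only nonnegative powers of \<open>x\<close> are formed, so the Bezout
      coefficient is reduced modulo \<open>N\<close>; the integer \<open>z\<close> that this leaves
      over is removed by a factor \<open>c\<close> from \<open>K\<close>.\<close>
    define a where "a = nat (r mod int N)"
    have ra: "int a = r mod int N" unfolding a_def using N0 by simp
    obtain d where d: "r = d * int N + int a" unfolding ra by (metis div_mult_mod_eq)
    have "int a * m = 1 - (s + d * m) * int N" using rs unfolding d by (simp add: algebra_simps)
    then obtain z where z: "int a * m = 1 + z * int N" by (metis diff_conv_add_uminus mult_minus_left)
    obtain c where c: "c \<in> K" "c \<noteq> \<zero>" "v c = ereal (real_of_int (- z))" using K_val_surj by blast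
    define t where "t = x [^] a \<otimes> c"
    note sF = subfieldE(1)[OF F_facts(1)]
    have "x [^] a \<in> F" by (induction a) (use x subringE(3,6)[OF sF] in auto)
    then have tF: "t \<in> F" "t \<in> carrier R" unfolding t_def using c(1) F_facts(2) subringE(6)[OF sF] FR by auto
    have "v t = ereal (real a * (m / N) - z)"
      unfolding t_def using v_mult[of "x [^] a" c] v_pow_real[OF FR[OF x(1)] m, of a] FR[OF x(1)] c K_carrier by simp
    also have "real a * (m / N) - z = real_of_int (int a * m - z * int N) / N" using N0 by (simp add: field_simps)
    finally have vt: "v t = ereal (1 / N)" using z by simp
    note alg = galoisD(5)[OF F_facts(6) tF(1)]
    have "N \<le> degree (Irr K t)" using degree_Irr_ge[OF tF(2) vt alg] .
    moreover note S = subfield_simple_extension[OF KD(1) tF(2) alg]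
    have "simple_extension K t \<subseteq> F" using simple_extension_subring_incl[OF sF F_facts(2) tF(1)] .
    then have "degree (Irr K t) \<le> p"
      using dimension_mono[OF galoisE S(1,2) dimension_simple_extension[OF KD(1) tF(2) alg] F_facts(1,3) _ dims(1)] by blast
    ultimately show False using N0 by simp
  qed
  then obtain j where "m = int p * j" by blast
  then have "real_of_int m / N = j / p" using N0 by simp
  then show ?thesis using m by auto
qed

text \<open>The norm of \<open>\<pi>\<close> over the centre \<open>Z0\<close> has value
  \<open>p / N\<close>. Elements of \<open>Z0\<close> permute its factors; elements of
  \<open>H0\<close> fix each factor, since they fix \<open>\<pi>\<close> and commute with
  \<open>Z0\<close>; products of the two kinds give all of \<open>M0\<close>.\<close>

lemma F_uniformizer: "\<exists>t \<in> F. v t = ereal (1 / p)"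
proof -
  let ?t = "\<Otimes>\<rho>\<in>u.Z0. \<rho> \<pi>"
  have fin: "finite u.Z0" using finite_subset[OF subG(2) galois_card(2)[OF galoisE]] .
  have Z: "\<rho> \<in> carrier G" "\<rho> \<pi> \<in> E" "\<rho> \<pi> \<in> carrier R" "v (\<rho> \<pi>) = ereal (1 / N)" if "\<rho> \<in> u.Z0" for \<rho>
  proof -
    show r: "\<rho> \<in> carrier G" using that subG(2) by blast
    show "\<rho> \<pi> \<in> E" "\<rho> \<pi> \<in> carrier R" "v (\<rho> \<pi>) = ereal (1 / N)" using Z_stable[OF r pi_Z] Z_E Z_carrier Z_val by auto
  qed
  have tE: "?t \<in> E" by (rule finprod_in_subring[OF ED(7) fin]) (use Z(2) in blast)
  have vt: "v ?t = ereal (1 / p)" using v_finprod[OF fin, of "\<lambda>\<rho>. \<rho> \<pi>" "1 / real N"] Z u.cards(2) p_gt(4) p_gtN(4) by simp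
  have fz: "\<mu> ?t = ?t" if m: "\<mu> \<in> u.Z0" for \<mu>
    by (rule norm_fixed[OF galoisE u.subgroups(2) pi_facts(1) Z(1)[OF m] r.G.translation_bij[OF u.subgroups(2) m]])
      (use Gal_mult_apply[OF Z(1)[OF m] Z(1) pi_facts(1)] in simp)
  have fh: "h ?t = ?t" if h: "h \<in> u.H0" for h
  proof -
    have hG: "h \<in> carrier G" "h \<pi> = \<pi>" "h \<in> u.M0" using h unfolding H0_Gal Gal_L by (auto simp: H0_Gal[symmetric] h u.H0_def u.M0_def) (use h in \<open>auto simp: u.H0_def u.M0_def\<close>)
    show ?thesis
    proof (rule norm_fixed[OF galoisE u.subgroups(2) pi_facts(1) hG(1), of "\<lambda>\<rho>. \<rho>"])
      show "bij_betw (\<lambda>\<rho>. \<rho>) u.Z0 u.Z0" by (simp add: bij_betw_def)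
      fix \<rho> assume r: "\<rho> \<in> u.Z0"
      then have "\<rho> \<in> u.M0" unfolding u.Z0_def u.M0_def by simp
      then have "h \<otimes>\<^bsub>G\<^esub> \<rho> = \<rho> \<otimes>\<^bsub>G\<^esub> h" using u.M0_mult[OF hG(3)] by blast
      then show "h (\<rho> \<pi>) = \<rho> \<pi>"
        using Gal_mult_apply[OF hG(1) Z(1)[OF r] pi_facts(1)] Gal_mult_apply[OF Z(1)[OF r] hG(1) pi_facts(1)] hG(2) by simp
    qed
  qed
  have "\<mu> ?t = ?t" if m: "\<mu> \<in> u.M0" for \<mu>
  proof -
    obtain \<zeta> h where zh: "\<zeta> \<in> u.Z0" "h \<in> u.H0" "\<mu> = \<zeta> \<otimes>\<^bsub>G\<^esub> h" using u.M0_decomp[OF m] by blast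
    have "h \<in> carrier G" using zh(2) subG(3) by blast
    then show ?thesis unfolding zh(3) using Gal_mult_apply[OF Z(1)[OF zh(1)] _ tE] fz[OF zh(1)] fh[OF zh(2)] by simp
  qed
  then have "?t \<in> F" unfolding F_def fixed_field_def using tE by simp
  then show ?thesis using vt by blast
qed

lemma U_values: "v ` (U - {\<zero>}) = range (\<lambda>m::int. ereal (m / p))"
proof
  show "v ` (U - {\<zero>}) \<subseteq> range (\<lambda>m::int. ereal (m / p))" using U_val F_val by fastforce
  show "range (\<lambda>m::int. ereal (m / p)) \<subseteq> v ` (U - {\<zero>})"
  proof
    fix y assume "y \<in> range (\<lambda>m::int. ereal (m / p))"
    then obtain m :: int where m: "y = ereal (m / p)" by blast
    have p0: "real p > 0" using p_gtN by simp
    obtain t where t: "t \<in> F" "v t = ereal (1 / p)" using F_uniformizer by blast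
    \<comment> \<open>The quotient of \<open>m\<close> by \<open>p\<close> is realised as a value on
      \<open>K\<close>, the remainder by a power of \<open>t\<close>.\<close>
    obtain c where c: "c \<in> K" "c \<noteq> \<zero>" "v c = ereal (real_of_int (m div int p))" using K_val_surj by blast
    define n where "n = nat (m mod int p)"
    have n: "int n = m mod int p" unfolding n_def using p0 by simp
    have tU: "t \<in> U" "t \<in> carrier R" "t \<noteq> \<zero>" using t U_facts(3,6) E_carrier by auto
    have "t [^] n \<in> U" by (induction n) (use tU subringE(3,6)[OF subfieldE(1)[OF U_facts(1)]] in auto)
    then have mem: "t [^] n \<otimes> c \<in> U" "t [^] n \<in> carrier R" "c \<in> carrier R" using c U_facts(2) tU subringE(6)[OF subfieldE(1)[OF U_facts(1)]] K_carrier by auto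
    have "v (t [^] n \<otimes> c) = ereal (real n / p + m div int p)" using v_mult[OF mem(2,3)] v_pow_real[OF tU(2) t(2), of n] c(3) by simp
    also have "real n / p + m div int p = real_of_int (int n + int p * (m div int p)) / p" using p0 by (simp add: field_simps)
    also have "int n + int p * (m div int p) = m" unfolding n by simp
    finally have vy: "v (t [^] n \<otimes> c) = y" unfolding m .
    then have "t [^] n \<otimes> c \<noteq> \<zero>" using m by auto
    then show "y \<in> v ` (U - {\<zero>})" using vy mem(1) by blast
  qed
qed

lemma F_values: "v ` (F - {\<zero>}) = v ` (U - {\<zero>})"
  using U_val U_facts(6) by (auto simp: image_iff)

lemma coset_values: "{v x + v y | y. y \<in> U - {\<zero>}} = range (\<lambda>m::int. v x + ereal (m / p))"
proof -
  have "{v x + v y | y. y \<in> U - {\<zero>}} = (\<lambda>r. v x + r) ` (v ` (U - {\<zero>}))" by auto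
  then show ?thesis unfolding U_values by (simp add: image_image)
qed

lemma unramified_U: "unramified v F U"
  unfolding unramified_def
proof (intro conjI)
  show "subfield F R" "subfield U R" "F \<subseteq> U" using F_facts U_facts by auto
  show "finite_dimension F U" using finite_dimensionI[OF dims(2)] .
  have p0: "real p > 0" using p_gtN by simp
  have "{v x + v y | y. y \<in> F - {\<zero>}} = range (\<lambda>m::int. ereal (m / p))" if x: "x \<in> U - {\<zero>}" for x
  proof -
    obtain k :: int where k: "v x = ereal (k / p)" using x U_values by blast
    have "{v x + v y | y. y \<in> F - {\<zero>}} = (\<lambda>r. v x + r) ` (v ` (F - {\<zero>}))" by auto
    also have "\<dots> = (\<lambda>m::int. ereal (m / p)) ` ((\<lambda>m. k + m) ` UNIV)"
      unfolding F_values U_values k image_image by (simp add: add_divide_distrib)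
    finally show ?thesis unfolding surj_plus .
  qed
  then have "(\<lambda>x. {v x + v y | y. y \<in> F - {\<zero>}}) ` (U - {\<zero>}) = (\<lambda>x. range (\<lambda>m::int. ereal (m / p))) ` (U - {\<zero>})"
    by (intro image_cong refl) blast
  also have "\<dots> = {range (\<lambda>m::int. ereal (m / p))}"
    using subringE(3)[OF subfieldE(1)[OF U_facts(1)]] zero_not_one by auto
  finally show "ram_index v F U = 1" unfolding ram_index_def by simp
qed

text \<open>Values on \<open>E\<close> are the multiples of \<open>1 / N\<close>; modulo the
  multiples of \<open>1 / p\<close> they fall into \<open>p\<close> classes, each represented by a
  power of \<open>\<pi>\<close>.\<close>

lemma totally_ramified_E: "totally_ramified v U E"
proof -
  have p0: "real p > 0" "N = p * p" using p_gtN p_gt(4) by auto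
  let ?C = "\<lambda>i::int. range (\<lambda>m::int. ereal (real_of_int (i + int p * m) / N))"
  have cos: "{v x + v y | y. y \<in> U - {\<zero>}} = ?C i" if "v x = ereal (i / N)" for x and i :: int
  proof -
    have "real_of_int i / N + m / p = real_of_int (i + int p * m) / N" for m :: int using p0 by (simp add: field_simps)
    then show ?thesis unfolding coset_values unfolding that by simp
  qed
  have Cmod: "?C i = ?C (i mod int p)" for i
  proof -
    have e: "i mod int p + int p * (i div int p + m) = i + int p * m" for m by (simp add: algebra_simps)
    have "?C (i mod int p) = (\<lambda>m::int. ereal (real_of_int (i mod int p + int p * m) / N)) ` ((\<lambda>m. i div int p + m) ` UNIV)"
      unfolding surj_plus ..
    also have "\<dots> = ?C i" unfolding image_image e ..
    finally show ?thesis ..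
  qed
  have "(\<lambda>x. {v x + v y | y. y \<in> U - {\<zero>}}) ` (E - {\<zero>}) = ?C ` {0..<int p}"
  proof
    show "(\<lambda>x. {v x + v y | y. y \<in> U - {\<zero>}}) ` (E - {\<zero>}) \<subseteq> ?C ` {0..<int p}"
    proof
      fix A assume "A \<in> (\<lambda>x. {v x + v y | y. y \<in> U - {\<zero>}}) ` (E - {\<zero>})"
      then obtain x where x: "x \<in> E" "x \<noteq> \<zero>" "A = {v x + v y | y. y \<in> U - {\<zero>}}" by blast
      obtain i :: int where i: "v x = ereal (i / N)" using E_val[OF x(1,2)] by blast
      have "A = ?C (i mod int p)" unfolding x(3) cos[OF i] by (rule Cmod)
      moreover have "i mod int p \<in> {0..<int p}" using p0 by simp
      ultimately show "A \<in> ?C ` {0..<int p}" by (rule image_eqI)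
    qed
    show "?C ` {0..<int p} \<subseteq> (\<lambda>x. {v x + v y | y. y \<in> U - {\<zero>}}) ` (E - {\<zero>})"
    proof
      fix A assume "A \<in> ?C ` {0..<int p}"
      then obtain i where i: "0 \<le> i" "A = ?C i" by auto
      have vx: "v (\<pi> [^] nat i) = ereal (i / N)" using v_pow_real[OF pi(1) pi_facts(2), of "nat i"] i(1) by simp
      have "\<pi> [^] n \<in> E" for n :: nat by (induction n) (use pi_facts subringE(3,6)[OF ED(7)] in auto)
      then have "\<pi> [^] nat i \<in> E" .
      moreover have "\<pi> [^] nat i \<noteq> \<zero>" using vx by auto
      ultimately show "A \<in> (\<lambda>x. {v x + v y | y. y \<in> U - {\<zero>}}) ` (E - {\<zero>})"
        using cos[OF vx] i(2) by (intro image_eqI[of _ _ "\<pi> [^] nat i"]) auto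
    qed
  qed
  moreover have "inj_on ?C {0..<int p}"
  proof (rule inj_onI)
    fix i j assume ij: "i \<in> {0..<int p}" "j \<in> {0..<int p}" "?C i = ?C j"
    have "ereal (real_of_int (i + int p * 0) / N) \<in> ?C i" by (rule rangeI)
    then have "ereal (real_of_int (i + int p * 0) / N) \<in> ?C j" unfolding ij(3) .
    then obtain m :: int where "real_of_int (i + int p * 0) / N = real_of_int (j + int p * m) / N" by auto
    then have "real_of_int i = real_of_int (j + int p * m)" using p0 by simp
    then have "i = j + int p * m" by linarith
    then have "i mod int p = j mod int p" by simp
    then show "i = j" using ij(1,2) by simp
  qed
  ultimately have "ram_index v U E = p" unfolding ram_index_def by (simp add: card_image)
  then show ?thesis unfolding totally_ramified_def using U_facts(1,3) ED(2) dims(3) by simp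
qed

subsection \<open>The lower ramification groups over \<open>U\<close>\<close>

text \<open>The integers \<open>x\<close> satisfying the bound form a ring containing the integers
  of \<open>K\<close>, \<open>\<pi>\<close> and \<open>\<omega>\<close>, and these generate the
  integers of \<open>E\<close>. This replaces the usual argument with a single generator of the ring
  of integers.\<close>

lemma Z0_displacement:
  assumes r: "\<rho> \<in> u.Z0" and x: "x \<in> E" "0 \<le> v x" shows "ereal (2 / N) \<le> v (\<rho> x \<ominus> x)"
proof -
  have rG: "\<rho> \<in> carrier G" using r subG(2) by blast
  let ?A = "{x \<in> E. 0 \<le> v x \<and> ereal (2 / N) \<le> v (\<rho> x \<ominus> x)}"
  have AE: "x \<in> carrier R" "\<rho> x \<in> carrier R" "0 \<le> v (\<rho> x)" if "x \<in> ?A" for x using Gal_O[OF rG, of x] that by auto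
  have N2: "(0::ereal) \<le> ereal (2 / N)" by (simp add: zero_ereal_def)
  have A: "subring ?A R"
  proof (rule subringI)
    show "?A \<subseteq> carrier R" using AE by blast
    show "\<one> \<in> ?A" using subringE(3)[OF ED(7)] Gal_memD(8)[OF rG] by (simp add: a_minus_def r_neg)
    fix x assume x: "x \<in> ?A"
    note xR = AE[OF x]
    have "\<rho> (\<ominus> x) \<ominus> \<ominus> x = \<ominus> (\<rho> x \<ominus> x)" using Gal_minus(3)[OF ED(7) rG] x xR by (simp add: a_minus_def minus_add)
    then show "\<ominus> x \<in> ?A" using x xR subringE(5)[OF ED(7)] by simp
    fix y assume y: "y \<in> ?A"
    note yR = AE[OF y]
    have dx: "\<rho> x \<ominus> x \<in> carrier R" "\<rho> y \<ominus> y \<in> carrier R" using xR yR by auto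
    have "\<rho> (x \<oplus> y) \<ominus> (x \<oplus> y) = (\<rho> x \<ominus> x) \<oplus> (\<rho> y \<ominus> y)"
      using Gal_memD(6)[OF rG] x y xR yR by (simp add: a_minus_def minus_add a_ac)
    then show "x \<oplus> y \<in> ?A" using x y xR yR subringE(7)[OF ED(7)] v_add_ge[OF dx] v_nonneg_closed(2)[of x y] by simp
    \<comment> \<open>The product rule for the map sending \<open>x\<close> to
      \<open>\<rho> x \<ominus> x\<close>, twisted by \<open>\<rho>\<close> in one factor.\<close>
    have e: "\<rho> (x \<otimes> y) \<ominus> (x \<otimes> y) = \<rho> x \<otimes> (\<rho> y \<ominus> y) \<oplus> (\<rho> x \<ominus> x) \<otimes> y"
      using Gal_memD(7)[OF rG] x y xR yR minus_add_minus[of "\<rho> x \<otimes> \<rho> y" "\<rho> x \<otimes> y" "x \<otimes> y"]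
      by (simp add: a_minus_def l_distr r_distr l_minus r_minus)
    have "ereal (2 / N) \<le> v (\<rho> x \<otimes> (\<rho> y \<ominus> y))" "ereal (2 / N) \<le> v ((\<rho> x \<ominus> x) \<otimes> y)"
      using v_mult_ge[OF xR(2) dx(2), of 0 "2 / real N"] v_mult_ge[OF dx(1) yR(1), of "2 / real N" 0] x y xR yR by (auto simp: zero_ereal_def)
    then have "ereal (2 / N) \<le> v (\<rho> (x \<otimes> y) \<ominus> (x \<otimes> y))" unfolding e using xR yR dx by (intro v_add_ge) auto
    then show "x \<otimes> y \<in> ?A" using x y xR yR subringE(6)[OF ED(7)] v_nonneg_closed(1)[of x y] by simp
  qed
  have KA: "{c \<in> K. 0 \<le> v c} \<subseteq> ?A"
    using ED(3) Gal_memD(5)[OF rG] K_carrier by (auto simp: a_minus_def r_neg)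
  have piA: "\<pi> \<in> ?A"
  proof -
    note y = yy[OF Z_stable[OF rG pi_Z]]
    have "ereal (2 / N + 0) \<le> v (\<rho> \<pi> \<ominus> \<pi>)" unfolding y(3) using pi_facts y(1,2) by (intro v_mult_ge) (auto simp: zero_ereal_def)
    then show ?thesis using pi_facts by simp
  qed
  have LA: "a \<in> ?A" if a: "a \<in> L" "0 \<le> v a" for a
  proof -
    obtain q where q: "set q \<subseteq> {c \<in> K. 0 \<le> v c}" "a = eval q \<pi>" using L_int[OF a] by blast
    show ?thesis unfolding q(2) using eval_in_subring[OF A order_trans[OF q(1) KA] piA] .
  qed
  have "r \<in> u.Z0 \<Longrightarrow> r \<in> u.I0" for r unfolding u.Z0_def u.I0_def by simp
  then have "\<rho> \<omega> = \<omega>" using omega(1) r unfolding fixed_field_def by blast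
  then have oA: "\<omega> \<in> ?A" using omega by (simp add: a_minus_def r_neg)
  have "x \<in> ?A"
  proof (cases "x = \<zero>")
    case True
    then show ?thesis using subringE(2)[OF A] by simp
  next
    case False
    obtain q b where q: "set q \<subseteq> L" "x = eval q \<omega>" "v x = v b" "\<forall>a \<in> set q. v b \<le> v a" using E_rep[OF x(1) False] by blast
    have "set q \<subseteq> ?A" using LA q x(2) by (metis (no_types, lifting) order_trans subsetD subsetI)
    then show ?thesis unfolding q(2) using eval_in_subring[OF A _ oA] by blast
  qed
  then show ?thesis by simp
qed

text \<open>A uniformizer of \<open>E\<close> has value \<open>1 / N\<close>, so the threshold is
  \<open>(s + 1) / N\<close>. Elements of \<open>Z0\<close> move integers by at least
  \<open>2 / N\<close>, and a nontrivial one moves \<open>\<pi>\<close> by exactly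
  \<open>2 / N\<close>; so the jump is at \<open>s = 1\<close>.\<close>

lemma lower_groups: "lower_ram_group v U E s = (if s \<le> 1 then u.Z0 else {\<one>\<^bsub>G\<^esub>})"
proof -
  have N0: "real N > 0" using p_gtN by simp
  have unif: "v t = ereal (1 / N)" if "uniformizer v E t" for t
  proof -
    have t: "t \<in> E" "t \<noteq> \<zero>" "0 < v t" "v t \<le> v \<pi>" using that pi_facts unfolding uniformizer_def by auto
    obtain m :: int where m: "v t = ereal (m / N)" using E_val[OF t(1,2)] by blast
    have "0 < real_of_int m" "real_of_int m \<le> 1" using t(3,4) m N0 pi_facts(2) by (auto simp: zero_ereal_def field_simps)
    then have "m = 1" by linarith
    then show ?thesis using m by simp
  qed
  have piu: "uniformizer v E \<pi>"
    unfolding uniformizer_def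
  proof (intro conjI ballI impI)
    show "\<pi> \<in> E - {\<zero>}" "0 < v \<pi>" using pi_facts by auto
    fix y assume y: "y \<in> E" "0 < v y"
    show "v \<pi> \<le> v y"
    proof (cases "y = \<zero>")
      case False
      obtain m :: int where m: "v y = ereal (m / N)" using E_val[OF y(1) False] by blast
      then have "0 < m" using y(2) N0 by (simp add: zero_ereal_def zero_less_divide_iff)
      then show ?thesis unfolding m pi_facts(2) using N0 by (simp add: divide_right_mono)
    qed simp
  qed
  have mem: "\<rho> \<in> lower_ram_group v U E s \<longleftrightarrow> \<rho> \<in> u.Z0 \<and> (\<forall>x \<in> E. 0 \<le> v x \<longrightarrow> ereal ((s + 1) / N) \<le> v (\<rho> x \<ominus> x))" for \<rho>
    unfolding lower_ram_group_def val_ring_def U_facts(4) using unif piu by auto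
  show ?thesis
  proof (cases "s \<le> 1")
    case True
    then have "ereal ((s + 1) / N) \<le> ereal (2 / N)" using N0 by (simp add: divide_right_mono)
    then have "lower_ram_group v U E s = u.Z0" using mem Z0_displacement order_trans by blast
    then show ?thesis using True by simp
  next
    case False
    have "\<rho> = \<one>\<^bsub>G\<^esub>" if r: "\<rho> \<in> lower_ram_group v U E s" for \<rho>
    proof -
      have rZ: "\<rho> \<in> u.Z0" "ereal ((s + 1) / N) \<le> v (\<rho> \<pi> \<ominus> \<pi>)" using r mem pi_facts by auto
      have rG: "\<rho> \<in> carrier G" using rZ subG(2) by blast
      have "\<rho> \<pi> = \<pi>"
      proof (rule ccontr)
        assume n: "\<rho> \<pi> \<noteq> \<pi>"
        note z = Z_stable[OF rG pi_Z]
        obtain y where y: "vge 0 y" "\<rho> \<pi> \<ominus> \<pi> = \<pi> [^] (2::nat) \<otimes> y" "\<rho> \<pi> \<noteq> \<pi> \<longrightarrow> v y = 0"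
          using root_shift[OF pi, of "\<rho> \<pi>"] z unfolding Z_def by blast
        have "v (\<rho> \<pi> \<ominus> \<pi>) = ereal (2 / N)" unfolding y(2) using v_mult[OF pi_facts(4) vge_carrier[OF y(1)]] pi_facts(8) y(3) n by simp
        then have "(s + 1) / N \<le> 2 / N" using rZ(2) by simp
        then show False using False N0 by (simp add: divide_le_cancel)
      qed
      then have "Y \<rho> = \<zero>\<^bsub>kR\<^esub>" using Y_zero_iff[OF rG] by simp
      then show ?thesis using u.Y_zero_iff_coord[OF rG] u.one_if_zero[OF rG] rZ(1) unfolding u.Z0_def by simp
    qed
    moreover have "\<one>\<^bsub>G\<^esub> \<in> lower_ram_group v U E s"
      unfolding mem using subgroup.one_closed[OF u.subgroups(2)] E_carrier by (auto simp: Gal_one a_minus_def r_neg)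
    ultimately have "lower_ram_group v U E s = {\<one>\<^bsub>G\<^esub>}" by blast
    then show ?thesis using False by simp
  qed
qed

lemma upper_breaks_U: "upper_breaks v U E = {1}"
  by (rule upper_breaks_single[OF lower_groups u.cards(2)]) (use p_gtN in auto)

end

section \<open>Complements, elementary abelian groups and composition length\<close>

lemma split_extension_complement:
  assumes G: "group G" and Q: "group Q" and r: "r \<in> epi G Q" "kernel G Q r = N"
    and C: "subgroup C G" "C \<inter> N = {\<one>\<^bsub>G\<^esub>}" "\<And>g. g \<in> carrier G \<Longrightarrow> \<exists>c \<in> C. inv\<^bsub>G\<^esub> c \<otimes>\<^bsub>G\<^esub> g \<in> N"
  shows "split_extension G N Q r"
proof -
  interpret G: group G by (rule G)
  interpret r: group_hom G Q r using G Q r(1) unfolding epi_def by (auto intro!: group_hom.intro group_hom_axioms.intro)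
  note CG = subgroup.subset[OF C(1)]
  have eq: "r c = r g" if "c \<in> carrier G" "g \<in> carrier G" "inv\<^bsub>G\<^esub> c \<otimes>\<^bsub>G\<^esub> g \<in> N" for c g
  proof -
    have "inv\<^bsub>Q\<^esub> r c \<otimes>\<^bsub>Q\<^esub> r g = \<one>\<^bsub>Q\<^esub>" using that unfolding r(2)[symmetric] kernel_def by simp
    then have "inv\<^bsub>Q\<^esub> (inv\<^bsub>Q\<^esub> r c) = r g" using that group.inv_equality[OF Q] by (metis group.inv_comm[OF Q] group.inv_closed[OF Q] r.hom_closed)
    then show ?thesis using that group.inv_inv[OF Q] by simp
  qed
  have inj: "inj_on r C"
  proof (rule inj_onI)
    fix c e assume ce: "c \<in> C" "e \<in> C" "r c = r e"
    then have m: "c \<in> carrier G" "e \<in> carrier G" using CG by auto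
    have "r (inv\<^bsub>G\<^esub> c \<otimes>\<^bsub>G\<^esub> e) = \<one>\<^bsub>Q\<^esub>" using ce(3) m group.l_inv[OF Q] by simp
    then have "inv\<^bsub>G\<^esub> c \<otimes>\<^bsub>G\<^esub> e \<in> C \<inter> N"
      using ce m subgroup.m_closed[OF C(1) subgroup.m_inv_closed[OF C(1)]] unfolding r(2)[symmetric] kernel_def by simp
    then have "inv\<^bsub>G\<^esub> c \<otimes>\<^bsub>G\<^esub> e = \<one>\<^bsub>G\<^esub>" using C(2) by simp
    then show "c = e" using m by (metis G.inv_closed G.inv_equality G.inv_inv)
  qed
  have surj: "r ` C = carrier Q"
  proof
    show "r ` C \<subseteq> carrier Q" using CG r.hom_closed by blast
    show "carrier Q \<subseteq> r ` C"
    proof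
      fix q assume "q \<in> carrier Q"
      then obtain g where g: "g \<in> carrier G" "q = r g" using r(1) unfolding epi_def by blast
      then obtain c where c: "c \<in> C" "inv\<^bsub>G\<^esub> c \<otimes>\<^bsub>G\<^esub> g \<in> N" using C(3) by blast
      have "r c = q" using eq[OF subsetD[OF CG c(1)] g(1) c(2)] g(2) by simp
      then show "q \<in> r ` C" using c(1) by (rule image_eqI[OF sym])
    qed
  qed
  \<comment> \<open>\<open>r\<close> maps the complement bijectively onto the quotient; the section
    is the inverse of this bijection.\<close>
  let ?s = "inv_into C r"
  have s: "?s q \<in> C" "r (?s q) = q" if "q \<in> carrier Q" for q
    using that inv_into_into[of q r C] f_inv_into_f[of q r C] surj by auto
  have "?s \<in> hom Q G"
  proof (rule homI)
    fix x y assume xy: "x \<in> carrier Q" "y \<in> carrier Q"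
    then have "r (?s x \<otimes>\<^bsub>G\<^esub> ?s y) = x \<otimes>\<^bsub>Q\<^esub> y" using s CG by (simp add: subset_iff)
    moreover have "?s x \<otimes>\<^bsub>G\<^esub> ?s y \<in> C" using s xy subgroup.m_closed[OF C(1)] by blast
    ultimately show "?s (x \<otimes>\<^bsub>Q\<^esub> y) = ?s x \<otimes>\<^bsub>G\<^esub> ?s y" using inv_into_f_f[OF inj] by metis
  qed (use s CG in blast)
  then show ?thesis unfolding split_extension_def using G Q r s(2) by blast
qed

lemma (in ring) Gal_restrict: "(Gal K E)\<lparr>carrier := carrier (Gal F E)\<rparr> = Gal F E"
  unfolding Gal_def by simp

context char0_closed begin

lemma elementary_abelian_Gal:
  assumes g: "galois K E" and F: "subfield F R" "K \<subseteq> F" "F \<subseteq> E"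
    and comm: "\<And>\<rho> \<tau>. \<rho> \<in> carrier (Gal F E) \<Longrightarrow> \<tau> \<in> carrier (Gal F E) \<Longrightarrow> \<rho> \<otimes>\<^bsub>Gal K E\<^esub> \<tau> = \<tau> \<otimes>\<^bsub>Gal K E\<^esub> \<rho>"
    and pow: "\<And>\<rho>. \<rho> \<in> carrier (Gal F E) \<Longrightarrow> \<rho> [^]\<^bsub>Gal K E\<^esub> q = \<one>\<^bsub>Gal K E\<^esub>"
  shows "elementary_abelian q (Gal F E)"
  unfolding elementary_abelian_def
proof (intro conjI ballI)
  note d = galoisD[OF g]
  interpret G: group "Gal K E" using Gal_group[OF d(7,3)] .
  interpret GF: group "Gal F E" using Gal_group[OF d(7) F(3)] .
  show "comm_group (Gal F E)" by (rule GF.group_comm_groupI) (simp add: Gal_subset_mult[OF F(2)] comm)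
  show "finite (carrier (Gal F E))" using galois_card(2)[OF galois_intermediate[OF g F]] .
  fix \<rho> assume r: "\<rho> \<in> carrier (Gal F E)"
  show "\<rho> [^]\<^bsub>Gal F E\<^esub> q = \<one>\<^bsub>Gal F E\<^esub>"
    using pow[OF r] G.nat_pow_consistent[of \<rho> q "carrier (Gal F E)"] unfolding Gal_restrict Gal_one by simp
qed

text \<open>A chain of normal subgroups with all indices equal to the prime \<open>q\<close> is a
  composition series, since not even a subgroup fits between consecutive terms.\<close>

lemma gal_module_length:
  fixes q :: nat
  assumes g: "galois K E" "galois K F" "F \<subseteq> E" and ea: "elementary_abelian q (Gal F E)" and q: "Factorial_Ring.prime q"
    and N: "N 0 = {\<one>\<^bsub>Gal K E\<^esub>}" "N n = carrier (Gal F E)"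
      "\<And>i. i \<le> n \<Longrightarrow> subgroup (N i) (Gal K E)"
      "\<And>i \<rho> \<tau>. i \<le> n \<Longrightarrow> \<rho> \<in> carrier (Gal K E) \<Longrightarrow> \<tau> \<in> N i \<Longrightarrow> \<rho> \<otimes>\<^bsub>Gal K E\<^esub> \<tau> \<otimes>\<^bsub>Gal K E\<^esub> inv\<^bsub>Gal K E\<^esub> \<rho> \<in> N i"
      "\<And>i. i < n \<Longrightarrow> N i \<subseteq> N (Suc i) \<and> card (N (Suc i)) = q * card (N i)"
  shows "gal_module_has_length q K F E n"
  unfolding gal_module_has_length_def
proof (intro conjI exI[of _ N] allI impI)
  note d = galoisD[OF g(1)] and dF = galoisD[OF g(2)]
  interpret G: group "Gal K E" using Gal_group[OF d(7,3)] .
  note GF = subgroup_Gal[OF g(1) dF(3) g(3)]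
  show "gal_module q K F E" unfolding gal_module_def using normal_extension_galois g ea by blast
  show "N 0 = {\<one>\<^bsub>Gal F E\<^esub>}" "N n = carrier (Gal F E)" using N(1,2) unfolding Gal_one by auto
  have up: "N i \<subseteq> N (i + j)" if "i + j \<le> n" for i j
    using that
  proof (induction j)
    case (Suc j)
    then have "N i \<subseteq> N (i + j)" "N (i + j) \<subseteq> N (Suc (i + j))" using N(5)[of "i + j"] by auto
    then show ?case by simp
  qed simp
  have sub: "N i \<subseteq> carrier (Gal F E)" if "i \<le> n" for i using up[of i "n - i"] that N(2) by simp
  show "gal_submodule K F E (N i)" if i: "i \<le> n" for i
    unfolding gal_submodule_def using G.subgroup_incl[OF N(3)[OF i] GF sub[OF i]] N(4)[OF i] unfolding Gal_restrict by blast
  fix i assume i: "i < n"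
  then have i': "i \<le> n" "Suc i \<le> n" by auto
  have fin: "finite (N j)" if "j \<le> n" for j using finite_subset[OF subgroup.subset[OF N(3)[OF that]] galois_card(2)[OF g(1)]] .
  have "card (N i) > 0" using fin[OF i'(1)] subgroup.one_closed[OF N(3)[OF i'(1)]] by (auto simp: card_gt_0_iff)
  then have "card (N i) < card (N (Suc i))" using N(5)[OF i] prime_gt_1_nat[OF q] by simp
  then have "N i \<noteq> N (Suc i)" by (metis less_irrefl)
  then show "N i \<subset> N (Suc i)" using N(5)[OF i] by blast
  show "\<not> (\<exists>H. gal_submodule K F E H \<and> N i \<subset> H \<and> H \<subset> N (Suc i))"
  proof
    assume "\<exists>H. gal_submodule K F E H \<and> N i \<subset> H \<and> H \<subset> N (Suc i)"
    then obtain H where H: "subgroup H (Gal F E)" "N i \<subset> H" "H \<subset> N (Suc i)" unfolding gal_submodule_def by blast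
    have sH: "subgroup H (Gal K E)" using G.incl_subgroup[OF GF, of H] H(1) unfolding Gal_restrict by simp
    have "N i \<subseteq> H" "H \<subseteq> N (Suc i)" using H(2,3) by auto
    from G.subgroup_between[OF q N(3)[OF i'(1)] sH N(3)[OF i'(2)] this fin[OF i'(2)]] N(5)[OF i]
    have "H = N i \<or> H = N (Suc i)" by blast
    then show False using H(2,3) by blast
  qed
qed

end

section \<open>Module structure and splitting in the two cases\<close>

context eis_unsplit begin

lemma unsplit_conclusion:
  "subextension p K L F" "gal_module_has_length p K F E 2" "split_extension (Gal K E) (carrier (Gal F E)) (Gal K F) (\<lambda>\<rho>. restrict \<rho> F)" "U \<noteq> F"
proof -
  show "subextension p K L F" unfolding subextension_def using F_facts U_facts(7) dims(1) by blast
  have ea: "elementary_abelian p (Gal F E)"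
    by (rule elementary_abelian_Gal[OF galoisE F_facts(1-3)]) (use u.M0_mult u.M0_pow F_facts(4) in auto)
  \<comment> \<open>The composition series runs through the centre \<open>Z0\<close>, which is
    stable under conjugation.\<close>
  let ?N = "\<lambda>i::nat. if i = 0 then {\<one>\<^bsub>G\<^esub>} else if i = 1 then u.Z0 else u.M0"
  show "gal_module_has_length p K F E 2"
  proof (rule gal_module_length[OF galoisE F_facts(6,3) ea prime_p, of ?N])
    show "?N 0 = {\<one>\<^bsub>G\<^esub>}" "?N 2 = carrier (Gal F E)" using F_facts(4) by auto
    show "subgroup (?N i) G" for i using r.G.triv_subgroup u.subgroups by simp
    show "\<rho> \<otimes>\<^bsub>G\<^esub> \<tau> \<otimes>\<^bsub>G\<^esub> inv\<^bsub>G\<^esub> \<rho> \<in> ?N i" if "\<rho> \<in> carrier G" "\<tau> \<in> ?N i" for i \<rho> \<tau>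
      using that u.conj_closed by (auto split: if_splits)
    show "?N i \<subseteq> ?N (Suc i) \<and> card (?N (Suc i)) = p * card (?N i)" if "i < 2" for i
    proof -
      have "i = 0 \<or> i = 1" using that by auto
      moreover have "u.Z0 \<subseteq> u.M0" unfolding u.Z0_def u.M0_def by auto
      ultimately show ?thesis using subgroup.one_closed[OF u.subgroups(2)] u.cards by auto
    qed
  qed
  show "split_extension (Gal K E) (carrier (Gal F E)) (Gal K F) (\<lambda>\<rho>. restrict \<rho> F)"
  proof (rule split_extension_complement[OF groupG _ restrict_Gal[OF galoisE F_facts(6,3)] u.subgroups(5)])
    note dF = galoisD[OF F_facts(6)]
    show "group (Gal K F)" using Gal_group[OF dF(7,3)] .
  qed (use u.C0_complement F_facts(4) in auto)
  have "p \<noteq> p * p" using p_gtN by simp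
  then show "U \<noteq> F" using U_facts(4) F_facts(4) u.cards(1,2) by auto
qed

end

context eis_data begin

text \<open>Here \<open>E = L\<close> has an elementary abelian group of order \<open>p * p\<close>.
  An intermediate field \<open>J\<close> of degree \<open>p\<close> is normal because the group is
  commutative, and \<open>Gal J E\<close> has prime order, hence length one.\<close>

lemma rational_conclusion:
  assumes rat: "\<And>\<rho>. \<rho> \<in> carrier G \<Longrightarrow> Y \<rho> \<in> \<kappa>"
  shows "\<exists>J. subextension p K L J" "\<And>J. subextension p K L J \<Longrightarrow> gal_module_has_length p K J E 1"
    "elementary_abelian_extension p K L"
proof -
  have rc: "comm_group G" "\<And>\<rho>. \<rho> \<in> carrier G \<Longrightarrow> \<rho> [^]\<^bsub>G\<^esub> p = \<one>\<^bsub>G\<^esub>" "card (carrier G) = p * p"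
      "\<And>\<rho>. \<rho> \<in> carrier G \<Longrightarrow> Y \<rho> = \<zero>\<^bsub>kR\<^esub> \<Longrightarrow> \<rho> = \<one>\<^bsub>G\<^esub>"
    using r.rational_case rat by blast+
  have EL: "E = L" by (rule inert(2), rule rc(4))
  have comm: "\<rho> \<otimes>\<^bsub>G\<^esub> \<tau> = \<tau> \<otimes>\<^bsub>G\<^esub> \<rho>" if "\<rho> \<in> carrier G" "\<tau> \<in> carrier G" for \<rho> \<tau>
    using comm_groupE(4)[OF rc(1)] that by blast
  have sub: "carrier (Gal J E) \<subseteq> carrier G" if "K \<subseteq> J" for J using Gal_carrier_mono[OF that] .
  have "elementary_abelian p (Gal K E)"
    by (rule elementary_abelian_Gal[OF galoisE ED(1) order_refl ED(3)]) (use comm rc(2) in auto)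
  then show "elementary_abelian_extension p K L"
    unfolding elementary_abelian_extension_def EL[symmetric] using normal_extension_galois[OF galoisE] ED(4) by blast
  \<comment> \<open>A nontrivial element generates a subgroup of order \<open>p\<close>, whose fixed
    field is the required subextension.\<close>
  have "\<exists>\<rho> \<in> carrier G. \<rho> \<noteq> \<one>\<^bsub>G\<^esub>"
  proof (rule ccontr)
    assume "\<not> ?thesis"
    then have "carrier G \<subseteq> {\<one>\<^bsub>G\<^esub>}" by blast
    then have "card (carrier G) \<le> 1" using card_mono[of "{\<one>\<^bsub>G\<^esub>}"] by simp
    moreover have "1 < p * p" using p_gt(3) unfolding p_gt(4) by simp
    ultimately show False using rc(3) by simp
  qed
  then obtain \<rho> where r: "\<rho> \<in> carrier G" "\<rho> \<noteq> \<one>\<^bsub>G\<^esub>" by blast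
  have "r.G.ord \<rho> dvd p" using rc(2)[OF r(1)] r.G.pow_eq_id[OF r(1)] by simp
  moreover have "r.G.ord \<rho> \<noteq> 1" using r r.G.ord_eq_1 by blast
  ultimately have o: "r.G.ord \<rho> = p" using prime_p by (metis prime_nat_iff)
  let ?H = "generate G {\<rho>}"
  have H: "subgroup ?H G" "card ?H = p" using r.G.generate_is_subgroup[of "{\<rho>}"] r.G.generate_pow_card[OF r(1), symmetric] r(1) o by auto
  let ?J = "fixed_field E ?H"
  note J = fixed_field_subfield[OF galoisE subgroup.subset[OF H(1)]]
  obtain n where n: "dimension n K ?J" "n * card (carrier (Gal ?J E)) = card (carrier G)" using dimension_quotient[OF galoisE J] by blast
  then have "n = p" using Gal_fixed_field[OF galoisE H(1)] H(2) rc(3) p_gtN(4) by simp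
  then have "subextension p K L ?J" unfolding subextension_def using J n(1) EL by simp
  then show "\<exists>J. subextension p K L J" by blast
  fix J assume "subextension p K L J"
  then have J: "subfield J R" "K \<subseteq> J" "J \<subseteq> E" "dimension p K J" unfolding subextension_def EL by auto
  obtain n where n: "dimension n K J" "n * card (carrier (Gal J E)) = card (carrier G)" using dimension_quotient[OF galoisE J(1-3)] by blast
  have "n = p" using dimension_is_inj[OF KD(1) n(1) J(4)] .
  then have c: "card (carrier (Gal J E)) = p" using n(2) rc(3) p_gtN(4) by simp
  note sJ = subgroup_Gal[OF galoisE J(2,3)]
  have cj: "\<rho> \<otimes>\<^bsub>G\<^esub> \<tau> \<otimes>\<^bsub>G\<^esub> inv\<^bsub>G\<^esub> \<rho> = \<tau>" if "\<rho> \<in> carrier G" "\<tau> \<in> carrier G" for \<rho> \<tau>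
    using comm[OF that] that by (simp add: r.G.m_assoc)
  have "galois K (fixed_field E (carrier (Gal J E)))"
  proof (rule normal_fixed_field[OF galoisE sJ])
    fix \<rho> \<tau> assume "\<rho> \<in> carrier G" and t: "\<tau> \<in> carrier (Gal J E)"
    then have "\<rho> \<otimes>\<^bsub>G\<^esub> \<tau> \<otimes>\<^bsub>G\<^esub> inv\<^bsub>G\<^esub> \<rho> = \<tau>" using cj sub[OF J(2)] by blast
    then show "\<rho> \<otimes>\<^bsub>G\<^esub> \<tau> \<otimes>\<^bsub>G\<^esub> inv\<^bsub>G\<^esub> \<rho> \<in> carrier (Gal J E)" using t by simp
  qed
  then have gJ: "galois K J" unfolding fixed_field_Gal[OF galoisE J(1-3)] .
  have ea: "elementary_abelian p (Gal J E)"
    by (rule elementary_abelian_Gal[OF galoisE J(1-3)]) (use comm rc(2) sub[OF J(2)] in auto)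
  let ?N = "\<lambda>i::nat. if i = 0 then {\<one>\<^bsub>G\<^esub>} else carrier (Gal J E)"
  show "gal_module_has_length p K J E 1"
  proof (rule gal_module_length[OF galoisE gJ J(3) ea prime_p, of ?N])
    show "?N 0 = {\<one>\<^bsub>G\<^esub>}" "?N 1 = carrier (Gal J E)" by simp_all
    show "subgroup (?N i) G" for i using r.G.triv_subgroup sJ by simp
    show "\<rho> \<otimes>\<^bsub>G\<^esub> \<tau> \<otimes>\<^bsub>G\<^esub> inv\<^bsub>G\<^esub> \<rho> \<in> ?N i" if "\<rho> \<in> carrier G" "\<tau> \<in> ?N i" for i \<rho> \<tau>
      using that cj sub[OF J(2)] by (auto split: if_splits)
    show "?N i \<subseteq> ?N (Suc i) \<and> card (?N (Suc i)) = p * card (?N i)" if "i < 1" for i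
      using that c subgroup.one_closed[OF sJ] by simp
  qed
qed

end

section \<open>The reduced polynomial\<close>

text \<open>Mapping coefficients can create leading zeros, so the two sums agree only after
  normalisation; evaluation is insensitive to it.\<close>

lemma (in ring_hom_ring) eval_map_poly_add:
  assumes "set q \<subseteq> carrier R" "set r \<subseteq> carrier R" "z \<in> carrier S"
  shows "eval (map h (R.poly_add q r)) z = eval (map h q) z \<oplus>\<^bsub>S\<^esub> eval (map h r) z"
proof -
  have c: "set (map h q) \<subseteq> carrier S" "set (map h r) \<subseteq> carrier S" "set (map h (R.poly_add q r)) \<subseteq> carrier S"
    using assms(1,2) R.poly_add_in_carrier[OF assms(1,2)] by auto
  then have "eval (map h (R.poly_add q r)) z = eval (normalize (map h (R.poly_add q r))) z" using eval_normalize assms(3) by simp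
  then show ?thesis unfolding poly_add_hom'[OF assms(1,2)] using eval_poly_add[OF c(1,2) assms(3)] by simp
qed

text \<open>Linear factors are split off one at a time: either \<open>z\<close> is the image of the
  current root or it is a root of the image of the cofactor.\<close>

lemma splitted_hom_root:
  assumes h: "ring_hom_ring k S h" and k: "field k" and S: "field S" and z: "z \<in> carrier S"
    and q: "q \<in> carrier (poly_ring k)" "q \<noteq> []" "ring.splitted k q" "ring.eval S (map h q) z = \<zero>\<^bsub>S\<^esub>"
  shows "z \<in> h ` carrier k"
proof -
  interpret k: field k by (rule k)
  interpret S: field S by (rule S)
  interpret h: ring_hom_ring k S h by (rule h)
  interpret UP: domain "poly_ring k" using k.univ_poly_is_domain[OF k.carrier_is_subring] .
  show ?thesis using q
  proof (induction "length q" arbitrary: q rule: less_induct)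
    case less
    show ?case
    proof (cases "k.roots q = {#}")
      case True
      then have "degree q = 0" using less.prems(3) unfolding k.splitted_def by simp
      then obtain c where c: "q = [c]" using less.prems(2) by (cases q) auto
      then have cc: "c \<in> carrier k" "c \<noteq> \<zero>\<^bsub>k\<^esub>" using less.prems(1) by (auto simp: univ_poly_def polynomial_def)
      then have "h c = \<zero>\<^bsub>S\<^esub>" using less.prems(4) z unfolding c by simp
      moreover have "h c \<otimes>\<^bsub>S\<^esub> h (inv\<^bsub>k\<^esub> c) = \<one>\<^bsub>S\<^esub>" using cc k.field_Units h.hom_mult[of c "inv\<^bsub>k\<^esub> c"] by simp
      ultimately have False using cc k.field_Units S.zero_not_one by simp
      then show ?thesis ..
    next
      case False
      obtain a where a: "a \<in> carrier k" "[\<one>\<^bsub>k\<^esub>, \<ominus>\<^bsub>k\<^esub> a] \<in> carrier (poly_ring k)" "[\<one>\<^bsub>k\<^esub>, \<ominus>\<^bsub>k\<^esub> a] pdivides\<^bsub>k\<^esub> q"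
        using k.not_empty_rootsE[OF less.prems(1) False] by blast
      obtain r where r: "r \<in> carrier (poly_ring k)" "q = [\<one>\<^bsub>k\<^esub>, \<ominus>\<^bsub>k\<^esub> a] \<otimes>\<^bsub>poly_ring k\<^esub> r"
        using a(3) unfolding pdivides_def factor_def by blast
      have r0: "r \<noteq> []" using r less.prems(2) a(2) UP.r_null[OF a(2)] by (auto simp: univ_poly_zero)
      have qm: "q = k.poly_mult [\<one>\<^bsub>k\<^esub>, \<ominus>\<^bsub>k\<^esub> a] r" using r(2) unfolding univ_poly_mult .
      have deg: "degree q = Suc (degree r)"
        unfolding qm using k.poly_mult_degree_eq[OF k.carrier_is_subring, of "[\<one>\<^bsub>k\<^esub>, \<ominus>\<^bsub>k\<^esub> a]" r] a(2) r(1) r0 by (simp add: univ_poly_carrier)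
      have "k.roots q = add_mset a (k.roots r)" unfolding r(2) using k.poly_mult_degree_one_monic_imp_same_roots[OF a(1) r(1) r0] .
      then have spl: "k.splitted r" using less.prems(3) deg unfolding k.splitted_def by simp
      have cs: "set [\<one>\<^bsub>k\<^esub>, \<ominus>\<^bsub>k\<^esub> a] \<subseteq> carrier k" "set r \<subseteq> carrier k" using a(1) k.poly_coeffs[OF r(1)] by auto
      have cq: "set (map h q) \<subseteq> carrier S" using k.poly_coeffs[OF less.prems(1)] by auto
      have cm: "set (map h [\<one>\<^bsub>k\<^esub>, \<ominus>\<^bsub>k\<^esub> a]) \<subseteq> carrier S" "set (map h r) \<subseteq> carrier S" using cs by auto
      have "S.eval (map h q) z = S.eval (S.poly_mult (map h [\<one>\<^bsub>k\<^esub>, \<ominus>\<^bsub>k\<^esub> a]) (map h r)) z"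
        using S.eval_normalize[OF cq z] h.poly_mult_hom'[OF cs] unfolding qm by simp
      also have "\<dots> = (z \<ominus>\<^bsub>S\<^esub> h a) \<otimes>\<^bsub>S\<^esub> S.eval (map h r) z"
        unfolding S.eval_poly_mult[OF cm z] using z a(1) by (simp add: a_minus_def)
      finally have "(z \<ominus>\<^bsub>S\<^esub> h a) \<otimes>\<^bsub>S\<^esub> S.eval (map h r) z = \<zero>\<^bsub>S\<^esub>" using less.prems(4) by simp
      then consider "z \<ominus>\<^bsub>S\<^esub> h a = \<zero>\<^bsub>S\<^esub>" | "S.eval (map h r) z = \<zero>\<^bsub>S\<^esub>"
        using S.integral[of "z \<ominus>\<^bsub>S\<^esub> h a"] S.eval_in_carrier[OF cm(2) z] z a(1) by auto
      then show ?thesis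
      proof cases
        case 1
        then have "z = h a" using z a(1) S.r_right_minus_eq[of z "h a"] by simp
        then show ?thesis using a(1) by blast
      next
        case 2
        have "length r < length q" using deg by simp
        then show ?thesis using less.hyps[OF _ r(1) r0 spl 2] by blast
      qed
    qed
  qed
qed

context eis_root begin

abbreviation "kk \<equiv> residue_field v p K"
abbreviation "cc \<equiv> residue_class v p K"

text \<open>\<open>\<phi>\<close> is constant on each class modulo \<open>p\<close>, so the image of
  a class is a singleton; this identifies the residue field of \<open>K\<close> with
  \<open>\<kappa>\<close> inside \<open>kR\<close>.\<close>

definition \<psi> :: "'a set \<Rightarrow> 'a set" where "\<psi> = (\<lambda>A. the_elem (\<phi> ` A))"

text \<open>On the integers of \<open>K\<close> the kernel of \<open>\<phi>\<close> is the ideal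
  generated by \<open>p\<close>: as \<open>K\<close> is unramified, its values are integers, so a
  positive one is at least \<open>1 = v P\<close>.\<close>

lemma residue_iso:
  "field kk" "\<psi> \<in> ring_iso kk (kR\<lparr>carrier := \<kappa>\<rparr>)" "ring_hom_ring kk kR \<psi>"
  "\<And>x. x \<in> K \<Longrightarrow> 0 \<le> v x \<Longrightarrow> cc x \<in> carrier kk \<and> \<psi> (cc x) = \<phi> x"
proof -
  let ?O = "val_ring v K"
  let ?S = "R\<lparr>carrier := ?O\<rparr>"
  note sK = subringE[OF subfieldE(1)[OF KD(1)]]
  have O: "x \<in> ?O \<longleftrightarrow> x \<in> K \<and> 0 \<le> v x" for x unfolding val_ring_def by simp
  have subO: "subring ?O R"
  proof (rule subringI)
    show "?O \<subseteq> carrier R" using O K_carrier by blast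
    show "\<one> \<in> ?O" using O sK by simp
    show "\<ominus> x \<in> ?O" if "x \<in> ?O" for x using that O sK K_carrier by simp
    show "x \<otimes> y \<in> ?O" "x \<oplus> y \<in> ?O" if "x \<in> ?O" "y \<in> ?O" for x y
      using that O sK(6,7) K_carrier v_nonneg_closed(1,2)[of x y] by auto
  qed
  interpret S: domain ?S using subring_is_domain[OF subO] .
  have "\<phi> \<in> ring_hom ?S kR"
    by (rule ring_hom_memI) (use O K_carrier \<phi>_simps in auto)
  then interpret h: ring_hom_ring ?S kR \<phi> using ring_hom_ringI2[OF S.ring_axioms k.ring_axioms] by blast
  have ker: "a_kernel ?S kR \<phi> = PIdl\<^bsub>?S\<^esub> ([p] \<cdot> \<one>)"
  proof -
    have "x \<in> ?O \<and> \<phi> x = \<zero>\<^bsub>kR\<^esub> \<longleftrightarrow> (\<exists>y \<in> ?O. x = y \<otimes> P)" for x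
    proof
      assume x: "x \<in> ?O \<and> \<phi> x = \<zero>\<^bsub>kR\<^esub>"
      then have xK: "x \<in> K" "x \<in> carrier R" "0 < v x" using O K_carrier \<phi>_zero_iff by auto
      note iP = v_inv[OF P_facts(1,3)]
      have m: "x \<otimes> inv P \<in> K" using xK sK(6) subfield_m_inv(1)[OF KD(1)] P_facts by simp
      have "0 \<le> v (x \<otimes> inv P)"
      proof (cases "x = \<zero>")
        case False
        obtain z :: int where z: "v x = ereal z" using KD(5)[OF xK(1) False] by auto
        then have "1 \<le> z" using xK(3) by (simp add: zero_ereal_def)
        then show ?thesis using v_mult[OF xK(2) iP(2)] iP(1) P_facts(2) z by (simp add: one_ereal_def zero_ereal_def)
      qed (use iP in simp)
      moreover have "x = (x \<otimes> inv P) \<otimes> P" using xK(2) P_facts iP field_Units by (simp add: m_assoc)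
      ultimately show "\<exists>y \<in> ?O. x = y \<otimes> P" using m O by blast
    next
      assume "\<exists>y \<in> ?O. x = y \<otimes> P"
      then obtain y where y: "y \<in> K" "0 \<le> v y" "x = y \<otimes> P" using O by blast
      have "0 < v x" unfolding y(3) using v_mult[OF K_carrier[OF y(1)] P_facts(1)] y(2) P_facts(2) by (simp add: add_nonneg_pos)
      moreover have "x \<in> K" unfolding y(3) using y(1) P_facts(4) sK(6) by blast
      ultimately show "x \<in> ?O \<and> \<phi> x = \<zero>\<^bsub>kR\<^esub>" using O \<phi>_zero_iff[of x] K_carrier by (simp add: less_imp_le)
    qed
    then show ?thesis unfolding a_kernel_def' cgenideal_def P_def by auto
  qed
  have kk: "kk = ?S Quot (a_kernel ?S kR \<phi>)" unfolding residue_field_def Let_def ker ..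
  have cc: "cc x = (a_kernel ?S kR \<phi>) +>\<^bsub>?S\<^esub> x" for x unfolding residue_class_def Let_def ker ..
  have kap: "\<phi> ` carrier ?S = \<kappa>" unfolding \<kappa>_def val_ring_def by simp
  show iso: "\<psi> \<in> ring_iso kk (kR\<lparr>carrier := \<kappa>\<rparr>)" using h.FactRing_iso_set_aux unfolding kk kap \<psi>_def .
  have rk: "ring kk" unfolding kk using ideal.quotient_is_ring[OF h.kernel_is_ideal] .
  have hom: "\<psi> \<in> ring_hom kk kR" using h.the_elem_hom unfolding kk \<psi>_def .
  then show "ring_hom_ring kk kR \<psi>" using ring_hom_ringI2[OF rk k.ring_axioms] by blast
  show "cc x \<in> carrier kk \<and> \<psi> (cc x) = \<phi> x" if "x \<in> K" "0 \<le> v x" for x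
  proof -
    have x: "x \<in> carrier ?S" using that O by simp
    have "cc x \<in> carrier kk" unfolding cc kk FactRing_def A_RCOSETS_def' using x by auto
    moreover have "\<psi> (cc x) = \<phi> x" unfolding cc \<psi>_def using h.the_elem_simp[OF x] .
    ultimately show ?thesis by simp
  qed
  have fK: "field (kR\<lparr>carrier := \<kappa>\<rparr>)" using k.subfield_iff(2)[OF \<kappa>_facts(1)] .
  interpret fK: field "kR\<lparr>carrier := \<kappa>\<rparr>" by (rule fK)
  let ?g = "inv_into (carrier kk) \<psi>"
  have g: "?g \<in> ring_iso (kR\<lparr>carrier := \<kappa>\<rparr>) kk" using ring_iso_set_sym[OF rk iso] .
  \<comment> \<open>The transport of the field structure yields a ring whose zero is the image of
    zero; this has to be recognised as the zero of \<open>kk\<close>.\<close>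
  have "?g \<zero>\<^bsub>kR\<lparr>carrier := \<kappa>\<rparr>\<^esub> = \<zero>\<^bsub>kk\<^esub>" using ring_hom_zero[of ?g "kR\<lparr>carrier := \<kappa>\<rparr>" kk] g rk fK.ring_axioms unfolding ring_iso_def by blast
  then have "kk\<lparr>zero := ?g \<zero>\<^bsub>kR\<lparr>carrier := \<kappa>\<rparr>\<^esub>\<rparr> = kk" by simp
  then show "field kk" using fK.ring_iso_imp_img_field[OF g] by simp
qed

lemma \<psi>_facts: "x \<in> carrier kk \<Longrightarrow> \<psi> x \<in> \<kappa>" "inj_on \<psi> (carrier kk)" "\<psi> ` carrier kk = \<kappa>"
  using residue_iso(2) unfolding ring_iso_def bij_betw_def by auto

lemma red_coeff: assumes "1 \<le> i" "i \<le> N"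
  shows "red_coeff v p K f i \<in> carrier kk" "\<psi> (red_coeff v p K f i) = ab i"
  using residue_iso(4)[OF ab_mem(1,3)[OF assms]] unfolding red_coeff_def ab_def P_def by auto

lemma red_poly:
  "red_poly v p K f \<in> carrier (poly_ring kk)" "red_poly v p K f \<noteq> []" "degree (red_poly v p K f) \<le> N"
  "\<And>z. z \<in> carrier kR \<Longrightarrow> k.eval (map \<psi> (red_poly v p K f)) z =
    ab N \<otimes>\<^bsub>kR\<^esub> z [^]\<^bsub>kR\<^esub> (p * p) \<oplus>\<^bsub>kR\<^esub> (ab p \<otimes>\<^bsub>kR\<^esub> z [^]\<^bsub>kR\<^esub> p \<oplus>\<^bsub>kR\<^esub> ab 1 \<otimes>\<^bsub>kR\<^esub> z)"
proof -
  interpret kk: field kk by (rule residue_iso(1))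
  interpret h: ring_hom_ring kk kR \<psi> by (rule residue_iso(3))
  let ?c = "red_coeff v p K f"
  let ?m = "\<lambda>n. kk.monom (?c n) n"
  have b: "1 \<le> N" "1 \<le> p" "p \<le> N" using p_gtN by auto
  note c = red_coeff[OF b(1) order_refl] red_coeff[OF b(2,3)] red_coeff[OF order_refl b(1)]
  have m: "set (?m N) \<subseteq> carrier kk" "set (?m p) \<subseteq> carrier kk" "set (?m 1) \<subseteq> carrier kk"
    using kk.monom_in_carrier c by auto
  note m12 = kk.poly_add_in_carrier[OF m(1,2)]
  have A: "red_poly v p K f = kk.poly_add (kk.poly_add (?m N) (?m p)) (?m 1)"
    unfolding red_poly_def Let_def univ_poly_add N_def ..
  show "red_poly v p K f \<in> carrier (poly_ring kk)"
    unfolding A univ_poly_carrier[symmetric] using kk.poly_add_is_polynomial[OF kk.carrier_is_subring m12 m(3)] .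
  \<comment> \<open>The other two monomials have degrees \<open>p\<close> and \<open>1\<close>, both
    below \<open>N\<close>, so the coefficient of degree \<open>N\<close> survives; it is nonzero
    because \<open>f ! N\<close> has value exactly \<open>1\<close>.\<close>
  have "kk.coeff (red_poly v p K f) N = ?c N"
    unfolding A kk.poly_add_coeff[OF m12 m(3)] kk.poly_add_coeff[OF m(1,2)] kk.monom_coeff using c p_gtN by simp
  moreover have "?c N \<noteq> \<zero>\<^bsub>kk\<^esub>" using ab_nonzero(2) c(2) h.hom_zero by auto
  ultimately have "kk.coeff (red_poly v p K f) N \<noteq> \<zero>\<^bsub>kk\<^esub>" by (simp only: not_False_eq_True)
  then show "red_poly v p K f \<noteq> []" by (metis kk.coeff.simps(1))
  have len: "length (?m n) = Suc n" for n unfolding kk.monom_def by simp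
  have le: "length (kk.poly_add q r) \<le> Suc N" if "length q \<le> Suc N" "length r \<le> Suc N" for q r
    using kk.poly_add_length_le[of q r] that by (meson max.boundedI order_trans)
  have "length (red_poly v p K f) \<le> Suc N"
    unfolding A by (intro le) (simp_all only: len Suc_le_mono b order_refl)
  then show "degree (red_poly v p K f) \<le> N" by simp
  fix z assume z: "z \<in> carrier kR"
  have mm: "map \<psi> (?m n) = k.monom (\<psi> (?c n)) n" for n unfolding kk.monom_def k.monom_def by (simp add: map_replicate_const replicate_append_same)
  have abR: "ab N \<in> carrier kR" "ab p \<in> carrier kR" "ab 1 \<in> carrier kR" using ab_mem(4) b by auto
  have "k.eval (map \<psi> (red_poly v p K f)) z = (ab N \<otimes>\<^bsub>kR\<^esub> z [^]\<^bsub>kR\<^esub> N \<oplus>\<^bsub>kR\<^esub> ab p \<otimes>\<^bsub>kR\<^esub> z [^]\<^bsub>kR\<^esub> p) \<oplus>\<^bsub>kR\<^esub> ab 1 \<otimes>\<^bsub>kR\<^esub> z"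
    unfolding A h.eval_map_poly_add[OF m12 m(3) z] h.eval_map_poly_add[OF m(1,2) z] mm c(2,4,6)
    using k.eval_monom[OF _ z] abR z by simp
  then show "k.eval (map \<psi> (red_poly v p K f)) z =
    ab N \<otimes>\<^bsub>kR\<^esub> z [^]\<^bsub>kR\<^esub> (p * p) \<oplus>\<^bsub>kR\<^esub> (ab p \<otimes>\<^bsub>kR\<^esub> z [^]\<^bsub>kR\<^esub> p \<oplus>\<^bsub>kR\<^esub> ab 1 \<otimes>\<^bsub>kR\<^esub> z)"
    using abR z p_gt(4) by (simp add: k.a_assoc)
qed

lemma red_poly_eval:
  assumes x: "x \<in> carrier kk"
  shows "ring.eval kk (red_poly v p K f) x = \<zero>\<^bsub>kk\<^esub> \<longleftrightarrow>
    ab N \<otimes>\<^bsub>kR\<^esub> \<psi> x [^]\<^bsub>kR\<^esub> (p * p) \<oplus>\<^bsub>kR\<^esub> (ab p \<otimes>\<^bsub>kR\<^esub> \<psi> x [^]\<^bsub>kR\<^esub> p \<oplus>\<^bsub>kR\<^esub> ab 1 \<otimes>\<^bsub>kR\<^esub> \<psi> x) = \<zero>\<^bsub>kR\<^esub>"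
proof -
  interpret kk: field kk by (rule residue_iso(1))
  interpret h: ring_hom_ring kk kR \<psi> by (rule residue_iso(3))
  note A = kk.poly_coeffs[OF red_poly(1)]
  have e: "kk.eval (red_poly v p K f) x \<in> carrier kk" using kk.eval_in_carrier[OF A x] .
  have "kk.eval (red_poly v p K f) x = \<zero>\<^bsub>kk\<^esub> \<longleftrightarrow> \<psi> (kk.eval (red_poly v p K f) x) = \<zero>\<^bsub>kR\<^esub>"
    using inj_onD[OF \<psi>_facts(2) _ e kk.zero_closed] h.hom_zero by auto
  then show ?thesis unfolding h.eval_hom'[OF x A] using red_poly(4)[OF h.hom_closed[OF x]] by simp
qed

text \<open>The \<open>N\<close> values of \<open>Y\<close> are distinct roots of the image of the
  reduced polynomial, whose degree is at most \<open>N\<close>; hence splitting means that all of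
  them lie in \<open>\<kappa>\<close>.\<close>

lemma splitted_iff: "ring.splitted kk (red_poly v p K f) \<longleftrightarrow> (\<forall>\<rho> \<in> carrier G. Y \<rho> \<in> \<kappa>)"
proof
  interpret kk: field kk by (rule residue_iso(1))
  have YR: "Y \<rho> \<in> carrier kR" if "\<rho> \<in> carrier G" for \<rho> using Y_mem[OF that] subfieldE(3)[OF \<kappa>_facts(2)] by blast
  assume s: "ring.splitted kk (red_poly v p K f)"
  show "\<forall>\<rho> \<in> carrier G. Y \<rho> \<in> \<kappa>"
  proof
    fix \<rho> assume r: "\<rho> \<in> carrier G"
    show "Y \<rho> \<in> \<kappa>" using splitted_hom_root[OF residue_iso(3,1) kR_field YR[OF r] red_poly(1,2) s] red_poly(4)[OF YR[OF r]] Y_res[OF r] \<psi>_facts(3) by simp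
  qed
next
  interpret kk: field kk by (rule residue_iso(1))
  assume rat: "\<forall>\<rho> \<in> carrier G. Y \<rho> \<in> \<kappa>"
  let ?S = "{x \<in> carrier kk. \<psi> x \<in> Y ` carrier G}"
  have "\<psi> ` ?S = Y ` carrier G"
  proof
    show "Y ` carrier G \<subseteq> \<psi> ` ?S"
    proof
      fix y assume y: "y \<in> Y ` carrier G"
      then have "y \<in> \<psi> ` carrier kk" unfolding \<psi>_facts(3) using rat by blast
      then obtain x where x: "x \<in> carrier kk" "y = \<psi> x" by blast
      then show "y \<in> \<psi> ` ?S" using y by (intro image_eqI[of _ _ x]) simp_all
    qed
  qed blast
  moreover have "inj_on \<psi> ?S" by (rule inj_on_subset[OF \<psi>_facts(2) Collect_restrict])
  ultimately have "bij_betw \<psi> ?S (Y ` carrier G)" unfolding bij_betw_def by blast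
  then have c: "card ?S = N" using bij_betw_same_card[of \<psi> ?S "Y ` carrier G"] card_Y by simp
  have fin: "finite ?S" by (rule card_ge_0_finite) (use c p_gtN in simp)
  show "ring.splitted kk (red_poly v p K f)"
  proof (rule kk.splitted_if_card_roots[OF red_poly(1,2) fin])
    show "degree (red_poly v p K f) \<le> card ?S" unfolding c by (rule red_poly(3))
    fix x assume "x \<in> ?S"
    then obtain \<rho> where x: "x \<in> carrier kk" "\<rho> \<in> carrier G" "\<psi> x = Y \<rho>" by blast
    show "x \<in> carrier kk \<and> kk.eval (red_poly v p K f) x = \<zero>\<^bsub>kk\<^esub>"
      using x(1) red_poly_eval[OF x(1)] Y_res[OF x(2)] unfolding x(3) by blast
  qed
qed

text \<open>Both witnesses are carried along \<open>\<psi>\<close> from the abstract residue field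
  into \<open>\<kappa>\<close>, where \<open>eis_data\<close> expects them.\<close>

lemma eis_data_exists:
  assumes y: "\<exists>y \<in> Units kk. ring.eval kk (red_poly v p K f) y = \<zero>\<^bsub>kk\<^esub>"
    and z: "\<exists>z \<in> Units kk. red_coeff v p K f 1 \<otimes>\<^bsub>kk\<^esub> inv\<^bsub>kk\<^esub> (red_coeff v p K f (p\<^sup>2)) = z [^]\<^bsub>kk\<^esub> (p - 1)"
  shows "\<exists>W Zc. eis_data R v p Qp K f \<pi> W Zc"
proof -
  interpret kk: field kk by (rule residue_iso(1))
  interpret h: ring_hom_ring kk kR \<psi> by (rule residue_iso(3))
  have U: "x \<in> carrier kk" "\<psi> x \<in> \<kappa>" "\<psi> x \<noteq> \<zero>\<^bsub>kR\<^esub>" if "x \<in> Units kk" for x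
  proof -
    show x: "x \<in> carrier kk" "\<psi> x \<in> \<kappa>" using that \<psi>_facts(1) by auto
    have "x \<noteq> \<zero>\<^bsub>kk\<^esub>" using that kk.field_Units by simp
    then show "\<psi> x \<noteq> \<zero>\<^bsub>kR\<^esub>" using inj_onD[OF \<psi>_facts(2) _ x(1) kk.zero_closed] h.hom_zero by auto
  qed
  obtain y where y: "y \<in> Units kk" "ring.eval kk (red_poly v p K f) y = \<zero>\<^bsub>kk\<^esub>" using y by blast
  obtain z where z: "z \<in> Units kk" "red_coeff v p K f 1 \<otimes>\<^bsub>kk\<^esub> inv\<^bsub>kk\<^esub> (red_coeff v p K f N) = z [^]\<^bsub>kk\<^esub> (p - 1)"
    using z unfolding N_def by blast
  have b: "1 \<le> N" using p_gtN by auto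
  note c = red_coeff[OF b order_refl] red_coeff[OF order_refl b]
  have c0: "red_coeff v p K f N \<noteq> \<zero>\<^bsub>kk\<^esub>" using ab_nonzero(2) c(2) h.hom_zero by auto
  then have cU: "red_coeff v p K f N \<in> Units kk" using c(1) kk.field_Units by simp
  have "red_coeff v p K f 1 = (red_coeff v p K f 1 \<otimes>\<^bsub>kk\<^esub> inv\<^bsub>kk\<^esub> (red_coeff v p K f N)) \<otimes>\<^bsub>kk\<^esub> red_coeff v p K f N"
    using c cU by (simp add: kk.m_assoc)
  also have "\<dots> = red_coeff v p K f N \<otimes>\<^bsub>kk\<^esub> z [^]\<^bsub>kk\<^esub> (p - 1)" unfolding z(2) using U(1)[OF z(1)] c by (simp add: kk.m_comm)
  finally have "\<psi> (red_coeff v p K f 1) = \<psi> (red_coeff v p K f N \<otimes>\<^bsub>kk\<^esub> z [^]\<^bsub>kk\<^esub> (p - 1))" by simp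
  then have "ab 1 = ab N \<otimes>\<^bsub>kR\<^esub> \<psi> z [^]\<^bsub>kR\<^esub> (p - 1)" using c U(1)[OF z(1)] h.hom_nat_pow by simp
  then have "eis_data R v p Qp K f \<pi> (\<psi> y) (\<psi> z)"
    using U(2,3)[OF y(1)] U(2,3)[OF z(1)] y(2) red_poly_eval[OF U(1)[OF y(1)]]
    by (intro eis_data.intro eis_data_axioms.intro eis_root_axioms) auto
  then show ?thesis by blast
qed

end

theorem theorem4:
  fixes R :: "'a ring" (structure)
    and v :: "'a \<Rightarrow> ereal"
    and p :: nat
    and Qp K L Lt :: "'a set"
    and f :: "'a list"
    and \<pi> :: 'a
    and k :: "'a set ring"
    and Fc :: "nat \<Rightarrow> 'a set"
    and A :: "'a set list"
  assumes p: "Factorial_Ring.prime p" "odd p"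
    and ambient: "algebraic_closure R Qp" "ring.valuation R v"
    and Qp: "ring.padic_numbers R v p Qp"
    and K: "ring.unramified R v Qp K"
    and f: "f \<in> carrier ((val_ring v K)[X])" "length f = p^2 + 1" "ring.eisenstein R v f"
    and cond1: "1 \<le> v (f ! p)" "\<And>i. i \<in> coprime_range p 2 (p - 1) \<Longrightarrow> 2 \<le> v (f ! (p * i))"
    and cond2: "v (f ! 1) = 1" "\<And>i. i \<in> coprime_range p 2 (p^2 - 1) \<Longrightarrow> 2 \<le> v (f ! i)"
    and k: "k = ring.residue_field R v p K"
    and Fc: "Fc = ring.red_coeff R v p K f"
    and A: "A = ring.red_poly R v p K f"
    and cond3: "\<exists>y \<in> Units k. ring.eval k A y = \<zero>\<^bsub>k\<^esub>"
      "\<exists>z \<in> Units k. Fc 1 \<otimes>\<^bsub>k\<^esub> inv\<^bsub>k\<^esub> (Fc (p^2)) = z [^]\<^bsub>k\<^esub> (p - 1)"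
    and L: "\<pi> \<in> carrier R" "ring.eval R f \<pi> = \<zero>" "L = generate_field R (insert \<pi> K)"
    and Lt: "Lt = ring.normal_closure R K L"
  shows "(\<exists>F. ring.subextension R p K L F) \<and>
    (\<forall>F. ring.subextension R p K L F \<longrightarrow>
      (\<not> ring.splitted k A \<longrightarrow>
         (\<forall>F'. ring.subextension R p K L F' \<longrightarrow> F' = F) \<and>
         ring.gal_module_has_length R p K F Lt 2 \<and>
         (\<exists>U. U \<noteq> F \<and> ring.unramified R v F U \<and> ring.totally_ramified R v U Lt \<and>
              ring.upper_breaks R v U Lt = {1}) \<and>
         split_extension (ring.Gal R K Lt) (carrier (ring.Gal R F Lt)) (ring.Gal R K F)
           (\<lambda>\<sigma>. restrict \<sigma> F)) \<and>
      (ring.splitted k A \<longrightarrow>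
         ring.gal_module_has_length R p K F Lt 1 \<and>
         ring.elementary_abelian_extension R p K L))"
proof -
  interpret C: algebraic_closure R Qp by (rule ambient(1))
  have vf: "valued_field R v" using C.field_axioms ambient(2) by (intro valued_field.intro valued_field_axioms.intro)
  then interpret V: valued_field R v .
  \<comment> \<open>A nonzero integer has finite valuation, so its image in \<open>R\<close> cannot
    be zero.\<close>
  have char0: "[n] \<cdot> \<one> \<noteq> \<zero>" if "n \<noteq> 0" for n :: nat
  proof -
    have "v ([int n] \<cdot> \<one>) = ereal (real (multiplicity (int p) (int n)))" using Qp that unfolding C.padic_numbers_def by simp
    then show ?thesis by (auto simp: add_pow_int_ge)
  qed
  have fK: "set f \<subseteq> K" using C.poly_coeffs[OF f(1)] unfolding val_ring_def by blast
  have "eis_root R v p Qp K f \<pi>"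
    by (intro eis_root.intro eis_root_axioms.intro eisenstein_case.intro eisenstein_case_axioms.intro padic_closure.intro
        padic_closure_axioms.intro char0_closed.intro char0_closed_axioms.intro C.algebraically_closed_axioms vf)
      (use p Qp K fK f(2,3) cond1 cond2 L(1,2) char0 in auto)
  then interpret e: eis_root R v p Qp K f \<pi> .
  \<comment> \<open>The abstractly given \<open>L\<close> and \<open>Lt\<close> are the simple
    extension by \<open>\<pi>\<close> and the splitting field of \<open>f\<close>, for which
    everything above is stated.\<close>
  have Le: "L = e.L" unfolding L(3) e.L_eq ..
  have Lte: "Lt = e.E" unfolding Lt Le by (rule e.normal_closure_L)
  obtain W Zc where "eis_data R v p Qp K f \<pi> W Zc"
    using e.eis_data_exists cond3 unfolding k A Fc by blast
  then interpret d: eis_data R v p Qp K f \<pi> W Zc .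
  show ?thesis
  proof (cases "ring.splitted k A")
    case True
    then have rat: "e.Y \<rho> \<in> e.\<kappa>" if "\<rho> \<in> carrier (C.Gal K e.E)" for \<rho>
      using e.splitted_iff that unfolding k A by blast
    show ?thesis using True d.rational_conclusion[OF rat] unfolding Le Lte by blast
  next
    case False
    then have "\<exists>\<rho> \<in> carrier (C.Gal K e.E). e.Y \<rho> \<notin> e.\<kappa>" using e.splitted_iff unfolding k A by blast
    then interpret u: eis_unsplit R v p Qp K f \<pi> W Zc by unfold_locales
    \<comment> \<open>Uniqueness reduces the statement about all subextensions of degree
      \<open>p\<close> to one about the single field \<open>u.F\<close>.\<close>
    have uniq: "J = u.F" if "C.subextension p K e.L J" for J using u.F_unique[OF that] .
    have ex: "\<exists>F. C.subextension p K e.L F" using u.unsplit_conclusion(1) by blast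
    show ?thesis unfolding Le Lte
    proof (intro conjI allI impI ex)
      fix J assume J: "C.subextension p K e.L J"
      note JF = uniq[OF J]
      show "J' = J" if "C.subextension p K e.L J'" for J' using uniq[OF that] JF by simp
      show "C.gal_module_has_length p K J e.E 2" unfolding JF by (rule u.unsplit_conclusion(2))
      show "\<exists>U. U \<noteq> J \<and> C.unramified v J U \<and> C.totally_ramified v U e.E \<and> C.upper_breaks v U e.E = {1}"
        unfolding JF using u.unsplit_conclusion(4) u.unramified_U u.totally_ramified_E u.upper_breaks_U by blast
      show "split_extension (C.Gal K e.E) (carrier (C.Gal J e.E)) (C.Gal K J) (\<lambda>\<sigma>. restrict \<sigma> J)"
        unfolding JF by (rule u.unsplit_conclusion(3))
    qed (use False in simp_all)
  qed
qed

end
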